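(* Let $N\ge2$, let $\Omega\subset\mathbb{R}^N$ be a bounded radially symmetric domain, let $\alpha\ge 0$, and let $1<p<\frac{N+2}{N-2}$ if $N\ge3$, or $p>1$ if $N=2$. A least energy nodal solution to $$-\Delta u=|x|^\alpha|u|^{p-1}u\ \text{ in }\Omega,\qquad u=0\ \text{ on }\partial\Omega$$ is not radial.
   Context: A bounded radially symmetric domain of $\mathbb{R}^N$ is a ball centered at the origin or an annulus $\{a<|x|<b\}$ with $0<a<b<\infty$. Let $$\mathcal E(u)=\frac12\int_\Omega|\nabla u|^2\,dx-\frac1{p+1}\int_\Omega|x|^\alpha|u|^{p+1}\,dx,\qquad u\in H^1_0(\Omega),$$ be the energy functional of the problem. A least energy nodal solution is a minimizer of $\mathcal E$ on the nodal Nehari set $$\Big\{u\in H^1_0(\Omega): u^+\ne0,\ u^-\ne0,\ \int_\Omega|\nabla u^\pm|^2\,dx=\int_\Omega|x|^\alpha|u^\pm|^{p+1}\,dx\Big\},$$ where $u^+=\max\{u,0\}$ and $u^-=\min\{u,0\}$. (Such a minimizer is a sign-changing solution of the problem.) *)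

theory Defs
  imports "HOL-Analysis.Analysis"
begin

definition bounded_radial_domain :: "'a::euclidean_space set \<Rightarrow> bool" where
  "bounded_radial_domain \<Omega> \<longleftrightarrow>
     (\<exists>R>0. \<Omega> = ball 0 R) \<or>
     (\<exists>a b. 0 < a \<and> a < b \<and> \<Omega> = {x. a < norm x \<and> norm x < b})"

primrec Ck :: "nat \<Rightarrow> ('a::euclidean_space \<Rightarrow> real) \<Rightarrow> bool" where
  "Ck 0 f \<longleftrightarrow> continuous_on UNIV f"
| "Ck (Suc k) f \<longleftrightarrow>
     (\<forall>x. f differentiable (at x)) \<and>
     (\<forall>i\<in>Basis. Ck k (\<lambda>x. frechet_derivative f (at x) i))"

definition test_functions :: "'a::euclidean_space set \<Rightarrow> ('a \<Rightarrow> real) set" where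
  "test_functions \<Omega> =
     {\<phi>. (\<forall>k. Ck k \<phi>) \<and> compact (closure {x. \<phi> x \<noteq> 0}) \<and> closure {x. \<phi> x \<noteq> 0} \<subseteq> \<Omega>}"

text \<open>
  Elements of Lebesgue and Sobolev spaces on \<open>\<Omega>\<close> are represented by functions on the whole
  space. Only the values almost everywhere in \<open>\<Omega>\<close> matter.
\<close>

definition L2 :: "'a::euclidean_space set \<Rightarrow> ('a \<Rightarrow> 'b::euclidean_space) set" where
  "L2 \<Omega> = {f. f \<in> borel_measurable (lebesgue_on \<Omega>) \<and>
               integrable (lebesgue_on \<Omega>) (\<lambda>x. (norm (f x))\<^sup>2)}"

definition has_weak_gradient ::
    "'a::euclidean_space set \<Rightarrow> ('a \<Rightarrow> real) \<Rightarrow> ('a \<Rightarrow> 'a) \<Rightarrow> bool" where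
  "has_weak_gradient \<Omega> u g \<longleftrightarrow>
     (\<forall>\<phi>\<in>test_functions \<Omega>. \<forall>i\<in>Basis.
        (LINT x|lebesgue_on \<Omega>. u x * frechet_derivative \<phi> (at x) i) =
        - (LINT x|lebesgue_on \<Omega>. (g x \<bullet> i) * \<phi> x))"

definition H1 :: "'a::euclidean_space set \<Rightarrow> ('a \<Rightarrow> real) set" where
  "H1 \<Omega> = {u \<in> L2 \<Omega>. \<exists>g\<in>L2 \<Omega>. has_weak_gradient \<Omega> u g}"

text \<open>For \<open>u \<in> H1 \<Omega>\<close> with \<open>\<Omega>\<close> open, the chosen gradient is unique almost everywhere in \<open>\<Omega>\<close>.\<close>

definition weak_grad :: "'a::euclidean_space set \<Rightarrow> ('a \<Rightarrow> real) \<Rightarrow> 'a \<Rightarrow> 'a" where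
  "weak_grad \<Omega> u = (SOME g. g \<in> L2 \<Omega> \<and> has_weak_gradient \<Omega> u g)"

definition dirichlet_integral :: "'a::euclidean_space set \<Rightarrow> ('a \<Rightarrow> real) \<Rightarrow> real" where
  "dirichlet_integral \<Omega> u = (LINT x|lebesgue_on \<Omega>. (norm (weak_grad \<Omega> u x))\<^sup>2)"

definition H1_norm :: "'a::euclidean_space set \<Rightarrow> ('a \<Rightarrow> real) \<Rightarrow> real" where
  "H1_norm \<Omega> u = sqrt ((LINT x|lebesgue_on \<Omega>. (u x)\<^sup>2) + dirichlet_integral \<Omega> u)"

definition H10 :: "'a::euclidean_space set \<Rightarrow> ('a \<Rightarrow> real) set" where
  "H10 \<Omega> = {u \<in> H1 \<Omega>. \<exists>\<phi>. (\<forall>n. \<phi> n \<in> test_functions \<Omega>) \<and>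
                        (\<lambda>n. H1_norm \<Omega> (\<lambda>x. \<phi> n x - u x)) \<longlonglongrightarrow> 0}"

text \<open>
  For \<open>\<alpha> = 0\<close> the convention \<open>0 powr 0 = 0\<close> makes the weight vanish at the origin instead of
  being \<open>1\<close> there. This does not affect the integral.
\<close>

definition weighted_integral ::
    "'a::euclidean_space set \<Rightarrow> real \<Rightarrow> real \<Rightarrow> ('a \<Rightarrow> real) \<Rightarrow> real" where
  "weighted_integral \<Omega> \<alpha> p u =
     (LINT x|lebesgue_on \<Omega>. norm x powr \<alpha> * \<bar>u x\<bar> powr (p + 1))"

definition energy ::
    "'a::euclidean_space set \<Rightarrow> real \<Rightarrow> real \<Rightarrow> ('a \<Rightarrow> real) \<Rightarrow> real" where
  "energy \<Omega> \<alpha> p u =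
     1 / 2 * dirichlet_integral \<Omega> u - 1 / (p + 1) * weighted_integral \<Omega> \<alpha> p u"

definition nodal_Nehari_set ::
    "'a::euclidean_space set \<Rightarrow> real \<Rightarrow> real \<Rightarrow> ('a \<Rightarrow> real) set" where
  "nodal_Nehari_set \<Omega> \<alpha> p =
     {u \<in> H10 \<Omega>. \<forall>v \<in> {\<lambda>x. max (u x) 0, \<lambda>x. min (u x) 0}.
        \<not> (AE x in lebesgue_on \<Omega>. v x = 0) \<and>
        dirichlet_integral \<Omega> v = weighted_integral \<Omega> \<alpha> p v}"

text \<open>
  The functional \<open>energy\<close> is the one associated with the Dirichlet problem
  \<open>- \<Delta>u = |x|^\<alpha> |u|^(p - 1) u\<close> in \<open>\<Omega>\<close>, \<open>u = 0\<close> on the boundary. A least energy nodal solution of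
  this problem is by definition a minimizer on the nodal Nehari set; that it solves the equation
  is a consequence and not part of the definition.
\<close>

definition least_energy_nodal_solution ::
    "'a::euclidean_space set \<Rightarrow> real \<Rightarrow> real \<Rightarrow> ('a \<Rightarrow> real) \<Rightarrow> bool" where
  "least_energy_nodal_solution \<Omega> \<alpha> p u \<longleftrightarrow>
     is_arg_min (energy \<Omega> \<alpha> p) (\<lambda>v. v \<in> nodal_Nehari_set \<Omega> \<alpha> p) u"

definition radial_on :: "'a::euclidean_space set \<Rightarrow> ('a \<Rightarrow> real) \<Rightarrow> bool" where
  "radial_on \<Omega> u \<longleftrightarrow> (\<exists>f. AE x in lebesgue_on \<Omega>. u x = f (norm x))"

end

theory Submission imports Defs "HOL-Real_Asymp.Real_Asymp" begin

text \<open>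
  Let \<open>u\<close> be a radial minimizer. An odd test function \<open>h\<close> is orthogonal to all radial functions. For
  small \<open>\<epsilon>\<close> the function \<open>u + \<epsilon> h\<close> can be moved back to the nodal Nehari set by multiplying \<open>u\<^sup>+\<close> and \<open>u\<^sup>-\<close>
  with factors close to \<open>1\<close>, which exist by the Poincare-Miranda theorem; as the energy of
  \<open>s u\<^sup>+ + t u\<^sup>-\<close> is largest at \<open>s = t = 1\<close>, comparing energies shows that \<open>u\<close> is a weak solution and
  that the second variation of the energy at \<open>u\<close> is nonnegative in the odd directions
  \<open>x\<^sub>i \<psi>(|x|\<^sup>2)\<close>.

  Since \<open>u\<close> changes sign and vanishes on the boundary, its radial profile has a critical
  point at which \<open>u\<close> does not vanish and, on an annulus, a second critical point further inside.
  Multiply a partial derivative of \<open>u\<close> by \<open>|x| powr (- \<alpha> / 2)\<close> and restrict it to the shell between the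
  critical points, or to the ball inside the critical point. By the differentiated equation, the
  second variation in this direction is at most \<open>0\<close>. The direction has a corner at the outer critical
  point, and cutting the corner makes the second variation negative.
\<close>

section \<open>Smooth functions and test functions\<close>

text \<open>The parts \<open>u\<^sup>+\<close> and \<open>u\<^sup>-\<close> do not depend smoothly
  on u, so the nodal Nehari set offers no tangent spaces or Lagrange multipliers; both variations
  are extracted from energy comparisons along sequences s, t -> 1 and \<epsilon> -> 0. The speed of
  s and t relative to \<epsilon> is unknown. Odd directions overcome this: s
  \<open>u\<^sup>+\<close> + t \<open>u\<^sup>-\<close> is radial for all s and t, so the first
  order terms vanish identically and survive division by \<epsilon>^2.

  The exponent -\<alpha>/2 compensates for the differentiated weight. For \<alpha> = 0 the partial
  derivatives solve the linearised equation; for \<alpha> > 0 a term without a sign appears, and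
  exactly this power turns it into part of an exact derivative plus a remainder with the sign of
  \<alpha>.

  The variable |x|^2 is used instead of |x| because \<psi>(|x|^2) is smooth at the origin.
  Regularity of the profile comes from the weak equation in one variable, and the boundary values of
  u enter as an integral inequality. On a ball there is no inner critical point; the centre takes
  its place, and the growth of u there has to be bounded by a bootstrap.\<close>

abbreviation pderiv_at :: "('a::euclidean_space \<Rightarrow> real) \<Rightarrow> 'a \<Rightarrow> 'a \<Rightarrow> real" where
  "pderiv_at f i x \<equiv> frechet_derivative f (at x) i"

text \<open>\<open>frechet_derivative\<close> is a choice, so \<open>Ck\<close> does not unfold
  against a computed derivative; by uniqueness any derivative \<open>D\<close> may stand in for the
  chosen one.\<close>

lemma CkI:
  assumes "\<And>x. (f has_derivative D x) (at x)" "\<And>i. i \<in> Basis \<Longrightarrow> Ck k (\<lambda>x. D x i)"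
  shows "Ck (Suc k) f"
proof -
  have "frechet_derivative f (at x) = D x" for x
    using frechet_derivative_at[OF assms(1)] by simp
  then show ?thesis
    using assms by (auto simp: differentiable_def)
qed

lemma Ck_Suc_has_derivative:
  "Ck (Suc k) f \<Longrightarrow> (f has_derivative frechet_derivative f (at x)) (at x)"
  using frechet_derivative_works by auto

lemma Ck_Suc_imp: "Ck (Suc k) f \<Longrightarrow> Ck k f"
proof (induction k arbitrary: f)
  case 0
  then show ?case
    by (auto simp: continuous_on_eq_continuous_at differentiable_imp_continuous_within)
next
  case (Suc k)
  show ?case
    unfolding Ck.simps(2)[of k f]
  proof (intro conjI allI ballI)
    show "f differentiable at x" for x using Suc.prems by simp
    fix i :: 'a assume "i \<in> Basis"
    then have "Ck (Suc k) (\<lambda>x. pderiv_at f i x)"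
      using Suc.prems unfolding Ck.simps(2)[of "Suc k"] by blast
    then show "Ck k (\<lambda>x. pderiv_at f i x)" by (rule Suc.IH)
  qed
qed

lemma Ck_continuous: "Ck k f \<Longrightarrow> continuous_on UNIV f"
proof (induction k)
  case (Suc k) then show ?case using Ck_Suc_imp by blast
qed simp

lemma Ck_const [simp]: "Ck k (\<lambda>x. c)"
proof (induction k arbitrary: c)
  case (Suc k)
  show ?case by (rule CkI[where D="\<lambda>x. \<lambda>h. 0"]) (use Suc in auto)
qed auto

lemma Ck_linear: assumes "bounded_linear f" shows "Ck k f"
proof (cases k)
  case 0
  then show ?thesis using assms by (simp add: linear_continuous_on)
next
  case (Suc k')
  show ?thesis unfolding Suc
    by (rule CkI[where D="\<lambda>x. f"]) (use assms bounded_linear_imp_has_derivative in auto)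
qed

lemma Ck_add: "Ck k f \<Longrightarrow> Ck k g \<Longrightarrow> Ck k (\<lambda>x. f x + g x)"
proof (induction k arbitrary: f g)
  case 0 then show ?case by (auto intro: continuous_intros)
next
  case (Suc k)
  show ?case
    by (rule CkI[OF has_derivative_add[OF Ck_Suc_has_derivative[OF Suc.prems(1)] Ck_Suc_has_derivative[OF Suc.prems(2)]]])
      (use Suc in auto)
qed

lemma Ck_mult: "Ck k f \<Longrightarrow> Ck k g \<Longrightarrow> Ck k (\<lambda>x. f x * g x)"
proof (induction k arbitrary: f g)
  case 0 then show ?case by (auto intro: continuous_intros)
next
  case (Suc k)
  have "Ck k f" "Ck k g" using Suc.prems Ck_Suc_imp by auto
  with Suc show ?case
    by (intro CkI[OF has_derivative_mult[OF Ck_Suc_has_derivative[OF Suc.prems(1)] Ck_Suc_has_derivative[OF Suc.prems(2)]]])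
       (auto intro!: Ck_add)
qed

lemma Ck_cmult: "Ck k f \<Longrightarrow> Ck k (\<lambda>x. c * f x)"
  by (intro Ck_mult) auto

lemma Ck_diff: "Ck k f \<Longrightarrow> Ck k g \<Longrightarrow> Ck k (\<lambda>x. f x - g x)"
  using Ck_add[of k f "\<lambda>x. -1 * g x"] Ck_cmult[of k g "-1"] by simp

lemma Ck_sum: "(\<And>i. i \<in> I \<Longrightarrow> Ck k (f i)) \<Longrightarrow> Ck k (\<lambda>x. \<Sum>i\<in>I. f i x)"
  by (induction I rule: infinite_finite_induct) (auto intro: Ck_add)

lemma Ck_prod: "(\<And>i. i \<in> I \<Longrightarrow> Ck k (f i)) \<Longrightarrow> Ck k (\<lambda>x. \<Prod>i\<in>I. f i x)"
  by (induction I rule: infinite_finite_induct) (auto intro: Ck_mult)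

lemma Ck_inner: "Ck k (\<lambda>x. x \<bullet> v)"
  by (intro Ck_linear bounded_linear_intros)

lemma Ck_id_real: "Ck k (\<lambda>x::real. x)"
  by (intro Ck_linear bounded_linear_intros)

lemma Ck_inner_self: "Ck k (\<lambda>x::'a::euclidean_space. x \<bullet> x)"
proof -
  have "(\<lambda>x::'a. x \<bullet> x) = (\<lambda>x. \<Sum>i\<in>Basis. (x \<bullet> i) * (x \<bullet> i))"
    by (subst euclidean_inner) auto
  then show ?thesis by (auto intro!: Ck_sum Ck_mult Ck_inner)
qed

lemma Ck_realI:
  assumes "\<And>x. (f has_real_derivative f' x) (at x)" "Ck k f'"
  shows "Ck (Suc k) f"
  by (rule CkI[where D="\<lambda>x h. f' x * h"])
     (use assms in \<open>auto simp: has_field_derivative_def mult.commute[of _ "f' _"]\<close>)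

lemma Ck_real_deriv:
  assumes "Ck (Suc k) (f :: real \<Rightarrow> real)"
  shows "(f has_real_derivative deriv f x) (at x)" "Ck k (deriv f)"
proof -
  have d: "(f has_derivative frechet_derivative f (at x)) (at x)" for x
    using Ck_Suc_has_derivative[OF assms] .
  have "frechet_derivative f (at x) = (\<lambda>h. h * pderiv_at f 1 x)" for x
  proof
    fix h
    show "pderiv_at f h x = h * pderiv_at f 1 x"
      using linear_scale[OF has_derivative_linear[OF d], of x h 1] by simp
  qed
  then have r: "(f has_real_derivative pderiv_at f 1 x) (at x)" for x
    using d[of x] by (metis (no_types, lifting) ext has_derivative_imp_has_field_derivative mult.commute)
  then have e: "deriv f = pderiv_at f 1" by (auto simp: DERIV_imp_deriv)
  show "(f has_real_derivative deriv f x) (at x)" using r e by simp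
  show "Ck k (deriv f)" using assms e by auto
qed

lemma Ck_compose: "Ck k (F :: real \<Rightarrow> real) \<Longrightarrow> Ck k \<phi> \<Longrightarrow> Ck k (\<lambda>x. F (\<phi> x))"
proof (induction k arbitrary: F)
  case 0 then show ?case by (auto intro: continuous_on_compose2)
next
  case (Suc k)
  have 1: "((\<lambda>x. F (\<phi> x)) has_derivative (\<lambda>h. deriv F (\<phi> x) * frechet_derivative \<phi> (at x) h)) (at x)" for x
    using has_derivative_compose[OF Ck_Suc_has_derivative[OF Suc.prems(2)], of F "(*) (deriv F (\<phi> x))"]
      Ck_real_deriv(1)[OF Suc.prems(1)] unfolding has_field_derivative_def by blast
  show ?case
    by (rule CkI[OF 1])
       (use Suc Ck_real_deriv(2)[OF Suc.prems(1)] Ck_Suc_imp[OF Suc.prems(2)] in \<open>auto intro!: Ck_mult\<close>)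
qed

definition smooth :: "('a::euclidean_space \<Rightarrow> real) \<Rightarrow> bool" where
  "smooth f \<longleftrightarrow> (\<forall>k. Ck k f)"

lemma smooth_intros:
  "smooth (\<lambda>x. c)" "smooth (\<lambda>x. x \<bullet> v)" "smooth (\<lambda>x::'a::euclidean_space. x \<bullet> x)" "smooth (\<lambda>x::real. x)"
  "smooth f \<Longrightarrow> smooth g \<Longrightarrow> smooth (\<lambda>x. f x + g x)"
  "smooth f \<Longrightarrow> smooth g \<Longrightarrow> smooth (\<lambda>x. f x * g x)"
  "smooth f \<Longrightarrow> smooth g \<Longrightarrow> smooth (\<lambda>x. f x - g x)"
  "(\<And>i. i \<in> I \<Longrightarrow> smooth (h i)) \<Longrightarrow> smooth (\<lambda>x. \<Sum>i\<in>I. h i x)"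
  "(\<And>i. i \<in> I \<Longrightarrow> smooth (h i)) \<Longrightarrow> smooth (\<lambda>x. \<Prod>i\<in>I. h i x)"
  by (auto simp: smooth_def Ck_inner Ck_inner_self Ck_id_real intro!: Ck_add Ck_mult Ck_diff Ck_sum Ck_prod)

lemma smooth_compose: "smooth (F :: real \<Rightarrow> real) \<Longrightarrow> smooth \<phi> \<Longrightarrow> smooth (\<lambda>x. F (\<phi> x))"
  by (auto simp: smooth_def intro: Ck_compose)

lemma smooth_has_derivative: "smooth f \<Longrightarrow> (f has_derivative frechet_derivative f (at x)) (at x)"
  using Ck_Suc_has_derivative unfolding smooth_def by blast

lemma smooth_pderiv: "smooth f \<Longrightarrow> i \<in> Basis \<Longrightarrow> smooth (pderiv_at f i)"
  unfolding smooth_def by (metis Ck.simps(2))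

lemma smooth_continuous: "smooth f \<Longrightarrow> continuous_on S f"
  unfolding smooth_def using Ck_continuous continuous_on_subset by blast

lemma smooth_deriv:
  assumes "smooth (f :: real \<Rightarrow> real)"
  shows "(f has_real_derivative deriv f x) (at x)" "smooth (deriv f)"
  using assms Ck_real_deriv unfolding smooth_def by blast+

lemma smooth_realI:
  assumes "\<And>x. (f has_real_derivative f' x) (at x)" "smooth f'"
  shows "smooth f"
  unfolding smooth_def
proof
  fix k
  have "Ck (Suc k) f" using Ck_realI assms unfolding smooth_def by blast
  then show "Ck k f" by (rule Ck_Suc_imp)
qed

lemma smooth_polynomial:
  "real_polynomial_function (f :: real \<Rightarrow> real) \<Longrightarrow> smooth f"
  by (induction f rule: real_polynomial_function.induct) (auto simp: smooth_def Ck_linear intro!: Ck_add Ck_mult)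

section \<open>A smooth function vanishing on a half-line\<close>

definition bump0 :: "nat \<Rightarrow> real \<Rightarrow> real" where
  "bump0 j y = (if y > 0 then exp (- (1 / y)) / y ^ j else 0)"

text \<open>This rule explains the index \<open>j\<close>: differentiating exp (-1/y) brings down
  powers of 1/y, and the family over all \<open>j\<close> is closed under differentiation up to
  linear combinations, so one induction with \<open>j\<close> arbitrary yields smoothness. At 0 the
  difference quotient is exp (-1/h) / h^(j+1) from the right and 0 from the left.\<close>

lemma bump0_deriv:
  "(bump0 j has_real_derivative bump0 (j + 2) y - real j * bump0 (Suc j) y) (at y)"
proof -
  consider "y > 0" | "y < 0" | "y = 0" by linarith
  then show ?thesis
  proof cases
    case 1
    \<comment> \<open>The case split is for \<open>y ^ (j - 1)\<close>, where the subtraction is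
      truncated; at \<open>j = 0\<close> the factor \<open>real j\<close> removes the term.\<close>
    have e: "(exp (- (1 / y)) * (1 / y\<^sup>2) * y ^ j - exp (- (1 / y)) * (real j * y ^ (j - 1))) / (y ^ j * y ^ j)
       = bump0 (j + 2) y - real j * bump0 (Suc j) y"
      using 1 by (cases j) (auto simp: bump0_def field_simps power2_eq_square)
    have "((\<lambda>y. exp (- (1 / y)) / y ^ j) has_real_derivative
        (exp (- (1 / y)) * (1 / y\<^sup>2) * y ^ j - exp (- (1 / y)) * (real j * y ^ (j - 1))) / (y ^ j * y ^ j)) (at y)"
      by (rule DERIV_divide) (use 1 in \<open>auto intro!: derivative_eq_intros simp: power2_eq_square\<close>)
    then have "((\<lambda>y. exp (- (1 / y)) / y ^ j) has_real_derivative bump0 (j + 2) y - real j * bump0 (Suc j) y) (at y)"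
      unfolding e .
    then show ?thesis
      by (rule has_field_derivative_transform_within[where d=y]) (use 1 in \<open>auto simp: bump0_def dist_real_def\<close>)
  next
    case 2
    have "((\<lambda>y. 0) has_real_derivative bump0 (j + 2) y - real j * bump0 (Suc j) y) (at y)"
      using 2 by (auto simp: bump0_def)
    then show ?thesis
      by (rule has_field_derivative_transform_within[where d="-y"]) (use 2 in \<open>auto simp: bump0_def dist_real_def\<close>)
  next
    case 3
    have r: "((\<lambda>h. bump0 j h / h) \<longlongrightarrow> 0) (at_right 0)"
    proof -
      have "((\<lambda>h::real. exp (- (1 / h)) / h ^ j / h) \<longlongrightarrow> 0) (at_right 0)" by real_asymp
      then show ?thesis
        by (rule tendsto_cong[THEN iffD1, rotated])
           (auto simp: bump0_def eventually_at_right_less intro!: eventually_mono[OF eventually_at_right_less])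
    qed
    have l: "((\<lambda>h. bump0 j h / h) \<longlongrightarrow> 0) (at_left 0)"
      by (rule tendsto_cong[THEN iffD1, OF _ tendsto_const[of 0]])
         (auto simp: bump0_def eventually_at_left_field intro!: exI[of _ "-1"])
    have "((\<lambda>h. bump0 j h / h) \<longlongrightarrow> 0) (at 0)"
      using l r by (simp add: filterlim_split_at)
    then show ?thesis unfolding 3 DERIV_def by (simp add: bump0_def)
  qed
qed

lemma smooth_bump0: "smooth (bump0 j)"
proof -
  have "Ck k (bump0 j)" for k
  proof (induction k arbitrary: j)
    case 0
    show ?case using DERIV_isCont[OF bump0_deriv] by (simp add: continuous_on_eq_continuous_at)
  next
    case (Suc k)
    show ?case by (rule Ck_realI[OF bump0_deriv]) (use Suc in \<open>auto intro!: Ck_diff Ck_cmult\<close>)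
  qed
  then show ?thesis by (auto simp: smooth_def)
qed

text \<open>The logistic function is smooth because its derivative is a polynomial in itself.\<close>

lemma smooth_logistic: "smooth (\<lambda>t::real. 1 / (1 + exp (- t)))"
proof -
  have d: "((\<lambda>t::real. 1 / (1 + exp (- t))) has_real_derivative
      (1 / (1 + exp (- t))) * (1 - 1 / (1 + exp (- t)))) (at t)" for t :: real
  proof -
    have "1 + exp (-t) > 0" by (simp add: add_pos_pos)
    then show ?thesis by (auto intro!: derivative_eq_intros simp: field_simps power2_eq_square)
  qed
  have "Ck k (\<lambda>t::real. 1 / (1 + exp (- t)))" for k
  proof (induction k)
    case 0
    show ?case using DERIV_isCont[OF d] by (simp add: continuous_on_eq_continuous_at)
  next
    case (Suc k)
    show ?case by (rule Ck_realI[OF d]) (intro Ck_mult Ck_diff Ck_const Suc)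
  qed
  then show ?thesis by (auto simp: smooth_def)
qed

section \<open>Test functions\<close>

lemma test_functionsI:
  assumes "smooth \<phi>" "compact K" "K \<subseteq> \<Omega>" "\<And>x. x \<notin> K \<Longrightarrow> \<phi> x = 0"
  shows "\<phi> \<in> test_functions \<Omega>"
proof -
  have s: "closure {x. \<phi> x \<noteq> 0} \<subseteq> K"
    using assms by (intro closure_minimal) (auto simp: compact_imp_closed)
  moreover have "compact (closure {x. \<phi> x \<noteq> 0})"
    using s assms(2) closed_closure compact_Int_closed
    by (metis inf.absorb_iff2)
  ultimately show ?thesis using assms by (auto simp: test_functions_def smooth_def)
qed

text \<open>Provides a single compact set off which \<open>\<phi>\<close> and all its partial
  derivatives vanish; the derivatives do because the complement of the closed support is
  open.\<close>

lemma test_functionsE: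
  assumes "\<phi> \<in> test_functions \<Omega>"
  obtains K where "smooth \<phi>" "compact K" "K \<subseteq> \<Omega>" "\<And>x. x \<notin> K \<Longrightarrow> \<phi> x = 0"
    "\<And>x i. x \<notin> K \<Longrightarrow> pderiv_at \<phi> i x = 0"
proof
  let ?K = "closure {x. \<phi> x \<noteq> 0}"
  show "smooth \<phi>" "compact ?K" "?K \<subseteq> \<Omega>"
    using assms by (auto simp: test_functions_def smooth_def)
  show z: "\<phi> x = 0" if "x \<notin> ?K" for x using that closure_subset[of "{x. \<phi> x \<noteq> 0}"] by auto
  show "pderiv_at \<phi> i x = 0" if "x \<notin> ?K" for x i
  proof -
    have "((\<lambda>x. 0) has_derivative (\<lambda>h. 0)) (at x)" by simp
    then have "(\<phi> has_derivative (\<lambda>h. 0)) (at x)"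
      by (rule has_derivative_transform_within_open[where s="- ?K"])
         (use z that in \<open>simp_all only: Compl_iff open_Compl closed_closure not_False_eq_True\<close>)
    then show ?thesis by (metis frechet_derivative_at)
  qed
qed

lemma test_smooth: "\<phi> \<in> test_functions \<Omega> \<Longrightarrow> smooth \<phi>"
  by (auto simp: test_functions_def smooth_def)

lemma test_pderiv:
  assumes "\<phi> \<in> test_functions \<Omega>" "i \<in> Basis"
  shows "pderiv_at \<phi> i \<in> test_functions \<Omega>"
proof -
  obtain K where "smooth \<phi>" "compact K" "K \<subseteq> \<Omega>" "\<And>x i. x \<notin> K \<Longrightarrow> pderiv_at \<phi> i x = 0"
    using assms(1) by (elim test_functionsE) blast
  then show ?thesis using assms(2) by (intro test_functionsI[of _ K]) (auto intro: smooth_pderiv)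
qed

lemma test_add:
  assumes "\<phi> \<in> test_functions \<Omega>" "\<psi> \<in> test_functions \<Omega>"
  shows "(\<lambda>x. \<phi> x + \<psi> x) \<in> test_functions \<Omega>"
proof -
  obtain K where K: "smooth \<phi>" "compact K" "K \<subseteq> \<Omega>" "\<And>x. x \<notin> K \<Longrightarrow> \<phi> x = 0"
    using assms(1) by (elim test_functionsE) blast
  obtain L where L: "smooth \<psi>" "compact L" "L \<subseteq> \<Omega>" "\<And>x. x \<notin> L \<Longrightarrow> \<psi> x = 0"
    using assms(2) by (elim test_functionsE) blast
  show ?thesis using K L by (intro test_functionsI[of _ "K \<union> L"] smooth_intros) auto
qed

lemma test_mult:
  assumes "\<phi> \<in> test_functions \<Omega>" "smooth \<psi>"
  shows "(\<lambda>x. \<psi> x * \<phi> x) \<in> test_functions \<Omega>"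
proof -
  obtain K where "smooth \<phi>" "compact K" "K \<subseteq> \<Omega>" "\<And>x. x \<notin> K \<Longrightarrow> \<phi> x = 0"
    using assms(1) by (elim test_functionsE) blast
  then show ?thesis using assms(2) by (intro test_functionsI[of _ K] smooth_intros) auto
qed

lemma test_compose:
  assumes "\<phi> \<in> test_functions \<Omega>" "smooth F" "F 0 = (0::real)"
  shows "(\<lambda>x. F (\<phi> x)) \<in> test_functions \<Omega>"
proof -
  obtain K where "smooth \<phi>" "compact K" "K \<subseteq> \<Omega>" "\<And>x. x \<notin> K \<Longrightarrow> \<phi> x = 0"
    using assms(1) by (elim test_functionsE) blast
  then show ?thesis using assms(2,3) by (intro test_functionsI[of _ K] smooth_compose[of F \<phi>]) auto
qed

section \<open>Gradients of smooth functions\<close>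

definition grad :: "('a::euclidean_space \<Rightarrow> real) \<Rightarrow> 'a \<Rightarrow> 'a" where
  "grad f x = (\<Sum>i\<in>Basis. pderiv_at f i x *\<^sub>R i)"

lemma grad_inner_Basis [simp]: "i \<in> Basis \<Longrightarrow> grad f x \<bullet> i = pderiv_at f i x"
  by (simp add: grad_def)

lemma continuous_grad: "smooth f \<Longrightarrow> continuous_on S (grad f)"
  unfolding grad_def by (intro continuous_intros smooth_continuous smooth_pderiv)

lemma grad_inner:
  assumes "f differentiable at x"
  shows "grad f x \<bullet> v = frechet_derivative f (at x) v"
proof -
  have lin: "linear (frechet_derivative f (at x))"
    using assms by (rule linear_frechet_derivative)
  have "frechet_derivative f (at x) v = frechet_derivative f (at x) (\<Sum>i\<in>Basis. (v \<bullet> i) *\<^sub>R i)"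
    by (simp add: euclidean_representation)
  also have "\<dots> = (\<Sum>i\<in>Basis. (v \<bullet> i) * pderiv_at f i x)"
    by (simp add: linear_sum[OF lin] linear_scale[OF lin])
  finally show ?thesis by (subst euclidean_inner) (simp add: mult.commute)
qed

lemma gradI:
  assumes "(f has_derivative (\<lambda>h. G \<bullet> h)) (at x)"
  shows "grad f x = G"
proof (rule euclidean_eqI)
  fix i :: 'a assume "i \<in> Basis"
  then show "grad f x \<bullet> i = G \<bullet> i"
    using frechet_derivative_at[OF assms, symmetric] by simp
qed

lemma smooth_has_grad: "smooth f \<Longrightarrow> (f has_derivative (\<lambda>h. grad f x \<bullet> h)) (at x)"
  using smooth_has_derivative[of f x] grad_inner[of f x]
  by (metis (no_types, lifting) differentiable_def ext)

lemma grad_add: "smooth f \<Longrightarrow> smooth g \<Longrightarrow> grad (\<lambda>x. f x + g x) x = grad f x + grad g x"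
  by (intro gradI) (auto simp: inner_add_left intro!: derivative_eq_intros smooth_has_grad)

lemma grad_cmult: "smooth f \<Longrightarrow> grad (\<lambda>x. c * f x) x = c *\<^sub>R grad f x"
  by (intro gradI) (auto intro!: derivative_eq_intros smooth_has_grad)

lemma grad_mult: "smooth f \<Longrightarrow> smooth g \<Longrightarrow> grad (\<lambda>x. f x * g x) x = f x *\<^sub>R grad g x + g x *\<^sub>R grad f x"
  by (intro gradI)
     (auto simp: inner_add_left algebra_simps intro!: derivative_eq_intros smooth_has_grad)

lemma grad_compose:
  assumes "(F has_real_derivative F') (at (f x))" "smooth f"
  shows "grad (\<lambda>x. F (f x)) x = F' *\<^sub>R grad f x"
proof (rule gradI)
  show "((\<lambda>x. F (f x)) has_derivative (\<lambda>h. (F' *\<^sub>R grad f x) \<bullet> h)) (at x)"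
    using has_derivative_compose[OF smooth_has_grad[OF assms(2)], of F "(*) F'"] assms(1)
    by (simp add: has_field_derivative_def)
qed

lemma grad_inner_self: "grad (\<lambda>x. x \<bullet> x) x = 2 *\<^sub>R x"
  by (intro gradI) (auto intro!: derivative_eq_intros simp: inner_commute)

lemma grad_coord: "grad (\<lambda>x. x \<bullet> v) x = v"
  by (intro gradI) (auto intro!: derivative_eq_intros simp: inner_commute)

section \<open>Square-integrable functions\<close>

text \<open>The algebra behind Cauchy-Schwarz in \<open>L2_mult\<close>, where the polynomial is the
  squared norm of t f + g. The case a = 0 has to be covered, since f may vanish almost
  everywhere.\<close>

lemma quadratic_nonneg_discriminant:
  fixes a b c :: real
  assumes "\<And>t. a * t\<^sup>2 + 2 * b * t + c \<ge> 0" "a \<ge> 0"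
  shows "b\<^sup>2 \<le> a * c"
proof (cases "a = 0")
  case True
  have "b = 0"
  proof (rule ccontr)
    assume "b \<noteq> 0"
    \<comment> \<open>At this t the affine function takes the value -1.\<close>
    then show False using assms(1)[of "(- c - 1) / (2 * b)"] True by (simp add: field_simps)
  qed
  then show ?thesis using True by simp
next
  case False
  then have "a > 0" using assms by simp
  have "a * (- b / a)\<^sup>2 + 2 * b * (- b / a) + c = c - b\<^sup>2 / a"
    using \<open>a > 0\<close> by (simp add: field_simps power2_eq_square)
  then have "b\<^sup>2 / a \<le> c" using assms(1)[of "- b / a"] by simp
  then show ?thesis using \<open>a > 0\<close> by (simp add: field_simps)
qed

locale bounded_open =
  fixes \<Omega> :: "'a::euclidean_space set"
  assumes open_Om [simp]: "open \<Omega>" and bounded_Om [simp]: "bounded \<Omega>"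
begin

abbreviation M where "M \<equiv> lebesgue_on \<Omega>"

lemma Om_lebesgue [simp, measurable]: "\<Omega> \<in> sets lebesgue"
  using open_Om by (metis borel_open sets_completionI_sets sets_lborel)

lemma finite_measure_M: "finite_measure M"
proof
  have "emeasure lebesgue \<Omega> < \<infinity>"
    using bounded_set_imp_lmeasurable[OF bounded_Om Om_lebesgue] by (simp add: fmeasurable_def)
  then show "emeasure M (space M) \<noteq> \<infinity>" by (simp add: emeasure_restrict_space)
qed

lemma measurable_M_borel: "f \<in> borel_measurable borel \<Longrightarrow> f \<in> borel_measurable M"
  by (rule measurable_restrict_space1, rule measurable_completion) simp

lemma continuous_measurable_M: "continuous_on UNIV f \<Longrightarrow> f \<in> borel_measurable M"
  by (intro measurable_M_borel borel_measurable_continuous_onI)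

lemma integrable_bounded:
  fixes f :: "'a \<Rightarrow> 'b::{banach,second_countable_topology}"
  assumes "f \<in> borel_measurable M" "\<And>x. x \<in> \<Omega> \<Longrightarrow> norm (f x) \<le> B"
  shows "integrable M f"
  by (rule finite_measure.integrable_const_bound[OF finite_measure_M, of _ B]) (use assms in auto)

lemma continuous_bounded_Om:
  fixes f :: "'a \<Rightarrow> 'b::real_normed_vector"
  assumes "continuous_on UNIV f"
  obtains B where "B > 0" "\<And>x. x \<in> \<Omega> \<Longrightarrow> norm (f x) \<le> B"
proof -
  have "compact (f ` closure \<Omega>)"
    using assms by (intro compact_continuous_image) (auto intro: continuous_on_subset)
  then obtain B where "\<And>x. x \<in> closure \<Omega> \<Longrightarrow> norm (f x) \<le> B"
    unfolding bounded_iff using compact_imp_bounded bounded_iff by (metis imageI)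
  then show ?thesis using closure_subset[of \<Omega>]
    by (intro that[of "max B 1"]) fastforce+
qed

text \<open>The notions of the theorem integrate with respect to \<open>lebesgue_on\<close>, while
  translations, reflections and image measures are available for \<open>lborel\<close>; this is the
  bridge for Borel functions that vanish off the domain.\<close>

lemma integral_M_eq_lborel:
  fixes f :: "'a \<Rightarrow> real"
  assumes "f \<in> borel_measurable borel" "\<And>x. x \<notin> \<Omega> \<Longrightarrow> f x = 0"
  shows "(LINT x|M. f x) = (LINT x|lborel. f x)"
proof -
  have "(LINT x|M. f x) = (LINT x|lebesgue. indicator \<Omega> x *\<^sub>R f x)"
    by (subst integral_restrict_space) auto
  also have "(\<lambda>x. indicator \<Omega> x *\<^sub>R f x) = f" using assms(2) by (auto simp: indicator_def fun_eq_iff)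
  finally show ?thesis using assms(1) by (simp add: integral_completion)
qed

subsection \<open>The space of square-integrable functions\<close>

text \<open>The squared norm rather than the norm, so that no roots appear; the price is a factor 2
  in the triangle inequality, and hence the quarters of e in the approximation arguments.\<close>

definition sqint :: "('a \<Rightarrow> 'b::euclidean_space) \<Rightarrow> real" where
  "sqint f = (LINT x|M. (norm (f x))\<^sup>2)"

lemma sqint_nonneg [simp]: "sqint f \<ge> 0" by (simp add: sqint_def)

lemma L2D: assumes "f \<in> L2 \<Omega>"
  shows "f \<in> borel_measurable M" "integrable M (\<lambda>x. (norm (f x))\<^sup>2)"
  using assms by (auto simp: L2_def)

lemma L2_dominated:
  fixes f :: "'a \<Rightarrow> 'b::euclidean_space" and g :: "'a \<Rightarrow> 'c::euclidean_space"
  assumes "g \<in> L2 \<Omega>" "f \<in> borel_measurable M" "AE x in M. norm (f x) \<le> C * norm (g x)"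
  shows "f \<in> L2 \<Omega>" "sqint f \<le> C\<^sup>2 * sqint g"
proof -
  have i: "integrable M (\<lambda>x. C\<^sup>2 * (norm (g x))\<^sup>2)"
    using L2D[OF assms(1)] by auto
  have ae: "AE x in M. (norm (f x))\<^sup>2 \<le> C\<^sup>2 * (norm (g x))\<^sup>2"
    using assms(3) by eventually_elim (metis norm_ge_zero power_mono power_mult_distrib)
  have if': "integrable M (\<lambda>x. (norm (f x))\<^sup>2)"
    by (rule Bochner_Integration.integrable_bound[OF i]) (use assms(2) ae in auto)
  then show "f \<in> L2 \<Omega>" using assms(2) by (simp add: L2_def)
  show "sqint f \<le> C\<^sup>2 * sqint g"
    unfolding sqint_def integral_mult_right_zero[symmetric]
    by (rule integral_mono_AE[OF if' i ae])
qed

lemma L2_bounded: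
  fixes f :: "'a \<Rightarrow> 'b::euclidean_space"
  assumes "f \<in> borel_measurable M" "\<And>x. x \<in> \<Omega> \<Longrightarrow> norm (f x) \<le> B"
  shows "f \<in> L2 \<Omega>"
proof -
  have "integrable M (\<lambda>x. (norm (f x))\<^sup>2)"
    using assms by (intro integrable_bounded[of _ "B\<^sup>2"]) (auto intro: power_mono)
  then show ?thesis using assms(1) by (simp add: L2_def)
qed

lemma L2_continuous:
  fixes f :: "'a \<Rightarrow> 'b::euclidean_space"
  assumes "continuous_on UNIV f" shows "f \<in> L2 \<Omega>"
  using continuous_bounded_Om[OF assms] L2_bounded[OF continuous_measurable_M[OF assms]] by metis

lemma norm_add_sq_le: "(norm (a + b))\<^sup>2 \<le> 2 * (norm a)\<^sup>2 + 2 * (norm b)\<^sup>2"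
  for a b :: "'b::real_inner"
proof -
  have "2 * (a \<bullet> b) \<le> (norm a)\<^sup>2 + (norm b)\<^sup>2"
    using inner_ge_zero[of "a - b"] unfolding power2_norm_eq_inner
    by (simp add: inner_diff_left inner_diff_right inner_commute)
  then show ?thesis unfolding power2_norm_eq_inner
    by (simp add: inner_add_left inner_add_right inner_commute)
qed

lemma L2_add:
  fixes f g :: "'a \<Rightarrow> 'b::euclidean_space"
  assumes "f \<in> L2 \<Omega>" "g \<in> L2 \<Omega>"
  shows "(\<lambda>x. f x + g x) \<in> L2 \<Omega>" "sqint (\<lambda>x. f x + g x) \<le> 2 * sqint f + 2 * sqint g"
proof -
  have i: "integrable M (\<lambda>x. 2 * (norm (f x))\<^sup>2 + 2 * (norm (g x))\<^sup>2)"
    using L2D[OF assms(1)] L2D[OF assms(2)] by auto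
  have m: "(\<lambda>x. f x + g x) \<in> borel_measurable M"
    using L2D(1)[OF assms(1)] L2D(1)[OF assms(2)] by measurable
  have if': "integrable M (\<lambda>x. (norm (f x + g x))\<^sup>2)"
    by (rule Bochner_Integration.integrable_bound[OF i]) (use m norm_add_sq_le[of "f _" "g _"] in auto)
  then show "(\<lambda>x. f x + g x) \<in> L2 \<Omega>" using m by (simp add: L2_def)
  have "sqint (\<lambda>x. f x + g x) \<le> (LINT x|M. 2 * (norm (f x))\<^sup>2 + 2 * (norm (g x))\<^sup>2)"
    unfolding sqint_def by (rule integral_mono[OF if' i]) (rule norm_add_sq_le)
  also have "\<dots> = 2 * sqint f + 2 * sqint g"
    using L2D[OF assms(1)] L2D[OF assms(2)] by (simp add: sqint_def)
  finally show "sqint (\<lambda>x. f x + g x) \<le> 2 * sqint f + 2 * sqint g" .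
qed

lemma L2_scaleR:
  fixes f :: "'a \<Rightarrow> 'b::euclidean_space"
  assumes "f \<in> L2 \<Omega>"
  shows "(\<lambda>x. c *\<^sub>R f x) \<in> L2 \<Omega>" "sqint (\<lambda>x. c *\<^sub>R f x) = c\<^sup>2 * sqint f"
  using L2D[OF assms] by (auto simp: L2_def sqint_def power_mult_distrib)

lemma L2_diff:
  fixes f g :: "'a \<Rightarrow> 'b::euclidean_space"
  assumes "f \<in> L2 \<Omega>" "g \<in> L2 \<Omega>"
  shows "(\<lambda>x. f x - g x) \<in> L2 \<Omega>" "sqint (\<lambda>x. f x - g x) \<le> 2 * sqint f + 2 * sqint g"
  using L2_add[OF assms(1) L2_scaleR(1)[OF assms(2), of "-1"]] L2_scaleR(2)[OF assms(2), of "-1"]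
  by simp_all

lemma sqint_triangle:
  fixes f g h :: "'a \<Rightarrow> 'b::euclidean_space"
  assumes "f \<in> L2 \<Omega>" "g \<in> L2 \<Omega>" "h \<in> L2 \<Omega>"
  shows "sqint (\<lambda>x. f x - h x) \<le> 2 * sqint (\<lambda>x. f x - g x) + 2 * sqint (\<lambda>x. g x - h x)"
  using L2_add(2)[OF L2_diff(1)[OF assms(1,2)] L2_diff(1)[OF assms(2,3)]] by simp

lemma L2_mult:
  fixes f g :: "'a \<Rightarrow> 'b::euclidean_space"
  assumes "f \<in> L2 \<Omega>" "g \<in> L2 \<Omega>"
  shows "integrable M (\<lambda>x. f x \<bullet> g x)" "(LINT x|M. f x \<bullet> g x)\<^sup>2 \<le> sqint f * sqint g"
proof -
  have i: "integrable M (\<lambda>x. (norm (f x))\<^sup>2 + (norm (g x))\<^sup>2)"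
    using L2D[OF assms(1)] L2D[OF assms(2)] by auto
  have b: "\<bar>f x \<bullet> g x\<bar> \<le> (norm (f x))\<^sup>2 + (norm (g x))\<^sup>2" for x
  proof -
    have "\<bar>f x \<bullet> g x\<bar> \<le> norm (f x) * norm (g x)" by (rule Cauchy_Schwarz_ineq2)
    also have "\<dots> \<le> (norm (f x))\<^sup>2 + (norm (g x))\<^sup>2"
    proof -
      have "2 * (norm (f x) * norm (g x)) \<le> (norm (f x))\<^sup>2 + (norm (g x))\<^sup>2"
        using sum_squares_bound[of "norm (f x)" "norm (g x)"] by simp
      moreover have "0 \<le> norm (f x) * norm (g x)" by simp
      ultimately show ?thesis by linarith
    qed
    finally show ?thesis .
  qed
  show int: "integrable M (\<lambda>x. f x \<bullet> g x)"
    by (rule Bochner_Integration.integrable_bound[OF i])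
       (use b L2D(1)[OF assms(1)] L2D(1)[OF assms(2)] in auto)
  have "sqint f * t\<^sup>2 + 2 * (LINT x|M. f x \<bullet> g x) * t + sqint g \<ge> 0" for t
  proof -
    have "0 \<le> (LINT x|M. (norm (t *\<^sub>R f x + g x))\<^sup>2)" by simp
    also have "(\<lambda>x. (norm (t *\<^sub>R f x + g x))\<^sup>2) =
        (\<lambda>x. t\<^sup>2 * (norm (f x))\<^sup>2 + 2 * t * (f x \<bullet> g x) + (norm (g x))\<^sup>2)"
      unfolding power2_norm_eq_inner
      by (auto simp: inner_add_left inner_add_right inner_commute power2_eq_square algebra_simps)
    also have "(LINT x|M. \<dots> x) = t\<^sup>2 * sqint f + 2 * t * (LINT x|M. f x \<bullet> g x) + sqint g"
      unfolding sqint_def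
      using L2D[OF assms(1)] L2D[OF assms(2)] int by simp
    finally show ?thesis by (simp add: algebra_simps)
  qed
  then show "(LINT x|M. f x \<bullet> g x)\<^sup>2 \<le> sqint f * sqint g"
    by (rule quadratic_nonneg_discriminant) simp
qed

lemma L2_mult_real:
  fixes f g :: "'a \<Rightarrow> real"
  assumes "f \<in> L2 \<Omega>" "g \<in> L2 \<Omega>"
  shows "integrable M (\<lambda>x. f x * g x)" "(LINT x|M. f x * g x)\<^sup>2 \<le> sqint f * sqint g"
  using L2_mult[OF assms] by auto

lemma L2_inner_const:
  fixes g :: "'a \<Rightarrow> 'b::euclidean_space"
  assumes "g \<in> L2 \<Omega>" "norm i \<le> 1"
  shows "(\<lambda>x. g x \<bullet> i) \<in> L2 \<Omega>" "sqint (\<lambda>x. g x \<bullet> i) \<le> sqint g"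
proof -
  have b: "norm (g x \<bullet> i) \<le> 1 * norm (g x)" for x
    using Cauchy_Schwarz_ineq2[of "g x" i] mult_left_le[OF assms(2) norm_ge_zero[of "g x"]] by simp
  have "(\<lambda>x. g x \<bullet> i) \<in> borel_measurable M" using L2D(1)[OF assms(1)] by simp
  then show "(\<lambda>x. g x \<bullet> i) \<in> L2 \<Omega>" "sqint (\<lambda>x. g x \<bullet> i) \<le> sqint g"
    using L2_dominated[OF assms(1), of "\<lambda>x. g x \<bullet> i" 1] b by auto
qed

lemma L2_limit_integral:
  fixes f g h :: "'a \<Rightarrow> real"
  assumes "f \<in> L2 \<Omega>" "g \<in> L2 \<Omega>" "h \<in> L2 \<Omega>" "sqint (\<lambda>x. f x - g x) \<le> e"
  shows "\<bar>(LINT x|M. f x * h x) - (LINT x|M. g x * h x)\<bar> \<le> sqrt (e * sqint h)"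
proof -
  have "(LINT x|M. f x * h x) - (LINT x|M. g x * h x) = (LINT x|M. (f x - g x) * h x)"
    using L2_mult_real assms by (simp add: left_diff_distrib)
  moreover have "(LINT x|M. (f x - g x) * h x)\<^sup>2 \<le> e * sqint h"
    using L2_mult_real(2)[OF L2_diff(1)[OF assms(1,2)] assms(3)] mult_right_mono[OF assms(4), of "sqint h"]
    by simp
  ultimately show ?thesis by (simp add: real_le_rsqrt)
qed

lemma sqint_cong_AE:
  assumes "f \<in> borel_measurable M" "g \<in> borel_measurable M" "AE x in M. f x = g x"
  shows "sqint f = sqint g"
  unfolding sqint_def by (rule integral_cong_AE) (use assms in auto)

lemma sqint_zero_iff:
  assumes "f \<in> L2 \<Omega>" shows "sqint f = 0 \<longleftrightarrow> (AE x in M. f x = 0)"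
  unfolding sqint_def using integral_nonneg_eq_0_iff_AE[OF L2D(2)[OF assms]] by simp

end

section \<open>Integration by parts and weak gradients\<close>

lemma integrable_compact_support:
  fixes f :: "'a::euclidean_space \<Rightarrow> real"
  assumes "continuous_on UNIV f" "compact K" "\<And>x. x \<notin> K \<Longrightarrow> f x = 0"
  shows "integrable lborel f"
proof -
  have "(\<lambda>x. indicator K x *\<^sub>R f x) = f" using assms(3) by (auto simp: indicator_def fun_eq_iff)
  then show ?thesis using borel_integrable_compact[OF assms(2), of f] assms(1) continuous_on_subset by fastforce
qed

text \<open>Translation invariance makes the integrals of the difference quotients vanish.\<close>

lemma integral_directional_derivative_zero:
  fixes f :: "'a::euclidean_space \<Rightarrow> real"
  assumes der: "\<And>x. ((\<lambda>t. f (x + t *\<^sub>R i)) has_real_derivative D x) (at 0)"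
    and cf: "continuous_on UNIV f" and cD: "continuous_on UNIV D"
    and K: "compact K" "\<And>x. x \<notin> K \<Longrightarrow> f x = 0" "\<And>x. x \<notin> K \<Longrightarrow> D x = 0"
  shows "(LINT x|lborel. D x) = 0"
proof -
  define q where "q n x = (f (x + (1 / real (Suc n)) *\<^sub>R i) - f x) * real (Suc n)" for n x
  \<comment> \<open>Contains every x from which a step of length at most 1 in direction i reaches
    \<open>K\<close>; it therefore carries all difference quotients at once, whose steps are 1 / (n
    + 1).\<close>
  define K' where "K' = (\<lambda>(x, t). x - t *\<^sub>R i) ` (K \<times> {0..1})"
  have K': "compact K'" unfolding K'_def
    using K(1) by (intro compact_continuous_image compact_Times) (auto intro!: continuous_intros simp: split_def)
  have "bounded (D ` K)" using K(1) cD by (intro compact_imp_bounded compact_continuous_image) (auto intro: continuous_on_subset)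
  then obtain B where B0: "\<And>x. x \<in> K \<Longrightarrow> \<bar>D x\<bar> \<le> B" unfolding bounded_iff by auto
  have B: "\<bar>D x\<bar> \<le> max B 0" for x using B0[of x] K(3)[of x] by (cases "x \<in> K") auto
  have der2: "((\<lambda>t. f (x + t *\<^sub>R i)) has_real_derivative D (x + s *\<^sub>R i)) (at s)" for x s
  proof -
    let ?F = "\<lambda>t. f ((x + s *\<^sub>R i) + t *\<^sub>R i)"
    have "((\<lambda>t. ?F (t - s)) has_real_derivative D (x + s *\<^sub>R i) * 1) (at s)"
      by (rule DERIV_chain2[where f="?F" and g="\<lambda>t. t - s"])
         (use der[of "x + s *\<^sub>R i"] in \<open>auto intro!: derivative_eq_intros\<close>)
    moreover have "(x + s *\<^sub>R i) + (t - s) *\<^sub>R i = x + t *\<^sub>R i" for t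
      by (simp add: algebra_simps)
    ultimately show ?thesis by simp
  qed
  have bound: "\<bar>q n x\<bar> \<le> max B 0 * indicator K' x" for n x
  proof -
    have "\<exists>z>0. z < 1 / real (Suc n) \<and> f (x + (1 / real (Suc n)) *\<^sub>R i) - f (x + 0 *\<^sub>R i) = (1 / real (Suc n) - 0) * D (x + z *\<^sub>R i)"
      using MVT2[of 0 "1 / real (Suc n)" "\<lambda>t. f (x + t *\<^sub>R i)" "\<lambda>s. D (x + s *\<^sub>R i)"] der2 by auto
    then obtain z where z: "z > 0" "z < 1 / real (Suc n)"
      "f (x + (1 / real (Suc n)) *\<^sub>R i) - f x = (1 / real (Suc n)) * D (x + z *\<^sub>R i)"
      by auto
    then have q: "q n x = D (x + z *\<^sub>R i)" unfolding q_def by simp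
    have "z \<le> 1" using z(2) by (smt (verit) divide_le_eq_1 of_nat_0_less_iff of_nat_Suc of_nat_0_le_iff)
    have "x \<in> K'" if "x + z *\<^sub>R i \<in> K"
      unfolding K'_def using that z(1) \<open>z \<le> 1\<close> by (intro image_eqI[of _ _ "(x + z *\<^sub>R i, z)"]) auto
    then show ?thesis using B[of "x + z *\<^sub>R i"] K(3)[of "x + z *\<^sub>R i"] q by (cases "x \<in> K'") auto
  qed
  have cq: "q n \<in> borel_measurable borel" for n
    unfolding q_def by (intro borel_measurable_continuous_onI continuous_intros continuous_on_compose2[OF cf]) auto
  have lim: "(\<lambda>n. q n x) \<longlonglongrightarrow> D x" for x
  proof -
    have "((\<lambda>h. (f (x + h *\<^sub>R i) - f x) / h) \<longlongrightarrow> D x) (at 0)"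
      using der[of x] unfolding DERIV_def by simp
    moreover have "filterlim (\<lambda>n. 1 / real (Suc n)) (at 0) sequentially"
      by (rule filterlim_atI) (use LIMSEQ_Suc[OF lim_1_over_n] in auto)
    ultimately have "(\<lambda>n. (f (x + (1 / real (Suc n)) *\<^sub>R i) - f x) / (1 / real (Suc n))) \<longlonglongrightarrow> D x"
      by (rule filterlim_compose)
    then show ?thesis unfolding q_def by simp
  qed
  have "(\<lambda>n. LINT x|lborel. q n x) \<longlonglongrightarrow> (LINT x|lborel. D x)"
  proof (rule integral_dominated_convergence[where w="\<lambda>x. max B 0 * indicator K' x"])
    show "integrable lborel (\<lambda>x. max B 0 * indicator K' x)"
      using K' by (intro integrable_mult_right integrable_real_indicator) (use emeasure_compact_finite[OF K'] in \<open>auto simp: compact_imp_closed\<close>)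
  qed (use cq bound lim cD in \<open>auto simp: borel_measurable_continuous_onI\<close>)
  moreover have "(LINT x|lborel. q n x) = 0" for n
  proof -
    have i: "integrable lborel f" by (rule integrable_compact_support[OF cf K(1,2)])
    let ?c = "(1 / real (Suc n)) *\<^sub>R i"
    have d: "distr lborel borel ((+) ?c) = lborel" by (rule lborel_distr_plus)
    have e: "(LINT x|lborel. f (?c + x)) = (LINT x|lborel. f x)"
      by (subst (2) d[symmetric], subst integral_distr) (auto simp: cf borel_measurable_continuous_onI)
    have "integrable (distr lborel borel ((+) ?c)) f" using i d by simp
    then have "integrable lborel (\<lambda>x. f (?c + x))"
      by (subst (asm) integrable_distr_eq) (auto simp: cf borel_measurable_continuous_onI)
    then have "(LINT x|lborel. q n x) = ((LINT x|lborel. f (?c + x)) - (LINT x|lborel. f x)) * real (Suc n)"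
      unfolding q_def using i by (simp add: add.commute del: of_nat_Suc)
    then show ?thesis using e by simp
  qed
  ultimately show ?thesis by (simp add: LIMSEQ_const_iff)
qed

lemma has_derivative_imp_directional:
  assumes "(f has_derivative f') (at x)"
  shows "((\<lambda>t. f (x + t *\<^sub>R i)) has_real_derivative f' i) (at 0)"
proof -
  have "((\<lambda>t. f (x + t *\<^sub>R i)) has_derivative (\<lambda>t. f' (t *\<^sub>R i))) (at 0)"
    by (rule has_derivative_compose[where g=f and f="\<lambda>t. x + t *\<^sub>R i" and g'=f' and f'="\<lambda>t. t *\<^sub>R i"])
       (use assms in \<open>auto intro!: derivative_eq_intros\<close>)
  moreover have "(\<lambda>t. f' (t *\<^sub>R i)) = (*) (f' i)"
    using linear_scale[OF has_derivative_linear[OF assms]] by (auto simp: mult.commute)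
  ultimately show ?thesis by (simp add: has_field_derivative_def)
qed

context bounded_open
begin

lemma test_bounded:
  assumes "\<phi> \<in> test_functions \<Omega>" obtains B where "B > 0" "\<And>x. \<bar>\<phi> x\<bar> \<le> B"
proof -
  obtain K where K: "smooth \<phi>" "K \<subseteq> \<Omega>" "\<And>x. x \<notin> K \<Longrightarrow> \<phi> x = 0"
    using assms by (elim test_functionsE) blast
  obtain B where "B > 0" "\<And>x. x \<in> \<Omega> \<Longrightarrow> norm (\<phi> x) \<le> B"
    using continuous_bounded_Om[OF smooth_continuous[OF K(1)]] by blast
  then show ?thesis using K that[of B] by (metis abs_zero in_mono less_imp_le real_norm_def)
qed

lemma smooth_L2: "smooth \<phi> \<Longrightarrow> \<phi> \<in> L2 \<Omega>"
  by (rule L2_continuous[OF smooth_continuous])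

lemma smooth_grad_L2: "smooth \<phi> \<Longrightarrow> grad \<phi> \<in> L2 \<Omega>"
  by (rule L2_continuous[OF continuous_grad])

lemma test_L2: "\<phi> \<in> test_functions \<Omega> \<Longrightarrow> \<phi> \<in> L2 \<Omega>" "\<phi> \<in> test_functions \<Omega> \<Longrightarrow> grad \<phi> \<in> L2 \<Omega>"
  by (auto dest: test_smooth intro: smooth_L2 smooth_grad_L2)

text \<open>The product of \<open>\<phi>\<close> and \<open>\<psi>\<close> has compact support
  whatever \<open>\<psi>\<close> is, so its derivative in direction i integrates to 0. For
  \<open>\<psi>\<close> a continuous partial derivative in that one direction is enough, which is
  why it is not taken from the smooth functions.\<close>

lemma integration_by_parts_test:
  assumes \<phi>: "\<phi> \<in> test_functions \<Omega>" and i: "i \<in> Basis"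
    and \<psi>: "\<And>x. (\<psi> has_derivative \<psi>' x) (at x)" "continuous_on UNIV (\<lambda>x. \<psi>' x i)"
  shows "(LINT x|M. \<phi> x * \<psi>' x i) = - (LINT x|M. pderiv_at \<phi> i x * \<psi> x)"
proof -
  obtain K where K: "smooth \<phi>" "compact K" "K \<subseteq> \<Omega>" "\<And>x. x \<notin> K \<Longrightarrow> \<phi> x = 0"
    "\<And>x i. x \<notin> K \<Longrightarrow> pderiv_at \<phi> i x = 0"
    using \<phi> by (elim test_functionsE) blast
  have c\<psi>: "continuous_on UNIV \<psi>"
    using \<psi>(1) by (auto simp: continuous_on_eq_continuous_at intro: has_derivative_continuous)
  have c: "continuous_on UNIV \<phi>" "continuous_on UNIV (pderiv_at \<phi> i)"
    using K(1) i by (auto intro: smooth_continuous smooth_pderiv)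
  let ?D = "\<lambda>x. \<phi> x * \<psi>' x i + pderiv_at \<phi> i x * \<psi> x"
  have "(LINT x|lborel. ?D x) = 0"
  proof (rule integral_directional_derivative_zero[where f="\<lambda>x. \<phi> x * \<psi> x" and i=i and K=K])
    fix x
    show "((\<lambda>t. \<phi> (x + t *\<^sub>R i) * \<psi> (x + t *\<^sub>R i)) has_real_derivative ?D x) (at 0)"
      using has_derivative_imp_directional[OF has_derivative_mult[OF smooth_has_derivative[OF K(1)] \<psi>(1)], of x i]
      by simp
  qed (use c c\<psi> \<psi>(2) K in \<open>auto intro!: continuous_intros\<close>)
  moreover have "(LINT x|M. ?D x) = (LINT x|lborel. ?D x)"
  proof (rule integral_M_eq_lborel)
    show "?D \<in> borel_measurable borel"
      by (intro borel_measurable_continuous_onI continuous_intros c c\<psi> \<psi>(2))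
    show "?D x = 0" if "x \<notin> \<Omega>" for x
    proof -
      have "x \<notin> K" using K(3) that by auto
      then show ?thesis using K(4,5)[of x] by simp
    qed
  qed
  moreover have "integrable M (\<lambda>x. \<phi> x * \<psi>' x i)" "integrable M (\<lambda>x. pderiv_at \<phi> i x * \<psi> x)"
    by (intro L2_mult_real L2_continuous c c\<psi> \<psi>(2))+
  ultimately show ?thesis by simp
qed

text \<open>The factors are smooth functions of the scaled signed distances to the faces of the box;
  they stay below 1, vanish beyond the face and tend to 1 inside. These cutoffs take the place of
  mollifiers.\<close>

lemma box_bump:
  fixes a b :: 'a
  assumes "cbox a b \<subseteq> \<Omega>"
  defines "\<phi> \<equiv> \<lambda>n x. \<Prod>i\<in>Basis. bump0 0 (real (Suc n) * ((x - a) \<bullet> i)) * bump0 0 (real (Suc n) * ((b - x) \<bullet> i))"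
  shows "\<phi> n \<in> test_functions \<Omega>" "\<bar>\<phi> n x\<bar> \<le> 1" "(\<lambda>n. \<phi> n x) \<longlonglongrightarrow> indicator (box a b) x"
proof -
  have s: "smooth (\<lambda>x. bump0 0 (c * ((x - a) \<bullet> i)))" "smooth (\<lambda>x. bump0 0 (c * ((b - x) \<bullet> i)))" for c :: real and i
  proof -
    have "smooth (\<lambda>x. c * (x \<bullet> i - a \<bullet> i))" "smooth (\<lambda>x. c * (b \<bullet> i - x \<bullet> i))"
      by (intro smooth_intros)+
    then show "smooth (\<lambda>x. bump0 0 (c * ((x - a) \<bullet> i)))" "smooth (\<lambda>x. bump0 0 (c * ((b - x) \<bullet> i)))"
      using smooth_compose[OF smooth_bump0[of 0]] by (auto simp: inner_diff_left)
  qed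
  have z: "\<phi> n x = 0" if nb: "x \<notin> box a b" for n x
  proof -
    obtain i where i: "i \<in> Basis" "\<not> (a \<bullet> i < x \<bullet> i \<and> x \<bullet> i < b \<bullet> i)" using nb unfolding mem_box by blast
    then have "(x - a) \<bullet> i \<le> 0 \<or> (b - x) \<bullet> i \<le> 0" by (auto simp: inner_diff_left)
    then have "bump0 0 (real (Suc n) * ((x - a) \<bullet> i)) * bump0 0 (real (Suc n) * ((b - x) \<bullet> i)) = 0"
      by (auto simp: bump0_def mult_less_0_iff zero_less_mult_iff)
    then show ?thesis unfolding \<phi>_def using i(1) by (meson finite_Basis prod_zero)
  qed
  show "\<phi> n \<in> test_functions \<Omega>"
  proof (rule test_functionsI[of _ "cbox a b"])
    show "smooth (\<phi> n)" unfolding \<phi>_def by (intro smooth_intros s)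
    show "\<phi> n x = 0" if "x \<notin> cbox a b" for x
      using z that box_subset_cbox[of a b] by blast
  qed (use assms(1) in auto)
  have b: "0 \<le> bump0 0 y \<and> bump0 0 y \<le> 1" for y by (auto simp: bump0_def)
  show "\<bar>\<phi> n x\<bar> \<le> 1"
    unfolding \<phi>_def abs_prod by (intro prod_le_1) (use b in \<open>auto simp: abs_mult intro!: mult_le_one\<close>)
  show "(\<lambda>n. \<phi> n x) \<longlonglongrightarrow> indicator (box a b) x"
  proof (cases "x \<in> box a b")
    case True
    have l: "(\<lambda>n. bump0 0 (real (Suc n) * y)) \<longlonglongrightarrow> 1" if "y > 0" for y
    proof -
      have "(\<lambda>n. exp (- (1 / (real (Suc n) * y)))) \<longlonglongrightarrow> 1" using that by real_asymp
      then show ?thesis using that by (simp add: bump0_def)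
    qed
    have "(\<lambda>n. \<phi> n x) \<longlonglongrightarrow> (\<Prod>i\<in>(Basis::'a set). 1 * 1)"
      unfolding \<phi>_def using True
      by (intro tendsto_prod tendsto_mult l) (auto simp: mem_box inner_diff_left)
    then show ?thesis using True by simp
  next
    case False
    then show ?thesis using z by simp
  qed
qed

text \<open>Cutoffs converging to the indicator of a box show that f integrates to 0 over every
  closed box inside the domain; Lebesgue differentiation over cubes with a corner at x then recovers
  f x off a negligible set.\<close>

theorem fundamental_lemma:
  fixes f :: "'a \<Rightarrow> real"
  assumes f: "integrable M f" and z: "\<And>\<phi>. \<phi> \<in> test_functions \<Omega> \<Longrightarrow> (LINT x|M. f x * \<phi> x) = 0"
  shows "AE x in M. f x = 0"
proof -
  define F where "F x = indicator \<Omega> x *\<^sub>R f x" for x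
  have iF: "integrable lebesgue F" using f by (simp add: integrable_restrict_space F_def[abs_def])
  have box0: "(LINT x|M. f x * indicator (box a b) x) = 0" if ab: "cbox a b \<subseteq> \<Omega>" for a b
  proof -
    define \<phi> where "\<phi> n x = (\<Prod>i\<in>Basis. bump0 0 (real (Suc n) * ((x - a) \<bullet> i)) * bump0 0 (real (Suc n) * ((b - x) \<bullet> i)))" for n x
    note \<phi> = box_bump[OF ab, folded \<phi>_def]
    have m: "f \<in> borel_measurable M" "\<phi> n \<in> borel_measurable M" for n
      using f \<phi>(1)[of n] by (auto dest: test_L2(1) L2D(1))
    have "(\<lambda>n. LINT x|M. f x * \<phi> n x) \<longlonglongrightarrow> (LINT x|M. f x * indicator (box a b) x)"
    proof (rule integral_dominated_convergence[where w="\<lambda>x. norm (f x)"])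
      show "AE x in M. norm (f x * \<phi> n x) \<le> norm (f x)" for n
        using \<phi>(2)[of n] by (auto simp: abs_mult intro!: mult_left_le)
      show "AE x in M. (\<lambda>n. f x * \<phi> n x) \<longlonglongrightarrow> f x * indicator (box a b) x"
        by (auto intro!: tendsto_mult \<phi>(3))
      have "indicator (box a b) \<in> borel_measurable M" by (intro measurable_M_borel) auto
      then show "(\<lambda>x. f x * indicator (box a b) x) \<in> borel_measurable M" using m(1) by measurable
    qed (use m f in \<open>auto\<close>)
    then show ?thesis using z[OF \<phi>(1)] by (simp add: LIMSEQ_const_iff)
  qed
  have int0: "integral (cbox a b) F = 0" if "cbox a b \<subseteq> \<Omega>" for a b
  proof -
    have "integrable (lebesgue_on (box a b)) F"
      by (subst integrable_restrict_space) (use iF in \<open>auto intro!: integrable_mult_indicator simp del: real_scaleR_def\<close>)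
    then have "integral (box a b) F = (LINT x|lebesgue_on (box a b). F x)"
      by (subst lebesgue_integral_eq_integral) auto
    also have "\<dots> = (LINT x|lebesgue. indicator (box a b) x *\<^sub>R F x)"
      by (subst integral_restrict_space) auto
    also have "\<dots> = (LINT x|lebesgue. indicator \<Omega> x *\<^sub>R (f x * indicator (box a b) x))"
      by (rule Bochner_Integration.integral_cong) (auto simp: F_def)
    also have "\<dots> = (LINT x|M. f x * indicator (box a b) x)"
      by (subst integral_restrict_space) auto
    finally show ?thesis using box0[OF that] by (simp add: integral_open_interval)
  qed
  have "F integrable_on cbox a b" for a b
    using integrable_on_lebesgue[OF iF] integrable_on_subcbox by blast
  then obtain N where N: "negligible N" "\<And>x e. x \<notin> N \<Longrightarrow> 0 < e \<Longrightarrow>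
      \<exists>d>0. \<forall>h. 0 < h \<and> h < d \<longrightarrow> norm (integral (cbox x (x + h *\<^sub>R One)) F /\<^sub>R h ^ DIM('a) - F x) < e"
    using integrable_ccontinuous_explicit[of F] by metis
  have "f x = 0" if x: "x \<in> \<Omega>" "x \<notin> N" for x
  proof (rule ccontr)
    assume "f x \<noteq> 0"
    then have "\<bar>F x\<bar> > 0" using x by (simp add: F_def)
    then obtain d where d: "d > 0" "\<And>h. 0 < h \<Longrightarrow> h < d \<Longrightarrow>
        norm (integral (cbox x (x + h *\<^sub>R One)) F /\<^sub>R h ^ DIM('a) - F x) < \<bar>F x\<bar>"
      using N(2)[OF x(2)] by meson
    obtain r where r: "r > 0" "cball x r \<subseteq> \<Omega>" using x open_Om open_contains_cball by blast
    \<comment> \<open>The cube with corner x and side h has diameter h * norm One, so it stays in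
      the ball of radius r; d / 2 makes h strictly smaller than d.\<close>
    define h where "h = min (d / 2) (r / (norm (One::'a) + 1))"
    have h: "0 < h" "h < d" using d r by (auto simp: h_def add_nonneg_pos)
    have hr: "h * norm (One::'a) \<le> r"
    proof -
      have "h * norm (One::'a) \<le> r / (norm (One::'a) + 1) * norm (One::'a)"
        unfolding h_def by (intro mult_right_mono) auto
      also have "\<dots> \<le> r" using r(1) by (simp add: divide_le_eq mult_left_mono add_nonneg_pos)
      finally show ?thesis .
    qed
    have "cbox x (x + h *\<^sub>R One) \<subseteq> \<Omega>"
    proof
      fix y assume y: "y \<in> cbox x (x + h *\<^sub>R One)"
      have "norm (y - x) \<le> norm (h *\<^sub>R (One::'a))"
      proof (rule norm_le_componentwise)
        fix b :: 'a assume "b \<in> Basis"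
        then show "\<bar>(y - x) \<bullet> b\<bar> \<le> \<bar>(h *\<^sub>R (One::'a)) \<bullet> b\<bar>"
          using y by (auto simp: mem_box inner_diff_left inner_add_left)
      qed
      then have "y \<in> cball x r" using hr h(1) by (simp add: dist_norm norm_minus_commute)
      then show "y \<in> \<Omega>" using r by blast
    qed
    then show False using d(2)[OF h] int0 by simp
  qed
  then have "AE x in lebesgue. x \<in> \<Omega> \<longrightarrow> f x = 0"
    using N(1) by (intro AE_I'[of N]) (auto simp: negligible_iff_null_sets)
  then show ?thesis by (subst AE_restrict_space_iff) auto
qed

lemma weak_gradient_unique:
  assumes "g \<in> L2 \<Omega>" "g' \<in> L2 \<Omega>" "has_weak_gradient \<Omega> u g" "has_weak_gradient \<Omega> u g'"
  shows "AE x in M. g x = g' x"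
proof -
  have "AE x in M. (g x - g' x) \<bullet> i = 0" if i: "i \<in> Basis" for i
  proof (rule fundamental_lemma)
    have l2: "(\<lambda>x. g x \<bullet> i) \<in> L2 \<Omega>" "(\<lambda>x. g' x \<bullet> i) \<in> L2 \<Omega>"
      using assms i by (auto intro: L2_inner_const)
    have "(\<lambda>x. 1::real) \<in> L2 \<Omega>" by (rule L2_continuous) auto
    from L2_mult_real(1)[OF l2(1) this] L2_mult_real(1)[OF l2(2) this]
    show "integrable M (\<lambda>x. (g x - g' x) \<bullet> i)" by (simp add: inner_diff_left)
    fix \<phi> assume \<phi>: "\<phi> \<in> test_functions \<Omega>"
    have "(LINT x|M. (g x \<bullet> i) * \<phi> x) = (LINT x|M. (g' x \<bullet> i) * \<phi> x)"
      using assms(3,4) \<phi> i unfolding has_weak_gradient_def by fastforce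
    then show "(LINT x|M. ((g x - g' x) \<bullet> i) * \<phi> x) = 0"
      using L2_mult_real(1)[OF l2(1) test_L2(1)[OF \<phi>]] L2_mult_real(1)[OF l2(2) test_L2(1)[OF \<phi>]]
      by (simp add: inner_diff_left left_diff_distrib)
  qed
  then have "AE x in M. \<forall>i\<in>Basis. (g x - g' x) \<bullet> i = 0"
    by (intro AE_finite_allI) auto
  then show ?thesis
  proof eventually_elim
    case (elim x)
    then show ?case by (subst euclidean_eq_iff) (simp add: inner_diff_left)
  qed
qed

subsection \<open>The closure of the test functions\<close>

text \<open>The graph of the gradient on the closure of the test functions: u travels together with
  its gradient. Sums, multiples and truncations then come with explicit gradients, whereas the
  chosen \<open>weak_grad\<close> respects them only almost everywhere.\<close>

definition H0 :: "('a \<Rightarrow> real) \<Rightarrow> ('a \<Rightarrow> 'a) \<Rightarrow> bool" where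
  "H0 u g \<longleftrightarrow> u \<in> L2 \<Omega> \<and> g \<in> L2 \<Omega> \<and>
     (\<forall>e>0. \<exists>\<phi>\<in>test_functions \<Omega>. sqint (\<lambda>x. \<phi> x - u x) < e \<and> sqint (\<lambda>x. grad \<phi> x - g x) < e)"

lemma H0_L2: "H0 u g \<Longrightarrow> u \<in> L2 \<Omega>" "H0 u g \<Longrightarrow> g \<in> L2 \<Omega>"
  by (auto simp: H0_def)

lemma H0_test: "\<phi> \<in> test_functions \<Omega> \<Longrightarrow> H0 \<phi> (grad \<phi>)"
  unfolding H0_def by (auto intro!: test_L2 bexI[of _ \<phi>] simp: sqint_def)

lemma H0_closed:
  assumes "u \<in> L2 \<Omega>" "g \<in> L2 \<Omega>"
    and "\<And>e. e > 0 \<Longrightarrow> \<exists>v h. H0 v h \<and> sqint (\<lambda>x. v x - u x) < e \<and> sqint (\<lambda>x. h x - g x) < e"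
  shows "H0 u g"
  unfolding H0_def
proof (intro conjI allI impI assms(1,2))
  fix e :: real assume "e > 0"
  obtain v h where v: "H0 v h" "sqint (\<lambda>x. v x - u x) < e / 4" "sqint (\<lambda>x. h x - g x) < e / 4"
    using assms(3)[of "e / 4"] \<open>e > 0\<close> by auto
  obtain \<phi> where \<phi>: "\<phi> \<in> test_functions \<Omega>" "sqint (\<lambda>x. \<phi> x - v x) < e / 4" "sqint (\<lambda>x. grad \<phi> x - h x) < e / 4"
    using v(1) \<open>e > 0\<close> unfolding H0_def by (meson zero_less_divide_iff zero_less_numeral)
  have "sqint (\<lambda>x. \<phi> x - u x) < e" "sqint (\<lambda>x. grad \<phi> x - g x) < e"
    using sqint_triangle[OF test_L2(1)[OF \<phi>(1)] H0_L2(1)[OF v(1)] assms(1)]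
      sqint_triangle[OF test_L2(2)[OF \<phi>(1)] H0_L2(2)[OF v(1)] assms(2)] v \<phi> by linarith+
  then show "\<exists>\<phi>\<in>test_functions \<Omega>. sqint (\<lambda>x. \<phi> x - u x) < e \<and> sqint (\<lambda>x. grad \<phi> x - g x) < e"
    using \<phi>(1) by blast
qed

lemma H0_add:
  assumes "H0 u g" "H0 v h"
  shows "H0 (\<lambda>x. u x + v x) (\<lambda>x. g x + h x)"
  unfolding H0_def
proof (intro conjI allI impI)
  show "(\<lambda>x. u x + v x) \<in> L2 \<Omega>" "(\<lambda>x. g x + h x) \<in> L2 \<Omega>"
    using L2_add(1)[OF H0_L2(1)[OF assms(1)] H0_L2(1)[OF assms(2)]]
      L2_add(1)[OF H0_L2(2)[OF assms(1)] H0_L2(2)[OF assms(2)]] by simp_all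
  fix e :: real assume e: "e > 0"
  obtain \<phi> where \<phi>: "\<phi> \<in> test_functions \<Omega>" "sqint (\<lambda>x. \<phi> x - u x) < e / 4" "sqint (\<lambda>x. grad \<phi> x - g x) < e / 4"
    using assms(1) e unfolding H0_def by (meson zero_less_divide_iff zero_less_numeral)
  obtain \<psi> where \<psi>: "\<psi> \<in> test_functions \<Omega>" "sqint (\<lambda>x. \<psi> x - v x) < e / 4" "sqint (\<lambda>x. grad \<psi> x - h x) < e / 4"
    using assms(2) e unfolding H0_def by (meson zero_less_divide_iff zero_less_numeral)
  have 1: "sqint (\<lambda>x. (\<phi> x + \<psi> x) - (u x + v x)) < e"
    using L2_add(2)[OF L2_diff(1)[OF test_L2(1)[OF \<phi>(1)] H0_L2(1)[OF assms(1)]]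
        L2_diff(1)[OF test_L2(1)[OF \<psi>(1)] H0_L2(1)[OF assms(2)]]] \<phi>(2) \<psi>(2)
    by (simp add: algebra_simps)
  have 2: "sqint (\<lambda>x. grad (\<lambda>x. \<phi> x + \<psi> x) x - (g x + h x)) < e"
    using L2_add(2)[OF L2_diff(1)[OF test_L2(2)[OF \<phi>(1)] H0_L2(2)[OF assms(1)]]
        L2_diff(1)[OF test_L2(2)[OF \<psi>(1)] H0_L2(2)[OF assms(2)]]] \<phi>(3) \<psi>(3)
    by (simp add: algebra_simps grad_add test_smooth[OF \<phi>(1)] test_smooth[OF \<psi>(1)])
  show "\<exists>\<phi>\<in>test_functions \<Omega>. sqint (\<lambda>x. \<phi> x - (u x + v x)) < e \<and> sqint (\<lambda>x. grad \<phi> x - (g x + h x)) < e"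
    using 1 2 test_add[OF \<phi>(1) \<psi>(1)] by (intro bexI[of _ "\<lambda>x. \<phi> x + \<psi> x"] conjI)
qed

lemma H0_cmult:
  assumes "H0 u g"
  shows "H0 (\<lambda>x. c * u x) (\<lambda>x. c *\<^sub>R g x)"
  unfolding H0_def
proof (intro conjI allI impI)
  show "(\<lambda>x. c * u x) \<in> L2 \<Omega>" "(\<lambda>x. c *\<^sub>R g x) \<in> L2 \<Omega>"
    using L2_scaleR(1)[of u c] L2_scaleR(1)[of g c] H0_L2[OF assms] by auto
  fix e :: real assume e: "e > 0"
  \<comment> \<open>The summand 1 keeps the quotient meaningful for c = 0.\<close>
  have p: "c\<^sup>2 + 1 > 0" by (simp add: add_nonneg_pos)
  then obtain \<phi> where \<phi>: "\<phi> \<in> test_functions \<Omega>" "sqint (\<lambda>x. \<phi> x - u x) < e / (c\<^sup>2 + 1)"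
      "sqint (\<lambda>x. grad \<phi> x - g x) < e / (c\<^sup>2 + 1)"
    using assms e unfolding H0_def by (meson zero_less_divide_iff)
  have small: "c\<^sup>2 * y < e" if "y < e / (c\<^sup>2 + 1)" "y \<ge> 0" for y
  proof -
    have "c\<^sup>2 * y \<le> (c\<^sup>2 + 1) * y" using that by (simp add: mult_right_mono)
    also have "\<dots> < e" using that p by (simp add: pos_less_divide_eq mult.commute)
    finally show ?thesis .
  qed
  have 1: "sqint (\<lambda>x. c * \<phi> x - c * u x) < e"
    using L2_scaleR(2)[OF L2_diff(1)[OF test_L2(1)[OF \<phi>(1)] H0_L2(1)[OF assms]], of c] small[OF \<phi>(2)]
    by (simp add: right_diff_distrib)
  have 2: "sqint (\<lambda>x. grad (\<lambda>x. c * \<phi> x) x - c *\<^sub>R g x) < e"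
    using L2_scaleR(2)[OF L2_diff(1)[OF test_L2(2)[OF \<phi>(1)] H0_L2(2)[OF assms]], of c] small[OF \<phi>(3)]
    by (simp add: scaleR_diff_right grad_cmult test_smooth[OF \<phi>(1)])
  show "\<exists>\<phi>\<in>test_functions \<Omega>. sqint (\<lambda>x. \<phi> x - c * u x) < e \<and> sqint (\<lambda>x. grad \<phi> x - c *\<^sub>R g x) < e"
    using 1 2 test_mult[OF \<phi>(1) smooth_intros(1)[of c]]
    by (intro bexI[of _ "\<lambda>x. c * \<phi> x"] conjI)
qed

lemma H0_diff:
  assumes "H0 u g" "H0 v h"
  shows "H0 (\<lambda>x. u x - v x) (\<lambda>x. g x - h x)"
  using H0_add[OF assms(1) H0_cmult[OF assms(2), of "-1"]] by simp

text \<open>The boundary values of \<open>u\<close> vanish: \<open>\<psi>\<close> need not have support in \<open>\<Omega>\<close>.\<close>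

lemma H0_integration_by_parts:
  assumes H: "H0 u g" and i: "i \<in> Basis"
    and \<psi>: "\<And>x. (\<psi> has_derivative \<psi>' x) (at x)" "continuous_on UNIV (\<lambda>x. \<psi>' x i)"
  shows "(LINT x|M. u x * \<psi>' x i) = - (LINT x|M. (g x \<bullet> i) * \<psi> x)"
proof -
  have c\<psi>: "continuous_on UNIV \<psi>"
    using \<psi>(1) by (auto simp: continuous_on_eq_continuous_at intro: has_derivative_continuous)
  note l2 = L2_continuous[OF c\<psi>] L2_continuous[OF \<psi>(2)]
  define C where "C = sqint \<psi> + sqint (\<lambda>x. \<psi>' x i)"
  have C: "C \<ge> 0" by (simp add: C_def)
  let ?d = "(LINT x|M. u x * \<psi>' x i) + (LINT x|M. (g x \<bullet> i) * \<psi> x)"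
  have "\<bar>?d\<bar> \<le> 2 * sqrt (e * C)" if e: "e > 0" for e
  proof -
    obtain \<phi> where \<phi>: "\<phi> \<in> test_functions \<Omega>" "sqint (\<lambda>x. \<phi> x - u x) < e" "sqint (\<lambda>x. grad \<phi> x - g x) < e"
      using H e unfolding H0_def by blast
    have "sqint (\<lambda>x. grad \<phi> x \<bullet> i - g x \<bullet> i) \<le> sqint (\<lambda>x. grad \<phi> x - g x)"
      using L2_inner_const(2)[OF L2_diff(1)[OF test_L2(2)[OF \<phi>(1)] H0_L2(2)[OF H]], of i] i
      by (simp add: inner_diff_left)
    then have e2: "sqint (\<lambda>x. grad \<phi> x \<bullet> i - g x \<bullet> i) \<le> e" using \<phi>(3) by simp
    have 1: "\<bar>(LINT x|M. \<phi> x * \<psi>' x i) - (LINT x|M. u x * \<psi>' x i)\<bar> \<le> sqrt (e * sqint (\<lambda>x. \<psi>' x i))"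
      using L2_limit_integral[OF test_L2(1)[OF \<phi>(1)] H0_L2(1)[OF H] l2(2)] \<phi>(2) by simp
    have 2: "\<bar>(LINT x|M. (grad \<phi> x \<bullet> i) * \<psi> x) - (LINT x|M. (g x \<bullet> i) * \<psi> x)\<bar> \<le> sqrt (e * sqint \<psi>)"
      by (rule L2_limit_integral[OF _ _ l2(1) e2])
         (intro L2_inner_const test_L2(2)[OF \<phi>(1)] H0_L2(2)[OF H]; use i in simp)+
    have 3: "(LINT x|M. \<phi> x * \<psi>' x i) = - (LINT x|M. (grad \<phi> x \<bullet> i) * \<psi> x)"
      using integration_by_parts_test[OF \<phi>(1) i \<psi>] i by simp
    have "sqrt (e * sqint (\<lambda>x. \<psi>' x i)) \<le> sqrt (e * C)" "sqrt (e * sqint \<psi>) \<le> sqrt (e * C)"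
      using e by (auto simp: C_def intro!: mult_left_mono)
    then show ?thesis using 1 2 3 by linarith
  qed
  note b = this
  have "\<bar>?d\<bar> \<le> 0"
  proof (rule field_le_epsilon)
    fix r :: real assume r: "r > 0"
    define e where "e = (r / 2)\<^sup>2 / (C + 1)"
    have e: "e > 0" using r C by (simp add: e_def)
    have "e * C \<le> e * (C + 1)" using e by (intro mult_left_mono) auto
    also have "\<dots> = (r / 2)\<^sup>2" using C by (simp add: e_def)
    finally have "sqrt (e * C) \<le> r / 2" using r by (intro real_le_lsqrt) auto
    then show "\<bar>?d\<bar> \<le> 0 + r" using b[OF e] by linarith
  qed
  then show ?thesis by linarith
qed

lemma H0_weak_gradient: assumes "H0 u g" shows "has_weak_gradient \<Omega> u g"
  unfolding has_weak_gradient_def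
proof (intro ballI)
  fix \<phi> and i :: 'a assume \<phi>: "\<phi> \<in> test_functions \<Omega>" and i: "i \<in> Basis"
  show "(LINT x|M. u x * pderiv_at \<phi> i x) = - (LINT x|M. (g x \<bullet> i) * \<phi> x)"
    by (rule H0_integration_by_parts[OF assms i])
       (use \<phi> i in \<open>auto intro: test_smooth smooth_has_derivative smooth_continuous test_pderiv\<close>)
qed

lemma H0_unique: "H0 u g \<Longrightarrow> H0 u h \<Longrightarrow> AE x in M. g x = h x"
  by (rule weak_gradient_unique) (auto intro: H0_L2 H0_weak_gradient)

text \<open>The choice in \<open>weak_grad\<close> is harmless: by uniqueness almost everywhere
  every square-integrable weak gradient gives the same integral.\<close>

lemma dirichlet_integral_eq:
  assumes "g \<in> L2 \<Omega>" "has_weak_gradient \<Omega> u g"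
  shows "dirichlet_integral \<Omega> u = sqint g" "weak_grad \<Omega> u \<in> L2 \<Omega>" "has_weak_gradient \<Omega> u (weak_grad \<Omega> u)"
proof -
  have w: "weak_grad \<Omega> u \<in> L2 \<Omega> \<and> has_weak_gradient \<Omega> u (weak_grad \<Omega> u)"
    unfolding weak_grad_def by (rule someI[of _ g]) (use assms in auto)
  then show "weak_grad \<Omega> u \<in> L2 \<Omega>" "has_weak_gradient \<Omega> u (weak_grad \<Omega> u)" by auto
  have "AE x in M. weak_grad \<Omega> u x = g x"
    using weak_gradient_unique w assms by blast
  then show "dirichlet_integral \<Omega> u = sqint g"
    unfolding dirichlet_integral_def sqint_def[symmetric] using w assms L2D(1) by (intro sqint_cong_AE) auto
qed

lemma H0_dirichlet: "H0 u g \<Longrightarrow> dirichlet_integral \<Omega> u = sqint g"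
  by (rule dirichlet_integral_eq) (auto intro: H0_L2 H0_weak_gradient)

text \<open>\<open>H10\<close> measures the difference of \<phi> n and u in a norm that contains
  \<open>weak_grad\<close> of this difference, an unspecified choice. The norm can be evaluated only
  after grad (\<phi> n) - g has been recognised as a weak gradient of the difference.\<close>

lemma H10_iff: "u \<in> H10 \<Omega> \<longleftrightarrow> (\<exists>g. H0 u g)"
proof
  assume u: "u \<in> H10 \<Omega>"
  then obtain g where g: "g \<in> L2 \<Omega>" "has_weak_gradient \<Omega> u g" and u2: "u \<in> L2 \<Omega>"
    by (auto simp: H10_def H1_def)
  obtain \<phi> where \<phi>: "\<And>n. \<phi> n \<in> test_functions \<Omega>" "(\<lambda>n. H1_norm \<Omega> (\<lambda>x. \<phi> n x - u x)) \<longlonglongrightarrow> 0"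
    using u by (auto simp: H10_def)
  have wg: "has_weak_gradient \<Omega> (\<lambda>x. \<phi> n x - u x) (\<lambda>x. grad (\<phi> n) x - g x)" for n
    unfolding has_weak_gradient_def
  proof (intro ballI)
    fix \<psi> and i :: 'a assume \<psi>: "\<psi> \<in> test_functions \<Omega>" and i: "i \<in> Basis"
    have p: "pderiv_at \<psi> i \<in> L2 \<Omega>" using test_L2(1)[OF test_pderiv[OF \<psi> i]] .
    have "(LINT x|M. (\<phi> n x - u x) * pderiv_at \<psi> i x) =
        (LINT x|M. \<phi> n x * pderiv_at \<psi> i x) - (LINT x|M. u x * pderiv_at \<psi> i x)"
      using L2_mult_real(1)[OF test_L2(1)[OF \<phi>(1)] p] L2_mult_real(1)[OF u2 p] by (simp add: left_diff_distrib)
    also have "\<dots> = - (LINT x|M. (grad (\<phi> n) x \<bullet> i) * \<psi> x) + (LINT x|M. (g x \<bullet> i) * \<psi> x)"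
      using H0_weak_gradient[OF H0_test[OF \<phi>(1)[of n]]] g(2) \<psi> i unfolding has_weak_gradient_def by fastforce
    also have "\<dots> = - (LINT x|M. ((grad (\<phi> n) x - g x) \<bullet> i) * \<psi> x)"
    proof -
      have "integrable M (\<lambda>x. (grad (\<phi> n) x \<bullet> i) * \<psi> x)" "integrable M (\<lambda>x. (g x \<bullet> i) * \<psi> x)"
        using i by (intro L2_mult_real(1) L2_inner_const test_L2[OF \<phi>(1)] test_L2(1)[OF \<psi>] g(1); simp)+
      then show ?thesis by (simp add: inner_diff_left left_diff_distrib del: grad_inner_Basis)
    qed
    finally show "(LINT x|M. (\<phi> n x - u x) * pderiv_at \<psi> i x) = - (LINT x|M. ((grad (\<phi> n) x - g x) \<bullet> i) * \<psi> x)" .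
  qed
  have D: "dirichlet_integral \<Omega> (\<lambda>x. \<phi> n x - u x) = sqint (\<lambda>x. grad (\<phi> n) x - g x)" for n
    by (rule dirichlet_integral_eq(1)[OF _ wg]) (intro L2_diff test_L2[OF \<phi>(1)] g(1))
  have "H0 u g" unfolding H0_def
  proof (intro conjI u2 g(1) allI impI)
    fix e :: real assume e: "e > 0"
    then obtain n where n: "H1_norm \<Omega> (\<lambda>x. \<phi> n x - u x) < sqrt e"
      using order_tendstoD(2)[OF \<phi>(2), of "sqrt e"] by (auto simp: eventually_sequentially)
    then have "sqint (\<lambda>x. \<phi> n x - u x) + sqint (\<lambda>x. grad (\<phi> n) x - g x) < e"
      unfolding H1_norm_def D by (simp add: sqint_def)
    moreover have "sqint (\<lambda>x. \<phi> n x - u x) \<ge> 0" "sqint (\<lambda>x. grad (\<phi> n) x - g x) \<ge> 0" by auto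
    ultimately show "\<exists>\<phi>\<in>test_functions \<Omega>. sqint (\<lambda>x. \<phi> x - u x) < e \<and> sqint (\<lambda>x. grad \<phi> x - g x) < e"
      using \<phi>(1)[of n] by (intro bexI[of _ "\<phi> n"]) linarith+
  qed
  then show "\<exists>g. H0 u g" by (rule exI[of "H0 u"])
next
  assume "\<exists>g. H0 u g"
  then obtain g where g: "H0 u g" ..
  have "\<exists>\<phi>\<in>test_functions \<Omega>. sqint (\<lambda>x. \<phi> x - u x) < 1 / real (Suc n) \<and> sqint (\<lambda>x. grad \<phi> x - g x) < 1 / real (Suc n)" for n
    using g unfolding H0_def by simp
  then obtain \<phi> where \<phi>: "\<And>n. \<phi> n \<in> test_functions \<Omega>" "\<And>n. sqint (\<lambda>x. \<phi> n x - u x) < 1 / real (Suc n)"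
      "\<And>n. sqint (\<lambda>x. grad (\<phi> n) x - g x) < 1 / real (Suc n)" by metis
  have N: "H1_norm \<Omega> (\<lambda>x. \<phi> n x - u x) = sqrt (sqint (\<lambda>x. \<phi> n x - u x) + sqint (\<lambda>x. grad (\<phi> n) x - g x))" for n
    unfolding H1_norm_def H0_dirichlet[OF H0_diff[OF H0_test[OF \<phi>(1)] g]] by (simp add: sqint_def)
  have l: "(\<lambda>n. 1 / real (Suc n)) \<longlonglongrightarrow> 0" using LIMSEQ_Suc[OF lim_1_over_n] by simp
  have "(\<lambda>n. sqint (\<lambda>x. \<phi> n x - u x)) \<longlonglongrightarrow> 0" "(\<lambda>n. sqint (\<lambda>x. grad (\<phi> n) x - g x)) \<longlonglongrightarrow> 0"
    using \<phi>(2,3)[THEN less_imp_le]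
    by (auto intro!: tendsto_sandwich[OF _ _ tendsto_const l] simp del: of_nat_Suc)
  from tendsto_real_sqrt[OF tendsto_add[OF this]]
  have "(\<lambda>n. H1_norm \<Omega> (\<lambda>x. \<phi> n x - u x)) \<longlonglongrightarrow> 0" unfolding N by simp
  then show "u \<in> H10 \<Omega>" unfolding H10_def H1_def
    using \<phi>(1) H0_L2[OF g] H0_weak_gradient[OF g] by blast
qed

text \<open>The i-th coordinate has i-th derivative 1. Inserting this factor into the integral of
  \<phi>^2 and integrating by parts gives -2 times the integral of x_i \<phi> times the i-th
  derivative of \<phi>; as |x_i| \<le> R on the domain, Cauchy-Schwarz yields the constant 4
  R^2.\<close>

lemma test_poincare:
  obtains C where "C > 0" "\<And>\<phi>. \<phi> \<in> test_functions \<Omega> \<Longrightarrow> sqint \<phi> \<le> C * sqint (grad \<phi>)"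
proof -
  obtain R where R: "R > 0" "\<And>x. x \<in> \<Omega> \<Longrightarrow> norm x \<le> R"
    using bounded_Om by (metis bounded_pos)
  obtain i :: 'a where i: "i \<in> Basis" using nonempty_Basis by blast
  have "sqint \<phi> \<le> (4 * R\<^sup>2) * sqint (grad \<phi>)" if \<phi>: "\<phi> \<in> test_functions \<Omega>" for \<phi>
  proof -
    have s: "smooth \<phi>" using \<phi> by (rule test_smooth)
    have d: "((\<lambda>x. (x \<bullet> i) * \<phi> x) has_derivative (\<lambda>h. (x \<bullet> i) * frechet_derivative \<phi> (at x) h + (h \<bullet> i) * \<phi> x)) (at x)" for x
      by (auto intro!: derivative_eq_intros smooth_has_derivative[OF s])
    have cont: "continuous_on UNIV \<phi>" "continuous_on UNIV (pderiv_at \<phi> i)"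
      using s i by (auto intro: smooth_continuous smooth_pderiv)
    have l2: "\<phi> \<in> L2 \<Omega>" "(\<lambda>x. (x \<bullet> i) * \<phi> x) \<in> L2 \<Omega>" "pderiv_at \<phi> i \<in> L2 \<Omega>" "(\<lambda>x. (x \<bullet> i) * pderiv_at \<phi> i x) \<in> L2 \<Omega>"
      by (intro L2_continuous continuous_intros cont)+
    have "(LINT x|M. \<phi> x * ((x \<bullet> i) * pderiv_at \<phi> i x + (i \<bullet> i) * \<phi> x)) = - (LINT x|M. pderiv_at \<phi> i x * ((x \<bullet> i) * \<phi> x))"
      by (rule integration_by_parts_test[OF \<phi> i d]) (intro continuous_intros cont)
    moreover have "(LINT x|M. \<phi> x * ((x \<bullet> i) * pderiv_at \<phi> i x + (i \<bullet> i) * \<phi> x)) =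
        (LINT x|M. \<phi> x * ((x \<bullet> i) * pderiv_at \<phi> i x)) + (LINT x|M. \<phi> x * \<phi> x)"
      using i L2_mult_real(1)[OF l2(1,4)] L2_mult_real(1)[OF l2(1,1)] by (simp add: distrib_left)
    ultimately have "sqint \<phi> = - 2 * (LINT x|M. ((x \<bullet> i) * \<phi> x) * pderiv_at \<phi> i x)"
      by (simp add: sqint_def power2_eq_square mult_ac)
    then have "(sqint \<phi>)\<^sup>2 = 4 * (LINT x|M. ((x \<bullet> i) * \<phi> x) * pderiv_at \<phi> i x)\<^sup>2"
      by (simp add: power2_eq_square)
    also have "\<dots> \<le> 4 * (sqint (\<lambda>x. (x \<bullet> i) * \<phi> x) * sqint (pderiv_at \<phi> i))"
      using L2_mult_real(2)[OF l2(2,3)] by simp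
    also have "\<dots> \<le> 4 * ((R\<^sup>2 * sqint \<phi>) * sqint (grad \<phi>))"
    proof (intro mult_left_mono mult_mono)
      have "norm ((x \<bullet> i) * \<phi> x) \<le> R * norm (\<phi> x)" if "x \<in> \<Omega>" for x
        using R(2)[OF that] Basis_le_norm[OF i, of x] by (auto simp: abs_mult intro!: mult_right_mono)
      then show "sqint (\<lambda>x. (x \<bullet> i) * \<phi> x) \<le> R\<^sup>2 * sqint \<phi>"
        by (intro L2_dominated(2)[OF l2(1) L2D(1)[OF l2(2)]] AE_I2) auto
      have "sqint (\<lambda>x. grad \<phi> x \<bullet> i) \<le> sqint (grad \<phi>)"
        using i by (intro L2_inner_const(2) test_L2(2)[OF \<phi>]) auto
      then show "sqint (pderiv_at \<phi> i) \<le> sqint (grad \<phi>)" using i by simp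
    qed auto
    finally have f: "sqint \<phi> * sqint \<phi> \<le> sqint \<phi> * ((4 * R\<^sup>2) * sqint (grad \<phi>))"
      by (simp add: power2_eq_square mult_ac)
    show ?thesis
    proof (cases "sqint \<phi> = 0")
      case False
      then have "sqint \<phi> > 0" using sqint_nonneg[of \<phi>] by linarith
      then show ?thesis using f by simp
    qed simp
  qed
  then show ?thesis using that[of "4 * R\<^sup>2"] R(1) by simp
qed

text \<open>Makes the Dirichlet integrals of both parts of a minimiser strictly positive. The
  Poincare inequality is known for test functions and is passed on by approximation.\<close>

lemma H0_zero_gradient:
  assumes H: "H0 u g" and z: "sqint g = 0"
  shows "AE x in M. u x = 0"
proof -
  obtain C where C: "C > 0" "\<And>\<phi>. \<phi> \<in> test_functions \<Omega> \<Longrightarrow> sqint \<phi> \<le> C * sqint (grad \<phi>)"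
    using test_poincare by blast
  have "sqint u \<le> 0 + e" if "e > 0" for e
  proof -
    \<comment> \<open>Chosen so that the approximation error 2 d and the contribution 4 C d of the
      Poincare inequality add up to e.\<close>
    define d where "d = e / (2 + 4 * C)"
    have d: "d > 0" using C that by (simp add: d_def add_pos_pos)
    obtain \<phi> where \<phi>: "\<phi> \<in> test_functions \<Omega>" "sqint (\<lambda>x. \<phi> x - u x) < d" "sqint (\<lambda>x. grad \<phi> x - g x) < d"
      using H d unfolding H0_def by blast
    have "sqint (grad \<phi>) \<le> 2 * d"
      using L2_add(2)[OF L2_diff(1)[OF test_L2(2)[OF \<phi>(1)] H0_L2(2)[OF H]] H0_L2(2)[OF H]] \<phi>(3) z by simp
    then have "C * sqint (grad \<phi>) \<le> C * (2 * d)" using C(1) by (intro mult_left_mono) auto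
    then have "sqint \<phi> \<le> 2 * C * d" using C(2)[OF \<phi>(1)] by linarith
    moreover have "sqint u \<le> 2 * sqint \<phi> + 2 * sqint (\<lambda>x. \<phi> x - u x)"
      using L2_diff(2)[OF test_L2(1)[OF \<phi>(1)] L2_diff(1)[OF test_L2(1)[OF \<phi>(1)] H0_L2(1)[OF H]]] by simp
    ultimately have "sqint u \<le> (2 + 4 * C) * d" using \<phi>(2) by (simp add: algebra_simps)
    also have "\<dots> = e" using C(1) by (simp add: d_def)
    finally show ?thesis by simp
  qed
  then have "sqint u \<le> 0" by (rule field_le_epsilon)
  then have "sqint u = 0" using sqint_nonneg[of u] by linarith
  then show ?thesis using sqint_zero_iff[OF H0_L2(1)[OF H]] by simp
qed

section \<open>Truncations\<close>

lemma H0_seq: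
  assumes "\<And>n. H0 (v n) (h n)" "u \<in> L2 \<Omega>" "g \<in> L2 \<Omega>"
    "(\<lambda>n. sqint (\<lambda>x. v n x - u x)) \<longlonglongrightarrow> 0" "(\<lambda>n. sqint (\<lambda>x. h n x - g x)) \<longlonglongrightarrow> 0"
  shows "H0 u g"
proof (rule H0_closed[OF assms(2,3)])
  fix e :: real assume "e > 0"
  then have "eventually (\<lambda>n. sqint (\<lambda>x. v n x - u x) < e \<and> sqint (\<lambda>x. h n x - g x) < e) sequentially"
    using assms(4,5) by (intro eventually_conj order_tendstoD(2)) auto
  then show "\<exists>v h. H0 v h \<and> sqint (\<lambda>x. v x - u x) < e \<and> sqint (\<lambda>x. h x - g x) < e"
    using assms(1) by (auto simp: eventually_sequentially)
qed

lemma sqint_dominated_limit: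
  fixes f :: "nat \<Rightarrow> 'a \<Rightarrow> 'b::euclidean_space" and w :: "'a \<Rightarrow> 'c::euclidean_space"
  assumes "w \<in> L2 \<Omega>" "\<And>n. f n \<in> borel_measurable M"
    "\<And>n. AE x in M. norm (f n x) \<le> C * norm (w x)" "AE x in M. (\<lambda>n. f n x) \<longlonglongrightarrow> 0"
  shows "(\<lambda>n. sqint (f n)) \<longlonglongrightarrow> 0"
proof -
  have "(\<lambda>n. LINT x|M. (norm (f n x))\<^sup>2) \<longlonglongrightarrow> (LINT x|M. 0)"
  proof (rule integral_dominated_convergence[where w="\<lambda>x. C\<^sup>2 * (norm (w x))\<^sup>2"])
    show "integrable M (\<lambda>x. C\<^sup>2 * (norm (w x))\<^sup>2)" using L2D[OF assms(1)] by simp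
    show "AE x in M. (\<lambda>n. (norm (f n x))\<^sup>2) \<longlonglongrightarrow> 0"
      using assms(4) by eventually_elim (auto intro!: tendsto_eq_intros)
    show "AE x in M. norm ((norm (f n x))\<^sup>2) \<le> C\<^sup>2 * (norm (w x))\<^sup>2" for n
      using assms(3)[of n]
    proof eventually_elim
      case (elim x)
      then show ?case using power_mono[OF elim norm_ge_zero, of 2] by (simp add: power_mult_distrib)
    qed
  qed (use assms(2) in auto)
  then show ?thesis by (simp add: sqint_def)
qed

text \<open>For test functions this is the classical chain rule. In the limit the error of the
  gradients splits into f (\<psi> n) times grad (\<psi> n) - g, which is small because f is bounded,
  and f (\<psi> n) - f (u) times g, which is handled by dominated convergence.\<close>

lemma H0_compose:
  assumes H: "H0 u g" and F: "smooth F" "F 0 = 0" "\<And>t. (F has_real_derivative f t) (at t)"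
    and f: "\<And>t. \<bar>f t\<bar> \<le> 1" "continuous_on UNIV f"
  shows "H0 (\<lambda>x. F (u x)) (\<lambda>x. f (u x) *\<^sub>R g x)"
proof -
  have lip: "\<bar>F s - F t\<bar> \<le> 1 * \<bar>s - t\<bar>" for s t
    using field_differentiable_bound[of UNIV F f 1] F(3) f(1) by (auto simp: has_field_derivative_at_within)
  note ul = H0_L2[OF H]
  note um = L2D(1)[OF ul(1)] L2D(1)[OF ul(2)]
  have fm: "f \<in> borel_measurable borel" and Fm: "F \<in> borel_measurable borel"
    using f(2) F(1) by (auto intro: borel_measurable_continuous_onI smooth_continuous)
  have "\<exists>\<phi>\<in>test_functions \<Omega>. sqint (\<lambda>x. \<phi> x - u x) < 1 / real (Suc n) \<and> sqint (\<lambda>x. grad \<phi> x - g x) < 1 / real (Suc n)" for n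
    using H unfolding H0_def by simp
  then obtain \<phi> where \<phi>: "\<And>n. \<phi> n \<in> test_functions \<Omega>" "\<And>n. sqint (\<lambda>x. \<phi> n x - u x) < 1 / real (Suc n)"
      "\<And>n. sqint (\<lambda>x. grad (\<phi> n) x - g x) < 1 / real (Suc n)" by metis
  have l: "(\<lambda>n. 1 / real (Suc n)) \<longlonglongrightarrow> 0" using LIMSEQ_Suc[OF lim_1_over_n] by simp
  have c: "(\<lambda>n. sqint (\<lambda>x. \<phi> n x - u x)) \<longlonglongrightarrow> 0" "(\<lambda>n. sqint (\<lambda>x. grad (\<phi> n) x - g x)) \<longlonglongrightarrow> 0"
    using \<phi>(2,3)[THEN less_imp_le]
    by (auto intro!: tendsto_sandwich[OF _ _ tendsto_const l] simp del: of_nat_Suc)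
  \<comment> \<open>Convergence in L2 gives convergence almost everywhere only along a subsequence;
    the dominated convergence below needs the latter.\<close>
  have "\<exists>r::nat\<Rightarrow>nat. strict_mono r \<and> (AE x in M. (\<lambda>n. (\<phi> (r n) x - u x)\<^sup>2) \<longlonglongrightarrow> 0)"
    by (rule tendsto_L1_AE_subseq)
       (use c(1) L2D(2)[OF L2_diff(1)[OF test_L2(1)[OF \<phi>(1)] ul(1)]] in \<open>auto simp: sqint_def\<close>)
  then obtain r :: "nat \<Rightarrow> nat" where r: "strict_mono r" "AE x in M. (\<lambda>n. (\<phi> (r n) x - u x)\<^sup>2) \<longlonglongrightarrow> 0"
    by blast
  define \<psi> where "\<psi> n = \<phi> (r n)" for n
  have \<psi>: "\<psi> n \<in> test_functions \<Omega>" for n by (simp add: \<psi>_def \<phi>(1))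
  have \<psi>m: "\<psi> n \<in> borel_measurable M" for n using test_L2(1)[OF \<psi>] L2D by blast
  have \<psi>c: "(\<lambda>n. sqint (\<lambda>x. \<psi> n x - u x)) \<longlonglongrightarrow> 0" "(\<lambda>n. sqint (\<lambda>x. grad (\<psi> n) x - g x)) \<longlonglongrightarrow> 0"
    using LIMSEQ_subseq_LIMSEQ[OF c(1) r(1)] LIMSEQ_subseq_LIMSEQ[OF c(2) r(1)] by (auto simp: \<psi>_def o_def)
  have \<psi>a: "AE x in M. (\<lambda>n. \<psi> n x) \<longlonglongrightarrow> u x"
    using r(2)
  proof eventually_elim
    case (elim x)
    then have "(\<lambda>n. sqrt ((\<psi> n x - u x)\<^sup>2)) \<longlonglongrightarrow> sqrt 0" unfolding \<psi>_def by (rule tendsto_real_sqrt)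
    then have "(\<lambda>n. \<psi> n x - u x) \<longlonglongrightarrow> 0" by (simp add: tendsto_rabs_zero_iff)
    then show ?case by (rule LIM_zero_cancel)
  qed
  have fb: "norm (f s *\<^sub>R v) \<le> 1 * norm v" for s and v :: 'a
    using mult_right_mono[OF f(1)[of s] norm_ge_zero[of v]] by simp
  have fd: "norm ((f s - f t) *\<^sub>R v) \<le> 2 * norm v" for s t and v :: 'a
  proof -
    have "\<bar>f s - f t\<bar> \<le> 2" using f(1)[of s] f(1)[of t] by linarith
    then show ?thesis unfolding norm_scaleR by (rule mult_right_mono) simp
  qed
  have gl: "(\<lambda>x. f (u x) *\<^sub>R g x) \<in> L2 \<Omega>"
    by (rule L2_dominated(1)[OF ul(2), of _ 1]) (use um fm fb in auto)
  have Fl: "(\<lambda>x. F (u x)) \<in> L2 \<Omega>"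
    by (rule L2_dominated(1)[OF ul(1), of _ 1]) (use um Fm lip[of _ 0] F(2) in auto)
  show ?thesis
  proof (rule H0_seq[OF _ Fl gl])
    show "H0 (\<lambda>x. F (\<psi> n x)) (grad (\<lambda>x. F (\<psi> n x)))" for n
      by (rule H0_test, rule test_compose[of "\<psi> n" \<Omega> F, OF \<psi> F(1,2)])
    have s1: "sqint (\<lambda>x. F (\<psi> n x) - F (u x)) \<le> sqint (\<lambda>x. \<psi> n x - u x)" for n
      using L2_dominated(2)[OF L2_diff(1)[OF test_L2(1)[OF \<psi>] ul(1)], of "\<lambda>x. F (\<psi> n x) - F (u x)" 1]
        um \<psi>m Fm lip by auto
    show "(\<lambda>n. sqint (\<lambda>x. F (\<psi> n x) - F (u x))) \<longlonglongrightarrow> 0"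
      by (rule tendsto_sandwich[OF _ _ tendsto_const \<psi>c(1)]) (use s1 in auto)
    have b: "(\<lambda>n. sqint (\<lambda>x. (f (\<psi> n x) - f (u x)) *\<^sub>R g x)) \<longlonglongrightarrow> 0"
    proof (rule sqint_dominated_limit[OF ul(2), of _ 2])
      show "AE x in M. (\<lambda>n. (f (\<psi> n x) - f (u x)) *\<^sub>R g x) \<longlonglongrightarrow> 0"
        using \<psi>a
      proof eventually_elim
        case (elim x)
        have "(\<lambda>n. f (\<psi> n x)) \<longlonglongrightarrow> f (u x)"
          using f(2) elim by (auto intro: continuous_on_tendsto_compose)
        then show ?case by (auto intro!: tendsto_eq_intros)
      qed
      show "AE x in M. norm ((f (\<psi> n x) - f (u x)) *\<^sub>R g x) \<le> 2 * norm (g x)" for n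
        using fd by (intro AE_I2)
      show "(\<lambda>x. (f (\<psi> n x) - f (u x)) *\<^sub>R g x) \<in> borel_measurable M" for n
        using um \<psi>m fm by measurable
    qed
    have s2: "sqint (\<lambda>x. grad (\<lambda>x. F (\<psi> n x)) x - f (u x) *\<^sub>R g x) \<le>
        2 * sqint (\<lambda>x. grad (\<psi> n) x - g x) + 2 * sqint (\<lambda>x. (f (\<psi> n x) - f (u x)) *\<^sub>R g x)" for n
    proof -
      have e: "grad (\<lambda>x. F (\<psi> n x)) x = f (\<psi> n x) *\<^sub>R grad (\<psi> n) x" for x
        by (rule grad_compose) (use F(3) test_smooth[OF \<psi>] in auto)
      have d: "(\<lambda>x. grad (\<psi> n) x - g x) \<in> L2 \<Omega>" by (intro L2_diff test_L2(2)[OF \<psi>] ul)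
      have dm: "(\<lambda>x. f (\<psi> n x) *\<^sub>R (grad (\<psi> n) x - g x)) \<in> borel_measurable M"
        using L2D(1)[OF d] \<psi>m fm by measurable
      have d1: "(\<lambda>x. f (\<psi> n x) *\<^sub>R (grad (\<psi> n) x - g x)) \<in> L2 \<Omega>"
        "sqint (\<lambda>x. f (\<psi> n x) *\<^sub>R (grad (\<psi> n) x - g x)) \<le> sqint (\<lambda>x. grad (\<psi> n) x - g x)"
        using L2_dominated[OF d dm, of 1] fb by auto
      have d2: "(\<lambda>x. (f (\<psi> n x) - f (u x)) *\<^sub>R g x) \<in> L2 \<Omega>"
      proof (rule L2_dominated(1)[OF ul(2), of _ 2])
        show "AE x in M. norm ((f (\<psi> n x) - f (u x)) *\<^sub>R g x) \<le> 2 * norm (g x)"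
          using fd by (intro AE_I2)
      qed (use um \<psi>m fm in measurable)
      have "sqint (\<lambda>x. grad (\<lambda>x. F (\<psi> n x)) x - f (u x) *\<^sub>R g x) =
          sqint (\<lambda>x. f (\<psi> n x) *\<^sub>R (grad (\<psi> n) x - g x) + (f (\<psi> n x) - f (u x)) *\<^sub>R g x)"
        by (simp add: e algebra_simps)
      then show ?thesis using L2_add(2)[OF d1(1) d2] d1(2) by simp
    qed
    show "(\<lambda>n. sqint (\<lambda>x. grad (\<lambda>x. F (\<psi> n x)) x - f (u x) *\<^sub>R g x)) \<longlonglongrightarrow> 0"
    proof (rule tendsto_sandwich[OF _ _ tendsto_const])
      show "(\<lambda>n. 2 * sqint (\<lambda>x. grad (\<psi> n) x - g x) + 2 * sqint (\<lambda>x. (f (\<psi> n x) - f (u x)) *\<^sub>R g x)) \<longlonglongrightarrow> 0"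
        using b \<psi>c(2) by (auto intro!: tendsto_eq_intros)
    qed (use s2 in auto)
  qed
qed

end

lemma ln_1_plus_exp_bounds: "max y 0 \<le> ln (1 + exp y)" "ln (1 + exp y) \<le> max y 0 + ln 2" for y :: real
proof -
  have p: "1 + exp y > 0" by (simp add: add_pos_pos)
  have "exp (max y 0) \<le> 1 + exp y" by (auto simp: max_def)
  then show "max y 0 \<le> ln (1 + exp y)" using p by (simp add: ln_ge_iff)
  have "1 + exp y \<le> exp (max y 0) * 2" by (auto simp: max_def)
  then have "ln (1 + exp y) \<le> ln (exp (max y 0) * 2)" using p by (subst ln_le_cancel_iff) auto
  also have "\<dots> = max y 0 + ln 2" by (simp add: ln_mult)
  finally show "ln (1 + exp y) \<le> max y 0 + ln 2" .
qed

text \<open>A smooth approximation of the positive part. The shift by \<open>n\<close> makes its derivative tend to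
  \<open>0\<close>, and not to \<open>1 / 2\<close>, at the origin.\<close>

definition softplus :: "real \<Rightarrow> real \<Rightarrow> real" where
  "softplus n t = (ln (1 + exp (n\<^sup>2 * t - n)) - ln (1 + exp (- n))) / n\<^sup>2"

definition softplus' :: "real \<Rightarrow> real \<Rightarrow> real" where
  "softplus' n t = 1 / (1 + exp (- (n\<^sup>2 * t - n)))"

lemma softplus_derivative:
  assumes "n > 0" shows "(softplus n has_real_derivative softplus' n t) (at t)"
proof -
  have p: "1 + exp y > 0" for y :: real by (simp add: add_pos_pos)
  have "exp y / (1 + exp y) = 1 / (1 + exp (- y))" for y :: real
    using p[of y] p[of "-y"] by (simp add: field_simps exp_minus)
  note e = this[of "n\<^sup>2 * t - n"]
  have "((\<lambda>t. ln (1 + exp (n\<^sup>2 * t - n)) - ln (1 + exp (- n))) has_real_derivative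
      exp (n\<^sup>2 * t - n) * n\<^sup>2 / (1 + exp (n\<^sup>2 * t - n))) (at t)"
    using p by (auto intro!: derivative_eq_intros)
  from DERIV_cdivide[OF this, of "n\<^sup>2"]
  have "(softplus n has_real_derivative (exp (n\<^sup>2 * t - n) * n\<^sup>2 / (1 + exp (n\<^sup>2 * t - n))) / n\<^sup>2) (at t)"
    unfolding softplus_def[abs_def] .
  also have "(exp (n\<^sup>2 * t - n) * n\<^sup>2 / (1 + exp (n\<^sup>2 * t - n))) / n\<^sup>2 = softplus' n t"
    using e assms by (simp add: softplus'_def)
  finally show ?thesis .
qed

lemma softplus_simps:
  assumes "n > 0"
  shows "smooth (softplus n)" "smooth (softplus' n)" "softplus n 0 = 0" "0 \<le> softplus' n t" "softplus' n t \<le> 1"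
    "\<bar>softplus n t - max t 0\<bar> \<le> 1 / n + 2 / n\<^sup>2"
proof -
  have "smooth (\<lambda>t. n\<^sup>2 * t - n)" by (intro smooth_intros)
  from smooth_compose[OF smooth_logistic this]
  show s: "smooth (softplus' n)" by (simp add: softplus'_def[abs_def])
  show "smooth (softplus n)" using smooth_realI[OF softplus_derivative[OF assms] s] .
  show "softplus n 0 = 0" by (simp add: softplus_def)
  have "1 + exp y > 0" for y :: real by (simp add: add_pos_pos)
  then show "0 \<le> softplus' n t" "softplus' n t \<le> 1" by (auto simp: softplus'_def less_imp_le divide_le_eq_1)
  have l2: "ln 2 \<le> (1::real)" using ln_2_less_1 by simp
  have p: "n\<^sup>2 > 0" using assms by simp
  have e: "max (n\<^sup>2 * t - n) 0 / n\<^sup>2 = max (t - 1 / n) 0"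
    using assms by (auto simp: max_def field_simps power2_eq_square)
  have "\<bar>(ln (1 + exp (n\<^sup>2 * t - n)) - ln (1 + exp (- n))) - max (n\<^sup>2 * t - n) 0\<bar> \<le> 2"
  proof -
    have "max (- n) 0 = 0" using assms by simp
    then show ?thesis
      using ln_1_plus_exp_bounds[of "n\<^sup>2 * t - n"] ln_1_plus_exp_bounds[of "- n"] l2 by linarith
  qed
  then have "\<bar>(ln (1 + exp (n\<^sup>2 * t - n)) - ln (1 + exp (- n))) - max (n\<^sup>2 * t - n) 0\<bar> / n\<^sup>2 \<le> 2 / n\<^sup>2"
    using p by (intro divide_right_mono) auto
  then have "\<bar>((ln (1 + exp (n\<^sup>2 * t - n)) - ln (1 + exp (- n))) - max (n\<^sup>2 * t - n) 0) / n\<^sup>2\<bar> \<le> 2 / n\<^sup>2"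
    by (simp only: abs_divide abs_power2)
  then have "\<bar>softplus n t - max (t - 1 / n) 0\<bar> \<le> 2 / n\<^sup>2"
    unfolding softplus_def e[symmetric] by (simp only: diff_divide_distrib)
  moreover have "\<bar>max (t - 1 / n) 0 - max t 0\<bar> \<le> 1 / n"
  proof -
    have "\<bar>max (t - r) 0 - max t 0\<bar> \<le> r" if "0 < r" for r :: real
      using that by (auto simp: max_def)
    from this[of "1 / n"] show ?thesis using assms by (simp del: abs_minus_commute)
  qed
  ultimately show "\<bar>softplus n t - max t 0\<bar> \<le> 1 / n + 2 / n\<^sup>2" by linarith
qed

lemma softplus_limits:
  "(\<lambda>n. softplus (real (Suc n)) t) \<longlonglongrightarrow> max t 0"
  "(\<lambda>n. softplus' (real (Suc n)) t) \<longlonglongrightarrow> (if t > 0 then 1 else 0)"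
proof -
  have "(\<lambda>n. 1 / real (Suc n) + 2 / (real (Suc n))\<^sup>2) \<longlonglongrightarrow> 0" by real_asymp
  then have "(\<lambda>n. softplus (real (Suc n)) t - max t 0) \<longlonglongrightarrow> 0"
    by (rule Lim_null_comparison[rotated]) (use softplus_simps(6) in \<open>auto simp del: of_nat_Suc\<close>)
  then show "(\<lambda>n. softplus (real (Suc n)) t) \<longlonglongrightarrow> max t 0" by (rule LIM_zero_cancel)
  have "(\<lambda>n. 1 / (1 + exp (- ((real (Suc n))\<^sup>2 * t - real (Suc n))))) \<longlonglongrightarrow> 1" if "t > 0"
    using that by real_asymp
  moreover have "(\<lambda>n. 1 / (1 + exp (- ((real (Suc n))\<^sup>2 * t - real (Suc n))))) \<longlonglongrightarrow> 0" if "t < 0"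
    using that by real_asymp
  moreover have "(\<lambda>n. 1 / (1 + exp (- ((real (Suc n))\<^sup>2 * 0 - real (Suc n))))) \<longlonglongrightarrow> 0"
    by real_asymp
  ultimately show "(\<lambda>n. softplus' (real (Suc n)) t) \<longlonglongrightarrow> (if t > 0 then 1 else 0)"
    unfolding softplus'_def by (cases "t = 0") (auto simp del: of_nat_Suc)
qed

context bounded_open
begin

text \<open>The derivatives \<open>softplus'\<close> converge pointwise to the indicator of the open
  half-line, at 0 included, so the approximating gradients converge to g on u > 0 and to 0
  elsewhere; |g| dominates them and \<open>H0\<close> is closed.\<close>

lemma H0_pos:
  assumes H: "H0 u g"
  shows "H0 (\<lambda>x. max (u x) 0) (\<lambda>x. if u x > 0 then g x else 0)"
proof -
  note ul = H0_L2[OF H]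
  note um = L2D(1)[OF ul(1)] L2D(1)[OF ul(2)]
  let ?n = "\<lambda>n. real (Suc n)"
  have n: "?n n > 0" for n by simp
  have sm: "softplus (?n n) \<in> borel_measurable borel" "softplus' (?n n) \<in> borel_measurable borel" for n
    using softplus_simps(1,2)[OF n] by (auto intro: borel_measurable_continuous_onI smooth_continuous)
  have lip: "\<bar>softplus (?n n) t\<bar> \<le> \<bar>t\<bar>" for n t
  proof -
    have "norm (softplus (?n n) t - softplus (?n n) 0) \<le> 1 * norm (t - 0)"
      by (rule field_differentiable_bound[of UNIV "softplus (?n n)" "softplus' (?n n)" 1])
         (use softplus_derivative[OF n] softplus_simps(4,5)[OF n] in \<open>auto simp: has_field_derivative_at_within simp del: of_nat_Suc\<close>)
    then show ?thesis using softplus_simps(3)[OF n] by simp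
  qed
  have m1: "(\<lambda>x. max (u x) 0) \<in> borel_measurable M" "(\<lambda>x. if u x > 0 then g x else 0) \<in> borel_measurable M"
    using um by measurable
  have l1: "(\<lambda>x. max (u x) 0) \<in> L2 \<Omega>"
    by (rule L2_dominated(1)[OF ul(1) m1(1), of 1]) auto
  have l2: "(\<lambda>x. if u x > 0 then g x else 0) \<in> L2 \<Omega>"
    by (rule L2_dominated(1)[OF ul(2) m1(2), of 1]) auto
  show ?thesis
  proof (rule H0_seq[OF _ l1 l2])
    show "H0 (\<lambda>x. softplus (?n n) (u x)) (\<lambda>x. softplus' (?n n) (u x) *\<^sub>R g x)" for n
      by (rule H0_compose[OF H])
         (use softplus_simps[OF n] softplus_derivative[OF n] in \<open>auto simp del: of_nat_Suc intro: smooth_continuous\<close>)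
    show "(\<lambda>n. sqint (\<lambda>x. softplus (?n n) (u x) - max (u x) 0)) \<longlonglongrightarrow> 0"
    proof (rule sqint_dominated_limit[OF ul(1), of _ 2])
      show "(\<lambda>x. softplus (?n n) (u x) - max (u x) 0) \<in> borel_measurable M" for n
        using m1(1) um(1) measurable_compose[OF um(1) sm(1)] by measurable
      show "AE x in M. norm (softplus (?n n) (u x) - max (u x) 0) \<le> 2 * norm (u x)" for n
      proof (intro AE_I2)
        fix x show "norm (softplus (?n n) (u x) - max (u x) 0) \<le> 2 * norm (u x)"
          using lip[of n "u x"] unfolding real_norm_def by linarith
      qed
      show "AE x in M. (\<lambda>n. softplus (?n n) (u x) - max (u x) 0) \<longlonglongrightarrow> 0"
        using softplus_limits(1) by (intro AE_I2 LIM_zero)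
    qed
    show "(\<lambda>n. sqint (\<lambda>x. softplus' (?n n) (u x) *\<^sub>R g x - (if u x > 0 then g x else 0))) \<longlonglongrightarrow> 0"
    proof (rule sqint_dominated_limit[OF ul(2), of _ 1])
      show "(\<lambda>x. softplus' (?n n) (u x) *\<^sub>R g x - (if u x > 0 then g x else 0)) \<in> borel_measurable M" for n
        using m1(2) um(2) measurable_compose[OF um(1) sm(2)] by measurable
      have e: "softplus' (?n n) (u x) *\<^sub>R g x - (if u x > 0 then g x else 0) =
          (softplus' (?n n) (u x) - (if u x > 0 then 1 else 0)) *\<^sub>R g x" for x n
        by (auto simp: algebra_simps)
      show "AE x in M. norm (softplus' (?n n) (u x) *\<^sub>R g x - (if u x > 0 then g x else 0)) \<le> 1 * norm (g x)" for n
      proof (intro AE_I2)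
        fix x
        have "\<bar>softplus' (?n n) (u x) - (if u x > 0 then 1 else 0)\<bar> \<le> 1"
          using softplus_simps(4,5)[OF n, of n "u x"] by auto
        then show "norm (softplus' (?n n) (u x) *\<^sub>R g x - (if u x > 0 then g x else 0)) \<le> 1 * norm (g x)"
          unfolding e norm_scaleR by (rule mult_right_mono) simp
      qed
      show "AE x in M. (\<lambda>n. softplus' (?n n) (u x) *\<^sub>R g x - (if u x > 0 then g x else 0)) \<longlonglongrightarrow> 0"
      proof (intro AE_I2)
        fix x
        have "(\<lambda>n. (softplus' (?n n) (u x) - (if u x > 0 then 1 else 0)) *\<^sub>R g x) \<longlonglongrightarrow> 0 *\<^sub>R g x"
          using softplus_limits(2)[of "u x"] by (intro tendsto_scaleR LIM_zero tendsto_const)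
        then show "(\<lambda>n. softplus' (?n n) (u x) *\<^sub>R g x - (if u x > 0 then g x else 0)) \<longlonglongrightarrow> 0"
          unfolding e by simp
      qed
    qed
  qed
qed

lemma H0_neg:
  assumes H: "H0 u g"
  shows "H0 (\<lambda>x. min (u x) 0) (\<lambda>x. if u x < 0 then g x else 0)"
proof -
  have "H0 (\<lambda>x. - u x) (\<lambda>x. - g x)" using H0_cmult[OF H, of "-1"] by simp
  from H0_cmult[OF H0_pos[OF this], of "-1"]
  have "H0 (\<lambda>x. - max (- u x) 0) (\<lambda>x. - (if - u x > 0 then - g x else 0))" by simp
  moreover have "(\<lambda>x. - max (- u x) 0) = (\<lambda>x. min (u x) 0)" by (auto simp: max_def min_def)
  moreover have "(\<lambda>x. - (if - u x > 0 then - g x else 0)) = (\<lambda>x. if u x < 0 then g x else 0)" by auto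
  ultimately show ?thesis by simp
qed

text \<open>u is the sum of its two parts, and the gradients found for the parts both vanish where u
  = 0; uniqueness of the gradient forces g to agree with their sum. The later arguments on
  truncations rest on this.\<close>

lemma H0_gradient_zero_on_level_set:
  assumes H: "H0 u g" shows "AE x in M. u x = 0 \<longrightarrow> g x = 0"
proof -
  have "H0 (\<lambda>x. max (u x) 0 + min (u x) 0) (\<lambda>x. (if u x > 0 then g x else 0) + (if u x < 0 then g x else 0))"
    by (intro H0_add H0_pos[OF H] H0_neg[OF H])
  moreover have "(\<lambda>x. max (u x) 0 + min (u x) 0) = u" by auto
  ultimately have "AE x in M. g x = (if u x > 0 then g x else 0) + (if u x < 0 then g x else 0)"
    using H0_unique[OF H] by simp
  then show ?thesis by eventually_elim auto
qed

text \<open>Integration by parts against the vector field \<eta>(|x|^2) x, whose divergence is N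
  \<eta> + 2 |x|^2 \<eta>'. It turns statements about the weak gradient of a radial function into
  statements about the function alone.\<close>

lemma H0_radial_field:
  fixes \<eta> \<eta>' :: "real \<Rightarrow> real"
  assumes H: "H0 u g" and \<eta>: "\<And>s. (\<eta> has_real_derivative \<eta>' s) (at s)" "continuous_on UNIV \<eta>'"
  shows "(LINT x|M. u x * (DIM('a) * \<eta> (x \<bullet> x) + 2 * (x \<bullet> x) * \<eta>' (x \<bullet> x))) = - (LINT x|M. (g x \<bullet> x) * \<eta> (x \<bullet> x))"
proof -
  have c\<eta>: "continuous_on UNIV \<eta>" using \<eta>(1) DERIV_isCont by (auto simp: continuous_on_eq_continuous_at)
  define X where "X i x = (x \<bullet> i) * \<eta> (x \<bullet> x)" for i x :: 'a
  define X' where "X' i x h = (x \<bullet> i) * (\<eta>' (x \<bullet> x) * (2 * (x \<bullet> h))) + (h \<bullet> i) * \<eta> (x \<bullet> x)" for i x h :: 'a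
  have d\<eta>: "((\<lambda>x. \<eta> (x \<bullet> x)) has_derivative (\<lambda>h. \<eta>' (x \<bullet> x) * (2 * (x \<bullet> h)))) (at x)" for x :: 'a
  proof -
    have "((\<lambda>x. x \<bullet> x) has_derivative (\<lambda>h. 2 * (x \<bullet> h))) (at x)"
      by (auto intro!: derivative_eq_intros simp: inner_commute)
    from has_derivative_compose[OF this, of \<eta> "(*) (\<eta>' (x \<bullet> x))"] \<eta>(1)
    show ?thesis by (simp add: has_field_derivative_def)
  qed
  have dX: "(X i has_derivative X' i x) (at x)" for i x
    unfolding X_def[abs_def] X'_def[abs_def] by (auto intro!: derivative_eq_intros d\<eta>)
  have cs: "continuous_on UNIV (\<lambda>x::'a. \<eta> (x \<bullet> x))" "continuous_on UNIV (\<lambda>x::'a. \<eta>' (x \<bullet> x))"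
    by (intro continuous_on_compose2[OF c\<eta>] continuous_on_compose2[OF \<eta>(2)] continuous_intros; simp)+
  have cX: "continuous_on UNIV (\<lambda>x. X' i x i)" "continuous_on UNIV (X i)" for i
    unfolding X'_def X_def[abs_def] by (intro continuous_intros cs)+
  have ui: "integrable M (\<lambda>x. u x * X' i x i)" for i
    by (intro L2_mult_real H0_L2(1)[OF H] L2_continuous cX)
  have gi: "integrable M (\<lambda>x. (g x \<bullet> i) * X i x)" if "i \<in> Basis" for i
    using that by (intro L2_mult_real L2_inner_const H0_L2(2)[OF H] L2_continuous cX) auto
  have s1: "(\<Sum>i\<in>Basis. X' i x i) = DIM('a) * \<eta> (x \<bullet> x) + 2 * (x \<bullet> x) * \<eta>' (x \<bullet> x)" for x
  proof -
    have "(\<Sum>i\<in>Basis. X' i x i) = (\<Sum>i\<in>Basis. 2 * \<eta>' (x \<bullet> x) * ((x \<bullet> i) * (x \<bullet> i)) + \<eta> (x \<bullet> x))"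
      by (rule sum.cong) (auto simp: X'_def algebra_simps)
    also have "\<dots> = 2 * \<eta>' (x \<bullet> x) * (x \<bullet> x) + DIM('a) * \<eta> (x \<bullet> x)"
      by (subst (4) euclidean_inner) (simp add: sum.distrib sum_distrib_left)
    finally show ?thesis by simp
  qed
  have s2: "(\<Sum>i\<in>Basis. (g x \<bullet> i) * X i x) = (g x \<bullet> x) * \<eta> (x \<bullet> x)" for x
    unfolding X_def by (subst (2) euclidean_inner) (simp add: sum_distrib_right mult.assoc)
  have "(LINT x|M. u x * (DIM('a) * \<eta> (x \<bullet> x) + 2 * (x \<bullet> x) * \<eta>' (x \<bullet> x))) = (LINT x|M. (\<Sum>i\<in>Basis. u x * X' i x i))"
    unfolding s1[symmetric] by (simp add: sum_distrib_left)
  also have "\<dots> = (\<Sum>i\<in>Basis. LINT x|M. u x * X' i x i)" using ui by simp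
  also have "\<dots> = (\<Sum>i\<in>Basis. - (LINT x|M. (g x \<bullet> i) * X i x))"
    by (rule sum.cong[OF refl], rule H0_integration_by_parts[OF H _ dX cX(1)])
  also have "\<dots> = - (LINT x|M. (\<Sum>i\<in>Basis. (g x \<bullet> i) * X i x))"
    using gi by (simp add: sum_negf)
  finally show ?thesis by (simp add: s2)
qed

end

section \<open>Signed powers\<close>

text \<open>The nonlinearity |t|^(p - 1) t, written so that its absolute value is a single
  power.\<close>

definition spow :: "real \<Rightarrow> real \<Rightarrow> real" where
  "spow p t = sgn t * \<bar>t\<bar> powr p"

lemma abs_spow [simp]: "\<bar>spow p t\<bar> = \<bar>t\<bar> powr p" by (simp add: spow_def abs_mult)
lemma abs_powr_derivative:
  assumes "q > 1" shows "((\<lambda>t. \<bar>t\<bar> powr q) has_real_derivative q * spow (q - 1) t) (at t)"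
proof -
  consider "t > 0" | "t < 0" | "t = 0" by linarith
  then show ?thesis
  proof cases
    case 1
    have "((\<lambda>t. t powr q) has_real_derivative q * spow (q - 1) t) (at t)"
      using 1 by (auto intro!: derivative_eq_intros simp: spow_def)
    then show ?thesis
      by (rule has_field_derivative_transform_within[where d=t]) (use 1 in \<open>auto simp: dist_real_def\<close>)
  next
    case 2
    have "((\<lambda>t. (- t) powr q) has_real_derivative q * spow (q - 1) t) (at t)"
      using 2 by (auto intro!: derivative_eq_intros simp: spow_def)
    then show ?thesis
      by (rule has_field_derivative_transform_within[where d="-t"]) (use 2 in \<open>auto simp: dist_real_def\<close>)
  next
    case 3
    have e: "\<bar>h\<bar> powr q / h = sgn h * \<bar>h\<bar> powr (q - 1)" if "h \<noteq> 0" for h :: real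
      using that by (cases "h > 0") (auto simp: powr_diff sgn_if field_simps)
    have "((\<lambda>h. sgn h * \<bar>h\<bar> powr (q - 1)) \<longlongrightarrow> 0) (at (0::real))"
    proof (rule Lim_null_comparison)
      show "((\<lambda>h. \<bar>h\<bar> powr (q - 1)) \<longlongrightarrow> 0) (at (0::real))"
        using assms by (auto intro!: tendsto_eq_intros)
    qed (auto simp: abs_mult sgn_if intro!: always_eventually)
    then have "((\<lambda>h. \<bar>h\<bar> powr q / h) \<longlongrightarrow> 0) (at (0::real))"
      by (rule Lim_transform_eventually) (auto simp: eventually_at_filter e)
    then show ?thesis unfolding 3 DERIV_def using assms by (simp add: spow_def)
  qed
qed

lemma spow_derivative:
  assumes "p > 1" shows "(spow p has_real_derivative p * \<bar>t\<bar> powr (p - 1)) (at t)"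
proof -
  consider "t > 0" | "t < 0" | "t = 0" by linarith
  then show ?thesis
  proof cases
    case 1
    have "((\<lambda>t. t powr p) has_real_derivative p * \<bar>t\<bar> powr (p - 1)) (at t)"
      using 1 by (auto intro!: derivative_eq_intros)
    then show ?thesis
      by (rule has_field_derivative_transform_within[where d=t]) (use 1 in \<open>auto simp: dist_real_def spow_def\<close>)
  next
    case 2
    have "((\<lambda>t. - ((- t) powr p)) has_real_derivative p * \<bar>t\<bar> powr (p - 1)) (at t)"
      using 2 by (auto intro!: derivative_eq_intros)
    then show ?thesis
      by (rule has_field_derivative_transform_within[where d="-t"]) (use 2 in \<open>auto simp: dist_real_def spow_def\<close>)
  next
    case 3
    have e: "spow p h / h = \<bar>h\<bar> powr (p - 1)" if "h \<noteq> 0" for h :: real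
      using that by (cases "h > 0") (auto simp: spow_def powr_diff sgn_if field_simps)
    have "((\<lambda>h. \<bar>h\<bar> powr (p - 1)) \<longlongrightarrow> 0) (at (0::real))"
      using assms by (auto intro!: tendsto_eq_intros)
    then have "((\<lambda>h. spow p h / h) \<longlongrightarrow> 0) (at (0::real))"
      by (rule Lim_transform_eventually) (auto simp: eventually_at_filter e)
    then show ?thesis unfolding 3 DERIV_def using assms by (simp add: spow_def)
  qed
qed

lemma spow_continuous: "p > 1 \<Longrightarrow> continuous_on S (spow p)"
  using DERIV_isCont[OF spow_derivative] by (auto intro: continuous_at_imp_continuous_on)

text \<open>Replaces a difference quotient by a value at an intermediate point c at distance at most
  |b|, for b of either sign; under the integral such a value has an obvious majorant and an obvious
  limit.\<close>

lemma abs_powr_mvt: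
  fixes a b q :: real
  assumes "q > 1"
  shows "\<exists>c. \<bar>c - a\<bar> \<le> \<bar>b\<bar> \<and> \<bar>a + b\<bar> powr q - \<bar>a\<bar> powr q = q * spow (q - 1) c * b"
proof -
  consider "b = 0" | "b > 0" | "b < 0" by linarith
  then show ?thesis
  proof cases
    case 2
    then obtain z where "a < z" "z < a + b" "\<bar>a + b\<bar> powr q - \<bar>a\<bar> powr q = (a + b - a) * (q * spow (q - 1) z)"
      using MVT2[of a "a + b" "\<lambda>t. \<bar>t\<bar> powr q" "\<lambda>t. q * spow (q - 1) t"] abs_powr_derivative[OF assms] by auto
    then show ?thesis using 2 by (intro exI[of _ z]) (auto simp: mult_ac)
  next
    case 3
    then obtain z where "a + b < z" "z < a" "\<bar>a\<bar> powr q - \<bar>a + b\<bar> powr q = (a - (a + b)) * (q * spow (q - 1) z)"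
      using MVT2[of "a + b" a "\<lambda>t. \<bar>t\<bar> powr q" "\<lambda>t. q * spow (q - 1) t"] abs_powr_derivative[OF assms] by auto
    then show ?thesis using 3 by (intro exI[of _ z]) (auto simp: algebra_simps)
  qed (auto intro: exI[of _ a])
qed

text \<open>The second order counterpart of \<open>abs_powr_mvt\<close>, with Lagrange remainder.
  The expansion stops there because \<open>\<bar>t\<bar> powr (p - 1)\<close> is not differentiable
  at 0 for p \<le> 2.\<close>

lemma abs_powr_taylor:
  fixes a b p :: real
  assumes p: "p > 1"
  shows "\<exists>c. \<bar>c - a\<bar> \<le> \<bar>b\<bar> \<and>
    \<bar>a + b\<bar> powr (p + 1) - \<bar>a\<bar> powr (p + 1) - (p + 1) * spow p a * b = (p + 1) * p / 2 * \<bar>c\<bar> powr (p - 1) * b\<^sup>2"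
proof (cases "b = 0")
  case False
  define D where "D m t = (if m = 0 then \<bar>t\<bar> powr (p + 1) else if m = 1 then (p + 1) * spow p t
      else (p + 1) * p * \<bar>t\<bar> powr (p - 1))" for m :: nat and t
  have d: "(D m has_real_derivative D (Suc m) t) (at t)" if "m < 2" for m t
  proof -
    have "m = 0 \<or> m = 1" using that by auto
    then show ?thesis
      using abs_powr_derivative[of "p + 1" t] DERIV_cmult[OF spow_derivative[OF p, of t], of "p + 1"] p
      by (auto simp: D_def[abs_def] mult.assoc)
  qed
  have "\<exists>t. (if a + b < a then a + b < t \<and> t < a else a < t \<and> t < a + b) \<and>
    \<bar>a + b\<bar> powr (p + 1) = (\<Sum>m<2. D m a / fact m * (a + b - a) ^ m) + D 2 t / fact 2 * (a + b - a) ^ 2"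
    by (rule Taylor[of 2 D _ "min a (a + b)" "max a (a + b)"]) (use False d in \<open>auto simp: D_def\<close>)
  then obtain t where t: "if a + b < a then a + b < t \<and> t < a else a < t \<and> t < a + b"
    "\<bar>a + b\<bar> powr (p + 1) = (\<Sum>m<2. D m a / fact m * b ^ m) + D 2 t / fact 2 * b ^ 2"
    by auto
  have "{..<2} = {0, 1::nat}" by auto
  then have "\<bar>a + b\<bar> powr (p + 1) = \<bar>a\<bar> powr (p + 1) + (p + 1) * spow p a * b + (p + 1) * p / 2 * \<bar>t\<bar> powr (p - 1) * b\<^sup>2"
    using t(2) by (simp add: D_def)
  then show ?thesis using t(1) by (intro exI[of _ t]) (auto split: if_splits)
qed (auto intro: exI[of _ a])

lemma powr_le_1_plus:
  fixes x :: real assumes "0 \<le> x" "0 \<le> r" "r \<le> q" shows "x powr r \<le> 1 + x powr q"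
proof (cases "x \<le> 1")
  case True
  then have "x powr r \<le> 1" using assms by (simp add: powr_le1)
  then show ?thesis using powr_ge_zero[of x q] by linarith
next
  case False
  then have "x powr r \<le> x powr q" using assms by (intro powr_mono) auto
  then show ?thesis by simp
qed

lemma powr_add_le:
  fixes x y :: real assumes "0 \<le> x" "0 \<le> y" "0 \<le> q"
  shows "(x + y) powr q \<le> 2 powr q * (x powr q + y powr q)"
proof -
  have "(x + y) powr q \<le> (2 * max x y) powr q" using assms by (intro powr_mono2) auto
  also have "\<dots> = 2 powr q * max x y powr q" using assms by (simp add: powr_mult)
  also have "max x y powr q \<le> x powr q + y powr q" by (auto simp: max_def)
  finally show ?thesis by (simp add: mult_left_mono)
qed

section \<open>The Poincare-Miranda theorem in the plane\<close>

text \<open>Brouwer's theorem for y + f y clamped to the square. If a coordinate of the fixed point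
  lies inside, clamping was inactive and the component of f is 0; on an edge, clamping leaves one
  sign to the component and the hypothesis leaves the other.\<close>

lemma poincare_miranda:
  fixes f1 f2 :: "real \<times> real \<Rightarrow> real"
  assumes ab: "a \<le> b" and c: "continuous_on ({a..b} \<times> {a..b}) f1" "continuous_on ({a..b} \<times> {a..b}) f2"
    and f1: "\<And>t. t \<in> {a..b} \<Longrightarrow> f1 (a, t) \<ge> 0" "\<And>t. t \<in> {a..b} \<Longrightarrow> f1 (b, t) \<le> 0"
    and f2: "\<And>s. s \<in> {a..b} \<Longrightarrow> f2 (s, a) \<ge> 0" "\<And>s. s \<in> {a..b} \<Longrightarrow> f2 (s, b) \<le> 0"
  shows "\<exists>s\<in>{a..b}. \<exists>t\<in>{a..b}. f1 (s, t) = 0 \<and> f2 (s, t) = 0"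
proof -
  let ?S = "{a..b} \<times> {a..b}"
  define cl where "cl r = max a (min b r)" for r
  define F where "F y = (cl (fst y + f1 y), cl (snd y + f2 y))" for y
  have "continuous_on ?S F"
    unfolding F_def[abs_def] cl_def by (intro continuous_intros c)
  moreover have "F \<in> ?S \<rightarrow> ?S" using ab by (auto simp: F_def cl_def)
  moreover have "compact ?S" "convex ?S" "?S \<noteq> {}"
    using ab by (auto intro: compact_Times convex_Times)
  ultimately obtain y where y: "y \<in> ?S" "F y = y"
    using brouwer[of ?S F] by blast
  obtain s t where st: "y = (s, t)" by (cases y)
  have s: "s \<in> {a..b}" "t \<in> {a..b}" and e: "s = cl (s + f1 (s, t))" "t = cl (t + f2 (s, t))"
    using y by (auto simp: st F_def)
  have "f1 (s, t) = 0" using e(1) s f1[of t] by (auto simp: cl_def max_def min_def split: if_splits)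
  moreover have "f2 (s, t) = 0" using e(2) s f2[of s] by (auto simp: cl_def max_def min_def split: if_splits)
  ultimately show ?thesis using s by blast
qed

section \<open>The variational argument\<close>

locale henon = bounded_open \<Omega> for \<Omega> :: "'a::euclidean_space set" +
  fixes \<alpha> p :: real
  assumes \<alpha>: "\<alpha> \<ge> 0" and p: "p > 1"
begin

section \<open>The weighted power integral\<close>

definition wt :: "'a \<Rightarrow> real" where "wt x = norm x powr \<alpha>"

abbreviation W where "W \<equiv> weighted_integral \<Omega> \<alpha> p"

text \<open>A separate predicate, because the integral of a non-integrable function is 0 by
  convention and the value of \<open>W\<close> alone does not show finiteness.\<close>

definition Wfin :: "('a \<Rightarrow> real) \<Rightarrow> bool" where
  "Wfin v \<longleftrightarrow> integrable M (\<lambda>x. wt x * \<bar>v x\<bar> powr (p + 1))"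

lemma wt_nonneg [simp]: "wt x \<ge> 0" by (simp add: wt_def)

lemma wt_measurable [measurable]: "wt \<in> borel_measurable M"
  by (rule measurable_M_borel) (simp add: wt_def[abs_def])

lemma wt_bounded: obtains B where "B > 0" "\<And>x. x \<in> \<Omega> \<Longrightarrow> wt x \<le> B"
proof -
  obtain R where R: "R > 0" "\<And>x. x \<in> \<Omega> \<Longrightarrow> norm x \<le> R" using bounded_Om by (metis bounded_pos)
  then show ?thesis using \<alpha>
    by (intro that[of "R powr \<alpha>"]) (auto simp: wt_def intro!: powr_mono2)
qed

lemma W_eq: "W v = (LINT x|M. wt x * \<bar>v x\<bar> powr (p + 1))"
  by (simp add: weighted_integral_def wt_def)

lemma Wfin_bounded:
  assumes "v \<in> borel_measurable M" "\<And>x. x \<in> \<Omega> \<Longrightarrow> \<bar>v x\<bar> \<le> C"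
  shows "Wfin v"
proof -
  obtain B where B: "B > 0" "\<And>x. x \<in> \<Omega> \<Longrightarrow> wt x \<le> B" by (rule wt_bounded) blast
  show ?thesis unfolding Wfin_def
  proof (rule integrable_bounded[where B="B * C powr (p + 1)"])
    show "(\<lambda>x. wt x * \<bar>v x\<bar> powr (p + 1)) \<in> borel_measurable M" using assms(1) by measurable
    show "norm (wt x * \<bar>v x\<bar> powr (p + 1)) \<le> B * C powr (p + 1)" if "x \<in> \<Omega>" for x
      using B assms(2)[OF that] that p by (auto simp: abs_mult intro!: mult_mono powr_mono2)
  qed
qed

lemma Wfin_add:
  assumes "v \<in> borel_measurable M" "w \<in> borel_measurable M" "Wfin v" "Wfin w"
  shows "Wfin (\<lambda>x. \<bar>v x\<bar> + \<bar>w x\<bar>)"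
  unfolding Wfin_def
proof (rule Bochner_Integration.integrable_bound)
  show "integrable M (\<lambda>x. 2 powr (p + 1) * (wt x * \<bar>v x\<bar> powr (p + 1)) + 2 powr (p + 1) * (wt x * \<bar>w x\<bar> powr (p + 1)))"
    using assms(3,4) unfolding Wfin_def by simp
  show "(\<lambda>x. wt x * \<bar>\<bar>v x\<bar> + \<bar>w x\<bar>\<bar> powr (p + 1)) \<in> borel_measurable M" using assms(1,2) by measurable
  show "AE x in M. norm (wt x * \<bar>\<bar>v x\<bar> + \<bar>w x\<bar>\<bar> powr (p + 1)) \<le>
    norm (2 powr (p + 1) * (wt x * \<bar>v x\<bar> powr (p + 1)) + 2 powr (p + 1) * (wt x * \<bar>w x\<bar> powr (p + 1)))"
  proof (intro AE_I2)
    fix x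
    have "wt x * (\<bar>v x\<bar> + \<bar>w x\<bar>) powr (p + 1) \<le> wt x * (2 powr (p + 1) * (\<bar>v x\<bar> powr (p + 1) + \<bar>w x\<bar> powr (p + 1)))"
      using p by (intro mult_left_mono powr_add_le) auto
    then show "norm (wt x * \<bar>\<bar>v x\<bar> + \<bar>w x\<bar>\<bar> powr (p + 1)) \<le>
      norm (2 powr (p + 1) * (wt x * \<bar>v x\<bar> powr (p + 1)) + 2 powr (p + 1) * (wt x * \<bar>w x\<bar> powr (p + 1)))"
      by (simp add: algebra_simps)
  qed
qed

lemma Wfin_dominated:
  assumes "v \<in> borel_measurable M" "Wfin w" "\<And>x. \<bar>v x\<bar> \<le> C * \<bar>w x\<bar>" "C \<ge> 0"
  shows "Wfin v"
  unfolding Wfin_def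
proof (rule Bochner_Integration.integrable_bound)
  show "integrable M (\<lambda>x. C powr (p + 1) * (wt x * \<bar>w x\<bar> powr (p + 1)))"
    using assms(2) unfolding Wfin_def by simp
  show "(\<lambda>x. wt x * \<bar>v x\<bar> powr (p + 1)) \<in> borel_measurable M" using assms(1) by measurable
  show "AE x in M. norm (wt x * \<bar>v x\<bar> powr (p + 1)) \<le> norm (C powr (p + 1) * (wt x * \<bar>w x\<bar> powr (p + 1)))"
  proof (intro AE_I2)
    fix x
    have "\<bar>v x\<bar> powr (p + 1) \<le> (C * \<bar>w x\<bar>) powr (p + 1)" using assms(3)[of x] p by (intro powr_mono2) auto
    also have "\<dots> = C powr (p + 1) * \<bar>w x\<bar> powr (p + 1)" using assms(4) by (simp add: powr_mult)
    finally have "wt x * \<bar>v x\<bar> powr (p + 1) \<le> wt x * (C powr (p + 1) * \<bar>w x\<bar> powr (p + 1))"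
      by (rule mult_left_mono) simp
    then show "norm (wt x * \<bar>v x\<bar> powr (p + 1)) \<le> norm (C powr (p + 1) * (wt x * \<bar>w x\<bar> powr (p + 1)))"
      by (simp add: mult_ac)
  qed
qed

text \<open>Dominated convergence in the three coefficients, whose bound 2 provides the majorants.
  The gradient of the positive part jumps only where the limit function vanishes; there its gradient
  vanishes almost everywhere as well, so the jump has height 0 in the limit. The supply of
  continuity for \<open>poincare_miranda\<close>.\<close>

lemma positive_part_continuous:
  fixes v1 v2 v3 :: "'a \<Rightarrow> real"
  assumes H: "H0 v1 g1" "H0 v2 g2" "H0 v3 g3" and F: "Wfin v1" "Wfin v2" "Wfin v3"
  defines "w \<equiv> \<lambda>y x. fst y * v1 x + fst (snd y) * v2 x + snd (snd y) * v3 x"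
    and "gw \<equiv> \<lambda>y x. fst y *\<^sub>R g1 x + fst (snd y) *\<^sub>R g2 x + snd (snd y) *\<^sub>R g3 x"
    and "S \<equiv> {y::real \<times> real \<times> real. \<bar>fst y\<bar> \<le> 2 \<and> \<bar>fst (snd y)\<bar> \<le> 2 \<and> \<bar>snd (snd y)\<bar> \<le> 2}"
  shows "continuous_on S (\<lambda>y. dirichlet_integral \<Omega> (\<lambda>x. max (w y x) 0))" (is ?A)
    and "continuous_on S (\<lambda>y. W (\<lambda>x. max (w y x) 0))" (is ?B)
proof -
  have Hw: "H0 (w y) (gw y)" for y
    unfolding w_def gw_def by (intro H0_add H0_cmult H)
  note m = L2D(1)[OF H0_L2(1)[OF H(1)]] L2D(1)[OF H0_L2(1)[OF H(2)]] L2D(1)[OF H0_L2(1)[OF H(3)]]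
    L2D(1)[OF H0_L2(2)[OF H(1)]] L2D(1)[OF H0_L2(2)[OF H(2)]] L2D(1)[OF H0_L2(2)[OF H(3)]]
  note [measurable] = m
  have wm [measurable]: "w y \<in> borel_measurable M" "gw y \<in> borel_measurable M" for y
    using Hw H0_L2 L2D(1) by blast+
  have wlim: "(\<lambda>n. w (y n) x) \<longlonglongrightarrow> w z x" "(\<lambda>n. gw (y n) x) \<longlonglongrightarrow> gw z x" if "y \<longlonglongrightarrow> z" for y z x
    using that unfolding w_def gw_def by (auto intro!: tendsto_intros)
  define V where "V x = norm (g1 x) + norm (g2 x) + norm (g3 x)" for x
  have V: "V \<in> L2 \<Omega>"
  proof -
    have n: "(\<lambda>x. norm (g x)) \<in> L2 \<Omega>" if "g \<in> L2 \<Omega>" for g :: "'a \<Rightarrow> 'a"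
      by (rule L2_dominated(1)[OF that, of _ 1]) (use L2D(1)[OF that] in auto)
    show ?thesis unfolding V_def[abs_def] by (intro L2_add n H0_L2(2)[OF H(1)] H0_L2(2)[OF H(2)] H0_L2(2)[OF H(3)])
  qed
  have gb: "norm (gw y x) \<le> 2 * V x" if "y \<in> S" for y x
  proof -
    have "norm (gw y x) \<le> \<bar>fst y\<bar> * norm (g1 x) + \<bar>fst (snd y)\<bar> * norm (g2 x) + \<bar>snd (snd y)\<bar> * norm (g3 x)"
      unfolding gw_def by (intro norm_triangle_le add_mono) auto
    also have "\<dots> \<le> 2 * norm (g1 x) + 2 * norm (g2 x) + 2 * norm (g3 x)"
      using that unfolding S_def by (intro add_mono mult_right_mono) auto
    finally show ?thesis by (simp add: V_def)
  qed
  have Dd: "dirichlet_integral \<Omega> (\<lambda>x. max (w y x) 0) = (LINT x|M. (norm (if w y x > 0 then gw y x else 0))\<^sup>2)" for y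
    using H0_dirichlet[OF H0_pos[OF Hw]] by (simp add: sqint_def)
  show ?A unfolding continuous_on_sequentially Dd
  proof (intro allI ballI impI, elim conjE, unfold o_def)
    fix y z assume z: "z \<in> S" and y: "\<forall>n. y n \<in> S" "y \<longlonglongrightarrow> z"
    show "(\<lambda>n. LINT x|M. (norm (if w (y n) x > 0 then gw (y n) x else 0))\<^sup>2) \<longlonglongrightarrow>
      (LINT x|M. (norm (if w z x > 0 then gw z x else 0))\<^sup>2)"
    proof (rule integral_dominated_convergence[where w="\<lambda>x. 4 * (norm (V x))\<^sup>2"])
      show "integrable M (\<lambda>x. 4 * (norm (V x))\<^sup>2)" using L2D(2)[OF V] by simp
      show "AE x in M. norm ((norm (if w (y n) x > 0 then gw (y n) x else 0))\<^sup>2) \<le> 4 * (norm (V x))\<^sup>2" for n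
      proof (intro AE_I2)
        fix x
        have "(norm (gw (y n) x))\<^sup>2 \<le> (2 * V x)\<^sup>2"
          using gb[of "y n" x] y(1) by (intro power_mono) auto
        then show "norm ((norm (if w (y n) x > 0 then gw (y n) x else 0))\<^sup>2) \<le> 4 * (norm (V x))\<^sup>2"
          by (auto simp: power_mult_distrib)
      qed
      show "AE x in M. (\<lambda>n. (norm (if w (y n) x > 0 then gw (y n) x else 0))\<^sup>2) \<longlonglongrightarrow> (norm (if w z x > 0 then gw z x else 0))\<^sup>2"
        using H0_gradient_zero_on_level_set[OF Hw[of z]]
      proof eventually_elim
        case (elim x)
        have "(\<lambda>n. if w (y n) x > 0 then gw (y n) x else 0) \<longlonglongrightarrow> (if w z x > 0 then gw z x else 0)"
        proof -
          consider "w z x > 0" | "w z x < 0" | "w z x = 0" by linarith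
          then show ?thesis
          proof cases
            case 1
            then have "eventually (\<lambda>n. w (y n) x > 0) sequentially"
              using order_tendstoD(1)[OF wlim(1)[OF y(2)]] by blast
            then show ?thesis using 1
              by (intro Lim_transform_eventually[OF wlim(2)[OF y(2), of x, THEN back_subst[of "\<lambda>l. _ \<longlonglongrightarrow> l"]]])
                 (auto elim: eventually_mono)
          next
            case 2
            then have "eventually (\<lambda>n. w (y n) x < 0) sequentially"
              using order_tendstoD(2)[OF wlim(1)[OF y(2)]] by blast
            then have "eventually (\<lambda>n. (if w (y n) x > 0 then gw (y n) x else 0) = 0) sequentially"
              by (auto elim: eventually_mono)
            then show ?thesis using 2 tendsto_eventually by auto
          next
            case 3
            then have "(\<lambda>n. norm (gw (y n) x)) \<longlonglongrightarrow> 0"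
              using wlim(2)[OF y(2), of x] elim by (simp add: tendsto_norm_zero)
            then show ?thesis using 3
              by (auto intro: Lim_null_comparison[rotated])
          qed
        qed
        then show ?case by (intro tendsto_power tendsto_norm)
      qed
    qed measurable
  qed
  define U where "U x = \<bar>\<bar>v1 x\<bar> + \<bar>v2 x\<bar>\<bar> + \<bar>v3 x\<bar>" for x
  have Um [measurable]: "U \<in> borel_measurable M" unfolding U_def[abs_def] by measurable
  have U: "Wfin (\<lambda>x. 2 * U x)"
  proof (rule Wfin_dominated[of _ U 2])
    show "Wfin U" unfolding U_def[abs_def] by (intro Wfin_add F) measurable
  qed (auto simp: U_def)
  have wb: "\<bar>w y x\<bar> \<le> 2 * U x" if "y \<in> S" for y x
  proof -
    have "\<bar>w y x\<bar> \<le> \<bar>fst y\<bar> * \<bar>v1 x\<bar> + \<bar>fst (snd y)\<bar> * \<bar>v2 x\<bar> + \<bar>snd (snd y)\<bar> * \<bar>v3 x\<bar>"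
      unfolding w_def abs_mult[symmetric] by linarith
    also have "\<dots> \<le> 2 * \<bar>v1 x\<bar> + 2 * \<bar>v2 x\<bar> + 2 * \<bar>v3 x\<bar>"
      using that unfolding S_def by (intro add_mono mult_right_mono) auto
    finally show ?thesis by (simp add: U_def)
  qed
  show ?B unfolding continuous_on_sequentially W_eq
  proof (intro allI ballI impI, elim conjE, unfold o_def)
    fix y z assume z: "z \<in> S" and y: "\<forall>n. y n \<in> S" "y \<longlonglongrightarrow> z"
    show "(\<lambda>n. LINT x|M. wt x * \<bar>max (w (y n) x) 0\<bar> powr (p + 1)) \<longlonglongrightarrow> (LINT x|M. wt x * \<bar>max (w z x) 0\<bar> powr (p + 1))"
    proof (rule integral_dominated_convergence[where w="\<lambda>x. wt x * \<bar>2 * U x\<bar> powr (p + 1)"])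
      show "integrable M (\<lambda>x. wt x * \<bar>2 * U x\<bar> powr (p + 1))" using U by (simp only: Wfin_def)
      show "AE x in M. norm (wt x * \<bar>max (w (y n) x) 0\<bar> powr (p + 1)) \<le> wt x * \<bar>2 * U x\<bar> powr (p + 1)" for n
      proof (intro AE_I2)
        fix x
        have "\<bar>max (w (y n) x) 0\<bar> \<le> \<bar>2 * U x\<bar>" using wb[of "y n" x] y(1) by auto
        then have "\<bar>max (w (y n) x) 0\<bar> powr (p + 1) \<le> \<bar>2 * U x\<bar> powr (p + 1)" using p by (intro powr_mono2) auto
        then show "norm (wt x * \<bar>max (w (y n) x) 0\<bar> powr (p + 1)) \<le> wt x * \<bar>2 * U x\<bar> powr (p + 1)"
          by (auto simp: abs_mult intro!: mult_left_mono)
      qed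
      show "AE x in M. (\<lambda>n. wt x * \<bar>max (w (y n) x) 0\<bar> powr (p + 1)) \<longlonglongrightarrow> wt x * \<bar>max (w z x) 0\<bar> powr (p + 1)"
      proof (intro AE_I2)
        fix x
        show "(\<lambda>n. wt x * \<bar>max (w (y n) x) 0\<bar> powr (p + 1)) \<longlonglongrightarrow> wt x * \<bar>max (w z x) 0\<bar> powr (p + 1)"
        proof (rule tendsto_mult[OF tendsto_const])
          have "(\<lambda>n. \<bar>max (w (y n) x) 0\<bar>) \<longlonglongrightarrow> \<bar>max (w z x) 0\<bar>"
            by (intro tendsto_rabs tendsto_max tendsto_const wlim(1)[OF y(2)])
          moreover have "isCont (\<lambda>t. \<bar>t\<bar> powr (p + 1)) \<bar>max (w z x) 0\<bar>"
            using DERIV_isCont[OF abs_powr_derivative[of "p + 1"]] p by simp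
          ultimately show "(\<lambda>n. \<bar>max (w (y n) x) 0\<bar> powr (p + 1)) \<longlonglongrightarrow> \<bar>max (w z x) 0\<bar> powr (p + 1)"
            using isCont_tendsto_compose[of "\<bar>max (w z x) 0\<bar>" "\<lambda>t. \<bar>t\<bar> powr (p + 1)"] by fastforce
        qed
      qed
    qed measurable
  qed
qed

end

text \<open>Uniformity in s and t gives one threshold for \<epsilon> that works on all four edges of
  the square at the same time.\<close>

lemma uniform_in_last_parameter:
  fixes f :: "real \<times> real \<times> real \<Rightarrow> real"
  assumes c: "continuous_on ({a..b} \<times> {a..b} \<times> {0..1}) f" and m: "m > 0"
  obtains d where "0 < d" "d \<le> 1" "\<And>s t e. s \<in> {a..b} \<Longrightarrow> t \<in> {a..b} \<Longrightarrow> 0 \<le> e \<Longrightarrow> e < d \<Longrightarrow> \<bar>f (s, t, e) - f (s, t, 0)\<bar> < m"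
proof -
  have "uniformly_continuous_on ({a..b} \<times> {a..b} \<times> {0..1}) f"
    by (rule compact_uniformly_continuous[OF c]) (intro compact_Times compact_Icc)
  then obtain d where d: "d > 0" "\<And>x y. x \<in> {a..b} \<times> {a..b} \<times> {0..1} \<Longrightarrow> y \<in> {a..b} \<times> {a..b} \<times> {0..1} \<Longrightarrow>
      dist y x < d \<Longrightarrow> dist (f y) (f x) < m"
    by (rule uniformly_continuous_onE[OF _ m]) blast
  show ?thesis
  proof (rule that[of "min d 1"])
    fix s t e assume h: "s \<in> {a..b}" "t \<in> {a..b}" "0 \<le> e" "e < min d 1"
    have "dist (s, t, e) (s, t, 0) = e" using h by (simp add: dist_Pair_Pair)
    then show "\<bar>f (s, t, e) - f (s, t, 0)\<bar> < m"
      using d(2)[of "(s, t, 0)" "(s, t, e)"] h by (auto simp: dist_real_def)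
  qed (use d(1) in auto)
qed

text \<open>The fibering map is largest at s = 1. Young's inequality for s^2 * 1 with exponent r =
  (p + 1) / 2 and its conjugate gives this at once.\<close>

lemma fibering_bound:
  fixes s p :: real assumes "p > 1" "s > 0"
  shows "s\<^sup>2 / 2 - s powr (p + 1) / (p + 1) \<le> 1 / 2 - 1 / (p + 1)"
proof -
  define r where "r = (p + 1) / 2"
  have r: "r > 1" using assms by (simp add: r_def)
  have c: "1 / r + 1 / (r / (r - 1)) = 1" using r by (simp add: field_simps)
  have "s\<^sup>2 * 1 \<le> (s\<^sup>2) powr r / r + 1 powr (r / (r - 1)) / (r / (r - 1))"
    using Youngs_inequality[of r "r / (r - 1)" "s\<^sup>2" 1] r c by (simp add: less_divide_eq)
  moreover have "(s\<^sup>2) powr r = s powr (p + 1)"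
  proof -
    have "s\<^sup>2 = s powr 2" using assms by (simp add: powr_numeral)
    then have "(s\<^sup>2) powr r = s powr (2 * r)" by (simp only: powr_powr)
    moreover have "2 * r = p + 1" by (simp add: r_def)
    ultimately show ?thesis by simp
  qed
  ultimately have "s\<^sup>2 \<le> s powr (p + 1) / r + (r - 1) / r" by simp
  then have "s\<^sup>2 / 2 \<le> (s powr (p + 1) / r + (r - 1) / r) / 2" by simp
  also have "\<dots> = s powr (p + 1) / (2 * r) + (1 / 2 - 1 / (2 * r))"
    using r by (simp add: field_simps)
  also have "2 * r = p + 1" by (simp add: r_def)
  finally show ?thesis by simp
qed

section \<open>Perturbations inside the nodal Nehari set\<close>

locale minimizer = henon \<Omega> \<alpha> p for \<Omega> :: "'a::euclidean_space set" and \<alpha> p +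
  fixes u :: "'a \<Rightarrow> real" and g :: "'a \<Rightarrow> 'a"
  assumes H: "H0 u g" and least: "least_energy_nodal_solution \<Omega> \<alpha> p u"
begin

definition up where "up x = max (u x) 0"
definition um where "um x = min (u x) 0"
definition gp where "gp x = (if u x > 0 then g x else 0)"
definition gm where "gm x = (if u x < 0 then g x else 0)"

lemma Hp: "H0 up gp" and Hm: "H0 um gm"
  using H0_pos[OF H] H0_neg[OF H] by (simp_all add: up_def[abs_def] um_def[abs_def] gp_def[abs_def] gm_def[abs_def])

lemma um_meas [measurable]: "u \<in> borel_measurable M" "g \<in> borel_measurable M" "up \<in> borel_measurable M" "um \<in> borel_measurable M"
    "gp \<in> borel_measurable M" "gm \<in> borel_measurable M"
  using L2D(1)[OF H0_L2(1)[OF H]] L2D(1)[OF H0_L2(2)[OF H]] L2D(1)[OF H0_L2(1)[OF Hp]] L2D(1)[OF H0_L2(2)[OF Hp]]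
    L2D(1)[OF H0_L2(1)[OF Hm]] L2D(1)[OF H0_L2(2)[OF Hm]] by blast+

lemma u_split: "u x = up x + um x" by (auto simp: up_def um_def)

lemma u_nehari: "u \<in> nodal_Nehari_set \<Omega> \<alpha> p"
  using least by (simp add: least_energy_nodal_solution_def is_arg_min_def)

lemma energy_least: "v \<in> nodal_Nehari_set \<Omega> \<alpha> p \<Longrightarrow> energy \<Omega> \<alpha> p u \<le> energy \<Omega> \<alpha> p v"
  using least by (force simp: least_energy_nodal_solution_def is_arg_min_def)

lemma nehari: "\<not> (AE x in M. up x = 0)" "sqint gp = W up" "\<not> (AE x in M. um x = 0)" "sqint gm = W um"
  using u_nehari H0_dirichlet[OF Hp] H0_dirichlet[OF Hm]
  by (auto simp: nodal_Nehari_set_def up_def[abs_def] um_def[abs_def])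

lemma Dp_pos: "sqint gp > 0" and Dm_pos: "sqint gm > 0"
  using H0_zero_gradient[OF Hp] H0_zero_gradient[OF Hm] nehari(1,3) sqint_nonneg[of gp] sqint_nonneg[of gm]
  by linarith+

text \<open>If the integrand were not integrable, its integral would be 0 by convention, while the
  Nehari identity equates it with a positive Dirichlet integral. No Sobolev embedding
  enters.\<close>

lemma Wfin_up: "Wfin up" and Wfin_um: "Wfin um"
  using nehari(2,4) Dp_pos Dm_pos not_integrable_integral_eq unfolding Wfin_def W_eq by fastforce+

lemma W_cmult: "c \<ge> 0 \<Longrightarrow> W (\<lambda>x. c * v x) = c powr (p + 1) * W v"
proof -
  assume "c \<ge> 0"
  then have "wt x * \<bar>c * v x\<bar> powr (p + 1) = c powr (p + 1) * (wt x * \<bar>v x\<bar> powr (p + 1))" for x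
    by (simp add: abs_mult powr_mult)
  then show ?thesis by (simp only: W_eq integral_mult_right_zero)
qed

lemma dirichlet_cmult: "H0 v h \<Longrightarrow> dirichlet_integral \<Omega> (\<lambda>x. c * v x) = c\<^sup>2 * sqint h"
  using H0_dirichlet[OF H0_cmult] L2_scaleR(2) H0_L2(2) by metis

text \<open>At \<epsilon> = 0 the defects of the two constraints are \<open>sqint gp * k s\<close>
  and \<open>sqint gm * k t\<close>, with k positive on (0, 1) and negative beyond 1. They have
  opposite signs on opposite edges of the square around (1, 1); for small \<epsilon> the signs
  persist, and the Poincare-Miranda theorem supplies a common zero. Only \<epsilon> \<ge> 0 is
  treated, since h may be replaced by -h.\<close>

lemma nehari_perturbation:
  assumes h: "h \<in> test_functions \<Omega>" and \<delta>: "0 < \<delta>" "\<delta> < 1"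
  obtains \<epsilon>0 where "\<epsilon>0 > 0" "\<And>\<epsilon>. 0 \<le> \<epsilon> \<Longrightarrow> \<epsilon> < \<epsilon>0 \<Longrightarrow>
    \<exists>s\<in>{1-\<delta>..1+\<delta>}. \<exists>t\<in>{1-\<delta>..1+\<delta>}. (\<lambda>x. s * up x + t * um x + \<epsilon> * h x) \<in> nodal_Nehari_set \<Omega> \<alpha> p"
proof -
  define w where "w y x = fst y * up x + fst (snd y) * um x + snd (snd y) * h x" for y :: "real \<times> real \<times> real" and x
  define S where "S = {y::real \<times> real \<times> real. \<bar>fst y\<bar> \<le> 2 \<and> \<bar>fst (snd y)\<bar> \<le> 2 \<and> \<bar>snd (snd y)\<bar> \<le> 2}"
  define J where "J = {1-\<delta>..1+\<delta>}"
  have KS: "J \<times> J \<times> {0..1} \<subseteq> S" using \<delta> by (auto simp: S_def J_def)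
  have Hh: "H0 h (grad h)" by (rule H0_test[OF h])
  obtain C where "\<And>x. \<bar>h x\<bar> \<le> C" using test_bounded[OF h] by blast
  then have Wh: "Wfin h" using L2D(1)[OF test_L2(1)[OF h]] by (intro Wfin_bounded)
  have Hw: "\<exists>gw. H0 (w y) gw" for y
    unfolding w_def using H0_add[OF H0_add[OF H0_cmult[OF Hp] H0_cmult[OF Hm]] H0_cmult[OF Hh]] by blast
  have Wneg: "Wfin v \<Longrightarrow> Wfin (\<lambda>x. - 1 * v x)" for v by (simp add: Wfin_def)
  define Pp where "Pp y = dirichlet_integral \<Omega> (\<lambda>x. max (w y x) 0)" for y
  define Qp where "Qp y = W (\<lambda>x. max (w y x) 0)" for y
  define Pm where "Pm y = dirichlet_integral \<Omega> (\<lambda>x. min (w y x) 0)" for y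
  define Qm where "Qm y = W (\<lambda>x. min (w y x) 0)" for y
  have cp: "continuous_on S Pp" "continuous_on S Qp"
    using positive_part_continuous[OF Hp Hm Hh Wfin_up Wfin_um Wh]
    by (auto simp: Pp_def[abs_def] Qp_def[abs_def] w_def S_def)
  have nw: "fst y * (- 1 * up x) + fst (snd y) * (- 1 * um x) + snd (snd y) * (- 1 * h x) = - w y x" for y x
    by (simp add: w_def)
  have neg: "Pm y = dirichlet_integral \<Omega> (\<lambda>x. max (- w y x) 0)" "Qm y = W (\<lambda>x. max (- w y x) 0)" for y
  proof -
    have e: "(\<lambda>x. min (w y x) 0) = (\<lambda>x. - 1 * max (- w y x) 0)" by (auto simp: max_def min_def)
    obtain gw where gw: "H0 (w y) gw" using Hw by blast
    have "H0 (\<lambda>x. - w y x) (\<lambda>x. - gw x)" using H0_cmult[OF gw, of "-1"] by simp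
    from H0_pos[OF this] obtain k where k: "H0 (\<lambda>x. max (- w y x) 0) k" by blast
    show "Pm y = dirichlet_integral \<Omega> (\<lambda>x. max (- w y x) 0)"
      unfolding Pm_def e dirichlet_cmult[OF k] using H0_dirichlet[OF k] by simp
    show "Qm y = W (\<lambda>x. max (- w y x) 0)" unfolding Qm_def e W_eq by simp
  qed
  have cm: "continuous_on S Pm" "continuous_on S Qm"
    using positive_part_continuous[OF H0_cmult[OF Hp, of "-1"] H0_cmult[OF Hm, of "-1"] H0_cmult[OF Hh, of "-1"]
        Wneg[OF Wfin_up] Wneg[OF Wfin_um] Wneg[OF Wh]]
    unfolding nw neg[abs_def, symmetric] S_def[symmetric] neg(1)[symmetric] neg(2)[symmetric] by auto
  have z: "Pp (s, t, 0) = s\<^sup>2 * sqint gp" "Qp (s, t, 0) = s powr (p + 1) * sqint gp"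
      "Pm (s, t, 0) = t\<^sup>2 * sqint gm" "Qm (s, t, 0) = t powr (p + 1) * sqint gm" if "s > 0" "t > 0" for s t
  proof -
    have 1: "max (w (s, t, 0) x) 0 = s * up x" and 2: "min (w (s, t, 0) x) 0 = t * um x" for x
      using that by (auto simp: w_def up_def um_def max_def min_def mult_le_0_iff zero_le_mult_iff)
    show "Pp (s, t, 0) = s\<^sup>2 * sqint gp" "Qp (s, t, 0) = s powr (p + 1) * sqint gp"
      "Pm (s, t, 0) = t\<^sup>2 * sqint gm" "Qm (s, t, 0) = t powr (p + 1) * sqint gm"
      unfolding Pp_def Qp_def Pm_def Qm_def 1 2 using that nehari
      by (simp_all add: dirichlet_cmult[OF Hp] dirichlet_cmult[OF Hm] W_cmult)
  qed
  define k where "k s = s\<^sup>2 - s powr (p + 1)" for s :: real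
  have k1: "k (1 - \<delta>) > 0"
  proof -
    have "(1 - \<delta>) powr (p + 1) < (1 - \<delta>) powr 2" using \<delta> p by (intro powr_less_mono') auto
    then show ?thesis using \<delta> by (simp add: k_def powr_numeral)
  qed
  have k2: "k (1 + \<delta>) < 0"
  proof -
    have "(1 + \<delta>) powr 2 < (1 + \<delta>) powr (p + 1)" using \<delta> p by (intro powr_less_mono) auto
    then show ?thesis using \<delta> by (simp add: k_def powr_numeral)
  qed
  define D where "D = min (sqint gp) (sqint gm)"
  \<comment> \<open>A lower bound for the absolute value of the unperturbed defects on the edges; a
    change smaller than m cannot alter their signs.\<close>
  define m where "m = D * min (k (1 - \<delta>)) (- k (1 + \<delta>))"
  have D: "D > 0" using Dp_pos Dm_pos by (simp add: D_def)
  have m: "m > 0" using D k1 k2 by (simp add: m_def)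
  have mb: "m \<le> d * k (1 - \<delta>)" "m \<le> - (d * k (1 + \<delta>))" if "D \<le> d" for d
  proof -
    have "m \<le> d * min (k (1 - \<delta>)) (- k (1 + \<delta>))"
      unfolding m_def using that k1 k2 by (intro mult_right_mono) auto
    moreover have "d * min (k (1 - \<delta>)) (- k (1 + \<delta>)) \<le> d * k (1 - \<delta>)" "d * min (k (1 - \<delta>)) (- k (1 + \<delta>)) \<le> d * - k (1 + \<delta>)"
      using that D by (intro mult_left_mono; simp)+
    ultimately show "m \<le> d * k (1 - \<delta>)" "m \<le> - (d * k (1 + \<delta>))" by auto
  qed
  \<comment> \<open>A lower bound on the square for both unperturbed Dirichlet integrals; a change
    smaller than m' keeps them positive, so neither part of the perturbed function is
    trivial.\<close>
  define m' where "m' = (1 - \<delta>)\<^sup>2 * D"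
  have m': "m' > 0" using D \<delta> by (simp add: m'_def)
  note cK = continuous_on_subset[OF _ KS, unfolded J_def]
  obtain d1 where d1: "0 < d1" "d1 \<le> 1" "\<And>s t e. s \<in> J \<Longrightarrow> t \<in> J \<Longrightarrow> 0 \<le> e \<Longrightarrow> e < d1 \<Longrightarrow>
      \<bar>(Pp (s, t, e) - Qp (s, t, e)) - (Pp (s, t, 0) - Qp (s, t, 0))\<bar> < m"
    using uniform_in_last_parameter[OF cK[OF continuous_on_diff[OF cp]] m] unfolding J_def by blast
  obtain d2 where d2: "0 < d2" "d2 \<le> 1" "\<And>s t e. s \<in> J \<Longrightarrow> t \<in> J \<Longrightarrow> 0 \<le> e \<Longrightarrow> e < d2 \<Longrightarrow>
      \<bar>(Pm (s, t, e) - Qm (s, t, e)) - (Pm (s, t, 0) - Qm (s, t, 0))\<bar> < m"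
    using uniform_in_last_parameter[OF cK[OF continuous_on_diff[OF cm]] m] unfolding J_def by blast
  obtain d3 where d3: "0 < d3" "d3 \<le> 1" "\<And>s t e. s \<in> J \<Longrightarrow> t \<in> J \<Longrightarrow> 0 \<le> e \<Longrightarrow> e < d3 \<Longrightarrow>
      \<bar>Pp (s, t, e) - Pp (s, t, 0)\<bar> < m'"
    using uniform_in_last_parameter[OF cK[OF cp(1)] m'] unfolding J_def by blast
  obtain d4 where d4: "0 < d4" "d4 \<le> 1" "\<And>s t e. s \<in> J \<Longrightarrow> t \<in> J \<Longrightarrow> 0 \<le> e \<Longrightarrow> e < d4 \<Longrightarrow>
      \<bar>Pm (s, t, e) - Pm (s, t, 0)\<bar> < m'"
    using uniform_in_last_parameter[OF cK[OF cm(1)] m'] unfolding J_def by blast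
  have Jpos: "s > 0" "(1 - \<delta>)\<^sup>2 \<le> s\<^sup>2" if "s \<in> J" for s
    using that \<delta> by (auto simp: J_def intro!: power_mono)
  show ?thesis
  proof (rule that[of "min (min d1 d2) (min d3 d4)"])
    show "min (min d1 d2) (min d3 d4) > 0" using d1 d2 d3 d4 by simp
    fix \<epsilon> assume e: "0 \<le> \<epsilon>" "\<epsilon> < min (min d1 d2) (min d3 d4)"
    have ends: "1 - \<delta> \<in> J" "1 + \<delta> \<in> J" using \<delta> by (auto simp: J_def)
    have "\<exists>s\<in>J. \<exists>t\<in>J. (Pp (s, t, \<epsilon>) - Qp (s, t, \<epsilon>)) = 0 \<and> (Pm (s, t, \<epsilon>) - Qm (s, t, \<epsilon>)) = 0"
    proof -
      have sub: "(\<lambda>y. (fst y, snd y, \<epsilon>)) ` (J \<times> J) \<subseteq> S" using KS e d1 by fastforce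
      have c: "continuous_on (J \<times> J) (\<lambda>y. f (fst y, snd y, \<epsilon>))" if "continuous_on S f" for f :: "real \<times> real \<times> real \<Rightarrow> real"
        by (rule continuous_on_compose2[OF that _ sub]) (intro continuous_intros)
      have zk: "Pp (s, t, 0) - Qp (s, t, 0) = sqint gp * k s" "Pm (s, t, 0) - Qm (s, t, 0) = sqint gm * k t"
        if "s \<in> J" "t \<in> J" for s t
        using z[OF Jpos(1)[OF that(1)] Jpos(1)[OF that(2)]] by (simp_all add: k_def algebra_simps)
      have "\<exists>s\<in>{1-\<delta>..1+\<delta>}. \<exists>t\<in>{1-\<delta>..1+\<delta>}. (\<lambda>y. Pp (fst y, snd y, \<epsilon>) - Qp (fst y, snd y, \<epsilon>)) (s, t) = 0 \<and>
          (\<lambda>y. Pm (fst y, snd y, \<epsilon>) - Qm (fst y, snd y, \<epsilon>)) (s, t) = 0"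
      proof (rule poincare_miranda; (fold J_def)?)
        show "1 - \<delta> \<le> 1 + \<delta>" using \<delta> by simp
        show "continuous_on (J \<times> J) (\<lambda>y. Pp (fst y, snd y, \<epsilon>) - Qp (fst y, snd y, \<epsilon>))"
          "continuous_on (J \<times> J) (\<lambda>y. Pm (fst y, snd y, \<epsilon>) - Qm (fst y, snd y, \<epsilon>))"
          by (intro continuous_intros c cp cm)+
        fix t assume t: "t \<in> J"
        show "0 \<le> Pp (fst (1 - \<delta>, t), snd (1 - \<delta>, t), \<epsilon>) - Qp (fst (1 - \<delta>, t), snd (1 - \<delta>, t), \<epsilon>)"
          using d1(3)[OF ends(1) t e(1)] e(2) zk(1)[OF ends(1) t] mb(1)[of "sqint gp"] by (auto simp: D_def)
        show "Pp (fst (1 + \<delta>, t), snd (1 + \<delta>, t), \<epsilon>) - Qp (fst (1 + \<delta>, t), snd (1 + \<delta>, t), \<epsilon>) \<le> 0"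
          using d1(3)[OF ends(2) t e(1)] e(2) zk(1)[OF ends(2) t] mb(2)[of "sqint gp"] by (auto simp: D_def)
        show "0 \<le> Pm (fst (t, 1 - \<delta>), snd (t, 1 - \<delta>), \<epsilon>) - Qm (fst (t, 1 - \<delta>), snd (t, 1 - \<delta>), \<epsilon>)"
          using d2(3)[OF t ends(1) e(1)] e(2) zk(2)[OF t ends(1)] mb(1)[of "sqint gm"] by (auto simp: D_def)
        show "Pm (fst (t, 1 + \<delta>), snd (t, 1 + \<delta>), \<epsilon>) - Qm (fst (t, 1 + \<delta>), snd (t, 1 + \<delta>), \<epsilon>) \<le> 0"
          using d2(3)[OF t ends(2) e(1)] e(2) zk(2)[OF t ends(2)] mb(2)[of "sqint gm"] by (auto simp: D_def)
      qed
      then show ?thesis unfolding J_def by simp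
    qed
    then obtain s t where st: "s \<in> J" "t \<in> J" "Pp (s, t, \<epsilon>) = Qp (s, t, \<epsilon>)" "Pm (s, t, \<epsilon>) = Qm (s, t, \<epsilon>)"
      by auto
    have m'b: "m' \<le> s\<^sup>2 * sqint gp" "m' \<le> t\<^sup>2 * sqint gm"
      unfolding m'_def using Jpos st D by (auto intro!: mult_mono simp: D_def)
    have "Pp (s, t, \<epsilon>) > 0" "Pm (s, t, \<epsilon>) > 0"
      using d3(3)[OF st(1,2) e(1)] d4(3)[OF st(1,2) e(1)] e(2) z[OF Jpos(1)[OF st(1)] Jpos(1)[OF st(2)]] m'b
      by linarith+
    then have q: "W (\<lambda>x. max (w (s, t, \<epsilon>) x) 0) > 0" "W (\<lambda>x. min (w (s, t, \<epsilon>) x) 0) > 0"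
      using st(3,4) by (auto simp: Qp_def Qm_def)
    have ae: "\<not> (AE x in M. v x = 0)" if "W v > 0" for v
    proof
      assume "AE x in M. v x = 0"
      then have "AE x in M. wt x * \<bar>v x\<bar> powr (p + 1) = 0" by eventually_elim simp
      then have "W v = 0" unfolding W_eq by (rule integral_eq_zero_AE)
      then show False using that by simp
    qed
    have "w (s, t, \<epsilon>) \<in> nodal_Nehari_set \<Omega> \<alpha> p"
      unfolding nodal_Nehari_set_def
      using H10_iff Hw ae[OF q(1)] ae[OF q(2)] st(3,4) by (auto simp: Pp_def Qp_def Pm_def Qm_def)
    then show "\<exists>s\<in>{1-\<delta>..1+\<delta>}. \<exists>t\<in>{1-\<delta>..1+\<delta>}. (\<lambda>x. s * up x + t * um x + \<epsilon> * h x) \<in> nodal_Nehari_set \<Omega> \<alpha> p"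
      using st(1,2) unfolding J_def w_def fst_conv snd_conv by blast
  qed
qed

section \<open>Energy along multiples of the positive and negative part\<close>

definition U where "U s t x = s * up x + t * um x"
definition gU where "gU s t x = s *\<^sub>R gp x + t *\<^sub>R gm x"

lemma HU: "H0 (U s t) (gU s t)"
  unfolding U_def[abs_def] gU_def[abs_def] by (intro H0_add H0_cmult Hp Hm)

lemma U_cases: "U s t x = (if u x > 0 then s * u x else t * u x)"
  by (auto simp: U_def up_def um_def)

lemma U_bound: "\<bar>s\<bar> \<le> C \<Longrightarrow> \<bar>t\<bar> \<le> C \<Longrightarrow> \<bar>U s t x\<bar> \<le> C * \<bar>u x\<bar>"
  using mult_right_mono[of "\<bar>s\<bar>" C "\<bar>u x\<bar>"] mult_right_mono[of "\<bar>t\<bar>" C "\<bar>u x\<bar>"]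
  by (simp only: U_cases abs_mult if_distrib[of abs] abs_ge_zero split: if_split) simp

lemma Wfin_u: "Wfin u"
proof -
  have "Wfin (\<lambda>x. \<bar>up x\<bar> + \<bar>um x\<bar>)" by (intro Wfin_add Wfin_up Wfin_um um_meas)
  then show ?thesis by (rule Wfin_dominated[of _ _ 1, rotated]) (auto simp: u_split)
qed

lemma Wfin_U: "Wfin (U s t)"
proof (rule Wfin_dominated[OF _ Wfin_u, of _ "\<bar>s\<bar> + \<bar>t\<bar>"])
  show "\<bar>U s t x\<bar> \<le> (\<bar>s\<bar> + \<bar>t\<bar>) * \<bar>u x\<bar>" for x
    by (rule U_bound) auto
qed (simp_all add: U_def[abs_def])

text \<open>The two parts live on disjoint sets, so both integrals split, and the Nehari identities
  turn each summand into a Dirichlet integral times the fibering map.\<close>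

lemma energy_U_le:
  assumes "s > 0" "t > 0"
  shows "1 / 2 * sqint (gU s t) - 1 / (p + 1) * W (U s t) \<le> energy \<Omega> \<alpha> p u"
proof -
  have 1: "sqint (gU s t) = s\<^sup>2 * sqint gp + t\<^sup>2 * sqint gm" for s t
  proof -
    have "(norm (gU s t x))\<^sup>2 = s\<^sup>2 * (norm (gp x))\<^sup>2 + t\<^sup>2 * (norm (gm x))\<^sup>2" for x
      by (auto simp: gU_def gp_def gm_def power_mult_distrib)
    then show ?thesis unfolding sqint_def using L2D(2)[OF H0_L2(2)[OF Hp]] L2D(2)[OF H0_L2(2)[OF Hm]] by simp
  qed
  have 2: "W (U s t) = s powr (p + 1) * W up + t powr (p + 1) * W um" if "s > 0" "t > 0" for s t
  proof -
    have "\<bar>U s t x\<bar> powr (p + 1) = s powr (p + 1) * \<bar>up x\<bar> powr (p + 1) + t powr (p + 1) * \<bar>um x\<bar> powr (p + 1)" for x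
    proof (cases "u x > 0")
      case True
      then have "\<bar>U s t x\<bar> = s * \<bar>up x\<bar>" "um x = 0" using that by (auto simp: U_cases up_def um_def abs_mult)
      then show ?thesis using that by (simp add: powr_mult)
    next
      case False
      then have "\<bar>U s t x\<bar> = t * \<bar>um x\<bar>" "up x = 0" using that by (auto simp: U_cases up_def um_def abs_mult)
      then show ?thesis using that by (simp add: powr_mult)
    qed
    then have "wt x * \<bar>U s t x\<bar> powr (p + 1) =
        s powr (p + 1) * (wt x * \<bar>up x\<bar> powr (p + 1)) + t powr (p + 1) * (wt x * \<bar>um x\<bar> powr (p + 1))" for x
      by (simp add: algebra_simps)
    then show ?thesis using Wfin_up Wfin_um unfolding W_eq Wfin_def by simp
  qed
  have u1: "U 1 1 = u" "gU 1 1 x = g x \<or> u x = 0" for x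
    by (auto simp: U_def gU_def gp_def gm_def u_split)
  have "energy \<Omega> \<alpha> p u = 1 / 2 * (sqint gp + sqint gm) - 1 / (p + 1) * (W up + W um)"
    unfolding energy_def using H0_dirichlet[OF HU[of 1 1]] 1[of 1 1] 2[of 1 1] by (simp add: u1(1))
  then have "energy \<Omega> \<alpha> p u = (1 / 2 - 1 / (p + 1)) * sqint gp + (1 / 2 - 1 / (p + 1)) * sqint gm"
    using nehari by (simp add: algebra_simps)
  moreover have "1 / 2 * sqint (gU s t) - 1 / (p + 1) * W (U s t) =
      (s\<^sup>2 / 2 - s powr (p + 1) / (p + 1)) * sqint gp + (t\<^sup>2 / 2 - t powr (p + 1) / (p + 1)) * sqint gm"
    unfolding 1 2[OF assms] using nehari by (simp add: algebra_simps)
  ultimately show ?thesis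
    using mult_right_mono[OF fibering_bound[OF p assms(1)], of "sqint gp"]
      mult_right_mono[OF fibering_bound[OF p assms(2)], of "sqint gm"] by simp
qed

text \<open>The coefficients \<open>s\<close> and \<open>t\<close> restore the Nehari constraints after the perturbation by \<open>h\<close>,
  but they do not enter the first order terms, because the energy of \<open>s u\<^sup>+ + t u\<^sup>-\<close> is maximal
  at \<open>s = t = 1\<close>.\<close>

lemma perturbation_sequence:
  assumes h: "h \<in> test_functions \<Omega>"
  obtains s t \<epsilon> :: "nat \<Rightarrow> real" where
    "s \<longlonglongrightarrow> 1" "t \<longlonglongrightarrow> 1" "\<epsilon> \<longlonglongrightarrow> 0"
    "\<And>n. 0 < s n" "\<And>n. s n \<le> 2" "\<And>n. 0 < t n" "\<And>n. t n \<le> 2" "\<And>n. 0 < \<epsilon> n" "\<And>n. \<epsilon> n \<le> 1"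
    "\<And>n. (LINT x|M. wt x * (\<bar>U (s n) (t n) x + \<epsilon> n * h x\<bar> powr (p + 1) - \<bar>U (s n) (t n) x\<bar> powr (p + 1))) / (p + 1)
      \<le> \<epsilon> n * (LINT x|M. gU (s n) (t n) x \<bullet> grad h x) + (\<epsilon> n)\<^sup>2 / 2 * sqint (grad h)"
proof -
  have Hh: "H0 h (grad h)" by (rule H0_test[OF h])
  obtain C where C: "\<And>x. \<bar>h x\<bar> \<le> C" using test_bounded[OF h] by blast
  then have Wh: "Wfin h" using L2D(1)[OF test_L2(1)[OF h]] by (intro Wfin_bounded)
  \<comment> \<open>The offset 2 keeps the width at most 1/2 already for n = 0:
    \<open>nehari_perturbation\<close> asks for a width below 1, and s and t must stay positive and
    at most 2.\<close>
  have ex: "\<exists>s t \<epsilon>. \<bar>s - 1\<bar> \<le> 1 / real (n + 2) \<and> \<bar>t - 1\<bar> \<le> 1 / real (n + 2) \<and> 0 < \<epsilon> \<and> \<epsilon> \<le> 1 / real (n + 2) \<and>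
      (\<lambda>x. s * up x + t * um x + \<epsilon> * h x) \<in> nodal_Nehari_set \<Omega> \<alpha> p" for n
  proof -
    obtain e0 where e0: "e0 > 0" "\<And>\<epsilon>. 0 \<le> \<epsilon> \<Longrightarrow> \<epsilon> < e0 \<Longrightarrow>
      \<exists>s\<in>{1 - 1 / real (n + 2)..1 + 1 / real (n + 2)}. \<exists>t\<in>{1 - 1 / real (n + 2)..1 + 1 / real (n + 2)}.
        (\<lambda>x. s * up x + t * um x + \<epsilon> * h x) \<in> nodal_Nehari_set \<Omega> \<alpha> p"
      using nehari_perturbation[OF h, of "1 / real (n + 2)"] by auto
    define e where "e = min (e0 / 2) (1 / real (n + 2))"
    have e: "0 < e" "e < e0" "e \<le> 1 / real (n + 2)" using e0(1) by (auto simp: e_def)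
    obtain s t where "s \<in> {1 - 1 / real (n + 2)..1 + 1 / real (n + 2)}" "t \<in> {1 - 1 / real (n + 2)..1 + 1 / real (n + 2)}"
        "(\<lambda>x. s * up x + t * um x + e * h x) \<in> nodal_Nehari_set \<Omega> \<alpha> p"
      using e0(2)[of e] e by auto
    then show ?thesis using e by (intro exI[of _ s] exI[of _ t] exI[of _ e]) (auto simp: abs_le_iff)
  qed
  define P where "P n y \<longleftrightarrow> (case y of (s, t, \<epsilon>) \<Rightarrow> \<bar>s - 1\<bar> \<le> 1 / real (n + 2) \<and> \<bar>t - 1\<bar> \<le> 1 / real (n + 2) \<and> 0 < \<epsilon> \<and> \<epsilon> \<le> 1 / real (n + 2) \<and>
      (\<lambda>x. s * up x + t * um x + \<epsilon> * h x) \<in> nodal_Nehari_set \<Omega> \<alpha> p)" for n and y :: "real \<times> real \<times> real"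
  have "\<forall>n. \<exists>y. P n y" using ex unfolding P_def by force
  then obtain y where y: "\<And>n. P n (y n)" by metis
  define s t \<epsilon> where "s n = fst (y n)" and "t n = fst (snd (y n))" and "\<epsilon> n = snd (snd (y n))" for n
  have Y: "\<bar>s n - 1\<bar> \<le> 1 / real (n + 2)" "\<bar>t n - 1\<bar> \<le> 1 / real (n + 2)" "0 < \<epsilon> n" "\<epsilon> n \<le> 1 / real (n + 2)"
      "(\<lambda>x. s n * up x + t n * um x + \<epsilon> n * h x) \<in> nodal_Nehari_set \<Omega> \<alpha> p" for n
    using y[of n] by (auto simp: P_def s_def t_def \<epsilon>_def split_def)
  have l: "(\<lambda>n. 1 / real (n + 2)) \<longlonglongrightarrow> 0" by real_asymp
  have half: "1 / real (n + 2) \<le> 1 / 2" for n by (simp add: field_simps)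
  have st: "0 < s n" "s n \<le> 2" "0 < t n" "t n \<le> 2" "\<epsilon> n \<le> 1" for n
    using Y(1,2,4)[of n] half[of n] by linarith+
  show ?thesis
  proof (rule that[of s t \<epsilon>])
    have "(\<lambda>n. s n - 1) \<longlonglongrightarrow> 0" "(\<lambda>n. t n - 1) \<longlonglongrightarrow> 0"
      by (rule Lim_null_comparison[OF _ l]; use Y(1,2) in \<open>auto intro: always_eventually\<close>)+
    then show "s \<longlonglongrightarrow> 1" "t \<longlonglongrightarrow> 1" by (auto intro: LIM_zero_cancel)
    show "\<epsilon> \<longlonglongrightarrow> 0"
      by (rule Lim_null_comparison[OF _ l]) (use Y(3)[THEN less_imp_le] Y(4) in \<open>auto intro!: always_eventually\<close>)
    fix n
    let ?U = "U (s n) (t n)" and ?gU = "gU (s n) (t n)" and ?e = "\<epsilon> n"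
    let ?w = "\<lambda>x. ?U x + ?e * h x" and ?gw = "\<lambda>x. ?gU x + ?e *\<^sub>R grad h x"
    have Hw: "H0 ?w ?gw" by (intro H0_add H0_cmult HU Hh)
    have lU: "?gU \<in> L2 \<Omega>" "grad h \<in> L2 \<Omega>" using H0_L2(2)[OF HU] test_L2(2)[OF h] by auto
    have "sqint ?gw = (LINT x|M. (norm (?gU x))\<^sup>2 + 2 * ?e * (?gU x \<bullet> grad h x) + ?e\<^sup>2 * (norm (grad h x))\<^sup>2)"
      unfolding sqint_def power2_norm_eq_inner
      by (simp add: inner_add_left inner_add_right inner_commute power2_eq_square algebra_simps)
    also have "\<dots> = sqint ?gU + 2 * ?e * (LINT x|M. ?gU x \<bullet> grad h x) + ?e\<^sup>2 * sqint (grad h)"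
      unfolding sqint_def using L2D(2)[OF lU(1)] L2D(2)[OF lU(2)] L2_mult(1)[OF lU] by simp
    finally have D: "dirichlet_integral \<Omega> ?w = sqint ?gU + 2 * ?e * (LINT x|M. ?gU x \<bullet> grad h x) + ?e\<^sup>2 * sqint (grad h)"
      using H0_dirichlet[OF Hw] by simp
    have "Wfin (\<lambda>x. \<bar>?U x\<bar> + \<bar>h x\<bar>)"
      by (intro Wfin_add Wfin_U Wh L2D(1)[OF H0_L2(1)[OF HU]] L2D(1)[OF test_L2(1)[OF h]])
    then have Ww: "Wfin ?w"
    proof (rule Wfin_dominated[of _ _ 1, rotated])
      show "?w \<in> borel_measurable M" using L2D(1)[OF H0_L2(1)[OF Hw]] .
      show "\<bar>?w x\<bar> \<le> 1 * \<bar>\<bar>?U x\<bar> + \<bar>h x\<bar>\<bar>" for x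
      proof -
        have "\<bar>?e * h x\<bar> \<le> 1 * \<bar>h x\<bar>" unfolding abs_mult using Y(3)[of n] st(5)[of n] by (intro mult_right_mono) auto
        then have "\<bar>?w x\<bar> \<le> \<bar>?U x\<bar> + \<bar>h x\<bar>" using abs_triangle_ineq[of "?U x" "?e * h x"] by linarith
        then show ?thesis by simp
      qed
    qed simp
    have "W ?w - W ?U = (LINT x|M. wt x * (\<bar>?w x\<bar> powr (p + 1) - \<bar>?U x\<bar> powr (p + 1)))"
      using Ww Wfin_U[of "s n" "t n"] unfolding W_eq Wfin_def by (simp add: right_diff_distrib)
    moreover have "energy \<Omega> \<alpha> p u \<le> energy \<Omega> \<alpha> p ?w"
      using energy_least[OF Y(5)] by (simp add: U_def)
    then have "1 / 2 * sqint ?gU - 1 / (p + 1) * W ?U \<le> 1 / 2 * dirichlet_integral \<Omega> ?w - 1 / (p + 1) * W ?w"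
      using energy_U_le[OF st(1) st(3), of n n] unfolding energy_def by linarith
    then have "(W ?w - W ?U) / (p + 1) \<le> 1 / 2 * dirichlet_integral \<Omega> ?w - 1 / 2 * sqint ?gU"
      by (simp add: diff_divide_distrib)
    ultimately show "(LINT x|M. wt x * (\<bar>?w x\<bar> powr (p + 1) - \<bar>?U x\<bar> powr (p + 1))) / (p + 1)
      \<le> ?e * (LINT x|M. ?gU x \<bullet> grad h x) + ?e\<^sup>2 / 2 * sqint (grad h)"
      unfolding D by (simp add: algebra_simps)
  qed (use st Y in auto)
qed

section \<open>First and second variation\<close>

lemma L2_inner_limit:
  assumes "s \<longlonglongrightarrow> 1" "t \<longlonglongrightarrow> 1" "k \<in> L2 \<Omega>"
  shows "(\<lambda>n. LINT x|M. gU (s n) (t n) x \<bullet> k x) \<longlonglongrightarrow> (LINT x|M. g x \<bullet> k x)"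
proof -
  have i: "integrable M (\<lambda>x. gp x \<bullet> k x)" "integrable M (\<lambda>x. gm x \<bullet> k x)"
    using L2_mult(1) H0_L2(2)[OF Hp] H0_L2(2)[OF Hm] assms(3) by blast+
  have "(LINT x|M. gU a b x \<bullet> k x) = a * (LINT x|M. gp x \<bullet> k x) + b * (LINT x|M. gm x \<bullet> k x)" for a b
    using i by (simp add: gU_def inner_add_left)
  moreover have "(LINT x|M. g x \<bullet> k x) = 1 * (LINT x|M. gp x \<bullet> k x) + 1 * (LINT x|M. gm x \<bullet> k x)"
  proof -
    have "(LINT x|M. g x \<bullet> k x) = (LINT x|M. gp x \<bullet> k x + gm x \<bullet> k x)"
    proof (rule integral_cong_AE)
      show "AE x in M. g x \<bullet> k x = gp x \<bullet> k x + gm x \<bullet> k x"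
        using H0_gradient_zero_on_level_set[OF H] by eventually_elim (auto simp: gp_def gm_def)
    qed (use L2D(1)[OF assms(3)] in measurable)
    then show ?thesis using i by simp
  qed
  ultimately show ?thesis by (simp only:) (intro tendsto_intros assms)
qed

lemma U_limit: "s \<longlonglongrightarrow> 1 \<Longrightarrow> t \<longlonglongrightarrow> 1 \<Longrightarrow> (\<lambda>n. U (s n) (t n) x) \<longlonglongrightarrow> u x"
  by (cases "u x > 0") (auto simp: U_cases intro!: tendsto_eq_intros)

lemma intermediate_limit:
  fixes c a :: "nat \<Rightarrow> real"
  assumes "\<And>n. \<bar>c n - a n\<bar> \<le> \<bar>\<epsilon> n * b\<bar>" "a \<longlonglongrightarrow> l" "\<epsilon> \<longlonglongrightarrow> 0"
  shows "c \<longlonglongrightarrow> l"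
proof -
  have "(\<lambda>n. \<epsilon> n * b) \<longlonglongrightarrow> 0 * b" by (intro tendsto_intros assms)
  then have "(\<lambda>n. \<bar>\<epsilon> n * b\<bar>) \<longlonglongrightarrow> 0" by (simp add: tendsto_rabs_zero)
  then have "(\<lambda>n. c n - a n) \<longlonglongrightarrow> 0"
    by (rule Lim_null_comparison[rotated]) (use assms(1) in auto)
  from tendsto_add[OF this assms(2)] show ?thesis by simp
qed

text \<open>One integrable majorant for all n and for both the first and the second order quotients:
  the intermediate values lie within C of s \<open>u\<^sup>+\<close> + t \<open>u\<^sup>-\<close>
  with |s|, |t| \<le> 2, and a power of order at most p + 1 is bounded by 1 plus the power of order
  p + 1.\<close>

lemma majorant:
  fixes C :: real
  assumes "C > 0"
  defines "m \<equiv> \<lambda>x. wt x * (1 + (2 * \<bar>u x\<bar> + C) powr (p + 1))"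
  shows "integrable M m"
    and "\<And>x c s t b \<epsilon> r. \<bar>s\<bar> \<le> 2 \<Longrightarrow> \<bar>t\<bar> \<le> 2 \<Longrightarrow> \<bar>b\<bar> \<le> C \<Longrightarrow> \<bar>\<epsilon>\<bar> \<le> 1 \<Longrightarrow> \<bar>c - U s t x\<bar> \<le> \<bar>\<epsilon> * b\<bar> \<Longrightarrow>
      0 \<le> r \<Longrightarrow> r \<le> p + 1 \<Longrightarrow> wt x * \<bar>c\<bar> powr r \<le> m x"
proof -
  have "Wfin (\<lambda>x. \<bar>2 * u x\<bar> + \<bar>C\<bar>)"
  proof (rule Wfin_add)
    show "Wfin (\<lambda>x. 2 * u x)" by (rule Wfin_dominated[OF _ Wfin_u, of _ 2]) (auto simp: abs_mult)
    show "Wfin (\<lambda>x. C)" by (rule Wfin_bounded) auto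
  qed auto
  then have "integrable M (\<lambda>x. wt x * (2 * \<bar>u x\<bar> + C) powr (p + 1))"
    using assms(1) unfolding Wfin_def by (simp add: abs_mult)
  moreover have "integrable M wt"
  proof -
    obtain B where B: "B > 0" "\<And>x. x \<in> \<Omega> \<Longrightarrow> wt x \<le> B" by (rule wt_bounded) blast
    show ?thesis by (rule integrable_bounded[of _ B]) (use B in auto)
  qed
  ultimately show "integrable M m" unfolding m_def by (simp add: distrib_left)
  fix x c s t b \<epsilon> r :: real
  fix x :: 'a
  assume a: "\<bar>s\<bar> \<le> 2" "\<bar>t\<bar> \<le> 2" "\<bar>b\<bar> \<le> C" "\<bar>\<epsilon>\<bar> \<le> 1" "\<bar>c - U s t x\<bar> \<le> \<bar>\<epsilon> * b\<bar>" "0 \<le> r" "r \<le> p + 1"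
  have "\<bar>\<epsilon> * b\<bar> \<le> 1 * C" unfolding abs_mult using a by (intro mult_mono) auto
  then have "\<bar>c\<bar> \<le> 2 * \<bar>u x\<bar> + C" using a(5) U_bound[OF a(1,2), of x] by linarith
  then have "\<bar>c\<bar> powr (p + 1) \<le> (2 * \<bar>u x\<bar> + C) powr (p + 1)" using p by (intro powr_mono2) auto
  moreover have "\<bar>c\<bar> powr r \<le> 1 + \<bar>c\<bar> powr (p + 1)" using a by (intro powr_le_1_plus) auto
  ultimately show "wt x * \<bar>c\<bar> powr r \<le> m x" unfolding m_def by (intro mult_left_mono) auto
qed

text \<open>The energy comparison is divided by \<epsilon> n > 0 and n tends to infinity. The sign
  of \<epsilon> n makes the result one-sided; \<open>euler_lagrange\<close> applies it to h and to
  -h.\<close>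

lemma euler_lagrange_inequality:
  assumes h: "h \<in> test_functions \<Omega>"
  shows "(LINT x|M. wt x * spow p (u x) * h x) \<le> (LINT x|M. g x \<bullet> grad h x)"
proof -
  obtain s t \<epsilon> where seq: "s \<longlonglongrightarrow> 1" "t \<longlonglongrightarrow> 1" "\<epsilon> \<longlonglongrightarrow> 0"
    "\<And>n. 0 < s n" "\<And>n. s n \<le> 2" "\<And>n. 0 < t n" "\<And>n. t n \<le> 2" "\<And>n. 0 < \<epsilon> n" "\<And>n. \<epsilon> n \<le> 1"
    and le: "\<And>n. (LINT x|M. wt x * (\<bar>U (s n) (t n) x + \<epsilon> n * h x\<bar> powr (p + 1) - \<bar>U (s n) (t n) x\<bar> powr (p + 1))) / (p + 1)
      \<le> \<epsilon> n * (LINT x|M. gU (s n) (t n) x \<bullet> grad h x) + (\<epsilon> n)\<^sup>2 / 2 * sqint (grad h)"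
    using perturbation_sequence[OF h] by blast
  obtain C where C: "C > 0" "\<And>x. \<bar>h x\<bar> \<le> C" using test_bounded[OF h] by blast
  note maj = majorant[OF C(1)]
  have hm [measurable]: "h \<in> borel_measurable M" using L2D(1)[OF test_L2(1)[OF h]] .
  have Um [measurable]: "U a b \<in> borel_measurable M" for a b unfolding U_def[abs_def] by measurable
  have sm [measurable]: "spow p \<in> borel_measurable borel"
    using spow_continuous[OF p] by (intro borel_measurable_continuous_onI)
  define q where "q n x = wt x * ((\<bar>U (s n) (t n) x + \<epsilon> n * h x\<bar> powr (p + 1) - \<bar>U (s n) (t n) x\<bar> powr (p + 1)) / ((p + 1) * \<epsilon> n))" for n x
  have ex: "\<exists>c. \<bar>c - U (s n) (t n) x\<bar> \<le> \<bar>\<epsilon> n * h x\<bar> \<and> q n x = wt x * spow p c * h x" for n x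
  proof -
    obtain c where c: "\<bar>c - U (s n) (t n) x\<bar> \<le> \<bar>\<epsilon> n * h x\<bar>"
      "\<bar>U (s n) (t n) x + \<epsilon> n * h x\<bar> powr (p + 1) - \<bar>U (s n) (t n) x\<bar> powr (p + 1) = (p + 1) * spow (p + 1 - 1) c * (\<epsilon> n * h x)"
      using abs_powr_mvt[of "p + 1" "U (s n) (t n) x" "\<epsilon> n * h x"] p by auto
    have "q n x = wt x * (((p + 1) * spow p c * (\<epsilon> n * h x)) / ((p + 1) * \<epsilon> n))"
      unfolding q_def c(2) by simp
    also have "\<dots> = wt x * spow p c * h x" using seq(8)[of n] p by simp
    finally show ?thesis using c(1) by blast
  qed
  have "(\<lambda>n. LINT x|M. q n x) \<longlonglongrightarrow> (LINT x|M. wt x * spow p (u x) * h x)"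
  proof (rule integral_dominated_convergence[where w="\<lambda>x. C * (wt x * (1 + (2 * \<bar>u x\<bar> + C) powr (p + 1)))"])
    show "integrable M (\<lambda>x. C * (wt x * (1 + (2 * \<bar>u x\<bar> + C) powr (p + 1))))" using maj(1) by simp
    show "q n \<in> borel_measurable M" for n unfolding q_def by measurable
    show "(\<lambda>x. wt x * spow p (u x) * h x) \<in> borel_measurable M" by measurable
    show "AE x in M. norm (q n x) \<le> C * (wt x * (1 + (2 * \<bar>u x\<bar> + C) powr (p + 1)))" for n
    proof (intro AE_I2)
      fix x
      obtain c where c: "\<bar>c - U (s n) (t n) x\<bar> \<le> \<bar>\<epsilon> n * h x\<bar>" "q n x = wt x * spow p c * h x" using ex by blast
      have b: "wt x * \<bar>c\<bar> powr p \<le> wt x * (1 + (2 * \<bar>u x\<bar> + C) powr (p + 1))"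
        by (rule maj(2)[OF _ _ C(2)[of x] _ c(1)])
           (use seq(4-9)[of n] p in auto)
      have "norm (q n x) = \<bar>h x\<bar> * (wt x * \<bar>c\<bar> powr p)" by (simp add: c(2) abs_mult)
      also have "\<dots> \<le> C * (wt x * (1 + (2 * \<bar>u x\<bar> + C) powr (p + 1)))"
        using C(1) by (intro mult_mono C(2) b) auto
      finally show "norm (q n x) \<le> C * (wt x * (1 + (2 * \<bar>u x\<bar> + C) powr (p + 1)))" .
    qed
    show "AE x in M. (\<lambda>n. q n x) \<longlonglongrightarrow> wt x * spow p (u x) * h x"
    proof (intro AE_I2)
      fix x
      have "\<forall>n. \<exists>c. \<bar>c - U (s n) (t n) x\<bar> \<le> \<bar>\<epsilon> n * h x\<bar> \<and> q n x = wt x * spow p c * h x" using ex by blast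
      from choice[OF this] obtain c where "\<forall>n. \<bar>c n - U (s n) (t n) x\<bar> \<le> \<bar>\<epsilon> n * h x\<bar> \<and> q n x = wt x * spow p (c n) * h x" by blast
      then have c: "\<And>n. \<bar>c n - U (s n) (t n) x\<bar> \<le> \<bar>\<epsilon> n * h x\<bar>" "\<And>n. q n x = wt x * spow p (c n) * h x" by auto
      have "c \<longlonglongrightarrow> u x" by (rule intermediate_limit[OF c(1) U_limit[OF seq(1,2)] seq(3)])
      then have "(\<lambda>n. spow p (c n)) \<longlonglongrightarrow> spow p (u x)"
        using spow_continuous[OF p, of UNIV] by (auto intro: continuous_on_tendsto_compose)
      then show "(\<lambda>n. q n x) \<longlonglongrightarrow> wt x * spow p (u x) * h x"
        unfolding c(2) by (intro tendsto_intros)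
    qed
  qed
  moreover have "(\<lambda>n. (LINT x|M. gU (s n) (t n) x \<bullet> grad h x) + \<epsilon> n / 2 * sqint (grad h)) \<longlonglongrightarrow>
      (LINT x|M. g x \<bullet> grad h x) + 0 / 2 * sqint (grad h)"
    by (intro tendsto_intros L2_inner_limit seq test_L2(2)[OF h]) simp
  moreover have "(LINT x|M. q n x) \<le> (LINT x|M. gU (s n) (t n) x \<bullet> grad h x) + \<epsilon> n / 2 * sqint (grad h)" for n
  proof -
    have "q n x = wt x * (\<bar>U (s n) (t n) x + \<epsilon> n * h x\<bar> powr (p + 1) - \<bar>U (s n) (t n) x\<bar> powr (p + 1)) / ((p + 1) * \<epsilon> n)" for x
      by (simp add: q_def)
    then have "(LINT x|M. q n x) = (LINT x|M. wt x * (\<bar>U (s n) (t n) x + \<epsilon> n * h x\<bar> powr (p + 1) - \<bar>U (s n) (t n) x\<bar> powr (p + 1))) / ((p + 1) * \<epsilon> n)"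
      by simp
    also have "\<dots> \<le> (\<epsilon> n * (LINT x|M. gU (s n) (t n) x \<bullet> grad h x) + (\<epsilon> n)\<^sup>2 / 2 * sqint (grad h)) / \<epsilon> n"
      using divide_right_mono[OF le[of n] less_imp_le[OF seq(8)[of n]]] by (simp add: divide_divide_eq_left)
    also have "\<dots> = (LINT x|M. gU (s n) (t n) x \<bullet> grad h x) + \<epsilon> n / 2 * sqint (grad h)"
      using seq(8)[of n] by (simp add: field_simps power2_eq_square)
    finally show ?thesis .
  qed
  ultimately have "(LINT x|M. wt x * spow p (u x) * h x) \<le> (LINT x|M. g x \<bullet> grad h x) + 0 / 2 * sqint (grad h)"
    by (intro LIMSEQ_le) auto
  then show ?thesis by simp
qed

theorem euler_lagrange:
  assumes h: "h \<in> test_functions \<Omega>"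
  shows "(LINT x|M. g x \<bullet> grad h x) = (LINT x|M. wt x * spow p (u x) * h x)"
proof -
  have "(\<lambda>x. (- 1) * h x) \<in> test_functions \<Omega>" by (rule test_mult[OF h]) (rule smooth_intros)
  from euler_lagrange_inequality[OF this] euler_lagrange_inequality[OF h]
  show ?thesis by (simp only: grad_cmult[OF test_smooth[OF h]]) simp
qed

text \<open>Orthogonality is assumed for all s and t, not just for s = t = 1: the first order terms
  occur at s n and t n and are divided by \<epsilon> n, and nothing is known about how fast s n and
  t n tend to 1 in comparison.\<close>

theorem second_variation:
  assumes h: "h \<in> test_functions \<Omega>"
    and z: "\<And>s t. s > 0 \<Longrightarrow> t > 0 \<Longrightarrow> (LINT x|M. gU s t x \<bullet> grad h x) = 0"
      "\<And>s t. s > 0 \<Longrightarrow> t > 0 \<Longrightarrow> (LINT x|M. wt x * spow p (U s t x) * h x) = 0"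
  shows "integrable M (\<lambda>x. wt x * \<bar>u x\<bar> powr (p - 1) * (h x)\<^sup>2)"
    and "p * (LINT x|M. wt x * \<bar>u x\<bar> powr (p - 1) * (h x)\<^sup>2) \<le> sqint (grad h)"
proof -
  obtain s t \<epsilon> where seq: "s \<longlonglongrightarrow> 1" "t \<longlonglongrightarrow> 1" "\<epsilon> \<longlonglongrightarrow> 0"
    "\<And>n. 0 < s n" "\<And>n. s n \<le> 2" "\<And>n. 0 < t n" "\<And>n. t n \<le> 2" "\<And>n. 0 < \<epsilon> n" "\<And>n. \<epsilon> n \<le> 1"
    and le: "\<And>n. (LINT x|M. wt x * (\<bar>U (s n) (t n) x + \<epsilon> n * h x\<bar> powr (p + 1) - \<bar>U (s n) (t n) x\<bar> powr (p + 1))) / (p + 1)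
      \<le> \<epsilon> n * (LINT x|M. gU (s n) (t n) x \<bullet> grad h x) + (\<epsilon> n)\<^sup>2 / 2 * sqint (grad h)"
    using perturbation_sequence[OF h] by blast
  obtain C where C: "C > 0" "\<And>x. \<bar>h x\<bar> \<le> C" using test_bounded[OF h] by blast
  note maj = majorant[OF C(1)]
  have hm [measurable]: "h \<in> borel_measurable M" using L2D(1)[OF test_L2(1)[OF h]] .
  have Um [measurable]: "U a b \<in> borel_measurable M" for a b unfolding U_def[abs_def] by measurable
  have sm [measurable]: "spow p \<in> borel_measurable borel"
    using spow_continuous[OF p] by (intro borel_measurable_continuous_onI)
  have h2: "(h x)\<^sup>2 \<le> C\<^sup>2" for x using C(2)[of x] C(1) by (auto intro!: abs_le_square_iff[THEN iffD1])
  let ?m = "\<lambda>x. p * C\<^sup>2 * (wt x * (1 + (2 * \<bar>u x\<bar> + C) powr (p + 1)))"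
  have mi: "integrable M ?m" using maj(1) by simp
  have lim_int: "integrable M (\<lambda>x. wt x * \<bar>u x\<bar> powr (p - 1) * (h x)\<^sup>2)"
  proof (rule Bochner_Integration.integrable_bound[OF mi])
    show "AE x in M. norm (wt x * \<bar>u x\<bar> powr (p - 1) * (h x)\<^sup>2) \<le> norm (?m x)"
    proof (intro AE_I2)
      fix x
      have b: "wt x * \<bar>u x\<bar> powr (p - 1) \<le> wt x * (1 + (2 * \<bar>u x\<bar> + C) powr (p + 1))"
        by (rule maj(2)[of 1 1 0 0]) (use p C(1) in \<open>auto simp: U_cases\<close>)
      have "wt x * \<bar>u x\<bar> powr (p - 1) * (h x)\<^sup>2 \<le> (wt x * (1 + (2 * \<bar>u x\<bar> + C) powr (p + 1))) * C\<^sup>2"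
        by (intro mult_mono b h2) auto
      also have "\<dots> \<le> p * ((wt x * (1 + (2 * \<bar>u x\<bar> + C) powr (p + 1))) * C\<^sup>2)"
      proof -
        have "1 * ((wt x * (1 + (2 * \<bar>u x\<bar> + C) powr (p + 1))) * C\<^sup>2) \<le> p * ((wt x * (1 + (2 * \<bar>u x\<bar> + C) powr (p + 1))) * C\<^sup>2)"
          using p by (intro mult_right_mono) auto
        then show ?thesis by simp
      qed
      finally show "norm (wt x * \<bar>u x\<bar> powr (p - 1) * (h x)\<^sup>2) \<le> norm (?m x)"
        using p by (simp add: mult_ac abs_mult)
    qed
  qed measurable
  then show "integrable M (\<lambda>x. wt x * \<bar>u x\<bar> powr (p - 1) * (h x)\<^sup>2)" .
  define q where "q n x = wt x * ((\<bar>U (s n) (t n) x + \<epsilon> n * h x\<bar> powr (p + 1) - \<bar>U (s n) (t n) x\<bar> powr (p + 1)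
      - (p + 1) * spow p (U (s n) (t n) x) * (\<epsilon> n * h x)) / ((p + 1) * (\<epsilon> n)\<^sup>2))" for n x
  have ex: "\<exists>c. \<bar>c - U (s n) (t n) x\<bar> \<le> \<bar>\<epsilon> n * h x\<bar> \<and> q n x = p / 2 * (wt x * \<bar>c\<bar> powr (p - 1) * (h x)\<^sup>2)" for n x
  proof -
    obtain c where c: "\<bar>c - U (s n) (t n) x\<bar> \<le> \<bar>\<epsilon> n * h x\<bar>"
      "\<bar>U (s n) (t n) x + \<epsilon> n * h x\<bar> powr (p + 1) - \<bar>U (s n) (t n) x\<bar> powr (p + 1) - (p + 1) * spow p (U (s n) (t n) x) * (\<epsilon> n * h x)
        = (p + 1) * p / 2 * \<bar>c\<bar> powr (p - 1) * (\<epsilon> n * h x)\<^sup>2"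
      using abs_powr_taylor[OF p, of "U (s n) (t n) x" "\<epsilon> n * h x"] by auto
    have "q n x = wt x * (((p + 1) * p / 2 * \<bar>c\<bar> powr (p - 1) * (\<epsilon> n * h x)\<^sup>2) / ((p + 1) * (\<epsilon> n)\<^sup>2))"
      unfolding q_def c(2) by simp
    also have "\<dots> = p / 2 * (wt x * \<bar>c\<bar> powr (p - 1) * (h x)\<^sup>2)"
      using seq(8)[of n] p by (simp add: power_mult_distrib)
    finally show ?thesis using c(1) by blast
  qed
  have qm: "q n \<in> borel_measurable M" for n unfolding q_def by measurable
  have qb: "norm (q n x) \<le> ?m x" for n x
  proof -
    obtain c where c: "\<bar>c - U (s n) (t n) x\<bar> \<le> \<bar>\<epsilon> n * h x\<bar>" "q n x = p / 2 * (wt x * \<bar>c\<bar> powr (p - 1) * (h x)\<^sup>2)"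
      using ex by blast
    have b: "wt x * \<bar>c\<bar> powr (p - 1) \<le> wt x * (1 + (2 * \<bar>u x\<bar> + C) powr (p + 1))"
      by (rule maj(2)[OF _ _ C(2)[of x] _ c(1)]) (use seq(4-9)[of n] p in auto)
    have "norm (q n x) = p / 2 * (wt x * \<bar>c\<bar> powr (p - 1) * (h x)\<^sup>2)" using p by (simp add: c(2) abs_mult)
    also have "\<dots> \<le> p * ((wt x * (1 + (2 * \<bar>u x\<bar> + C) powr (p + 1))) * C\<^sup>2)"
      using p by (intro mult_mono b h2) auto
    finally show ?thesis by (simp add: mult_ac)
  qed
  have "(\<lambda>n. LINT x|M. q n x) \<longlonglongrightarrow> (LINT x|M. p / 2 * (wt x * \<bar>u x\<bar> powr (p - 1) * (h x)\<^sup>2))"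
  proof (rule integral_dominated_convergence[OF _ qm mi])
    show "AE x in M. norm (q n x) \<le> ?m x" for n using qb by simp
    show "AE x in M. (\<lambda>n. q n x) \<longlonglongrightarrow> p / 2 * (wt x * \<bar>u x\<bar> powr (p - 1) * (h x)\<^sup>2)"
    proof (intro AE_I2)
      fix x
      have "\<forall>n. \<exists>c. \<bar>c - U (s n) (t n) x\<bar> \<le> \<bar>\<epsilon> n * h x\<bar> \<and> q n x = p / 2 * (wt x * \<bar>c\<bar> powr (p - 1) * (h x)\<^sup>2)" using ex by blast
      from choice[OF this] obtain c where "\<forall>n. \<bar>c n - U (s n) (t n) x\<bar> \<le> \<bar>\<epsilon> n * h x\<bar> \<and> q n x = p / 2 * (wt x * \<bar>c n\<bar> powr (p - 1) * (h x)\<^sup>2)" by blast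
      then have c: "\<And>n. \<bar>c n - U (s n) (t n) x\<bar> \<le> \<bar>\<epsilon> n * h x\<bar>" "\<And>n. q n x = p / 2 * (wt x * \<bar>c n\<bar> powr (p - 1) * (h x)\<^sup>2)" by auto
      have "c \<longlonglongrightarrow> u x" by (rule intermediate_limit[OF c(1) U_limit[OF seq(1,2)] seq(3)])
      then have "(\<lambda>n. \<bar>c n\<bar> powr (p - 1)) \<longlonglongrightarrow> \<bar>u x\<bar> powr (p - 1)"
        using p by (intro tendsto_powr2 tendsto_rabs) auto
      then show "(\<lambda>n. q n x) \<longlonglongrightarrow> p / 2 * (wt x * \<bar>u x\<bar> powr (p - 1) * (h x)\<^sup>2)"
        unfolding c(2) by (intro tendsto_mult tendsto_const)
    qed
  qed measurable
  moreover have "(LINT x|M. q n x) \<le> sqint (grad h) / 2" for n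
  proof -
    let ?A = "\<lambda>x. wt x * (\<bar>U (s n) (t n) x + \<epsilon> n * h x\<bar> powr (p + 1) - \<bar>U (s n) (t n) x\<bar> powr (p + 1))"
    let ?B = "\<lambda>x. wt x * spow p (U (s n) (t n) x) * h x"
    \<comment> \<open>\<open>q\<close> is the second order remainder. The first order term
      subtracted in it integrates to 0 by orthogonality, so the energy comparison bounds the
      integral of \<open>q\<close> itself.\<close>
    have e: "((p + 1) * (\<epsilon> n)\<^sup>2) * q n x = ?A x - ((p + 1) * \<epsilon> n) * ?B x" for x
    proof -
      have c: "c * (w * (X / c)) = w * X" if "c \<noteq> 0" for c w X :: real using that by simp
      have "(p + 1) * (\<epsilon> n)\<^sup>2 \<noteq> 0" using seq(8)[of n] p by simp
      then show ?thesis unfolding q_def by (subst c) (simp_all add: algebra_simps)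
    qed
    have iq: "integrable M (q n)"
      by (rule Bochner_Integration.integrable_bound[OF mi qm], rule AE_I2, rule order_trans[OF qb]) simp
    have iB: "integrable M ?B"
    proof (rule Bochner_Integration.integrable_bound)
      show "integrable M (\<lambda>x. C * (wt x * (1 + (2 * \<bar>u x\<bar> + C) powr (p + 1))))" using maj(1) by simp
      show "AE x in M. norm (?B x) \<le> norm (C * (wt x * (1 + (2 * \<bar>u x\<bar> + C) powr (p + 1))))"
      proof (intro AE_I2)
        fix x
        have b: "wt x * \<bar>U (s n) (t n) x\<bar> powr p \<le> wt x * (1 + (2 * \<bar>u x\<bar> + C) powr (p + 1))"
          by (rule maj(2)[of "s n" "t n" 0 0]) (use seq(4-7)[of n] p C(1) in auto)
        have "\<bar>h x\<bar> * (wt x * \<bar>U (s n) (t n) x\<bar> powr p) \<le> C * (wt x * (1 + (2 * \<bar>u x\<bar> + C) powr (p + 1)))"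
          using C(1) by (intro mult_mono C(2) b) auto
        then show "norm (?B x) \<le> norm (C * (wt x * (1 + (2 * \<bar>u x\<bar> + C) powr (p + 1))))"
          using C(1) by (simp add: abs_mult mult_ac)
      qed
    qed measurable
    have "((p + 1) * (\<epsilon> n)\<^sup>2) * (LINT x|M. q n x) + ((p + 1) * \<epsilon> n) * (LINT x|M. ?B x) =
        (LINT x|M. ((p + 1) * (\<epsilon> n)\<^sup>2) * q n x + ((p + 1) * \<epsilon> n) * ?B x)"
      using iq iB by simp
    also have "\<dots> = (LINT x|M. ?A x)" unfolding e by simp
    finally have "((p + 1) * (\<epsilon> n)\<^sup>2) * (LINT x|M. q n x) = (LINT x|M. ?A x)"
      using z(2)[OF seq(4) seq(6)] by simp
    then have "(\<epsilon> n)\<^sup>2 * (LINT x|M. q n x) = (LINT x|M. ?A x) / (p + 1)"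
      using p by (simp add: field_simps)
    also have "\<dots> \<le> (\<epsilon> n)\<^sup>2 * (sqint (grad h) / 2)" using le[of n] z(1)[OF seq(4) seq(6)] by simp
    finally show ?thesis using seq(8)[of n] by simp
  qed
  ultimately have "(LINT x|M. p / 2 * (wt x * \<bar>u x\<bar> powr (p - 1) * (h x)\<^sup>2)) \<le> sqint (grad h) / 2"
    by (intro LIMSEQ_le_const2) auto
  then show "p * (LINT x|M. wt x * \<bar>u x\<bar> powr (p - 1) * (h x)\<^sup>2) \<le> sqint (grad h)" by simp
qed

end

section \<open>Radial functions\<close>

lemma borel_measurable_inner_self [measurable]: "(\<lambda>x::'a::euclidean_space. x \<bullet> x) \<in> borel_measurable borel"
  by (intro borel_measurable_continuous_onI continuous_intros)

text \<open>A function of the norm need not be measurable as a function of the norm a priori: the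
  superlevel sets of \<open>u\<close> are exhausted by compact sets, whose images are compact.\<close>

lemma radial_borel_representative:
  fixes u :: "'a::euclidean_space \<Rightarrow> real"
  assumes S: "S \<in> sets lebesgue" and u: "u \<in> borel_measurable (lebesgue_on S)"
    and f: "AE x in lebesgue_on S. u x = f (norm x)"
  obtains U where "U \<in> borel_measurable borel" "AE x in lebesgue_on S. u x = U (x \<bullet> x)"
proof -
  have "AE x in lebesgue. x \<in> S \<longrightarrow> u x = f (norm x)" using f S by (simp add: AE_restrict_space_iff)
  then obtain Z where Z: "Z \<in> null_sets lebesgue" "\<And>x. x \<in> S \<Longrightarrow> x \<notin> Z \<Longrightarrow> u x = f (norm x)"
    by (rule AE_E3) auto
  define L where "L c = {x \<in> S. u x > c} - Z" for c
  have "L c \<in> sets lebesgue" for c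
  proof -
    have "{x \<in> space (lebesgue_on S). u x > c} \<in> sets (lebesgue_on S)" using u by measurable
    then have "{x \<in> S. u x > c} \<in> sets lebesgue" using S by (simp add: sets_restrict_space_iff)
    then show ?thesis unfolding L_def using Z(1) by auto
  qed
  then have "\<exists>K C. negligible K \<and> (\<forall>n::nat. compact (C n)) \<and> L c = (\<Union>n. C n) \<union> K" for c
    using lebesgue_regular_inner by metis
  then obtain K C where KC: "\<And>c. negligible (K c)" "\<And>c n. compact (C c (n::nat))" "\<And>c. L c = (\<Union>n. C c n) \<union> K c"
    by metis
  define B where "B c = (\<Union>n. (\<lambda>x. x \<bullet> x) ` C c n)" for c
  have B: "B c \<in> sets borel" for c
    unfolding B_def using KC(2)
    by (intro sets.countable_UN) (auto intro!: borel_compact compact_continuous_image continuous_intros)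
  \<comment> \<open>The function is rebuilt from its superlevel sets at rational levels. The values
    are extended reals, as the supremum may be infinite at radii that carry no point of the
    domain.\<close>
  define V where "V s = (SUP c\<in>\<rat>. if s \<in> B c then ereal c else - \<infinity>)" for s
  define U where "U s = real_of_ereal (V s)" for s
  have "V \<in> borel_measurable borel"
    unfolding V_def using B countable_rat by (intro borel_measurable_SUP) auto
  then have Um: "U \<in> borel_measurable borel" unfolding U_def by measurable
  \<comment> \<open>The negligible remainders of the compact exhaustions are discarded for rational
    levels only, so their union is still a null set.\<close>
  define N where "N = Z \<union> (\<Union>c\<in>\<rat>. K c)"
  have N: "N \<in> null_sets lebesgue"
    unfolding N_def using Z(1) KC(1) countable_rat negligible_iff_null_sets
    by (intro null_sets.Un null_sets_UN') auto
  have "u x = U (x \<bullet> x)" if x: "x \<in> S" "x \<notin> N" for x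
  proof -
    have iff: "x \<bullet> x \<in> B c \<longleftrightarrow> c < u x" if c: "c \<in> \<rat>" for c
    proof
      assume "c < u x"
      then have "x \<in> L c" using x by (auto simp: L_def N_def)
      then have "x \<in> (\<Union>n. C c n)" using KC(3)[of c] x c by (auto simp: N_def)
      then show "x \<bullet> x \<in> B c" unfolding B_def by blast
    next
      assume "x \<bullet> x \<in> B c"
      then obtain n y where y: "y \<in> C c n" "x \<bullet> x = y \<bullet> y" by (auto simp: B_def)
      have "y \<in> L c" using y(1) KC(3)[of c] by blast
      then have "y \<in> S" "u y > c" "y \<notin> Z" by (auto simp: L_def)
      moreover have "norm x = norm y" using y(2) by (simp add: norm_eq_sqrt_inner)
      ultimately show "c < u x" using Z(2)[of y] Z(2)[of x] x by (auto simp: N_def)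
    qed
    have "V (x \<bullet> x) = ereal (u x)"
      unfolding V_def
    proof (rule antisym)
      show "(SUP c\<in>\<rat>. if x \<bullet> x \<in> B c then ereal c else - \<infinity>) \<le> ereal (u x)"
        by (rule SUP_least) (auto simp: iff)
      show "ereal (u x) \<le> (SUP c\<in>\<rat>. if x \<bullet> x \<in> B c then ereal c else - \<infinity>)"
      proof (rule dense_le)
        fix y assume y: "y < ereal (u x)"
        then obtain r :: real where r: "y < ereal r" "r < u x" using ereal_dense2[OF y] by auto
        obtain c where c: "c \<in> \<rat>" "r < c" "c < u x" using Rats_dense_in_real[OF r(2)] by blast
        have "y \<le> ereal c" using r(1) c(2) by (meson ereal_less_eq(3) less_imp_le less_le_trans order.trans)
        also have "\<dots> \<le> (SUP c\<in>\<rat>. if x \<bullet> x \<in> B c then ereal c else - \<infinity>)"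
          by (rule SUP_upper2[OF c(1)]) (use iff[OF c(1)] c(3) in auto)
        finally show "y \<le> (SUP c\<in>\<rat>. if x \<bullet> x \<in> B c then ereal c else - \<infinity>)" .
      qed
    qed
    then show ?thesis by (simp add: U_def)
  qed
  then have "AE x in lebesgue. x \<in> S \<longrightarrow> u x = U (x \<bullet> x)"
    by (intro AE_I'[OF N]) auto
  then have "AE x in lebesgue_on S. u x = U (x \<bullet> x)" using S by (simp add: AE_restrict_space_iff)
  then show ?thesis using Um that by blast
qed

section \<open>Radial integration in the variable |x|^2\<close>

definition sphere_const :: "'a::euclidean_space itself \<Rightarrow> real" where
  "sphere_const _ = unit_ball_vol (DIM('a)) * (DIM('a) / 2)"

lemma sphere_const_pos: "sphere_const TYPE('a::euclidean_space) > 0"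
  by (simp add: sphere_const_def)

text \<open>Both measures are compared on half-lines, a generator stable under intersections. On the
  left appears the volume \<open>unit_ball_vol\<close> N * a^(N/2) of the ball of radius sqrt a, and
  the density is its derivative in a; the constant \<open>sphere_const\<close> is thus half the area
  of the unit sphere.\<close>

lemma distr_inner_self:
  "distr lborel borel (\<lambda>x::'a::euclidean_space. x \<bullet> x) =
    density lborel (\<lambda>s. ennreal (sphere_const TYPE('a) * s powr (DIM('a) / 2 - 1) * indicator {0..} s))"
  (is "?L = ?R")
proof (rule measure_eqI_generator_eq[where \<Omega>=UNIV and E="range (\<lambda>a. {..a})" and A="\<lambda>n. {..real n}"])
  have emb: "emeasure ?L {..a} = emeasure ?R {..a}" for a
  proof -
    have l: "emeasure ?L {..a} = emeasure lborel {x::'a. x \<bullet> x \<le> a}"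
      by (subst emeasure_distr) (auto simp: vimage_def)
    have r: "emeasure ?R {..a} = (\<integral>\<^sup>+ s. ennreal (sphere_const TYPE('a) * s powr (DIM('a) / 2 - 1)) * indicator {0..a} s \<partial>lborel)"
      by (subst emeasure_density) (auto intro!: nn_integral_cong simp: indicator_def)
    show ?thesis
    proof (cases "a < 0")
      case True
      then have "{x::'a. x \<bullet> x \<le> a} = {}" using less_le_trans[OF True inner_ge_zero] by (auto simp: not_le)
      then show ?thesis unfolding l r using True by simp
    next
      case False
      have "x \<bullet> x \<le> a \<longleftrightarrow> norm x \<le> sqrt a" for x :: 'a
        by (simp add: norm_eq_sqrt_inner)
      then have "{x::'a. x \<bullet> x \<le> a} = cball 0 (sqrt a)" by (simp only: cball_def dist_norm diff_0 norm_minus_cancel)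
      then have 1: "emeasure ?L {..a} = ennreal (unit_ball_vol (DIM('a)) * sqrt a ^ DIM('a))"
        unfolding l using False by (simp add: emeasure_cball)
      have "((\<lambda>s. s powr (DIM('a) / 2 - 1)) has_integral (a powr (DIM('a) / 2 - 1 + 1) / (DIM('a) / 2 - 1 + 1))) {0..a}"
        by (rule has_integral_powr_from_0) (use False in \<open>auto\<close>)
      from has_integral_mult_right[OF this, of "sphere_const TYPE('a)"]
      have hi: "((\<lambda>s. sphere_const TYPE('a) * s powr (DIM('a) / 2 - 1)) has_integral
          (sphere_const TYPE('a) * (a powr (DIM('a) / 2) / (DIM('a) / 2)))) {0..a}" by simp
      have "emeasure ?R {..a} = ennreal (sphere_const TYPE('a) * (a powr (DIM('a) / 2) / (DIM('a) / 2)))"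
        unfolding r by (rule nn_integral_has_integral_lebesgue'[OF _ hi]) (auto simp: sphere_const_def)
      also have "sphere_const TYPE('a) * (a powr (DIM('a) / 2) / (DIM('a) / 2)) = unit_ball_vol (DIM('a)) * sqrt a ^ DIM('a)"
      proof -
        have "a powr (DIM('a) / 2) = sqrt a ^ DIM('a)"
        proof (cases "a = 0")
          case False
          then have "a > 0" using \<open>\<not> a < 0\<close> by simp
          then have "sqrt a ^ DIM('a) = (a powr (1/2)) powr (DIM('a))" by (simp add: powr_half_sqrt powr_realpow)
          then show ?thesis by (simp add: powr_powr)
        qed simp
        then show ?thesis by (simp add: sphere_const_def)
      qed
      finally show ?thesis using 1 by simp
    qed
  qed
  show "\<And>X. X \<in> range (\<lambda>a. {..a}) \<Longrightarrow> emeasure ?L X = emeasure ?R X" using emb by auto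
  show "emeasure ?L {..real n} \<noteq> \<infinity>" for n
  proof -
    have "{x::'a. x \<bullet> x \<le> real n} \<subseteq> cball 0 (sqrt (real n))"
      by (auto simp: norm_eq_sqrt_inner)
    then have "emeasure lborel {x::'a. x \<bullet> x \<le> real n} \<le> emeasure lborel (cball (0::'a) (sqrt (real n)))"
      by (intro emeasure_mono) auto
    then have "emeasure lborel {x::'a. x \<bullet> x \<le> real n} < \<infinity>" using emeasure_lborel_cball_finite le_less_trans by blast
    then show ?thesis by (subst emeasure_distr) (auto simp: vimage_def)
  qed
  show "Int_stable (range (\<lambda>a::real. {..a}))"
    by (auto simp: Int_stable_def)
  show "(\<Union>n. {..real n}) = UNIV" by (auto intro: real_arch_simple)
qed (auto simp: borel_eq_atMost)

text \<open>In terms of \<open>s = |x|\<^sup>2\<close>, a radial domain is the interval between \<open>A\<close> and \<open>B\<close>; the ball has \<open>A = 0\<close>.\<close>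

locale radial_domain = bounded_open \<Omega> for \<Omega> :: "'a::euclidean_space set" +
  fixes A B :: real
  assumes AB: "0 \<le> A" "A < B" and Om_iff: "x \<noteq> 0 \<Longrightarrow> x \<in> \<Omega> \<longleftrightarrow> A < x \<bullet> x \<and> x \<bullet> x < B"
    and zero_Om: "0 \<in> \<Omega> \<longleftrightarrow> A = 0"
begin

definition \<nu> :: real where "\<nu> = DIM('a) / 2"

definition \<kappa> where "\<kappa> s = sphere_const TYPE('a) * (s powr (\<nu> - 1) * indicator {A<..<B} s)" for s :: real

lemma \<kappa>_nonneg [simp]: "\<kappa> s \<ge> 0" using sphere_const_pos[where 'a='a] by (simp add: \<kappa>_def)

lemma \<kappa>_measurable [measurable]: "\<kappa> \<in> borel_measurable borel" by (simp add: \<kappa>_def[abs_def])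

lemma q_measurable [measurable]: "(\<lambda>x. x \<bullet> x) \<in> borel_measurable M"
  by (rule measurable_M_borel) measurable

lemma distr_M: "distr M borel (\<lambda>x. x \<bullet> x) = density lborel (\<lambda>s. ennreal (\<kappa> s))"
proof (rule measure_eqI)
  fix X assume "X \<in> sets (distr M borel (\<lambda>x. x \<bullet> x))"
  then have X [measurable]: "X \<in> sets borel" by simp
  let ?X = "X \<inter> {A<..<B}"
  have qX: "(\<lambda>x::'a. x \<bullet> x) -` X \<in> sets borel" "(\<lambda>x::'a. x \<bullet> x) -` ?X \<in> sets borel"
    using measurable_sets[OF borel_measurable_inner_self, of X] measurable_sets[OF borel_measurable_inner_self, of ?X] by auto
  have "emeasure (distr M borel (\<lambda>x. x \<bullet> x)) X = emeasure M ((\<lambda>x. x \<bullet> x) -` X \<inter> \<Omega>)"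
    by (subst emeasure_distr) auto
  also have "\<dots> = emeasure lebesgue ((\<lambda>x. x \<bullet> x) -` X \<inter> \<Omega>)"
    by (subst emeasure_restrict_space) auto
  also have "\<dots> = emeasure lborel ((\<lambda>x. x \<bullet> x) -` X \<inter> \<Omega>)"
    using qX by (subst emeasure_completion) (auto simp: main_part_sets)
  also have "\<dots> = emeasure lborel ((\<lambda>x::'a. x \<bullet> x) -` ?X)"
  proof (rule emeasure_eq_AE)
    \<comment> \<open>The origin, the one point about which \<open>Om_iff\<close> is silent, is a
      null set.\<close>
    have "AE x in lborel. x \<noteq> (0::'a)" by (rule AE_lborel_singleton)
    then show "AE x in lborel. (x \<in> (\<lambda>x. x \<bullet> x) -` X \<inter> \<Omega>) = (x \<in> (\<lambda>x::'a. x \<bullet> x) -` ?X)"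
      by eventually_elim (auto simp: Om_iff)
  qed (use qX in auto)
  also have "\<dots> = emeasure (distr lborel borel (\<lambda>x::'a. x \<bullet> x)) ?X"
    by (subst emeasure_distr) auto
  also have "\<dots> = (\<integral>\<^sup>+ s. ennreal (sphere_const TYPE('a) * s powr (DIM('a) / 2 - 1) * indicator {0..} s) * indicator ?X s \<partial>lborel)"
    unfolding distr_inner_self by (subst emeasure_density) auto
  also have "\<dots> = (\<integral>\<^sup>+ s. ennreal (\<kappa> s) * indicator X s \<partial>lborel)"
    using AB by (intro nn_integral_cong) (auto simp: indicator_def \<kappa>_def \<nu>_def)
  also have "\<dots> = emeasure (density lborel (\<lambda>s. ennreal (\<kappa> s))) X"
    by (subst emeasure_density) auto
  finally show "emeasure (distr M borel (\<lambda>x. x \<bullet> x)) X = emeasure (density lborel (\<lambda>s. ennreal (\<kappa> s))) X" .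
qed auto

lemma radial_integral:
  fixes F :: "real \<Rightarrow> real"
  assumes [measurable]: "F \<in> borel_measurable borel"
  shows "(LINT x|M. F (x \<bullet> x)) = (LINT s|lborel. \<kappa> s * F s)"
    "integrable M (\<lambda>x. F (x \<bullet> x)) \<longleftrightarrow> integrable lborel (\<lambda>s. \<kappa> s * F s)"
proof -
  have "(LINT x|M. F (x \<bullet> x)) = (LINT s|distr M borel (\<lambda>x. x \<bullet> x). F s)"
    by (subst integral_distr) auto
  also have "\<dots> = (LINT s|lborel. \<kappa> s *\<^sub>R F s)"
    unfolding distr_M by (rule integral_density) auto
  finally show "(LINT x|M. F (x \<bullet> x)) = (LINT s|lborel. \<kappa> s * F s)" by simp
  have "integrable M (\<lambda>x. F (x \<bullet> x)) \<longleftrightarrow> integrable (distr M borel (\<lambda>x. x \<bullet> x)) F"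
    by (subst integrable_distr_eq) auto
  also have "\<dots> \<longleftrightarrow> integrable lborel (\<lambda>s. \<kappa> s *\<^sub>R F s)"
    unfolding distr_M by (rule integrable_density) auto
  finally show "integrable M (\<lambda>x. F (x \<bullet> x)) \<longleftrightarrow> integrable lborel (\<lambda>s. \<kappa> s * F s)" by simp
qed

lemma radial_AE:
  assumes "{s. P s} \<in> sets borel"
  shows "(AE x in M. P (x \<bullet> x)) \<longleftrightarrow> (AE s in lborel. A < s \<longrightarrow> s < B \<longrightarrow> P s)"
proof -
  have "(AE x in M. P (x \<bullet> x)) \<longleftrightarrow> (AE s in distr M borel (\<lambda>x. x \<bullet> x). P s)"
    using assms by (subst AE_distr_iff) auto
  also have "\<dots> \<longleftrightarrow> (AE s in lborel. 0 < ennreal (\<kappa> s) \<longrightarrow> P s)"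
    unfolding distr_M by (rule AE_density) auto
  also have "\<dots> \<longleftrightarrow> (AE s in lborel. A < s \<longrightarrow> s < B \<longrightarrow> P s)"
  proof -
    have "0 < ennreal (\<kappa> s) \<longleftrightarrow> A < s \<and> s < B" for s
      using sphere_const_pos[where 'a='a] AB by (auto simp: \<kappa>_def indicator_def zero_less_mult_iff)
    then show ?thesis by (simp add: imp_conjL)
  qed
  finally show ?thesis .
qed

lemma integral_odd:
  fixes F :: "'a \<Rightarrow> real"
  assumes [measurable]: "F \<in> borel_measurable borel" and odd: "\<And>x. F (- x) = - F x"
  shows "(LINT x|M. F x) = 0"
proof -
  have sym: "- x \<in> \<Omega> \<longleftrightarrow> x \<in> \<Omega>" for x
  proof (cases "x = 0")
    case False
    then show ?thesis using Om_iff[of x] Om_iff[of "- x"] by simp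
  qed simp
  have [measurable]: "\<Omega> \<in> sets borel" by simp
  have d: "distr lborel borel (\<lambda>x::'a. - x) = lborel"
    using lborel_affine[of "-1" "0::'a"] by (simp add: density_1)
  let ?G = "\<lambda>x. indicator \<Omega> x * F x"
  have "(LINT x|M. F x) = (LINT x|M. ?G x)" by (rule Bochner_Integration.integral_cong) auto
  also have "\<dots> = (LINT x|lborel. ?G x)"
    by (rule integral_M_eq_lborel) auto
  also have "\<dots> = (LINT x|distr lborel borel (\<lambda>x::'a. - x). ?G x)" unfolding d ..
  also have "\<dots> = (LINT x|lborel. ?G (- x))" by (subst integral_distr) auto
  also have "\<dots> = (LINT x|lborel. - ?G x)" by (rule Bochner_Integration.integral_cong) (auto simp: odd sym indicator_def)
  also have "\<dots> = - (LINT x|lborel. ?G x)" by simp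
  also have "(LINT x|lborel. ?G x) = (LINT x|M. ?G x)" by (rule integral_M_eq_lborel[symmetric]) auto
  also have "(LINT x|M. ?G x) = (LINT x|M. F x)" by (rule Bochner_Integration.integral_cong) auto
  finally show ?thesis by simp
qed

text \<open>The profiles of radial test functions. On a ball nothing is asked near s = 0, because
  \<eta>(|x|^2) is smooth at the origin anyway; this freedom is what later excludes the singular
  fundamental solution.\<close>

definition admissible :: "(real \<Rightarrow> real) \<Rightarrow> bool" where
  "admissible \<eta> \<longleftrightarrow> smooth \<eta> \<and> (\<exists>b<B. \<forall>s>b. \<eta> s = 0) \<and> (A > 0 \<longrightarrow> (\<exists>a>A. \<forall>s<a. \<eta> s = 0))"

lemma admissible_test:
  assumes "admissible \<eta>" shows "(\<lambda>x. \<eta> (x \<bullet> x)) \<in> test_functions \<Omega>"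
proof -
  obtain b where b: "b < B" "\<And>s. s > b \<Longrightarrow> \<eta> s = 0" using assms by (auto simp: admissible_def)
  obtain a where a: "A > 0 \<Longrightarrow> a > A" "\<And>s. A > 0 \<Longrightarrow> s < a \<Longrightarrow> \<eta> s = 0"
    using assms unfolding admissible_def by metis
  define K where "K = {x::'a. (A > 0 \<longrightarrow> a \<le> x \<bullet> x) \<and> x \<bullet> x \<le> b}"
  have "closed K"
    unfolding K_def by (intro closed_Collect_conj closed_Collect_imp closed_Collect_le continuous_intros open_Collect_const)
  moreover have "bounded K"
    unfolding bounded_iff K_def by (rule exI[of _ "sqrt b"]) (auto simp: norm_eq_sqrt_inner)
  ultimately have "compact K" by (simp add: compact_eq_bounded_closed)
  moreover have "K \<subseteq> \<Omega>"
  proof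
    fix x assume x: "x \<in> K"
    show "x \<in> \<Omega>"
    proof (cases "x = 0")
      case True
      then show ?thesis using x a AB zero_Om by (auto simp: K_def)
    next
      case False
      then have "x \<bullet> x > 0" by simp
      then have "A < x \<bullet> x" using x a(1) AB by (cases "A > 0") (auto simp: K_def)
      then show ?thesis using x b(1) Om_iff[OF False] by (auto simp: K_def)
    qed
  qed
  moreover have "smooth (\<lambda>x::'a. \<eta> (x \<bullet> x))"
    using assms by (intro smooth_compose[of \<eta> "\<lambda>x. x \<bullet> x"] smooth_intros) (auto simp: admissible_def)
  moreover have "\<eta> (x \<bullet> x) = 0" if "x \<notin> K" for x
    using that a(2) b(2) by (auto simp: K_def not_le)
  ultimately show ?thesis by (intro test_functionsI[of _ K]) auto
qed

lemma grad_radial: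
  assumes "smooth (\<eta> :: real \<Rightarrow> real)"
  shows "grad (\<lambda>x. \<eta> (x \<bullet> x)) x = (2 * deriv \<eta> (x \<bullet> x)) *\<^sub>R (x::'a)"
proof -
  have "smooth (\<lambda>x::'a. x \<bullet> x)" by (intro smooth_intros)
  from grad_compose[OF smooth_deriv(1)[OF assms] this, of x] show ?thesis by (simp add: grad_inner_self)
qed

end

text \<open>Differentiation flips the parity; used with c = -1 for odd and c = 1 for even
  functions.\<close>

lemma pderiv_reflect:
  fixes f :: "'a::euclidean_space \<Rightarrow> real"
  assumes f: "smooth f" and r: "\<And>x. f (- x) = c * f x"
  shows "pderiv_at f i (- x) = - (c * pderiv_at f i x)"
proof -
  have 1: "((\<lambda>x. f (- x)) has_derivative (\<lambda>h. grad f (- x) \<bullet> (- h))) (at x)"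
    by (rule has_derivative_compose[where f="\<lambda>x. - x" and g=f])
       (use smooth_has_grad[OF f, of "- x"] in \<open>auto intro!: derivative_eq_intros\<close>)
  have 2: "((\<lambda>x. f (- x)) has_derivative (\<lambda>h. c * (grad f x \<bullet> h))) (at x)"
    unfolding r by (intro has_derivative_mult_right smooth_has_grad[OF f])
  have "grad f (- x) \<bullet> (- i) = c * (grad f x \<bullet> i)"
    using has_derivative_unique[OF 1 2] by metis
  moreover have "f differentiable (at y)" for y
    using smooth_has_derivative[OF f] unfolding differentiable_def by blast
  ultimately show ?thesis using grad_inner[of f x i] grad_inner[of f "- x" i] by simp
qed

locale radial_minimizer = minimizer \<Omega> \<alpha> p u g + radial_domain \<Omega> A B
  for \<Omega> :: "'a::euclidean_space set" and \<alpha> p u g A B +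
  fixes v :: "real \<Rightarrow> real"
  assumes v_measurable [measurable]: "v \<in> borel_measurable borel" and u_eq: "AE x in M. u x = v (x \<bullet> x)"
begin

section \<open>Integral relations for the profile of a radial minimiser\<close>

abbreviation ind where "ind \<equiv> indicat_real {A<..<B}"

lemma wt_eq: "wt x = (x \<bullet> x) powr (\<alpha> / 2)"
proof -
  have "norm x = (x \<bullet> x) powr (1 / 2)" by (simp add: norm_eq_sqrt_inner powr_half_sqrt)
  then show ?thesis by (simp add: wt_def powr_powr)
qed

lemma radial_integral':
  fixes F :: "real \<Rightarrow> real"
  assumes "F \<in> borel_measurable borel"
  shows "(LINT x|M. F (x \<bullet> x)) = sphere_const TYPE('a) * (LINT s|lborel. ind s * (s powr (\<nu> - 1) * F s))"
    "integrable M (\<lambda>x. F (x \<bullet> x)) \<longleftrightarrow> integrable lborel (\<lambda>s. ind s * (s powr (\<nu> - 1) * F s))"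
proof -
  have e: "\<kappa> s * F s = sphere_const TYPE('a) * (ind s * (s powr (\<nu> - 1) * F s))" for s by (simp add: \<kappa>_def)
  show "(LINT x|M. F (x \<bullet> x)) = sphere_const TYPE('a) * (LINT s|lborel. ind s * (s powr (\<nu> - 1) * F s))"
    unfolding radial_integral(1)[OF assms] e by simp
  show "integrable M (\<lambda>x. F (x \<bullet> x)) \<longleftrightarrow> integrable lborel (\<lambda>s. ind s * (s powr (\<nu> - 1) * F s))"
    unfolding radial_integral(2)[OF assms] e using sphere_const_pos[where 'a='a] by simp
qed

lemma ind_cong: "(\<And>s. A < s \<Longrightarrow> s < B \<Longrightarrow> 0 < s \<Longrightarrow> F1 s = F2 s) \<Longrightarrow> (\<lambda>s. ind s * F1 s) = (\<lambda>s. ind s * F2 s)"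
  using AB by (auto simp: indicator_def fun_eq_iff)

lemma powr_shift: "0 < s \<Longrightarrow> s powr (\<nu> - 1) * s = s powr \<nu>" for s :: real
  by (simp add: powr_diff)

lemma profile_integrable:
  "integrable lborel (\<lambda>s. ind s * (s powr (\<nu> - 1 + \<alpha> / 2) * \<bar>v s\<bar> powr (p + 1)))"
proof -
  have m: "(\<lambda>s. s powr (\<alpha> / 2) * \<bar>v s\<bar> powr (p + 1)) \<in> borel_measurable borel" by measurable
  have "integrable M (\<lambda>x. wt x * \<bar>u x\<bar> powr (p + 1))" using Wfin_u by (simp add: Wfin_def)
  then have "integrable M (\<lambda>x. (x \<bullet> x) powr (\<alpha> / 2) * \<bar>v (x \<bullet> x)\<bar> powr (p + 1))"
  proof (rule integrable_cong_AE_imp)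
    show "(\<lambda>x. (x \<bullet> x) powr (\<alpha> / 2) * \<bar>v (x \<bullet> x)\<bar> powr (p + 1)) \<in> borel_measurable M" by measurable
    show "AE x in M. wt x * \<bar>u x\<bar> powr (p + 1) = (x \<bullet> x) powr (\<alpha> / 2) * \<bar>v (x \<bullet> x)\<bar> powr (p + 1)"
      using u_eq by eventually_elim (simp add: wt_eq)
  qed
  then have "integrable lborel (\<lambda>s. ind s * (s powr (\<nu> - 1) * (s powr (\<alpha> / 2) * \<bar>v s\<bar> powr (p + 1))))"
    using radial_integral'(2)[OF m] by simp
  also have "(\<lambda>s. ind s * (s powr (\<nu> - 1) * (s powr (\<alpha> / 2) * \<bar>v s\<bar> powr (p + 1)))) =
      (\<lambda>s. ind s * (s powr (\<nu> - 1 + \<alpha> / 2) * \<bar>v s\<bar> powr (p + 1)))"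
    by (rule ind_cong) (simp add: powr_add)
  finally show ?thesis .
qed

lemma profile_sq_integrable: "integrable lborel (\<lambda>s. ind s * (s powr (\<nu> - 1) * (v s)\<^sup>2))"
proof -
  have m: "(\<lambda>s. (v s)\<^sup>2) \<in> borel_measurable borel" by measurable
  have "integrable M (\<lambda>x. (norm (u x))\<^sup>2)" using L2D(2)[OF H0_L2(1)[OF H]] .
  then have "integrable M (\<lambda>x. (v (x \<bullet> x))\<^sup>2)"
    by (rule integrable_cong_AE_imp) (use u_eq in auto)
  then show ?thesis using radial_integral'(2)[OF m] by simp
qed

lemma smooth_measurable [measurable (raw)]: "smooth f \<Longrightarrow> f \<in> borel_measurable borel"
  by (intro borel_measurable_continuous_onI smooth_continuous)

text \<open>The factor 4 \<nu> \<eta>' + 4 s \<eta>'' is the Laplacian of \<eta>(|x|^2). Both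
  derivatives rest on the test function, so the equation speaks of \<open>v\<close> only, about
  which nothing but measurability and integrability is known so far.\<close>

lemma profile_euler_lagrange:
  assumes \<eta>: "admissible \<eta>"
  shows "(LINT s|lborel. ind s * (s powr (\<nu> - 1) * (v s * (4 * \<nu> * deriv \<eta> s + 4 * s * deriv (deriv \<eta>) s)))) =
    - (LINT s|lborel. ind s * (s powr (\<nu> - 1 + \<alpha> / 2) * (spow p (v s) * \<eta> s)))"
proof -
  have s: "smooth \<eta>" "smooth (deriv \<eta>)" "smooth (deriv (deriv \<eta>))"
    using \<eta> smooth_deriv(2) unfolding admissible_def by blast+
  note [measurable] = s[THEN smooth_measurable]
  have [measurable]: "spow p \<in> borel_measurable borel"
    using spow_continuous[OF p] by (intro borel_measurable_continuous_onI)
  let ?h = "\<lambda>x::'a. \<eta> (x \<bullet> x)"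
  have t: "?h \<in> test_functions \<Omega>" by (rule admissible_test[OF \<eta>])
  have d: "((\<lambda>s. 2 * deriv \<eta> s) has_real_derivative 2 * deriv (deriv \<eta>) s) (at s)" for s
    using DERIV_cmult[OF smooth_deriv(1)[OF s(2)]] .
  have "(LINT x|M. u x * (DIM('a) * (2 * deriv \<eta> (x \<bullet> x)) + 2 * (x \<bullet> x) * (2 * deriv (deriv \<eta>) (x \<bullet> x)))) =
      - (LINT x|M. (g x \<bullet> x) * (2 * deriv \<eta> (x \<bullet> x)))"
    by (rule H0_radial_field[OF H d]) (intro continuous_intros smooth_continuous s)
  also have "\<dots> = - (LINT x|M. g x \<bullet> grad ?h x)"
    by (simp add: grad_radial[OF s(1)] mult.commute)
  also have "\<dots> = - (LINT x|M. wt x * spow p (u x) * \<eta> (x \<bullet> x))"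
    using euler_lagrange[OF t] by simp
  finally have e: "(LINT x|M. u x * (DIM('a) * (2 * deriv \<eta> (x \<bullet> x)) + 2 * (x \<bullet> x) * (2 * deriv (deriv \<eta>) (x \<bullet> x)))) =
    - (LINT x|M. wt x * spow p (u x) * \<eta> (x \<bullet> x))" .
  let ?F = "\<lambda>s. v s * (4 * \<nu> * deriv \<eta> s + 4 * s * deriv (deriv \<eta>) s)"
  let ?G = "\<lambda>s. s powr (\<alpha> / 2) * (spow p (v s) * \<eta> s)"
  have 1: "(LINT x|M. u x * (DIM('a) * (2 * deriv \<eta> (x \<bullet> x)) + 2 * (x \<bullet> x) * (2 * deriv (deriv \<eta>) (x \<bullet> x)))) = (LINT x|M. ?F (x \<bullet> x))"
    by (rule integral_cong_AE) (use u_eq in \<open>auto simp: \<nu>_def\<close>)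
  have 2: "(LINT x|M. wt x * spow p (u x) * \<eta> (x \<bullet> x)) = (LINT x|M. ?G (x \<bullet> x))"
    by (rule integral_cong_AE) (use u_eq in \<open>auto simp: wt_eq mult.assoc\<close>)
  have mF: "?F \<in> borel_measurable borel" "?G \<in> borel_measurable borel" by measurable
  have "(\<lambda>s. ind s * (s powr (\<nu> - 1) * ?G s)) = (\<lambda>s. ind s * (s powr (\<nu> - 1 + \<alpha> / 2) * (spow p (v s) * \<eta> s)))"
    by (rule ind_cong) (simp add: powr_add)
  then have "sphere_const TYPE('a) * (LINT s|lborel. ind s * (s powr (\<nu> - 1) * ?F s)) =
      sphere_const TYPE('a) * (- (LINT s|lborel. ind s * (s powr (\<nu> - 1 + \<alpha> / 2) * (spow p (v s) * \<eta> s))))"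
    using e unfolding 1 2 radial_integral'(1)[OF mF(1)] radial_integral'(1)[OF mF(2)] by simp
  then show ?thesis using sphere_const_pos[where 'a='a] by (simp only: mult_cancel_left) simp
qed

lemma profile_gradient_bound:
  obtains C where "C \<ge> 0" "\<And>\<eta> \<eta>'. (\<And>s. (\<eta> has_real_derivative \<eta>' s) (at s)) \<Longrightarrow> continuous_on UNIV \<eta>' \<Longrightarrow>
    (LINT s|lborel. ind s * (s powr (\<nu> - 1) * (v s * (2 * \<nu> * \<eta> s + 2 * s * \<eta>' s))))\<^sup>2 \<le>
      C * (LINT s|lborel. ind s * (s powr \<nu> * (\<eta> s)\<^sup>2))"
proof -
  let ?c = "sphere_const TYPE('a)"
  have c: "?c > 0" by (rule sphere_const_pos)
  show ?thesis
  proof (rule that[of "sqint g / ?c"])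
    show "sqint g / ?c \<ge> 0" using c by simp
    fix \<eta> \<eta>' :: "real \<Rightarrow> real"
    assume \<eta>: "\<And>s. (\<eta> has_real_derivative \<eta>' s) (at s)" "continuous_on UNIV \<eta>'"
    have c\<eta>: "continuous_on UNIV \<eta>" using \<eta>(1) DERIV_isCont by (auto simp: continuous_on_eq_continuous_at)
    have m [measurable]: "\<eta> \<in> borel_measurable borel" "\<eta>' \<in> borel_measurable borel"
      using c\<eta> \<eta>(2) by (auto intro: borel_measurable_continuous_onI)
    have "continuous_on UNIV (\<lambda>x::'a. \<eta> (x \<bullet> x) *\<^sub>R x)"
      by (intro continuous_intros continuous_on_compose2[OF c\<eta>]) auto
    then have k: "(\<lambda>x::'a. \<eta> (x \<bullet> x) *\<^sub>R x) \<in> L2 \<Omega>" by (rule L2_continuous)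
    let ?F = "\<lambda>s. v s * (2 * \<nu> * \<eta> s + 2 * s * \<eta>' s)" and ?G = "\<lambda>s. (\<eta> s)\<^sup>2 * s"
    have mF: "?F \<in> borel_measurable borel" "?G \<in> borel_measurable borel" by measurable
    have 1: "(LINT x|M. ?F (x \<bullet> x)) = - (LINT x|M. g x \<bullet> (\<eta> (x \<bullet> x) *\<^sub>R x))"
    proof -
      have "(LINT x|M. ?F (x \<bullet> x)) = (LINT x|M. u x * (DIM('a) * \<eta> (x \<bullet> x) + 2 * (x \<bullet> x) * \<eta>' (x \<bullet> x)))"
        by (rule integral_cong_AE) (use u_eq in \<open>auto simp: \<nu>_def\<close>)
      also have "\<dots> = - (LINT x|M. (g x \<bullet> x) * \<eta> (x \<bullet> x))" by (rule H0_radial_field[OF H \<eta>])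
      finally show ?thesis by (simp add: mult.commute)
    qed
    have 2: "sqint (\<lambda>x. \<eta> (x \<bullet> x) *\<^sub>R x) = (LINT x|M. ?G (x \<bullet> x))"
      by (simp add: sqint_def power_mult_distrib power2_norm_eq_inner)
    have 3: "(\<lambda>s. ind s * (s powr (\<nu> - 1) * ?G s)) = (\<lambda>s. ind s * (s powr \<nu> * (\<eta> s)\<^sup>2))"
      by (rule ind_cong) (simp add: powr_shift[symmetric] mult_ac)
    have "(?c * (LINT s|lborel. ind s * (s powr (\<nu> - 1) * ?F s)))\<^sup>2 \<le> sqint g * (?c * (LINT s|lborel. ind s * (s powr \<nu> * (\<eta> s)\<^sup>2)))"
    proof -
      have "(LINT x|M. ?F (x \<bullet> x))\<^sup>2 \<le> sqint g * (LINT x|M. ?G (x \<bullet> x))"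
        using L2_mult(2)[OF H0_L2(2)[OF H] k] unfolding 1 2 by simp
      then show ?thesis unfolding radial_integral'(1)[OF mF(1)] radial_integral'(1)[OF mF(2)] 3 .
    qed
    then have "?c * (?c * (LINT s|lborel. ind s * (s powr (\<nu> - 1) * ?F s))\<^sup>2) \<le> ?c * (sqint g * (LINT s|lborel. ind s * (s powr \<nu> * (\<eta> s)\<^sup>2)))"
      by (simp add: power2_eq_square mult_ac)
    then have "?c * (LINT s|lborel. ind s * (s powr (\<nu> - 1) * ?F s))\<^sup>2 \<le> sqint g * (LINT s|lborel. ind s * (s powr \<nu> * (\<eta> s)\<^sup>2))"
      using c by simp
    then show "(LINT s|lborel. ind s * (s powr (\<nu> - 1) * ?F s))\<^sup>2 \<le> sqint g / ?c * (LINT s|lborel. ind s * (s powr \<nu> * (\<eta> s)\<^sup>2))"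
      using c by (simp add: field_simps)
  qed
qed

lemma profile_sign_change:
  "\<not> (AE s in lborel. A < s \<longrightarrow> s < B \<longrightarrow> v s \<le> 0)" "\<not> (AE s in lborel. A < s \<longrightarrow> s < B \<longrightarrow> v s \<ge> 0)"
proof -
  have m: "{s. v s \<le> 0} \<in> sets borel" "{s. v s \<ge> 0} \<in> sets borel" by measurable
  show "\<not> (AE s in lborel. A < s \<longrightarrow> s < B \<longrightarrow> v s \<le> 0)"
  proof
    assume "AE s in lborel. A < s \<longrightarrow> s < B \<longrightarrow> v s \<le> 0"
    then have "AE x in M. v (x \<bullet> x) \<le> 0" using radial_AE[OF m(1)] by simp
    with u_eq have "AE x in M. up x = 0" by eventually_elim (simp add: up_def)
    then show False using nehari(1) by simp
  qed
  show "\<not> (AE s in lborel. A < s \<longrightarrow> s < B \<longrightarrow> v s \<ge> 0)"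
  proof
    assume "AE s in lborel. A < s \<longrightarrow> s < B \<longrightarrow> v s \<ge> 0"
    then have "AE x in M. v (x \<bullet> x) \<ge> 0" using radial_AE[OF m(2)] by simp
    with u_eq have "AE x in M. um x = 0" by eventually_elim (simp add: um_def)
    then show False using nehari(3) by simp
  qed
qed

text \<open>The odd directions \<open>x\<^sub>i \<psi>(|x|\<^sup>2)\<close> are orthogonal to all radial functions.\<close>

lemma odd_direction:
  assumes h: "h \<in> test_functions \<Omega>" and odd: "\<And>x. h (- x) = - h x"
  shows "integrable M (\<lambda>x. wt x * \<bar>u x\<bar> powr (p - 1) * (h x)\<^sup>2)"
    and "p * (LINT x|M. wt x * \<bar>u x\<bar> powr (p - 1) * (h x)\<^sup>2) \<le> sqint (grad h)"
proof -
  define Us where "Us s t r = (if v r > 0 then s * v r else t * v r)" for s t r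
  have Us: "AE x in M. U s t x = Us s t (x \<bullet> x)" for s t
    using u_eq by eventually_elim (simp add: U_cases Us_def)
  have [measurable]: "Us s t \<in> borel_measurable borel" for s t unfolding Us_def by measurable
  have [measurable]: "spow p \<in> borel_measurable borel"
    using spow_continuous[OF p] by (intro borel_measurable_continuous_onI)
  have Um [measurable]: "U a b \<in> borel_measurable M" for a b unfolding U_def[abs_def] by measurable
  have test_m [measurable]: "\<phi> \<in> borel_measurable borel" "\<phi> \<in> borel_measurable M" if "\<phi> \<in> test_functions \<Omega>" for \<phi>
    using that test_smooth smooth_measurable measurable_M_borel by blast+
  note [measurable] = test_m[OF h]
  have z1: "(LINT x|M. gU s t x \<bullet> grad h x) = 0" for s t
  proof -
    have "(LINT x|M. gU s t x \<bullet> grad h x) = (LINT x|M. (\<Sum>j\<in>Basis. (gU s t x \<bullet> j) * pderiv_at h j x))"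
      by (subst euclidean_inner) (auto intro!: Bochner_Integration.integral_cong sum.cong)
    also have "\<dots> = (\<Sum>j\<in>Basis. LINT x|M. (gU s t x \<bullet> j) * pderiv_at h j x)"
      by (rule Bochner_Integration.integral_sum)
         (intro L2_mult_real L2_inner_const H0_L2(2)[OF HU] test_L2(1) test_pderiv h; simp)
    also have "\<dots> = (\<Sum>j\<in>(Basis::'a set). 0)"
    proof (rule sum.cong[OF refl])
      fix j :: 'a assume j: "j \<in> Basis"
      have t1: "pderiv_at h j \<in> test_functions \<Omega>" by (rule test_pderiv[OF h j])
      have t2: "pderiv_at (pderiv_at h j) j \<in> test_functions \<Omega>" by (rule test_pderiv[OF t1 j])
      note [measurable] = test_m[OF t2]
      have o1: "pderiv_at h j (- x) = 1 * pderiv_at h j x" for x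
        using pderiv_reflect[of h "-1" x j] test_smooth[OF h] odd by simp
      have o2: "pderiv_at (pderiv_at h j) j (- x) = - pderiv_at (pderiv_at h j) j x" for x
        using pderiv_reflect[of "pderiv_at h j" 1 x j] test_smooth[OF t1] o1 by simp
      \<comment> \<open>It is \<open>U\<close>, not its weak gradient, that is known to agree with a
        function of |x|^2. So the derivative is moved to h, whose second derivative is odd
        again.\<close>
      have "(LINT x|M. (gU s t x \<bullet> j) * pderiv_at h j x) = - (LINT x|M. U s t x * pderiv_at (pderiv_at h j) j x)"
        using H0_weak_gradient[OF HU[of s t]] t1 j unfolding has_weak_gradient_def by fastforce
      also have "(LINT x|M. U s t x * pderiv_at (pderiv_at h j) j x) = (LINT x|M. Us s t (x \<bullet> x) * pderiv_at (pderiv_at h j) j x)"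
        by (rule integral_cong_AE) (use Us[of s t] in auto)
      also have "\<dots> = 0" by (rule integral_odd) (auto simp: o2)
      finally show "(LINT x|M. (gU s t x \<bullet> j) * pderiv_at h j x) = 0" by simp
    qed
    finally show ?thesis by simp
  qed
  have z2: "(LINT x|M. wt x * spow p (U s t x) * h x) = 0" for s t
  proof -
    have "(LINT x|M. wt x * spow p (U s t x) * h x) = (LINT x|M. (x \<bullet> x) powr (\<alpha> / 2) * spow p (Us s t (x \<bullet> x)) * h x)"
      by (rule integral_cong_AE) (use Us[of s t] in \<open>auto simp: wt_eq\<close>)
    also have "\<dots> = 0" by (rule integral_odd) (auto simp: odd)
    finally show ?thesis .
  qed
  show "integrable M (\<lambda>x. wt x * \<bar>u x\<bar> powr (p - 1) * (h x)\<^sup>2)"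
    "p * (LINT x|M. wt x * \<bar>u x\<bar> powr (p - 1) * (h x)\<^sup>2) \<le> sqint (grad h)"
    using second_variation[OF h z1 z2] by blast+
qed

text \<open>Summing the second variation over all coordinate directions makes both sides radial,
  since the squares of the coordinates add up to |x|^2. In the gradient term N \<psi>^2 + 4 \<psi>
  \<psi>' |x|^2 is the divergence of \<psi>(|x|^2)^2 x and integrates to 0; what remains is 4
  \<psi>'^2 |x|^4.\<close>

lemma profile_stability:
  assumes \<psi>: "smooth \<psi>" and ab: "A < a" "b < B" "\<And>s. s < a \<Longrightarrow> \<psi> s = 0" "\<And>s. s > b \<Longrightarrow> \<psi> s = 0"
  shows "p * (LINT s|lborel. ind s * (s powr (\<nu> + \<alpha> / 2) * (\<bar>v s\<bar> powr (p - 1) * (\<psi> s)\<^sup>2))) \<le>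
      4 * (LINT s|lborel. ind s * (s powr (\<nu> + 1) * (deriv \<psi> s)\<^sup>2))"
proof -
  let ?c = "sphere_const TYPE('a)"
  have c: "?c > 0" by (rule sphere_const_pos)
  have adm: "admissible \<psi>" using \<psi> ab by (auto simp: admissible_def)
  have t: "(\<lambda>x. \<psi> (x \<bullet> x)) \<in> test_functions \<Omega>" by (rule admissible_test[OF adm])
  have s': "smooth (deriv \<psi>)" by (rule smooth_deriv(2)[OF \<psi>])
  note [measurable] = smooth_measurable[OF \<psi>] smooth_measurable[OF s']
  have cont: "continuous_on UNIV (\<lambda>x::'a. \<psi> (x \<bullet> x))" "continuous_on UNIV (\<lambda>x::'a. deriv \<psi> (x \<bullet> x))"
    by (intro continuous_on_compose2[OF smooth_continuous[OF \<psi>, of UNIV]] continuous_on_compose2[OF smooth_continuous[OF s', of UNIV]]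
        continuous_intros; simp)+
  have ci: "integrable M f" if "continuous_on UNIV f" for f :: "'a \<Rightarrow> real"
    using L2_mult_real(1)[OF L2_continuous[OF that] L2_continuous[of "\<lambda>x. 1"]] by simp
  define h where "h i x = (x \<bullet> i) * \<psi> (x \<bullet> x)" for i x :: 'a
  have ht: "h i \<in> test_functions \<Omega>" for i
    unfolding h_def[abs_def] by (rule test_mult[OF t]) (rule smooth_intros)
  have odd: "h i (- x) = - h i x" for i x by (simp add: h_def)
  have gh: "grad (h i) x = \<psi> (x \<bullet> x) *\<^sub>R i + ((x \<bullet> i) * (2 * deriv \<psi> (x \<bullet> x))) *\<^sub>R x" for i x
    unfolding h_def[abs_def] using smooth_intros(2) test_smooth[OF t]
    by (subst grad_mult) (auto simp: grad_coord grad_radial[OF \<psi>])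
  have ngh: "(norm (grad (h i) x))\<^sup>2 = (\<psi> (x \<bullet> x))\<^sup>2 * (i \<bullet> i) + (4 * \<psi> (x \<bullet> x) * deriv \<psi> (x \<bullet> x) +
      4 * (deriv \<psi> (x \<bullet> x))\<^sup>2 * (x \<bullet> x)) * ((x \<bullet> i) * (x \<bullet> i))" for i x
    unfolding power2_norm_eq_inner gh
    by (simp add: inner_add_left inner_add_right inner_commute power2_eq_square algebra_simps)
  have sq: "(\<Sum>i\<in>Basis. (x \<bullet> i) * (x \<bullet> i)) = x \<bullet> x" for x :: 'a by (subst euclidean_inner) simp
  let ?P = "\<lambda>x. (\<psi> (x \<bullet> x))\<^sup>2" and ?Q = "\<lambda>x. (4 * \<psi> (x \<bullet> x) * deriv \<psi> (x \<bullet> x)) * (x \<bullet> x)"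
    and ?R = "\<lambda>x. 4 * (deriv \<psi> (x \<bullet> x))\<^sup>2 * (x \<bullet> x)\<^sup>2"
  have iPQR: "integrable M ?P" "integrable M ?Q" "integrable M ?R"
    by (intro ci continuous_intros cont)+
  have "(\<Sum>i\<in>Basis. sqint (grad (h i))) = (LINT x|M. (\<Sum>i\<in>Basis. (norm (grad (h i) x))\<^sup>2))"
    unfolding sqint_def by (rule Bochner_Integration.integral_sum[symmetric]) (rule L2D(2)[OF test_L2(2)[OF ht]])
  also have "(\<lambda>x. \<Sum>i\<in>Basis. (norm (grad (h i) x))\<^sup>2) = (\<lambda>x. DIM('a) * ?P x + ?Q x + ?R x)"
  proof
    fix x
    have "(\<Sum>i\<in>Basis. (norm (grad (h i) x))\<^sup>2) = DIM('a) * ?P x + (4 * \<psi> (x \<bullet> x) * deriv \<psi> (x \<bullet> x) +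
      4 * (deriv \<psi> (x \<bullet> x))\<^sup>2 * (x \<bullet> x)) * (x \<bullet> x)"
      unfolding ngh sum.distrib sum_distrib_left[symmetric] sq by simp
    then show "(\<Sum>i\<in>Basis. (norm (grad (h i) x))\<^sup>2) = DIM('a) * ?P x + ?Q x + ?R x"
      by (simp add: power2_eq_square algebra_simps)
  qed
  also have "(LINT x|M. DIM('a) * ?P x + ?Q x + ?R x) = DIM('a) * (LINT x|M. ?P x) + (LINT x|M. ?Q x) + (LINT x|M. ?R x)"
    using iPQR by simp
  also have "DIM('a) * (LINT x|M. ?P x) + (LINT x|M. ?Q x) = 0"
  proof -
    have s2: "smooth (\<lambda>s. \<psi> s * \<psi> s)" by (intro smooth_intros \<psi>)
    have t2: "(\<lambda>x. \<psi> (x \<bullet> x) * \<psi> (x \<bullet> x)) \<in> test_functions \<Omega>"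
      by (rule test_mult[OF t test_smooth[OF t]])
    have d: "deriv (\<lambda>s. \<psi> s * \<psi> s) s = 2 * \<psi> s * deriv \<psi> s" for s
      by (rule DERIV_imp_deriv) (auto intro!: derivative_eq_intros smooth_deriv(1)[OF \<psi>])
    have "(LINT (x::'a)|M. (\<psi> (x \<bullet> x) * \<psi> (x \<bullet> x)) * (DIM('a) * 1 + 2 * (x \<bullet> x) * 0)) =
        - (LINT x|M. (grad (\<lambda>x. \<psi> (x \<bullet> x) * \<psi> (x \<bullet> x)) x \<bullet> x) * 1)"
      using H0_radial_field[OF H0_test[OF t2], of "\<lambda>s. 1" "\<lambda>s. 0"] by simp
    moreover have "grad (\<lambda>x. \<psi> (x \<bullet> x) * \<psi> (x \<bullet> x)) x \<bullet> x = ?Q x" for x :: 'a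
      using grad_radial[OF s2, of x] by (simp add: d)
    ultimately show ?thesis by (simp add: power2_eq_square mult.commute)
  qed
  finally have S1: "(\<Sum>i\<in>Basis. sqint (grad (h i))) = (LINT x|M. ?R x)" by simp
  let ?G = "\<lambda>s. s powr (\<alpha> / 2) * \<bar>v s\<bar> powr (p - 1) * (s * (\<psi> s)\<^sup>2)"
  have "(\<Sum>i\<in>Basis. p * (LINT x|M. wt x * \<bar>u x\<bar> powr (p - 1) * (h i x)\<^sup>2)) =
      p * (LINT x|M. (\<Sum>i\<in>Basis. wt x * \<bar>u x\<bar> powr (p - 1) * (h i x)\<^sup>2))"
    by (subst Bochner_Integration.integral_sum, rule odd_direction(1)[OF ht odd]) (rule sum_distrib_left[symmetric])
  also have "(LINT x|M. (\<Sum>i\<in>Basis. wt x * \<bar>u x\<bar> powr (p - 1) * (h i x)\<^sup>2)) = (LINT x|M. ?G (x \<bullet> x))"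
  proof (rule integral_cong_AE)
    have e: "(\<Sum>i\<in>Basis. wt x * \<bar>u x\<bar> powr (p - 1) * (h i x)\<^sup>2) = wt x * \<bar>u x\<bar> powr (p - 1) * ((x \<bullet> x) * (\<psi> (x \<bullet> x))\<^sup>2)" for x
    proof -
      have "(\<Sum>i\<in>Basis. (h i x)\<^sup>2) = (\<Sum>i\<in>Basis. (x \<bullet> i) * (x \<bullet> i)) * (\<psi> (x \<bullet> x))\<^sup>2"
        unfolding sum_distrib_right by (rule sum.cong) (auto simp: h_def power2_eq_square)
      then show ?thesis unfolding sum_distrib_left[symmetric] sq by simp
    qed
    show "AE x in M. (\<Sum>i\<in>Basis. wt x * \<bar>u x\<bar> powr (p - 1) * (h i x)\<^sup>2) = ?G (x \<bullet> x)"
      using u_eq unfolding e by eventually_elim (simp add: wt_eq)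
    show "(\<lambda>x. \<Sum>i\<in>Basis. wt x * \<bar>u x\<bar> powr (p - 1) * (h i x)\<^sup>2) \<in> borel_measurable M" unfolding e by measurable
  qed measurable
  finally have S2: "(\<Sum>i\<in>Basis. p * (LINT x|M. wt x * \<bar>u x\<bar> powr (p - 1) * (h i x)\<^sup>2)) = p * (LINT x|M. ?G (x \<bullet> x))" .
  have "(\<Sum>i\<in>Basis. p * (LINT x|M. wt x * \<bar>u x\<bar> powr (p - 1) * (h i x)\<^sup>2)) \<le> (\<Sum>i\<in>Basis. sqint (grad (h i)))"
    by (intro sum_mono odd_direction(2)[OF ht odd])
  then have le: "p * (LINT x|M. ?G (x \<bullet> x)) \<le> (LINT x|M. ?R x)" unfolding S1 S2 .
  let ?R' = "\<lambda>s. 4 * (deriv \<psi> s)\<^sup>2 * s\<^sup>2"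
  have m: "?G \<in> borel_measurable borel" "?R' \<in> borel_measurable borel" by measurable
  have e1: "(\<lambda>s. ind s * (s powr (\<nu> - 1) * ?G s)) = (\<lambda>s. ind s * (s powr (\<nu> + \<alpha> / 2) * (\<bar>v s\<bar> powr (p - 1) * (\<psi> s)\<^sup>2)))"
    by (rule ind_cong) (simp add: powr_add powr_diff)
  have e2: "(\<lambda>s. ind s * (s powr (\<nu> - 1) * ?R' s)) = (\<lambda>s. ind s * (4 * (s powr (\<nu> + 1) * (deriv \<psi> s)\<^sup>2)))"
    by (rule ind_cong) (simp add: powr_add powr_diff power2_eq_square)
  have "?c * (p * (LINT s|lborel. ind s * (s powr (\<nu> + \<alpha> / 2) * (\<bar>v s\<bar> powr (p - 1) * (\<psi> s)\<^sup>2)))) \<le>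
      ?c * (LINT s|lborel. ind s * (4 * (s powr (\<nu> + 1) * (deriv \<psi> s)\<^sup>2)))"
    using le radial_integral'(1)[OF m(1)] radial_integral'(1)[OF m(2)] unfolding e1 e2 by (simp add: mult_ac)
  then have "p * (LINT s|lborel. ind s * (s powr (\<nu> + \<alpha> / 2) * (\<bar>v s\<bar> powr (p - 1) * (\<psi> s)\<^sup>2))) \<le>
      (LINT s|lborel. ind s * (4 * (s powr (\<nu> + 1) * (deriv \<psi> s)\<^sup>2)))"
    using c by simp
  also have "\<dots> = 4 * (LINT s|lborel. ind s * (s powr (\<nu> + 1) * (deriv \<psi> s)\<^sup>2))"
    by (simp add: mult.left_commute)
  finally show ?thesis .
qed

end

section \<open>One-dimensional tools\<close>

lemma primitive_exists:
  fixes f :: "real \<Rightarrow> real"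
  assumes S: "open S" "is_interval S" and f: "continuous_on S f"
  obtains F where "\<And>x. x \<in> S \<Longrightarrow> (F has_real_derivative f x) (at x)"
proof (cases "S = {}")
  case True then show ?thesis using that by blast
next
  case False
  then obtain c where c: "c \<in> S" by blast
  show ?thesis
  proof (rule that[of "\<lambda>u. LBINT y=c..u. f y"])
    fix x assume x: "x \<in> S"
    obtain e where e: "e > 0" "cball x e \<subseteq> S" using S(1) x open_contains_cball by blast
    define a b where "a = min c (x - e)" and "b = max c (x + e)"
    have "x - e \<in> cball x e" "x + e \<in> cball x e" using e(1) by (auto simp: dist_real_def)
    then have "a \<in> S" "b \<in> S" using e(2) c by (auto simp: a_def b_def min_def max_def)
    then have ab: "{a..b} \<subseteq> S" using mem_is_interval_1_I[OF S(2)] by (meson atLeastAtMost_iff subsetI)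
    have "((\<lambda>u. LBINT y=c..u. f y) has_vector_derivative f x) (at x within {a..b})"
      by (rule interval_integral_FTC2[OF _ _ continuous_on_subset[OF f ab]]) (use e(1) in \<open>auto simp: a_def b_def\<close>)
    moreover have "at x within {a..b} = at x"
      using e(1) by (intro at_within_interior) (auto simp: interior_atLeastAtMost_real a_def b_def)
    ultimately show "((\<lambda>u. LBINT y=c..u. f y) has_real_derivative f x) (at x)"
      by (simp add: has_real_derivative_iff_has_vector_derivative)
  qed
qed

lemma integral_compact_support_FTC:
  fixes F f :: "real \<Rightarrow> real"
  assumes "a \<le> b" "\<And>x. (F has_real_derivative f x) (at x)" "continuous_on UNIV f" "\<And>x. x < a \<or> x > b \<Longrightarrow> f x = 0"
  shows "(LINT x|lborel. f x) = F b - F a"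
proof -
  have "(LINT x|lborel. f x) = (LINT x|lborel. f x * indicator {a..b} x)"
  proof (rule Bochner_Integration.integral_cong)
    show "f x = f x * indicator {a..b} x" for x
      using assms(4)[of x] by (cases "x \<in> {a..b}") auto
  qed simp
  also have "\<dots> = F b - F a"
    using assms by (intro integral_FTC_Icc_real) (auto simp: continuous_on_eq_continuous_at)
  finally show ?thesis .
qed

lemma constant_where_derivative_zero:
  fixes F f :: "real \<Rightarrow> real"
  assumes "\<And>x. (F has_real_derivative f x) (at x)" "\<And>x. x < a \<Longrightarrow> f x = 0" "\<And>x. x > b \<Longrightarrow> f x = 0"
  shows "x \<le> a \<Longrightarrow> F x = F a" "x \<ge> b \<Longrightarrow> F x = F b"
proof -
  show "F x = F a" if xa: "x \<le> a"
  proof (cases "x = a")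
    case False
    then obtain z where "x < z" "z < a" "F a - F x = (a - x) * f z" using MVT2[of x a F f] assms(1) xa by auto
    then show ?thesis using assms(2)[of z] by simp
  qed simp
  show "F x = F b" if xb: "x \<ge> b"
  proof (cases "x = b")
    case False
    then obtain z where "b < z" "z < x" "F x - F b = (x - b) * f z" using MVT2[of b x F f] assms(1) xb by auto
    then show ?thesis using assms(3)[of z] by simp
  qed simp
qed

lemma smooth_integrable:
  fixes f :: "real \<Rightarrow> real"
  assumes "smooth f" "\<And>x. x < a \<or> x > b \<Longrightarrow> f x = 0"
  shows "integrable lborel f"
  by (rule integrable_compact_support[of f "{a..b}"]) (use assms in \<open>auto intro: smooth_continuous simp: not_le\<close>)

lemma smooth_bump:
  fixes a b :: real
  assumes "a < b"
  obtains f where "smooth f" "\<And>s. f s \<ge> 0" "\<And>s. s \<le> a \<or> s \<ge> b \<Longrightarrow> f s = 0" "(LINT s|lborel. f s) = 1"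
proof -
  define h where "h s = bump0 0 (s - a) * bump0 0 (b - s)" for s
  have "smooth (\<lambda>s::real. s - a)" "smooth (\<lambda>s::real. b - s)" by (intro smooth_intros)+
  then have sh: "smooth h"
    unfolding h_def[abs_def] by (intro smooth_intros(6) smooth_compose[OF smooth_bump0])
  have h0: "h s \<ge> 0" for s by (auto simp: h_def bump0_def)
  have hz: "h s = 0" if "s \<le> a \<or> s \<ge> b" for s using that by (auto simp: h_def bump0_def)
  have hpos: "h s > 0" if "a < s" "s < b" for s using that by (auto simp: h_def bump0_def)
  have hi: "integrable lborel h" by (rule smooth_integrable[OF sh, of a b]) (use hz in auto)
  have "(LINT s|lborel. h s) > 0"
  proof -
    have "(LINT s|lborel. h s) \<noteq> 0"
    proof
      assume "(LINT s|lborel. h s) = 0"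
      then have "AE s in lborel. h s = 0" using integral_nonneg_eq_0_iff_AE[OF hi] h0 by auto
      then have "AE s in lborel. s \<notin> {a<..<b}" by eventually_elim (use hpos in force)
      then have "emeasure lborel {a<..<b} = 0"
        by (subst (asm) AE_iff_measurable[of "{a<..<b}"]) auto
      then show False using assms by simp
    qed
    moreover have "(LINT s|lborel. h s) \<ge> 0" using h0 by simp
    ultimately show ?thesis by linarith
  qed
  then show ?thesis
    using h0 hz by (intro that[of "\<lambda>s. (1 / (LINT s|lborel. h s)) * h s"] smooth_intros sh) auto
qed

text \<open>The singularity of the power at 0 is invisible because \<open>\<zeta>\<close> vanishes
  below a > 0. A derivative of such a product is a combination of products of the same kind, so the
  induction runs over all r and \<open>\<zeta>\<close>.\<close>

lemma smooth_powr_mult: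
  fixes \<zeta> :: "real \<Rightarrow> real"
  assumes "smooth \<zeta>" "a > 0" "\<And>s. s < a \<Longrightarrow> \<zeta> s = 0"
  shows "smooth (\<lambda>s. s powr r * \<zeta> s)"
    and "((\<lambda>s. s powr r * \<zeta> s) has_real_derivative s powr r * deriv \<zeta> s + r * s powr (r - 1) * \<zeta> s) (at s)"
proof -
  have d0: "deriv \<zeta> s = 0" if "s < a" "smooth \<zeta>" "\<And>s. s < a \<Longrightarrow> \<zeta> s = 0" for s and \<zeta> :: "real \<Rightarrow> real"
  proof -
    have "((\<lambda>x. 0) has_real_derivative deriv \<zeta> s) (at s)"
      by (rule has_field_derivative_transform_within[OF smooth_deriv(1)[OF that(2)], of "a - s"])
         (use that in \<open>auto simp: dist_real_def\<close>)
    then show ?thesis using DERIV_unique[OF _ DERIV_const] by blast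
  qed
  have d: "((\<lambda>s. s powr r * \<zeta> s) has_real_derivative s powr r * deriv \<zeta> s + r * s powr (r - 1) * \<zeta> s) (at s)"
    if \<zeta>: "smooth \<zeta>" "\<And>s. s < a \<Longrightarrow> \<zeta> s = 0" for s r and \<zeta> :: "real \<Rightarrow> real"
  proof (cases "s < a")
    case True
    have "((\<lambda>s. 0) has_real_derivative 0) (at s)" by simp
    then have "((\<lambda>s. s powr r * \<zeta> s) has_real_derivative 0) (at s)"
      by (rule has_field_derivative_transform_within[of _ _ _ _ "a - s"]) (use True \<zeta>(2) in \<open>auto simp: dist_real_def\<close>)
    then show ?thesis using d0[OF True \<zeta>] \<zeta>(2)[OF True] by simp
  next
    case False
    then have "s > 0" using assms(2) by simp
    have 1: "((\<lambda>s. s powr r) has_real_derivative r * s powr (r - 1)) (at s)"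
      by (rule has_real_derivative_powr[OF \<open>s > 0\<close>])
    from DERIV_mult[OF this smooth_deriv(1)[OF \<zeta>(1), of s]] show ?thesis by (simp add: mult_ac add.commute)
  qed
  show "((\<lambda>s. s powr r * \<zeta> s) has_real_derivative s powr r * deriv \<zeta> s + r * s powr (r - 1) * \<zeta> s) (at s)"
    by (rule d[OF assms(1,3)])
  have "Ck k (\<lambda>s. s powr r * \<zeta> s)" if "smooth \<zeta>" "\<And>s. s < a \<Longrightarrow> \<zeta> s = 0" for k r and \<zeta> :: "real \<Rightarrow> real"
    using that
  proof (induction k arbitrary: r \<zeta>)
    case 0
    show ?case using DERIV_isCont[OF d[OF 0]] by (simp add: continuous_on_eq_continuous_at)
  next
    case (Suc k)
    have "Ck k (\<lambda>s. s powr r * deriv \<zeta> s + r * s powr (r - 1) * \<zeta> s)"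
      unfolding mult.assoc
      by (intro Ck_add Ck_cmult Suc.IH Suc.prems smooth_deriv(2)) (use d0 Suc.prems in auto)
    then show ?case by (intro Ck_realI[OF d[OF Suc.prems]])
  qed
  then show "smooth (\<lambda>s. s powr r * \<zeta> s)" using assms unfolding smooth_def by blast
qed

lemma continuous_indefinite_integral:
  fixes k :: "real \<Rightarrow> real"
  assumes "integrable lborel k"
  shows "continuous_on UNIV (\<lambda>s. LINT t|lborel. indicator {..s} t * k t)"
  unfolding continuous_on_sequentially
proof (intro allI ballI impI, elim conjE, unfold o_def)
  fix x :: "nat \<Rightarrow> real" and a assume x: "x \<longlonglongrightarrow> a"
  have m: "k \<in> borel_measurable borel" using assms by simp
  show "(\<lambda>n. LINT t|lborel. indicator {..x n} t * k t) \<longlonglongrightarrow> (LINT t|lborel. indicator {..a} t * k t)"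
  proof (rule integral_dominated_convergence[where w="\<lambda>t. \<bar>k t\<bar>"])
    have "AE t in lborel. t \<noteq> a" by (rule AE_lborel_singleton)
    then show "AE t in lborel. (\<lambda>n. indicator {..x n} t * k t) \<longlonglongrightarrow> indicator {..a} t * k t"
    proof eventually_elim
      case (elim t)
      have "eventually (\<lambda>n. indicator {..x n} t = (indicator {..a} t :: real)) sequentially"
      proof (cases "t < a")
        case True
        then show ?thesis using order_tendstoD(1)[OF x True] by (auto elim!: eventually_mono simp: indicator_def)
      next
        case False
        then have "a < t" using elim by simp
        then show ?thesis using order_tendstoD(2)[OF x \<open>a < t\<close>] by (auto elim!: eventually_mono simp: indicator_def)
      qed
      then show ?case by (intro tendsto_mult tendsto_const tendsto_eventually)
    qed
  qed (use assms m in \<open>auto simp: indicator_def\<close>)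
qed

text \<open>The class of derivatives to which the stability inequality extends by dominated
  convergence. It admits jumps, that is, directions with corners.\<close>

definition test_limit :: "real \<Rightarrow> real \<Rightarrow> (real \<Rightarrow> real) \<Rightarrow> bool" where
  "test_limit a b \<theta> \<longleftrightarrow> (\<exists>\<theta>n C. (\<forall>n. smooth (\<theta>n n)) \<and> (\<forall>n::nat. \<forall>s. s < a \<or> s > b \<longrightarrow> \<theta>n n s = 0) \<and>
    (\<forall>n s. \<bar>\<theta>n n s\<bar> \<le> C) \<and> (\<forall>s. (\<lambda>n. \<theta>n n s) \<longlonglongrightarrow> \<theta> s))"

lemma test_limit_add:
  assumes "test_limit a b f" "test_limit a b g"
  shows "test_limit a b (\<lambda>s. f s + g s)"
proof -
  obtain fn C where f: "\<And>n. smooth (fn n)" "\<And>n s. s < a \<or> s > b \<Longrightarrow> fn n s = 0" "\<And>n s. \<bar>fn n s\<bar> \<le> C"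
      "\<And>s. (\<lambda>n. fn n s) \<longlonglongrightarrow> f s" for n :: nat
    using assms(1) unfolding test_limit_def by metis
  obtain gn D where g: "\<And>n. smooth (gn n)" "\<And>n s. s < a \<or> s > b \<Longrightarrow> gn n s = 0" "\<And>n s. \<bar>gn n s\<bar> \<le> D"
      "\<And>s. (\<lambda>n. gn n s) \<longlonglongrightarrow> g s" for n :: nat
    using assms(2) unfolding test_limit_def by metis
  show ?thesis
    unfolding test_limit_def
  proof (rule exI[of _ "\<lambda>n s. fn n s + gn n s"], rule exI[of _ "C + D"], intro conjI allI impI)
    fix n s
    show "smooth (\<lambda>s. fn n s + gn n s)" by (intro smooth_intros f g)
    show "\<bar>fn n s + gn n s\<bar> \<le> C + D" using f(3)[of n s] g(3)[of n s] by linarith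
    show "(\<lambda>n. fn n s + gn n s) \<longlonglongrightarrow> f s + g s" by (intro tendsto_add f g)
    show "fn n s + gn n s = 0" if "s < a \<or> b < s" using f(2)[OF that] g(2)[OF that] by simp
  qed
qed

text \<open>Polynomials approximate c uniformly on the closed interval by the Weierstrass theorem,
  and smooth cutoffs tend to the indicator of the open one; the products are bounded by |C| +
  1.\<close>

lemma test_limit_piece:
  fixes c :: "real \<Rightarrow> real"
  assumes "a \<le> x" "x < y" "y \<le> b" "continuous_on {x..y} c"
  shows "test_limit a b (\<lambda>s. indicator {x<..<y} s * c s)"
proof -
  have "\<exists>q. real_polynomial_function q \<and> (\<forall>s\<in>{x..y}. \<bar>c s - q s\<bar> < 1 / real (Suc n))" for n
  proof -
    have e: "0 < 1 / real (Suc n)" by simp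
    obtain q where "real_polynomial_function q" "\<And>s. s \<in> {x..y} \<Longrightarrow> \<bar>c s - q s\<bar> < 1 / real (Suc n)"
      using Stone_Weierstrass_real_polynomial_function[OF compact_Icc assms(4) e] by metis
    then show ?thesis by blast
  qed
  then obtain q where q: "\<And>n. real_polynomial_function (q n)" "\<And>n s. s \<in> {x..y} \<Longrightarrow> \<bar>c s - q n s\<bar> < 1 / real (Suc n)" for n
    by metis
  define ch where "ch n s = bump0 0 (real (Suc n) * (s - x)) * bump0 0 (real (Suc n) * (y - s))" for n s
  have lin: "smooth (\<lambda>s. real (Suc n) * (s - x))" "smooth (\<lambda>s. real (Suc n) * (y - s))" for n by (intro smooth_intros)+
  then have sch: "smooth (ch n)" for n
    unfolding ch_def[abs_def]
    using smooth_intros(6)[OF smooth_compose[OF smooth_bump0[of 0] lin(1)[of n]] smooth_compose[OF smooth_bump0[of 0] lin(2)[of n]]]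
    by simp
  have z: "ch n s = 0" if "s \<notin> {x<..<y}" for n s
    using that by (auto simp: ch_def bump0_def zero_less_mult_iff)
  have b1: "0 \<le> bump0 0 r \<and> bump0 0 r \<le> 1" for r by (auto simp: bump0_def)
  have ch1: "0 \<le> ch n s" "ch n s \<le> 1" for n s using b1 unfolding ch_def by (auto intro: mult_le_one)
  have l: "(\<lambda>n. bump0 0 (real (Suc n) * r)) \<longlonglongrightarrow> 1" if "r > 0" for r
  proof -
    have "(\<lambda>n. exp (- (1 / (real (Suc n) * r)))) \<longlonglongrightarrow> 1" using that by real_asymp
    then show ?thesis using that by (simp add: bump0_def)
  qed
  obtain C where C: "\<And>s. s \<in> {x..y} \<Longrightarrow> \<bar>c s\<bar> \<le> C"
  proof -
    have "bounded (c ` {x..y})" by (intro compact_imp_bounded compact_continuous_image assms) simp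
    then obtain D where "\<forall>r\<in>c ` {x..y}. norm r \<le> D" unfolding bounded_iff by blast
    then show ?thesis by (intro that[of D]) auto
  qed
  have n1: "1 / real (Suc n) \<le> 1" for n by simp
  show ?thesis
    unfolding test_limit_def
  proof (rule exI[of _ "\<lambda>n s. ch n s * q n s"], rule exI[of _ "\<bar>C\<bar> + 1"], intro conjI allI impI)
    fix n s
    show "smooth (\<lambda>s. ch n s * q n s)" by (intro smooth_intros sch smooth_polynomial q)
    show "ch n s * q n s = 0" if "s < a \<or> b < s" using that assms z[of s n] by auto
    show "\<bar>ch n s * q n s\<bar> \<le> \<bar>C\<bar> + 1"
    proof (cases "s \<in> {x..y}")
      case True
      have "\<bar>q n s\<bar> \<le> \<bar>C\<bar> + 1" using q(2)[OF True, of n] C[OF True] n1[of n] by linarith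
      then have "ch n s * \<bar>q n s\<bar> \<le> 1 * (\<bar>C\<bar> + 1)" using ch1 by (intro mult_mono) auto
      then show ?thesis using ch1(1)[of n s] by (simp add: abs_mult)
    next
      case False
      then show ?thesis using z[of s n] by auto
    qed
    show "(\<lambda>n. ch n s * q n s) \<longlonglongrightarrow> indicator {x<..<y} s * c s"
    proof (cases "s \<in> {x<..<y}")
      case True
      have "(\<lambda>n. ch n s) \<longlonglongrightarrow> 1 * 1" unfolding ch_def using True by (intro tendsto_mult l) auto
      moreover have "(\<lambda>n. q n s) \<longlonglongrightarrow> c s"
      proof -
        have l0: "(\<lambda>n. 1 / real (Suc n)) \<longlonglongrightarrow> 0" using LIMSEQ_Suc[OF lim_1_over_n] by simp
        have "s \<in> {x..y}" using True by simp
        from q(2)[OF this] have nb: "norm (q n s - c s) \<le> 1 / real (Suc n)" for n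
          unfolding real_norm_def abs_minus_commute[of "q n s"] by (rule less_imp_le)
        have "(\<lambda>n. q n s - c s) \<longlonglongrightarrow> 0"
          by (rule Lim_null_comparison[OF always_eventually[OF allI[OF nb]] l0])
        then show ?thesis by (rule LIM_zero_cancel)
      qed
      ultimately have "(\<lambda>n. ch n s * q n s) \<longlonglongrightarrow> (1 * 1) * c s" by (rule tendsto_mult)
      then show ?thesis using True by simp
    qed (simp add: z)
  qed
qed

section \<open>The radial profile\<close>

lemma emeasure_lborel_Ioo_finite [simp]: "emeasure lborel {a<..<b::real} < top"
  by (cases "a \<le> b") (auto simp: less_top[symmetric])

lemma deriv_zero_outside:
  assumes "smooth (\<zeta> :: real \<Rightarrow> real)" "\<And>s. s \<le> a \<or> s \<ge> b \<Longrightarrow> \<zeta> s = 0" "s < a \<or> s > b"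
  shows "deriv \<zeta> s = 0"
proof -
  define e where "e = (if s < a then a - s else s - b)"
  have e: "e > 0" using assms(3) by (auto simp: e_def)
  have "((\<lambda>x. 0) has_real_derivative deriv \<zeta> s) (at s)"
    by (rule has_field_derivative_transform_within[OF smooth_deriv(1)[OF assms(1)] e])
       (use assms(3) in \<open>auto simp: dist_real_def e_def split: if_splits intro!: assms(2)\<close>)
  then show ?thesis using DERIV_unique[OF _ DERIV_const] by blast
qed

text \<open>Here \<open>u x = v (|x|\<^sup>2)\<close> and \<open>\<nu> = N / 2\<close>: in the variable \<open>s = |x|\<^sup>2\<close> the problem reads
  \<open>- 4 (s\<^sup>\<nu> v')' = s powr (\<nu> - 1 + \<alpha> / 2) * spow p v\<close>.\<close>

locale profile =
  fixes \<nu> \<alpha> p A B :: real and v :: "real \<Rightarrow> real"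
  assumes nu: "\<nu> \<ge> 1" and al: "\<alpha> \<ge> 0" and p: "p > 1" and subcritical: "(p - 1) * (\<nu> - 1) < 2 + \<alpha>"
    and AB: "0 \<le> A" "A < B"
    and v_measurable [measurable]: "v \<in> borel_measurable borel"
    and v_integrable: "integrable lborel (\<lambda>s. indicator {A<..<B} s * (s powr (\<nu> - 1 + \<alpha> / 2) * \<bar>v s\<bar> powr (p + 1)))"
    and v_sq_integrable: "integrable lborel (\<lambda>s. indicator {A<..<B} s * (s powr (\<nu> - 1) * (v s)\<^sup>2))"
    and weak_equation: "\<And>\<eta>. smooth \<eta> \<Longrightarrow> \<exists>b<B. \<forall>s>b. \<eta> s = 0 \<Longrightarrow> A > 0 \<longrightarrow> (\<exists>a>A. \<forall>s<a. \<eta> s = 0) \<Longrightarrow>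
      (LINT s|lborel. indicator {A<..<B} s * (s powr (\<nu> - 1) * (v s * (4 * \<nu> * deriv \<eta> s + 4 * s * deriv (deriv \<eta>) s)))) =
      - (LINT s|lborel. indicator {A<..<B} s * (s powr (\<nu> - 1 + \<alpha> / 2) * (spow p (v s) * \<eta> s)))"
    and gradient_bound: "\<exists>C\<ge>0. \<forall>\<eta> \<eta>'. (\<forall>s. (\<eta> has_real_derivative \<eta>' s) (at s)) \<longrightarrow> continuous_on UNIV \<eta>' \<longrightarrow>
      (LINT s|lborel. indicator {A<..<B} s * (s powr (\<nu> - 1) * (v s * (2 * \<nu> * \<eta> s + 2 * s * \<eta>' s))))\<^sup>2 \<le>
        C * (LINT s|lborel. indicator {A<..<B} s * (s powr \<nu> * (\<eta> s)\<^sup>2))"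
    and stability: "\<And>\<psi> a b. smooth \<psi> \<Longrightarrow> A < a \<Longrightarrow> b < B \<Longrightarrow> (\<And>s. s < a \<Longrightarrow> \<psi> s = 0) \<Longrightarrow> (\<And>s. s > b \<Longrightarrow> \<psi> s = 0) \<Longrightarrow>
      p * (LINT s|lborel. indicator {A<..<B} s * (s powr (\<nu> + \<alpha> / 2) * (\<bar>v s\<bar> powr (p - 1) * (\<psi> s)\<^sup>2))) \<le>
      4 * (LINT s|lborel. indicator {A<..<B} s * (s powr (\<nu> + 1) * (deriv \<psi> s)\<^sup>2))"
    and sign_change: "\<not> (AE s in lborel. A < s \<longrightarrow> s < B \<longrightarrow> v s \<le> 0)" "\<not> (AE s in lborel. A < s \<longrightarrow> s < B \<longrightarrow> v s \<ge> 0)"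
begin

abbreviation I where "I \<equiv> {A<..<B}"

section \<open>The source term and its primitive\<close>

definition k where "k s = indicator I s * (s powr (\<nu> - 1 + \<alpha> / 2) * spow p (v s))" for s :: real
text \<open>Integration starts at the left end, because \<open>k\<close> vanishes off the interval.
  Once the profile is known to be regular, -K / 4 is the flux s^\<nu> v' up to an additive constant,
  and on a ball this constant is 0.\<close>

definition K where "K s = (LINT t|lborel. indicator {..s} t * k t)" for s :: real

lemma spow_measurable [measurable]: "spow p \<in> borel_measurable borel"
  using spow_continuous[OF p] by (intro borel_measurable_continuous_onI)

lemma k_measurable [measurable]: "k \<in> borel_measurable borel"
  unfolding k_def[abs_def] by measurable

lemma k_integrable: "integrable lborel k"
proof (rule Bochner_Integration.integrable_bound)
  let ?c = "B powr (\<nu> - 1 + \<alpha> / 2)"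
  show "integrable lborel (\<lambda>s. ?c * indicator I s + indicator I s * (s powr (\<nu> - 1 + \<alpha> / 2) * \<bar>v s\<bar> powr (p + 1)))"
    using v_integrable by (intro Bochner_Integration.integrable_add integrable_mult_right integrable_real_indicator) auto
  show "AE s in lborel. norm (k s) \<le> norm (?c * indicator I s + indicator I s * (s powr (\<nu> - 1 + \<alpha> / 2) * \<bar>v s\<bar> powr (p + 1)))"
  proof (intro AE_I2)
    fix s
    show "norm (k s) \<le> norm (?c * indicator I s + indicator I s * (s powr (\<nu> - 1 + \<alpha> / 2) * \<bar>v s\<bar> powr (p + 1)))"
    proof (cases "s \<in> I")
      case True
      then have "s powr (\<nu> - 1 + \<alpha> / 2) \<le> ?c" using AB nu al by (intro powr_mono2) auto
      moreover have "s powr (\<nu> - 1 + \<alpha> / 2) * \<bar>v s\<bar> powr p \<le> s powr (\<nu> - 1 + \<alpha> / 2) * (1 + \<bar>v s\<bar> powr (p + 1))"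
        using p by (intro mult_left_mono powr_le_1_plus) auto
      ultimately have "s powr (\<nu> - 1 + \<alpha> / 2) * \<bar>v s\<bar> powr p \<le> ?c + s powr (\<nu> - 1 + \<alpha> / 2) * \<bar>v s\<bar> powr (p + 1)"
        by (simp add: distrib_left)
      then show ?thesis using True by (simp add: k_def abs_mult)
    qed (simp add: k_def)
  qed
qed measurable

lemma K_continuous: "continuous_on S K"
  using continuous_on_subset[OF continuous_indefinite_integral[OF k_integrable]] unfolding K_def[abs_def] by blast

text \<open>\<eta> s is minus the integral of \<eta>' from s to B, because \<eta> B = 0; exchanging
  the integrations by Fubini is an integration by parts against the merely integrable
  \<open>k\<close>.\<close>

lemma weak_equation_K:
  assumes \<eta>: "smooth \<eta>" and b: "b < B" "\<And>s. s > b \<Longrightarrow> \<eta> s = 0" and a: "A > 0 \<Longrightarrow> \<exists>a>A. \<forall>s<a. \<eta> s = 0"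
  shows "(LINT s|lborel. indicator I s * (s powr (\<nu> - 1) * (v s * (4 * \<nu> * deriv \<eta> s + 4 * s * deriv (deriv \<eta>) s)))) =
    (LINT s|lborel. indicator I s * (K s * deriv \<eta> s))"
proof -
  define \<theta> where "\<theta> t = indicator {A..B} t * deriv \<eta> t" for t
  have cd: "continuous_on S (deriv \<eta>)" for S by (rule smooth_continuous[OF smooth_deriv(2)[OF \<eta>]])
  have [measurable]: "deriv \<eta> \<in> borel_measurable borel" "\<eta> \<in> borel_measurable borel"
    using cd smooth_continuous[OF \<eta>] by (auto intro: borel_measurable_continuous_onI)
  have \<theta>m [measurable]: "\<theta> \<in> borel_measurable borel" unfolding \<theta>_def[abs_def] by measurable
  have \<theta>i: "integrable lborel \<theta>"
    unfolding \<theta>_def[abs_def] using borel_integrable_compact[OF compact_Icc cd, of A B] by simp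
  define F where "F s t = k s * (indicator {..t} s * \<theta> t)" for s t
  have G: "integrable (lborel \<Otimes>\<^sub>M lborel) (\<lambda>(s, t). k s * \<theta> t)"
  proof (rule lborel_pair.Fubini_integrable)
    show "integrable lborel (\<lambda>s. LINT t|lborel. norm (case (s, t) of (s, t) \<Rightarrow> k s * \<theta> t))"
      using k_integrable by (simp add: abs_mult)
    show "AE s in lborel. integrable lborel (\<lambda>t. case (s, t) of (s, t) \<Rightarrow> k s * \<theta> t)" using \<theta>i by simp
  qed measurable
  have Fi: "integrable (lborel \<Otimes>\<^sub>M lborel) (case_prod F)"
  proof (rule Bochner_Integration.integrable_bound[OF G])
    have "(\<lambda>(s::real, t::real). (indicator {..t} s :: real)) = (\<lambda>y. if fst y \<le> snd y then 1 else 0)"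
      by (auto simp: indicator_def split: prod.splits)
    then have [measurable]: "(\<lambda>(s::real, t::real). (indicator {..t} s :: real)) \<in> borel_measurable (lborel \<Otimes>\<^sub>M lborel)"
      by simp
    have "case_prod F = (\<lambda>y. k (fst y) * ((\<lambda>(s, t). indicator {..t} s) y * \<theta> (snd y)))"
      by (auto simp: F_def)
    then show "case_prod F \<in> borel_measurable (lborel \<Otimes>\<^sub>M lborel)" by simp
  qed (auto simp: F_def abs_mult indicator_def split: prod.splits)
  have FF: "(LINT t|lborel. LINT s|lborel. F s t) = (LINT s|lborel. LINT t|lborel. F s t)"
    by (rule lborel_pair.Fubini_integral[OF Fi])
  have 1: "(LINT s|lborel. F s t) = K t * \<theta> t" for t
  proof -
    have "(\<lambda>s. F s t) = (\<lambda>s. (indicator {..t} s * k s) * \<theta> t)" by (auto simp: F_def)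
    then show ?thesis by (simp add: K_def)
  qed
  have 2: "(LINT t|lborel. F s t) = - (k s * \<eta> s)" for s
  proof (cases "s \<in> I")
    case True
    have "F s t = k s * (deriv \<eta> t * indicator {s..B} t)" for t
      using True by (auto simp: F_def \<theta>_def indicator_def)
    then have "(LINT t|lborel. F s t) = k s * (LINT t|lborel. deriv \<eta> t * indicator {s..B} t)" by simp
    also have "(LINT t|lborel. deriv \<eta> t * indicator {s..B} t) = \<eta> B - \<eta> s"
      using True cd[of UNIV] by (intro integral_FTC_Icc_real smooth_deriv(1)[OF \<eta>]) (auto simp: continuous_on_eq_continuous_at)
    finally show ?thesis using b by simp
  qed (simp add: F_def k_def)
  have "(LINT s|lborel. indicator I s * (s powr (\<nu> - 1) * (v s * (4 * \<nu> * deriv \<eta> s + 4 * s * deriv (deriv \<eta>) s)))) =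
      - (LINT s|lborel. k s * \<eta> s)"
    using weak_equation[OF \<eta>] a b by (auto simp: k_def mult.assoc)
  also have "\<dots> = (LINT t|lborel. K t * \<theta> t)" using FF unfolding 1 2 by simp
  also have "\<dots> = (LINT t|lborel. indicator I t * (K t * deriv \<eta> t))"
  proof (rule integral_cong_AE)
    have "AE t in lborel. t \<noteq> A" "AE t in lborel. t \<noteq> B" by (rule AE_lborel_singleton)+
    then show "AE t in lborel. K t * \<theta> t = indicator I t * (K t * deriv \<eta> t)"
      by eventually_elim (auto simp: \<theta>_def indicator_def)
    have [measurable]: "K \<in> borel_measurable borel" by (intro borel_measurable_continuous_onI K_continuous)
    show "(\<lambda>t. K t * \<theta> t) \<in> borel_measurable lborel" "(\<lambda>t. indicator I t * (K t * deriv \<eta> t)) \<in> borel_measurable lborel"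
      by measurable
  qed
  finally show ?thesis .
qed

section \<open>Regularity of the profile\<close>

lemma I_open [simp]: "open I" "is_interval I" by (auto simp: is_interval_1)

lemma v_local_integrable:
  assumes "A < a" "b < B"
  shows "integrable lborel (\<lambda>s. indicator {a<..<b} s * v s)"
proof (rule Bochner_Integration.integrable_bound)
  let ?c = "a powr (1 - \<nu>)"
  show "integrable lborel (\<lambda>s. indicator {a<..<b} s + ?c * (indicator I s * (s powr (\<nu> - 1) * (v s)\<^sup>2)))"
    using v_sq_integrable by (intro Bochner_Integration.integrable_add integrable_mult_right integrable_real_indicator) auto
  show "AE s in lborel. norm (indicator {a<..<b} s * v s) \<le> norm (indicator {a<..<b} s + ?c * (indicator I s * (s powr (\<nu> - 1) * (v s)\<^sup>2)))"
  proof (intro AE_I2)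
    fix s
    show "norm (indicator {a<..<b} s * v s) \<le> norm (indicator {a<..<b} s + ?c * (indicator I s * (s powr (\<nu> - 1) * (v s)\<^sup>2)))"
    proof (cases "s \<in> {a<..<b}")
      case True
      then have s: "s \<in> I" "a \<le> s" "0 < a" using assms AB by auto
      have "1 = a powr (1 - \<nu>) * a powr (\<nu> - 1)" using s(3) by (simp add: powr_add[symmetric])
      also have "\<dots> \<le> a powr (1 - \<nu>) * s powr (\<nu> - 1)" using s nu by (intro mult_left_mono powr_mono2) auto
      finally have "1 * (v s)\<^sup>2 \<le> (?c * s powr (\<nu> - 1)) * (v s)\<^sup>2" by (intro mult_right_mono) auto
      moreover have "\<bar>v s\<bar> \<le> 1 + (v s)\<^sup>2"
      proof -
        have "0 \<le> (\<bar>v s\<bar> - 1)\<^sup>2" by simp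
        then have "2 * \<bar>v s\<bar> \<le> (v s)\<^sup>2 + 1" by (simp add: power2_diff)
        then show ?thesis using abs_ge_zero[of "v s"] by linarith
      qed
      ultimately show ?thesis using True s(1) by (simp add: mult.assoc)
    qed simp
  qed
qed measurable

text \<open>The weak equation, tested with \<open>\<eta>' = s powr (- \<nu>) * \<zeta>\<close>.\<close>

lemma weak_equation_flux:
  assumes \<zeta>: "smooth \<zeta>" and ab: "A < a" "a < b" "b < B" and z: "\<And>s. s \<le> a \<Longrightarrow> \<zeta> s = 0" "\<And>s. s \<ge> b \<Longrightarrow> \<zeta> s = 0"
    and mean: "A > 0 \<Longrightarrow> (LINT s|lborel. s powr (- \<nu>) * \<zeta> s) = 0"
  shows "4 * (LINT s|lborel. indicator {a<..<b} s * (v s * deriv \<zeta> s)) = (LINT s|lborel. K s * (s powr (- \<nu>) * \<zeta> s))"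
proof -
  have a0: "a > 0" using ab AB by simp
  define \<theta> where "\<theta> s = s powr (- \<nu>) * \<zeta> s" for s
  have zl: "\<And>s. s < a \<Longrightarrow> \<zeta> s = 0" using z(1) by simp
  have \<theta>: "smooth \<theta>" "\<And>s. (\<theta> has_real_derivative s powr (- \<nu>) * deriv \<zeta> s + (- \<nu>) * s powr (- \<nu> - 1) * \<zeta> s) (at s)"
    using smooth_powr_mult[OF \<zeta> a0 zl, of "- \<nu>"] unfolding \<theta>_def[abs_def] by auto
  have \<theta>z: "\<theta> s = 0" if "s \<le> a \<or> s \<ge> b" for s using that z by (auto simp: \<theta>_def)
  obtain \<eta>0 where \<eta>0: "\<And>s. (\<eta>0 has_real_derivative \<theta> s) (at s)"
    using primitive_exists[of UNIV \<theta>] smooth_continuous[OF \<theta>(1)] by auto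
  define \<eta> where "\<eta> s = \<eta>0 s - \<eta>0 b" for s
  have \<eta>d: "(\<eta> has_real_derivative \<theta> s) (at s)" for s
    unfolding \<eta>_def[abs_def] by (auto intro!: derivative_eq_intros \<eta>0)
  have d\<eta>: "deriv \<eta> = \<theta>" using \<eta>d by (auto intro: DERIV_imp_deriv)
  have s\<eta>: "smooth \<eta>" by (rule smooth_realI[OF \<eta>d \<theta>(1)])
  have cz: "\<eta> s = \<eta> a" if "s \<le> a" for s by (rule constant_where_derivative_zero(1)[OF \<eta>d, of a b]) (use \<theta>z that in auto)
  have cb: "\<eta> s = 0" if "s > b" for s
    using constant_where_derivative_zero(2)[OF \<eta>d, of a b s] \<theta>z that by (auto simp: \<eta>_def)
  have e: "(LINT s|lborel. indicator I s * (s powr (\<nu> - 1) * (v s * (4 * \<nu> * deriv \<eta> s + 4 * s * deriv (deriv \<eta>) s)))) =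
    (LINT s|lborel. indicator I s * (K s * deriv \<eta> s))"
  proof (rule weak_equation_K[OF s\<eta> ab(3) cb])
    \<comment> \<open>On an annulus \<eta> must vanish near A as well; its total increase is the
      weighted mean of \<zeta>, which is assumed to be 0.\<close>
    assume "A > 0"
    then have "(LINT s|lborel. \<theta> s) = 0" using mean by (simp add: \<theta>_def)
    moreover have "(LINT s|lborel. \<theta> s) = \<eta> b - \<eta> a"
      by (rule integral_compact_support_FTC[OF _ \<eta>d smooth_continuous[OF \<theta>(1)]]) (use ab \<theta>z in auto)
    ultimately have \<eta>a: "\<eta> a = 0" by (simp add: \<eta>_def)
    show "\<exists>a>A. \<forall>s<a. \<eta> s = 0"
    proof (intro exI[of _ a] conjI allI impI ab(1))
      fix s assume "s < a"
      then show "\<eta> s = 0" using cz[of s] \<eta>a by simp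
    qed
  qed
  have "indicator I s * (s powr (\<nu> - 1) * (v s * (4 * \<nu> * deriv \<eta> s + 4 * s * deriv (deriv \<eta>) s))) =
      4 * (indicator {a<..<b} s * (v s * deriv \<zeta> s))" if "s \<noteq> a" "s \<noteq> b" for s
  proof (cases "s \<in> {a<..<b}")
    case True
    then have s: "s > 0" "s \<in> I" using a0 ab by auto
    have dd: "deriv \<theta> s = s powr (- \<nu>) * deriv \<zeta> s + (- \<nu>) * s powr (- \<nu> - 1) * \<zeta> s"
      by (rule DERIV_imp_deriv[OF \<theta>(2)])
    have p1: "s powr (\<nu> - 1) * s powr (- \<nu>) = 1 / s" "s powr (\<nu> - 1) * s powr (- \<nu> - 1) = 1 / s\<^sup>2"
    proof -
      have "s powr (\<nu> - 1) * s powr (- \<nu>) = s powr (- 1)" "s powr (\<nu> - 1) * s powr (- \<nu> - 1) = s powr (- 2)"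
        unfolding powr_add[symmetric] by simp_all
      then show "s powr (\<nu> - 1) * s powr (- \<nu>) = 1 / s" "s powr (\<nu> - 1) * s powr (- \<nu> - 1) = 1 / s\<^sup>2"
        using s(1) by (simp_all only: powr_minus_divide) (simp_all add: powr_numeral)
    qed
    have "s powr (\<nu> - 1) * (4 * \<nu> * \<theta> s + 4 * s * deriv \<theta> s) =
        4 * \<nu> * (s powr (\<nu> - 1) * s powr (- \<nu>)) * \<zeta> s + 4 * s * (s powr (\<nu> - 1) * s powr (- \<nu>)) * deriv \<zeta> s
        - 4 * s * \<nu> * (s powr (\<nu> - 1) * s powr (- \<nu> - 1)) * \<zeta> s"
      unfolding dd \<theta>_def by (simp add: algebra_simps)
    also have "\<dots> = 4 * deriv \<zeta> s" unfolding p1 using s(1) by (simp add: power2_eq_square)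
    finally have "v s * (s powr (\<nu> - 1) * (4 * \<nu> * \<theta> s + 4 * s * deriv \<theta> s)) = 4 * (v s * deriv \<zeta> s)" by simp
    then have "s powr (\<nu> - 1) * (v s * (4 * \<nu> * \<theta> s + 4 * s * deriv \<theta> s)) = 4 * (v s * deriv \<zeta> s)"
      by (simp only: mult.left_commute[of "s powr (\<nu> - 1)" "v s"])
    then show ?thesis using s True unfolding d\<eta> by simp
  next
    case False
    then have "s < a \<or> s > b" using \<open>s \<noteq> a\<close> \<open>s \<noteq> b\<close> by force
    then have "deriv \<eta> s = 0 \<and> deriv (deriv \<eta>) s = 0"
      using deriv_zero_outside[OF \<theta>(1) \<theta>z] \<theta>z[of s] unfolding d\<eta> by auto
    then show ?thesis using False by simp
  qed
  note e1 = this
  have [measurable]: "deriv \<zeta> \<in> borel_measurable borel" "deriv \<eta> \<in> borel_measurable borel" "deriv (deriv \<eta>) \<in> borel_measurable borel"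
    using smooth_deriv(2)[OF \<zeta>] smooth_deriv(2)[OF s\<eta>] smooth_deriv(2)[OF smooth_deriv(2)[OF s\<eta>]]
    by (auto intro!: borel_measurable_continuous_onI smooth_continuous)
  have "(LINT s|lborel. 4 * (indicator {a<..<b} s * (v s * deriv \<zeta> s))) = (LINT s|lborel. indicator I s * (s powr (\<nu> - 1) * (v s * (4 * \<nu> * deriv \<eta> s + 4 * s * deriv (deriv \<eta>) s))))"
  proof (rule integral_cong_AE)
    have "AE t in lborel. t \<noteq> a" "AE t in lborel. t \<noteq> b" by (rule AE_lborel_singleton)+
    then show "AE s in lborel. 4 * (indicator {a<..<b} s * (v s * deriv \<zeta> s)) = indicator I s * (s powr (\<nu> - 1) * (v s * (4 * \<nu> * deriv \<eta> s + 4 * s * deriv (deriv \<eta>) s)))"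
      by eventually_elim (rule e1[symmetric])
  qed measurable
  also have "\<dots> = (LINT s|lborel. K s * (s powr (- \<nu>) * \<zeta> s))"
    unfolding e unfolding d\<eta>
  proof (rule Bochner_Integration.integral_cong)
    show "indicator I s * (K s * \<theta> s) = K s * (s powr (- \<nu>) * \<zeta> s)" for s
      using \<theta>z[of s] ab by (cases "s \<in> I") (auto simp: \<theta>_def)
  qed simp
  finally show ?thesis by simp
qed

lemma continuous_on_I_measurable:
  fixes f :: "real \<Rightarrow> real"
  assumes "continuous_on I f" "A < a" "b < B"
  shows "(\<lambda>s. indicator {a<..<b} s * f s) \<in> borel_measurable borel"
proof -
  have "continuous_on {a<..<b} f" by (rule continuous_on_subset[OF assms(1)]) (use assms in auto)
  then have "(\<lambda>s. indicator {a<..<b} s *\<^sub>R f s) \<in> borel_measurable borel"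
    by (intro borel_measurable_continuous_on_indicator) auto
  then show ?thesis by simp
qed

lemma integrable_on_compact_subinterval:
  fixes f :: "real \<Rightarrow> real"
  assumes "continuous_on {a..b} f"
  shows "integrable lborel (\<lambda>s. indicator {a..b} s * f s)" "integrable lborel (\<lambda>s. indicator {a<..<b} s * f s)"
proof -
  show i: "integrable lborel (\<lambda>s. indicator {a..b} s * f s)"
    using borel_integrable_compact[OF compact_Icc assms] by simp
  have "integrable lborel (\<lambda>s. indicator {a<..<b} s *\<^sub>R (indicator {a..b} s * f s))"
    by (rule integrable_mult_indicator[OF _ i]) simp
  moreover have "(\<lambda>s. indicator {a<..<b} s *\<^sub>R (indicator {a..b} s * f s)) = (\<lambda>s. indicator {a<..<b} s * f s)"
    by (auto simp: indicator_def fun_eq_iff)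
  ultimately show "integrable lborel (\<lambda>s. indicator {a<..<b} s * f s)" by simp
qed

lemma integral_Ioo_Icc:
  fixes f :: "real \<Rightarrow> real"
  assumes "continuous_on {a..b} f"
  shows "(LINT s|lborel. indicator {a<..<b} s * f s) = (LINT s|lborel. f s * indicator {a..b} s)"
proof (rule integral_cong_AE)
  have "AE t in lborel. t \<noteq> a" "AE t in lborel. t \<noteq> b" by (rule AE_lborel_singleton)+
  then show "AE s in lborel. indicator {a<..<b} s * f s = f s * indicator {a..b} s"
    by eventually_elim (auto simp: indicator_def)
qed (use integrable_on_compact_subinterval[OF assms] in \<open>auto simp: mult.commute\<close>)

lemma integral_Ioo_FTC:
  fixes f :: "real \<Rightarrow> real"
  assumes "a \<le> b" "\<And>s. a \<le> s \<Longrightarrow> s \<le> b \<Longrightarrow> (F has_real_derivative f s) (at s)" "continuous_on {c..d} f" "c < a" "b < d"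
  shows "(LINT s|lborel. indicator {a<..<b} s * f s) = F b - F a"
proof -
  have "continuous_on {a..b} f" by (rule continuous_on_subset[OF assms(3)]) (use assms in auto)
  then have "(LINT s|lborel. indicator {a<..<b} s * f s) = (LINT s|lborel. f s * indicator {a..b} s)"
    by (rule integral_Ioo_Icc)
  also have "\<dots> = F b - F a"
  proof (rule integral_FTC_Icc_real[OF assms(1,2)])
    fix x assume "a \<le> x" "x \<le> b"
    moreover have "continuous_on {c<..<d} f" by (rule continuous_on_subset[OF assms(3)]) auto
    ultimately show "isCont f x" using assms(4,5) by (auto simp: continuous_on_eq_continuous_at)
  qed
  finally show ?thesis .
qed

lemma primitive_by_parts:
  fixes F f :: "real \<Rightarrow> real"
  assumes F: "\<And>s. s \<in> I \<Longrightarrow> (F has_real_derivative f s) (at s)" "continuous_on I f"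
    and \<zeta>: "smooth \<zeta>" and ab: "A < a" "a < b" "b < B" and z: "\<And>s. s \<le> a \<Longrightarrow> \<zeta> s = 0" "\<And>s. s \<ge> b \<Longrightarrow> \<zeta> s = 0"
  shows "(LINT s|lborel. indicator {a<..<b} s * (F s * deriv \<zeta> s)) = - (LINT s|lborel. f s * \<zeta> s)"
    and "integrable lborel (\<lambda>s. indicator {a<..<b} s * (F s * deriv \<zeta> s))"
proof -
  have cF: "continuous_on I F" using F(1) DERIV_isCont by (intro continuous_at_imp_continuous_on ballI) blast
  define c d where "c = (A + a) / 2" and "d = (b + B) / 2"
  have cd: "c < a" "b < d" "{c..d} \<subseteq> I" using ab by (auto simp: c_def d_def)
  have con: "continuous_on {c..d} F" "continuous_on {c..d} f" "continuous_on {c..d} \<zeta>" "continuous_on {c..d} (deriv \<zeta>)"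
    using continuous_on_subset[OF cF cd(3)] continuous_on_subset[OF F(2) cd(3)] smooth_continuous[OF \<zeta>]
      smooth_continuous[OF smooth_deriv(2)[OF \<zeta>]] by auto
  have con': "continuous_on {a..b} f'" if "continuous_on {c..d} f'" for f' :: "real \<Rightarrow> real"
    by (rule continuous_on_subset[OF that]) (use cd in auto)
  have i1: "integrable lborel (\<lambda>s. indicator {a<..<b} s * (F s * deriv \<zeta> s))"
    and i2: "integrable lborel (\<lambda>s. indicator {a<..<b} s * (f s * \<zeta> s))"
    by (intro integrable_on_compact_subinterval con' continuous_intros con)+
  show "integrable lborel (\<lambda>s. indicator {a<..<b} s * (F s * deriv \<zeta> s))" by (rule i1)
  have "(LINT s|lborel. indicator {a<..<b} s * (F s * deriv \<zeta> s + f s * \<zeta> s)) = F b * \<zeta> b - F a * \<zeta> a"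
  proof (rule integral_Ioo_FTC[OF _ _ _ cd(1,2)])
    show "((\<lambda>s. F s * \<zeta> s) has_real_derivative F s * deriv \<zeta> s + f s * \<zeta> s) (at s)" if "a \<le> s" "s \<le> b" for s
    proof -
      have "s \<in> I" using that ab by auto
      from DERIV_mult[OF F(1)[OF this] smooth_deriv(1)[OF \<zeta>, of s]] show ?thesis by (simp add: algebra_simps)
    qed
  qed (use ab in \<open>auto intro!: continuous_intros con\<close>)
  then have "(LINT s|lborel. indicator {a<..<b} s * (F s * deriv \<zeta> s)) + (LINT s|lborel. indicator {a<..<b} s * (f s * \<zeta> s)) = 0"
    using i1 i2 z by (simp add: distrib_left)
  moreover have "(LINT s|lborel. indicator {a<..<b} s * (f s * \<zeta> s)) = (LINT s|lborel. f s * \<zeta> s)"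
  proof (rule Bochner_Integration.integral_cong)
    show "indicator {a<..<b} s * (f s * \<zeta> s) = f s * \<zeta> s" for s using z[of s] by (cases "s \<in> {a<..<b}") auto
  qed simp
  ultimately show "(LINT s|lborel. indicator {a<..<b} s * (F s * deriv \<zeta> s)) = - (LINT s|lborel. f s * \<zeta> s)" by linarith
qed

text \<open>Du Bois-Reymond: a locally integrable function with vanishing weak derivative is constant.
  On an annulus the mean value constraint adds a multiple of the fundamental solution.\<close>

lemma profile_regular:
  obtains w V c where "\<And>s. s \<in> I \<Longrightarrow> (w has_real_derivative V s) (at s)"
    "\<And>s. s \<in> I \<Longrightarrow> s powr \<nu> * V s = - K s / 4 - c" "A = 0 \<Longrightarrow> c = 0" "AE s in lborel. s \<in> I \<longrightarrow> v s = w s"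
proof -
  have Ipos: "s > 0" if "s \<in> I" for s using that AB by auto
  \<comment> \<open>The derivative that the equation predicts for v, up to the contribution of the
    fundamental solution; \<open>L\<close> is the resulting candidate.\<close>
  define l where "l s = - K s * s powr (- \<nu>) / 4" for s
  have cp: "continuous_on I (\<lambda>s. s powr (- \<nu>))" using AB by (auto intro!: continuous_intros)
  have cl: "continuous_on I l" unfolding l_def[abs_def] by (intro continuous_intros K_continuous cp) auto
  obtain L where L: "\<And>s. s \<in> I \<Longrightarrow> (L has_real_derivative l s) (at s)" using primitive_exists[OF I_open cl] by blast
  obtain G where G: "\<And>s. s \<in> I \<Longrightarrow> (G has_real_derivative s powr (- \<nu>)) (at s)" using primitive_exists[OF I_open cp] by blast
  have cL: "continuous_on I L" "continuous_on I G"
    using L G DERIV_isCont by (intro continuous_at_imp_continuous_on ballI; blast)+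
  \<comment> \<open>The middle third of the interval carries one reference bump \<zeta>0, which
    serves to correct both the weighted mean and the plain integral of test functions.\<close>
  define a0 b0 where "a0 = A + (B - A) / 3" and "b0 = B - (B - A) / 3"
  have ab0: "A < a0" "a0 < b0" "b0 < B" using AB by (auto simp: a0_def b0_def field_simps)
  have vint: "integrable lborel (\<lambda>s. indicator {a<..<b} s * (v s * deriv \<zeta> s))"
    if "A < a" "b < B" "smooth \<zeta>" for a b and \<zeta> :: "real \<Rightarrow> real"
  proof -
    have cd: "continuous_on UNIV (deriv \<zeta>)" by (rule smooth_continuous[OF smooth_deriv(2)[OF that(3)]])
    then have [measurable]: "deriv \<zeta> \<in> borel_measurable borel" by (rule borel_measurable_continuous_onI)
    have "bounded (deriv \<zeta> ` {a..b})"
      by (intro compact_imp_bounded compact_continuous_image continuous_on_subset[OF cd]) auto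
    then obtain D where D: "\<forall>r\<in>deriv \<zeta> ` {a..b}. norm r \<le> D" unfolding bounded_iff by blast
    show ?thesis
    proof (rule Bochner_Integration.integrable_bound)
      show "integrable lborel (\<lambda>s. D * (indicator {a<..<b} s * v s))" using v_local_integrable[OF that(1,2)] by simp
      show "AE s in lborel. norm (indicator {a<..<b} s * (v s * deriv \<zeta> s)) \<le> norm (D * (indicator {a<..<b} s * v s))"
      proof (intro AE_I2)
        fix s show "norm (indicator {a<..<b} s * (v s * deriv \<zeta> s)) \<le> norm (D * (indicator {a<..<b} s * v s))"
        proof (cases "s \<in> {a<..<b}")
          case True
          then have "deriv \<zeta> s \<in> deriv \<zeta> ` {a..b}" by auto
          from bspec[OF D this] have "\<bar>deriv \<zeta> s\<bar> \<le> \<bar>D\<bar>" unfolding real_norm_def by linarith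
          then have "\<bar>deriv \<zeta> s\<bar> * \<bar>v s\<bar> \<le> \<bar>D\<bar> * \<bar>v s\<bar>" by (rule mult_right_mono) simp
          then show ?thesis using True by (simp add: abs_mult mult.commute)
        qed simp
      qed
    qed measurable
  qed
  have flux0: "(LINT s|lborel. indicator {a<..<b} s * ((v s - L s) * deriv \<zeta> s)) = 0"
    if ab: "A < a" "a < b" "b < B" and \<zeta>: "smooth \<zeta>" "\<And>s. s \<le> a \<Longrightarrow> \<zeta> s = 0" "\<And>s. s \<ge> b \<Longrightarrow> \<zeta> s = 0"
      and m: "A > 0 \<Longrightarrow> (LINT s|lborel. s powr (- \<nu>) * \<zeta> s) = 0" for a b \<zeta>
  proof -
    note P = primitive_by_parts[OF L cl \<zeta>(1) ab \<zeta>(2,3)]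
    have "(LINT s|lborel. l s * \<zeta> s) = (LINT s|lborel. (- 1 / 4) * (K s * (s powr (- \<nu>) * \<zeta> s)))"
      by (rule Bochner_Integration.integral_cong) (auto simp: l_def)
    then have "4 * (LINT s|lborel. indicator {a<..<b} s * (v s * deriv \<zeta> s)) = - 4 * (LINT s|lborel. l s * \<zeta> s)"
      using weak_equation_flux[OF \<zeta>(1) ab \<zeta>(2,3) m] by simp
    then have "(LINT s|lborel. indicator {a<..<b} s * (v s * deriv \<zeta> s)) = (LINT s|lborel. indicator {a<..<b} s * (L s * deriv \<zeta> s))"
      using P(1) by simp
    then show ?thesis
      using vint[OF ab(1,3) \<zeta>(1)] P(2) by (simp add: left_diff_distrib right_diff_distrib)
  qed
  obtain \<zeta>0 where \<zeta>0: "smooth \<zeta>0" "\<And>s. \<zeta>0 s \<ge> 0" "\<And>s. s \<le> a0 \<or> s \<ge> b0 \<Longrightarrow> \<zeta>0 s = 0" "(LINT s|lborel. \<zeta>0 s) = 1"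
    using smooth_bump[OF ab0(2)] by blast
  have a0: "a0 > 0" using ab0 AB by simp
  have pint: "integrable lborel (\<lambda>s. s powr (- \<nu>) * \<zeta> s)"
    if "A < a" "smooth \<zeta>" "\<And>s. s \<le> a \<Longrightarrow> \<zeta> s = 0" "\<And>s. s \<ge> b \<Longrightarrow> \<zeta> s = 0" for a b and \<zeta> :: "real \<Rightarrow> real"
  proof -
    have "smooth (\<lambda>s. s powr (- \<nu>) * \<zeta> s)"
      by (rule smooth_powr_mult(1)[OF that(2), of a]) (use that AB in auto)
    then show ?thesis by (rule smooth_integrable[of _ a b]) (use that in auto)
  qed
  define m0 where "m0 = (LINT s|lborel. s powr (- \<nu>) * \<zeta>0 s)"
  have m0: "m0 > 0"
  proof -
    have "(LINT s|lborel. B powr (- \<nu>) * \<zeta>0 s) \<le> m0"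
      unfolding m0_def
    proof (rule integral_mono)
      show "integrable lborel (\<lambda>s. B powr (- \<nu>) * \<zeta>0 s)"
        by (intro integrable_mult_right smooth_integrable[OF \<zeta>0(1), of a0 b0] \<zeta>0(3)) auto
      show "integrable lborel (\<lambda>s. s powr (- \<nu>) * \<zeta>0 s)" by (rule pint[OF ab0(1) \<zeta>0(1)]) (use \<zeta>0(3) in auto)
      show "B powr (- \<nu>) * \<zeta>0 s \<le> s powr (- \<nu>) * \<zeta>0 s" for s
      proof (cases "a0 < s \<and> s < b0")
        case True
        then have "B powr (- \<nu>) \<le> s powr (- \<nu>)" using a0 ab0 nu by (intro powr_mono2') auto
        then show ?thesis using \<zeta>0(2) by (intro mult_right_mono) auto
      next
        case False
        then show ?thesis using \<zeta>0(3)[of s] by auto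
      qed
    qed
    then show ?thesis using \<zeta>0(4) AB by (simp add: less_le_trans[of 0 "B powr (- \<nu>)"])
  qed
  \<comment> \<open>The integral of (v - L) \<zeta>' vanishes whenever the weighted mean of \<zeta>
    does, so it is a fixed multiple of this mean; the factor c is read off at \<zeta>0. For A = 0
    there is no mean constraint and the functional vanishes.\<close>
  define c where "c = (if A > 0 then (LINT s|lborel. indicator {a0<..<b0} s * ((v s - L s) * deriv \<zeta>0 s)) / m0 else 0)"
  have lint: "integrable lborel (\<lambda>s. indicator {a<..<b} s * ((v s - L s) * deriv \<zeta> s))"
    if ab: "A < a" "a < b" "b < B" and \<zeta>: "smooth \<zeta>" "\<And>s. s \<le> a \<Longrightarrow> \<zeta> s = 0" "\<And>s. s \<ge> b \<Longrightarrow> \<zeta> s = 0" for a b \<zeta>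
    using vint[OF ab(1,3) \<zeta>(1)] primitive_by_parts(2)[OF L cl \<zeta>(1) ab \<zeta>(2,3)]
    by (simp add: left_diff_distrib right_diff_distrib)
  have flux: "(LINT s|lborel. indicator {a<..<b} s * ((v s - L s) * deriv \<zeta> s)) = c * (LINT s|lborel. s powr (- \<nu>) * \<zeta> s)"
    if ab: "A < a" "a < b" "b < B" "a \<le> a0" "b0 \<le> b" and \<zeta>: "smooth \<zeta>" "\<And>s. s \<le> a \<Longrightarrow> \<zeta> s = 0" "\<And>s. s \<ge> b \<Longrightarrow> \<zeta> s = 0"
    for a b \<zeta>
  proof (cases "A > 0")
    case False
    then show ?thesis using flux0[OF ab(1-3) \<zeta>] by (simp add: c_def)
  next
    case True
    \<comment> \<open>The multiple of \<zeta>0 whose subtraction gives \<zeta> the weighted mean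
      0.\<close>
    define m where "m = (LINT s|lborel. s powr (- \<nu>) * \<zeta> s) / m0"
    define \<zeta>1 where "\<zeta>1 s = \<zeta> s - m * \<zeta>0 s" for s
    have \<zeta>0z: "\<And>s. s \<le> a \<Longrightarrow> \<zeta>0 s = 0" "\<And>s. s \<ge> b \<Longrightarrow> \<zeta>0 s = 0" using \<zeta>0(3) ab by auto
    have s1: "smooth \<zeta>1" unfolding \<zeta>1_def[abs_def] by (intro smooth_intros \<zeta>(1) \<zeta>0(1))
    have d1: "deriv \<zeta>1 s = deriv \<zeta> s - m * deriv \<zeta>0 s" for s
      unfolding \<zeta>1_def[abs_def]
      by (rule DERIV_imp_deriv) (auto intro!: derivative_eq_intros smooth_deriv(1)[OF \<zeta>(1)] smooth_deriv(1)[OF \<zeta>0(1)])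
    have mean: "(LINT s|lborel. s powr (- \<nu>) * \<zeta>1 s) = 0"
    proof -
      have e: "(\<lambda>s. s powr (- \<nu>) * \<zeta>1 s) = (\<lambda>s. s powr (- \<nu>) * \<zeta> s - m * (s powr (- \<nu>) * \<zeta>0 s))"
        by (auto simp: \<zeta>1_def algebra_simps)
      have "integrable lborel (\<lambda>s. s powr (- \<nu>) * \<zeta> s)"
        by (rule pint[OF ab(1) \<zeta>])
      moreover have "integrable lborel (\<lambda>s. s powr (- \<nu>) * \<zeta>0 s)"
        by (rule pint[OF ab(1) \<zeta>0(1) \<zeta>0z])
      ultimately have "(LINT s|lborel. s powr (- \<nu>) * \<zeta>1 s) = (LINT s|lborel. s powr (- \<nu>) * \<zeta> s) - m * m0"
        unfolding e m0_def by simp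
      then show ?thesis using m0 by (simp add: m_def)
    qed
    have "(LINT s|lborel. indicator {a<..<b} s * ((v s - L s) * deriv \<zeta>1 s)) = 0"
      by (rule flux0[OF ab(1-3) s1]) (use \<zeta> \<zeta>0z mean in \<open>auto simp: \<zeta>1_def\<close>)
    moreover have "(\<lambda>s. indicator {a<..<b} s * ((v s - L s) * deriv \<zeta>1 s)) =
      (\<lambda>s. indicator {a<..<b} s * ((v s - L s) * deriv \<zeta> s) - m * (indicator {a<..<b} s * ((v s - L s) * deriv \<zeta>0 s)))"
      by (auto simp: d1 algebra_simps)
    ultimately have "(LINT s|lborel. indicator {a<..<b} s * ((v s - L s) * deriv \<zeta> s)) =
        m * (LINT s|lborel. indicator {a<..<b} s * ((v s - L s) * deriv \<zeta>0 s))"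
      using lint[OF ab(1-3) \<zeta>] lint[OF ab(1-3) \<zeta>0(1) \<zeta>0z] by simp
    also have "(LINT s|lborel. indicator {a<..<b} s * ((v s - L s) * deriv \<zeta>0 s)) = (LINT s|lborel. indicator {a0<..<b0} s * ((v s - L s) * deriv \<zeta>0 s))"
    proof (rule integral_cong_AE)
      have "AE t in lborel. t \<noteq> a0" "AE t in lborel. t \<noteq> b0" by (rule AE_lborel_singleton)+
      then show "AE s in lborel. indicator {a<..<b} s * ((v s - L s) * deriv \<zeta>0 s) = indicator {a0<..<b0} s * ((v s - L s) * deriv \<zeta>0 s)"
      proof eventually_elim
        case (elim s)
        show ?case
        proof (cases "s < a0 \<or> s > b0")
          case True
          have "deriv \<zeta>0 s = 0"
          proof (rule deriv_zero_outside[of \<zeta>0 a0 b0 s])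
            show "\<zeta>0 r = 0" if "r \<le> a0 \<or> b0 \<le> r" for r by (rule \<zeta>0(3)[OF that])
          qed (fact \<zeta>0(1), fact True)
          then show ?thesis by simp
        next
          case False
          then show ?thesis using elim ab(4,5) by (auto simp: indicator_def)
        qed
      qed
    qed (use lint[OF ab(1-3) \<zeta>0(1) \<zeta>0z] lint[OF ab0 \<zeta>0(1)] \<zeta>0(3) in auto)
    finally show ?thesis using True m0 by (simp add: c_def m_def)
  qed
  \<comment> \<open>\<open>G\<close> has derivative s powr (-\<nu>), so the summand c * G cancels
    the multiple of the mean and Q has weak derivative 0.\<close>
  define Q where "Q s = v s - L s + c * G s" for s
  have Qint: "integrable lborel (\<lambda>s. indicator {a<..<b} s * (Q s * deriv \<zeta> s))"
    and Q0: "b0 \<le> b \<Longrightarrow> a \<le> a0 \<Longrightarrow> (LINT s|lborel. indicator {a<..<b} s * (Q s * deriv \<zeta> s)) = 0"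
    if ab: "A < a" "a < b" "b < B" and \<zeta>: "smooth \<zeta>" "\<And>s. s \<le> a \<Longrightarrow> \<zeta> s = 0" "\<And>s. s \<ge> b \<Longrightarrow> \<zeta> s = 0" for a b \<zeta>
  proof -
    note P = primitive_by_parts[OF G cp \<zeta>(1) ab \<zeta>(2,3)]
    have e: "(\<lambda>s. indicator {a<..<b} s * (Q s * deriv \<zeta> s)) =
      (\<lambda>s. indicator {a<..<b} s * ((v s - L s) * deriv \<zeta> s) + c * (indicator {a<..<b} s * (G s * deriv \<zeta> s)))"
      by (auto simp: Q_def algebra_simps)
    show "integrable lborel (\<lambda>s. indicator {a<..<b} s * (Q s * deriv \<zeta> s))"
      unfolding e using lint[OF ab \<zeta>] P(2) by simp
    show "(LINT s|lborel. indicator {a<..<b} s * (Q s * deriv \<zeta> s)) = 0" if "b0 \<le> b" "a \<le> a0"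
      unfolding e using lint[OF ab \<zeta>] P flux[OF ab that(2,1) \<zeta>] by simp
  qed
  have Qm: "(\<lambda>s. indicator {a<..<b} s * Q s) \<in> borel_measurable borel" "integrable lborel (\<lambda>s. indicator {a<..<b} s * Q s)"
    if ab: "A < a" "b < B" for a b
  proof -
    have sub: "{a..b} \<subseteq> I" using ab by auto
    have e: "(\<lambda>s. indicator {a<..<b} s * Q s) = (\<lambda>s. indicator {a<..<b} s * v s - indicator {a<..<b} s * L s + c * (indicator {a<..<b} s * G s))"
      by (auto simp: Q_def algebra_simps)
    show i: "integrable lborel (\<lambda>s. indicator {a<..<b} s * Q s)"
      unfolding e using v_local_integrable[OF ab] integrable_on_compact_subinterval(2)[OF continuous_on_subset[OF cL(1) sub]]
        integrable_on_compact_subinterval(2)[OF continuous_on_subset[OF cL(2) sub]] by simp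
    then show "(\<lambda>s. indicator {a<..<b} s * Q s) \<in> borel_measurable borel" by simp
  qed
  define d where "d = (LINT s|lborel. indicator {a0<..<b0} s * (Q s * \<zeta>0 s))"
  have AEloc: "AE s in lborel. s \<in> {a<..<b} \<longrightarrow> Q s = d" if ab: "A < a" "a < b" "b < B" "a \<le> a0" "b0 \<le> b" for a b
  proof -
    interpret R: bounded_open "{a<..<b}" by unfold_locales auto
    have toM: "(LINT x|lebesgue_on {a<..<b}. f x) = (LINT x|lborel. indicator {a<..<b} x * f x)"
      if "(\<lambda>x. indicator {a<..<b} x * f x) \<in> borel_measurable borel" for f :: "real \<Rightarrow> real"
    proof -
      have "(LINT x|lebesgue_on {a<..<b}. f x) = (LINT x|lebesgue_on {a<..<b}. indicator {a<..<b} x * f x)"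
        by (rule Bochner_Integration.integral_cong) auto
      also have "\<dots> = (LINT x|lborel. indicator {a<..<b} x * f x)"
        by (rule R.integral_M_eq_lborel[OF that]) auto
      finally show ?thesis .
    qed
    have "AE x in lebesgue_on {a<..<b}. Q x - d = 0"
    proof (rule R.fundamental_lemma)
      have "integrable lebesgue (\<lambda>s. indicator {a<..<b} s * (Q s - d))"
      proof -
        have "integrable lborel (\<lambda>s. indicator {a<..<b} s * Q s - d * indicator {a<..<b} s)"
          using Qm(2)[OF ab(1,3)] by (intro Bochner_Integration.integrable_diff integrable_mult_right integrable_real_indicator) auto
        then have i: "integrable lborel (\<lambda>s. indicator {a<..<b} s * (Q s - d))" by (simp add: algebra_simps)
        then show ?thesis by (subst integrable_completion) auto
      qed
      then show "integrable (lebesgue_on {a<..<b}) (\<lambda>x. Q x - d)" by (simp add: integrable_restrict_space)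
      fix \<rho> assume "\<rho> \<in> test_functions {a<..<b}"
      then obtain J where \<rho>: "smooth \<rho>" "J \<subseteq> {a<..<b}" "\<And>x. x \<notin> J \<Longrightarrow> \<rho> x = 0" by (elim test_functionsE) blast
      have \<rho>z: "\<rho> s = 0" if "s \<le> a \<or> s \<ge> b" for s using \<rho>(2) that by (intro \<rho>(3)) auto
      have \<zeta>0z: "\<zeta>0 s = 0" if "s \<le> a \<or> s \<ge> b" for s using \<zeta>0(3) ab that by auto
      define r where "r = (LINT s|lborel. \<rho> s)"
      \<comment> \<open>Now the plain integral is made 0, so that \<sigma> is the derivative of a
        function supported in [a, b]. As \<zeta>0 does not depend on a and b, the same constant d
        results for all intervals.\<close>
      define \<sigma> where "\<sigma> s = \<rho> s - r * \<zeta>0 s" for s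
      have \<sigma>: "smooth \<sigma>" unfolding \<sigma>_def[abs_def] by (intro smooth_intros \<rho>(1) \<zeta>0(1))
      have ri1: "integrable lborel \<rho>" by (rule smooth_integrable[OF \<rho>(1), of a b], rule \<rho>z) auto
      have ri2: "integrable lborel \<zeta>0" by (rule smooth_integrable[OF \<zeta>0(1), of a b], rule \<zeta>0z) auto
      note ri = ri1 ri2
      have \<sigma>0: "(LINT s|lborel. \<sigma> s) = 0" unfolding \<sigma>_def using ri \<zeta>0(4) by (simp add: r_def)
      have \<sigma>z: "\<sigma> s = 0" if "s \<le> a \<or> s \<ge> b" for s using \<rho>z[OF that] \<zeta>0z[OF that] by (simp add: \<sigma>_def)
      obtain \<zeta>' where \<zeta>': "\<And>s. (\<zeta>' has_real_derivative \<sigma> s) (at s)"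
        using primitive_exists[of UNIV \<sigma>] smooth_continuous[OF \<sigma>] by auto
      define \<zeta> where "\<zeta> s = \<zeta>' s - \<zeta>' a" for s
      have \<zeta>d: "(\<zeta> has_real_derivative \<sigma> s) (at s)" for s
        unfolding \<zeta>_def[abs_def] by (auto intro!: derivative_eq_intros \<zeta>')
      have dz: "deriv \<zeta> = \<sigma>" using \<zeta>d by (auto intro: DERIV_imp_deriv)
      have s\<zeta>: "smooth \<zeta>" by (rule smooth_realI[OF \<zeta>d \<sigma>])
      have \<sigma>l: "\<sigma> s = 0" if "s < a" for s by (rule \<sigma>z) (use that in simp)
      have \<sigma>r: "\<sigma> s = 0" if "s > b" for s by (rule \<sigma>z) (use that in simp)
      have "(LINT s|lborel. \<sigma> s) = \<zeta> b - \<zeta> a"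
        by (rule integral_compact_support_FTC[OF _ \<zeta>d smooth_continuous[OF \<sigma>]]) (use ab(2) \<sigma>l \<sigma>r in auto)
      then have \<zeta>ab: "\<zeta> a = 0" "\<zeta> b = 0" using \<sigma>0 by (simp_all add: \<zeta>_def)
      have z: "\<zeta> s = 0" if "s \<le> a \<or> s \<ge> b" for s
        using constant_where_derivative_zero(1)[of \<zeta> \<sigma> a b s, OF \<zeta>d \<sigma>l \<sigma>r]
          constant_where_derivative_zero(2)[of \<zeta> \<sigma> a b s, OF \<zeta>d \<sigma>l \<sigma>r] \<zeta>ab that by auto
      have q: "(LINT s|lborel. indicator {a<..<b} s * (Q s * \<sigma> s)) = 0"
        using Q0[OF ab(1-3) s\<zeta>] z ab(4,5) unfolding dz by auto
      have bd: "integrable lborel (\<lambda>s. indicator {a<..<b} s * (Q s * f s))" if f: "smooth f" for f :: "real \<Rightarrow> real"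
      proof -
        have cf: "continuous_on UNIV f" by (rule smooth_continuous[OF f])
        then have fm [measurable]: "f \<in> borel_measurable borel" by (rule borel_measurable_continuous_onI)
        have "bounded (f ` {a..b})"
          by (intro compact_imp_bounded compact_continuous_image continuous_on_subset[OF cf]) auto
        then obtain D where D: "\<forall>r\<in>f ` {a..b}. norm r \<le> D" unfolding bounded_iff by blast
        show ?thesis
        proof (rule Bochner_Integration.integrable_bound)
          show "integrable lborel (\<lambda>s. D * (indicator {a<..<b} s * Q s))" using Qm(2)[OF ab(1,3)] by simp
          have "(\<lambda>s. indicator {a<..<b} s * (Q s * f s)) = (\<lambda>s. (indicator {a<..<b} s * Q s) * f s)" by auto
          then show "(\<lambda>s. indicator {a<..<b} s * (Q s * f s)) \<in> borel_measurable lborel"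
            using Qm(1)[OF ab(1,3)] fm by simp
          show "AE s in lborel. norm (indicator {a<..<b} s * (Q s * f s)) \<le> norm (D * (indicator {a<..<b} s * Q s))"
          proof (intro AE_I2)
            fix s show "norm (indicator {a<..<b} s * (Q s * f s)) \<le> norm (D * (indicator {a<..<b} s * Q s))"
            proof (cases "s \<in> {a<..<b}")
              case True
              then have "f s \<in> f ` {a..b}" by auto
              from bspec[OF D this] have "\<bar>f s\<bar> \<le> \<bar>D\<bar>" unfolding real_norm_def by linarith
              then have "\<bar>f s\<bar> * \<bar>Q s\<bar> \<le> \<bar>D\<bar> * \<bar>Q s\<bar>" by (rule mult_right_mono) simp
              then show ?thesis using True by (simp add: abs_mult mult.commute)
            qed simp
          qed
        qed
      qed
      have i: "integrable lborel (\<lambda>s. indicator {a<..<b} s * (Q s * \<rho> s))" "integrable lborel (\<lambda>s. indicator {a<..<b} s * (Q s * \<zeta>0 s))"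
        by (rule bd[OF \<rho>(1)], rule bd[OF \<zeta>0(1)])
      have "(\<lambda>s. indicator {a<..<b} s * (Q s * \<sigma> s)) =
          (\<lambda>s. indicator {a<..<b} s * (Q s * \<rho> s) - r * (indicator {a<..<b} s * (Q s * \<zeta>0 s)))"
        by (auto simp: \<sigma>_def algebra_simps)
      then have "(LINT s|lborel. indicator {a<..<b} s * (Q s * \<rho> s)) = r * (LINT s|lborel. indicator {a<..<b} s * (Q s * \<zeta>0 s))"
        using q i by simp
      also have "(LINT s|lborel. indicator {a<..<b} s * (Q s * \<zeta>0 s)) = d"
        unfolding d_def
      proof (rule Bochner_Integration.integral_cong)
        show "indicator {a<..<b} s * (Q s * \<zeta>0 s) = indicator {a0<..<b0} s * (Q s * \<zeta>0 s)" for s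
          using \<zeta>0(3)[of s] ab(4,5) by (cases "s \<in> {a0<..<b0}") auto
      qed simp
      finally have fin: "(LINT s|lborel. indicator {a<..<b} s * (Q s * \<rho> s)) = r * d" .
      have e2: "(\<lambda>s. indicator {a<..<b} s * ((Q s - d) * \<rho> s)) = (\<lambda>s. indicator {a<..<b} s * (Q s * \<rho> s) - d * \<rho> s)"
      proof
        fix s show "indicator {a<..<b} s * ((Q s - d) * \<rho> s) = indicator {a<..<b} s * (Q s * \<rho> s) - d * \<rho> s"
          using \<rho>z[of s] by (cases "s \<in> {a<..<b}") (auto simp: algebra_simps)
      qed
      have e2i: "integrable lborel (\<lambda>s. indicator {a<..<b} s * ((Q s - d) * \<rho> s))" unfolding e2 using i(1) ri(1) by simp
      have "(LINT x|lebesgue_on {a<..<b}. (Q x - d) * \<rho> x) = (LINT s|lborel. indicator {a<..<b} s * ((Q s - d) * \<rho> s))"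
        by (rule toM) (use e2i in simp)
      also have "\<dots> = 0" unfolding e2 using fin i(1) ri(1) by (simp add: r_def)
      finally show "(LINT x|lebesgue_on {a<..<b}. (Q x - d) * \<rho> x) = 0" .
    qed
    then have "AE x in lebesgue. x \<in> {a<..<b} \<longrightarrow> Q x = d" by (simp add: AE_restrict_space_iff)
    then show ?thesis by (simp add: AE_completion_iff)
  qed
  have AEe: "AE s in lborel. s \<in> {A + e<..<B - e} \<longrightarrow> Q s = d" if "0 < e" "e \<le> (B - A) / 3" for e
  proof (rule AEloc)
    show "A < A + e" "B - e < B" using that by simp_all
    have "3 * e \<le> B - A" using that(2) by (simp add: field_simps)
    then show "A + e < B - e" using that(1) by linarith
    show "A + e \<le> a0" "b0 \<le> B - e" unfolding a0_def b0_def using that(2) by simp_all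
  qed
  have AEn: "AE s in lborel. \<forall>n::nat. s \<in> {A + (B - A) / (3 + real n)<..<B - (B - A) / (3 + real n)} \<longrightarrow> Q s = d"
    unfolding AE_all_countable
  proof
    fix n :: nat
    have f1: "(B - A) / (3 + real n) \<le> (B - A) / 3" by (rule divide_left_mono) (use AB in auto)
    have f2: "0 < (B - A) / (3 + real n)" using AB by simp
    note f = f1 f2
    show "AE s in lborel. s \<in> {A + (B - A) / (3 + real n)<..<B - (B - A) / (3 + real n)} \<longrightarrow> Q s = d"
      by (rule AEe[OF f2 f1])
  qed
  have AEQ: "AE s in lborel. s \<in> I \<longrightarrow> Q s = d"
    using AEn
  proof eventually_elim
    case (elim s)
    show ?case
    proof
      assume s: "s \<in> I"
      have "(\<lambda>n. (B - A) / (3 + real n)) \<longlonglongrightarrow> 0" by real_asymp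
      then have "eventually (\<lambda>n. (B - A) / (3 + real n) < min (s - A) (B - s)) sequentially"
        by (rule order_tendstoD(2)) (use s in auto)
      then obtain n where "(B - A) / (3 + real n) < min (s - A) (B - s)" by (auto simp: eventually_sequentially)
      then have "A + (B - A) / (3 + real n) < s" "s < B - (B - A) / (3 + real n)" by linarith+
      then show "Q s = d" using spec[OF elim, of n] by simp
    qed
  qed
  show ?thesis
  proof (rule that[of "\<lambda>s. L s - c * G s + d" "\<lambda>s. l s - c * s powr (- \<nu>)" c])
    fix s assume s: "s \<in> I"
    show "((\<lambda>s. L s - c * G s + d) has_real_derivative l s - c * s powr (- \<nu>)) (at s)"
      by (auto intro!: derivative_eq_intros L[OF s] G[OF s])
    have "s powr \<nu> * s powr (- \<nu>) = 1" using Ipos[OF s] by (simp add: powr_add[symmetric])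
    moreover have "s powr \<nu> * (l s - c * s powr (- \<nu>)) = (s powr \<nu> * s powr (- \<nu>)) * (- K s / 4 - c)"
      by (simp add: l_def algebra_simps)
    ultimately show "s powr \<nu> * (l s - c * s powr (- \<nu>)) = - K s / 4 - c" by simp
  next
    show "A = 0 \<Longrightarrow> c = 0" by (simp add: c_def)
    show "AE s in lborel. s \<in> I \<longrightarrow> v s = L s - c * G s + d"
      using AEQ by eventually_elim (auto simp: Q_def)
  qed
qed

end

lemma integral_powr_from_0:
  fixes a c :: real
  assumes "a > - 1" "c \<ge> 0"
  shows "integrable lborel (\<lambda>s. indicator {0<..<c} s * s powr a)"
    "(LINT s|lborel. indicator {0<..<c} s * s powr a) = c powr (a + 1) / (a + 1)"
proof -
  have "integral\<^sup>N lborel (\<lambda>x. ennreal (x powr a) * indicator {0..c} x) = ennreal (c powr (a + 1) / (a + 1))"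
    by (rule nn_integral_has_integral_lebesgue'[OF _ has_integral_powr_from_0]) (use assms in auto)
  also have "integral\<^sup>N lborel (\<lambda>x. ennreal (x powr a) * indicator {0..c} x) = integral\<^sup>N lborel (\<lambda>x. ennreal (indicator {0<..<c} x * x powr a))"
  proof (rule nn_integral_cong_AE)
    have "AE t in lborel. t \<noteq> 0" "AE t in lborel. t \<noteq> c" by (rule AE_lborel_singleton)+
    then show "AE x in lborel. ennreal (x powr a) * indicator {0..c} x = ennreal (indicator {0<..<c} x * x powr a)"
      by eventually_elim (auto simp: indicator_def)
  qed
  finally have n: "integral\<^sup>N lborel (\<lambda>x. ennreal (indicator {0<..<c} x * x powr a)) = ennreal (c powr (a + 1) / (a + 1))" .
  have m: "(\<lambda>x. indicator {0<..<c} x * x powr a) \<in> borel_measurable lborel" by measurable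
  show i: "integrable lborel (\<lambda>s. indicator {0<..<c} s * s powr a)"
    by (rule integrableI_nn_integral_finite[OF m _ n]) auto
  show "(LINT s|lborel. indicator {0<..<c} s * s powr a) = c powr (a + 1) / (a + 1)"
    using nn_integral_eq_integral[OF i] n assms by (auto simp: ennreal_inj)
qed

locale regular_profile = profile +
  fixes w V :: "real \<Rightarrow> real" and c :: real
  assumes w_deriv: "\<And>s. s \<in> {A<..<B} \<Longrightarrow> (w has_real_derivative V s) (at s)"
    and flux: "\<And>s. s \<in> {A<..<B} \<Longrightarrow> s powr \<nu> * V s = - K s / 4 - c"
    and no_flux: "A = 0 \<Longrightarrow> c = 0"
    and vw: "AE s in lborel. s \<in> {A<..<B} \<longrightarrow> v s = w s"
begin

lemma I_pos: "s \<in> I \<Longrightarrow> s > 0" using AB by auto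

lemma w_continuous: "S \<subseteq> I \<Longrightarrow> continuous_on S w"
  using w_deriv DERIV_isCont by (intro continuous_at_imp_continuous_on ballI) blast

lemma source_continuous:
  assumes "S \<subseteq> I" shows "continuous_on S (\<lambda>s. s powr (\<nu> - 1 + \<alpha> / 2) * spow p (w s))"
proof -
  have "s \<noteq> 0" if "s \<in> S" for s using that assms I_pos[of s] by auto
  then show ?thesis
    by (intro continuous_intros continuous_on_compose2[OF spow_continuous[OF p, of UNIV] w_continuous[OF assms]]) auto
qed

text \<open>\<open>K\<close> was built from the measurable \<open>v\<close>; under the integral
  \<open>v\<close> may be replaced by its continuous representative, and the fundamental theorem
  applies.\<close>

lemma K_deriv:
  assumes s: "s \<in> I"
  shows "(K has_real_derivative s powr (\<nu> - 1 + \<alpha> / 2) * spow p (w s)) (at s)"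
proof -
  let ?f = "\<lambda>s. s powr (\<nu> - 1 + \<alpha> / 2) * spow p (w s)"
  obtain P where P: "\<And>s. s \<in> I \<Longrightarrow> (P has_real_derivative ?f s) (at s)"
    using primitive_exists[OF I_open source_continuous[OF order_refl]] by blast
  define a b where "a = (A + s) / 2" and "b = (s + B) / 2"
  have ab: "A < a" "a < s" "s < b" "b < B" using s by (auto simp: a_def b_def)
  have K: "K x = P x + (K a - P a)" if x: "x \<in> {a<..<b}" for x
  proof -
    have ki: "integrable lborel (\<lambda>t. indicator {..x} t * k t)" for x
      using integrable_mult_indicator[OF _ k_integrable, of "{..x}"] by simp
    have "K x - K a = (LINT t|lborel. indicator {..x} t * k t - indicator {..a} t * k t)"
      unfolding K_def using ki by simp
    also have "\<dots> = (LINT t|lborel. indicator {a<..<x} t * ?f t)"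
    proof (rule integral_cong_AE)
      have "AE t in lborel. t \<noteq> a" "AE t in lborel. t \<noteq> x" by (rule AE_lborel_singleton)+
      with vw show "AE t in lborel. indicator {..x} t * k t - indicator {..a} t * k t = indicator {a<..<x} t * ?f t"
      proof eventually_elim
        case (elim t)
        have "t \<in> I" if "a < t" "t < x" using that x ab by simp
        then show ?case using elim x ab by (auto simp: k_def indicator_def)
      qed
      show "(\<lambda>t. indicator {a<..<x} t * ?f t) \<in> borel_measurable lborel"
        using continuous_on_I_measurable[OF source_continuous[OF order_refl], of a x] x ab by simp
    qed measurable
    also have "\<dots> = P x - P a"
    proof (rule integral_Ioo_FTC[of _ _ _ _ "(A + a) / 2" "(b + B) / 2"])
      show "continuous_on {(A + a) / 2..(b + B) / 2} ?f" by (rule source_continuous) (use ab in auto)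
      show "(P has_real_derivative ?f t) (at t)" if "a \<le> t" "t \<le> x" for t by (rule P) (use that x ab in auto)
    qed (use x ab in auto)
    finally show ?thesis by simp
  qed
  have "((\<lambda>x. P x + (K a - P a)) has_real_derivative ?f s) (at s)"
    by (auto intro!: derivative_eq_intros P[OF s])
  then show ?thesis
    by (rule has_field_derivative_transform_within_open[of _ _ _ "{a<..<b}"]) (use ab K in auto)
qed

lemma flux_deriv:
  assumes s: "s \<in> I"
  shows "((\<lambda>s. s powr \<nu> * V s) has_real_derivative - (s powr (\<nu> - 1 + \<alpha> / 2) * spow p (w s)) / 4) (at s)"
proof -
  have "((\<lambda>s. - K s / 4 - c) has_real_derivative - (s powr (\<nu> - 1 + \<alpha> / 2) * spow p (w s)) / 4) (at s)"
    by (auto intro!: derivative_eq_intros K_deriv[OF s])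
  then show ?thesis
    by (rule has_field_derivative_transform_within_open[of _ _ _ I]) (use s flux in auto)
qed

lemma V_eq: assumes "s \<in> I" shows "V s = s powr (- \<nu>) * (s powr \<nu> * V s)"
proof -
  have "s powr (- \<nu>) * s powr \<nu> = 1" using I_pos[OF assms] by (simp add: powr_add[symmetric])
  then show ?thesis by (simp add: mult.assoc[symmetric])
qed

subsection \<open>Pointwise bounds\<close>

text \<open>With \<eta> = s powr (-\<nu>) * Z the factor s powr (\<nu> - 1) * (2 \<nu> \<eta> + 2 s
  \<eta>') collapses to 2 Z'; hence the quarter of the constant. Z only has to vanish below some a >
  0, so it is free at B, and also at A if A > 0.\<close>

lemma gradient_bound_flux:
  obtains C where "C \<ge> 0" "\<And>Z a. smooth Z \<Longrightarrow> a > 0 \<Longrightarrow> (\<And>s. s < a \<Longrightarrow> Z s = 0) \<Longrightarrow>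
    (LINT s|lborel. indicator I s * (w s * deriv Z s))\<^sup>2 \<le> C * (LINT s|lborel. indicator I s * (s powr (- \<nu>) * (Z s)\<^sup>2))"
proof -
  obtain C where C: "C \<ge> 0" "\<forall>\<eta> \<eta>'. (\<forall>s. (\<eta> has_real_derivative \<eta>' s) (at s)) \<longrightarrow> continuous_on UNIV \<eta>' \<longrightarrow>
      (LINT s|lborel. indicator I s * (s powr (\<nu> - 1) * (v s * (2 * \<nu> * \<eta> s + 2 * s * \<eta>' s))))\<^sup>2 \<le>
        C * (LINT s|lborel. indicator I s * (s powr \<nu> * (\<eta> s)\<^sup>2))"
    using gradient_bound by blast
  show ?thesis
  proof (rule that[of "C / 4"])
    show "C / 4 \<ge> 0" using C by simp
    fix Z :: "real \<Rightarrow> real" and a :: real assume Z: "smooth Z" "a > 0" "\<And>s. s < a \<Longrightarrow> Z s = 0"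
    define \<eta> where "\<eta> s = s powr (- \<nu>) * Z s" for s
    define \<eta>' where "\<eta>' s = s powr (- \<nu>) * deriv Z s + (- \<nu>) * s powr (- \<nu> - 1) * Z s" for s
    have \<eta>: "smooth \<eta>" "\<And>s. (\<eta> has_real_derivative \<eta>' s) (at s)"
      using smooth_powr_mult[OF Z, of "- \<nu>"] unfolding \<eta>_def[abs_def] \<eta>'_def[abs_def] by auto
    have "deriv \<eta> = \<eta>'" using \<eta>(2) by (auto intro: DERIV_imp_deriv)
    then have c: "continuous_on UNIV \<eta>'" using smooth_continuous[OF smooth_deriv(2)[OF \<eta>(1)]] by simp
    have b: "(LINT s|lborel. indicator I s * (s powr (\<nu> - 1) * (v s * (2 * \<nu> * \<eta> s + 2 * s * \<eta>' s))))\<^sup>2 \<le>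
        C * (LINT s|lborel. indicator I s * (s powr \<nu> * (\<eta> s)\<^sup>2))"
      using C(2) \<eta>(2) c by blast
    have e1: "s powr (\<nu> - 1) * (2 * \<nu> * \<eta> s + 2 * s * \<eta>' s) = 2 * deriv Z s" if s: "s \<in> I" for s
    proof -
      have s0: "s > 0" using I_pos[OF s] .
      have "s powr (\<nu> - 1) * s powr (- \<nu>) = s powr (- 1)" "s powr (\<nu> - 1) * s powr (- \<nu> - 1) = s powr (- 2)"
        unfolding powr_add[symmetric] by simp_all
      then have p1: "s powr (\<nu> - 1) * s powr (- \<nu>) = 1 / s" "s powr (\<nu> - 1) * s powr (- \<nu> - 1) = 1 / s\<^sup>2"
        using s0 by (simp_all only: powr_minus_divide) (simp_all add: powr_numeral)
      have "s powr (\<nu> - 1) * (2 * \<nu> * \<eta> s + 2 * s * \<eta>' s) =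
        2 * \<nu> * (s powr (\<nu> - 1) * s powr (- \<nu>)) * Z s + 2 * s * (s powr (\<nu> - 1) * s powr (- \<nu>)) * deriv Z s
        - 2 * s * \<nu> * (s powr (\<nu> - 1) * s powr (- \<nu> - 1)) * Z s"
        unfolding \<eta>'_def \<eta>_def by (simp add: algebra_simps)
      also have "\<dots> = 2 * deriv Z s" unfolding p1 using s0 by (simp add: power2_eq_square)
      finally show ?thesis .
    qed
    have e2: "s powr \<nu> * (\<eta> s)\<^sup>2 = s powr (- \<nu>) * (Z s)\<^sup>2" if s: "s \<in> I" for s
    proof -
      have "s powr \<nu> * (s powr (- \<nu>) * s powr (- \<nu>)) = s powr (- \<nu>)" unfolding powr_add[symmetric] by simp
      then show ?thesis by (simp add: \<eta>_def power2_eq_square mult_ac)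
    qed
    have cZ: "continuous_on UNIV \<eta>" "continuous_on UNIV (deriv Z)" using \<eta>(1) Z(1) by (auto intro: smooth_continuous smooth_deriv)
    note [measurable] = borel_measurable_continuous_onI[OF cZ(1)] borel_measurable_continuous_onI[OF cZ(2)] borel_measurable_continuous_onI[OF c]
    have wm [measurable]: "(\<lambda>s. indicator I s * (w s * deriv Z s)) \<in> borel_measurable borel"
    proof -
      have "(\<lambda>s. indicator I s *\<^sub>R w s) \<in> borel_measurable borel"
        using w_continuous[OF order_refl] by (intro borel_measurable_continuous_on_indicator) auto
      then have "(\<lambda>s. (indicator I s *\<^sub>R w s) * deriv Z s) \<in> borel_measurable borel" by measurable
      then show ?thesis by (simp add: mult.assoc)
    qed
    have "(LINT s|lborel. indicator I s * (s powr (\<nu> - 1) * (v s * (2 * \<nu> * \<eta> s + 2 * s * \<eta>' s)))) = (LINT s|lborel. 2 * (indicator I s * (w s * deriv Z s)))"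
    proof (rule integral_cong_AE)
      show "AE s in lborel. indicator I s * (s powr (\<nu> - 1) * (v s * (2 * \<nu> * \<eta> s + 2 * s * \<eta>' s))) = 2 * (indicator I s * (w s * deriv Z s))"
        using vw
      proof eventually_elim
        case (elim s)
        show ?case
        proof (cases "s \<in> I")
          case True
          have "s powr (\<nu> - 1) * (w s * (2 * \<nu> * \<eta> s + 2 * s * \<eta>' s)) = w s * (2 * deriv Z s)"
            unfolding e1[OF True, symmetric] by (rule mult.left_commute)
          then show ?thesis using True elim by simp
        qed simp
      qed
    qed measurable
    also have "\<dots> = 2 * (LINT s|lborel. indicator I s * (w s * deriv Z s))" by simp
    finally have l: "(LINT s|lborel. indicator I s * (s powr (\<nu> - 1) * (v s * (2 * \<nu> * \<eta> s + 2 * s * \<eta>' s)))) =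
      2 * (LINT s|lborel. indicator I s * (w s * deriv Z s))" .
    have r: "(LINT s|lborel. indicator I s * (s powr \<nu> * (\<eta> s)\<^sup>2)) = (LINT s|lborel. indicator I s * (s powr (- \<nu>) * (Z s)\<^sup>2))"
      by (rule Bochner_Integration.integral_cong) (use e2 in \<open>auto simp: indicator_def\<close>)
    show "(LINT s|lborel. indicator I s * (w s * deriv Z s))\<^sup>2 \<le> C / 4 * (LINT s|lborel. indicator I s * (s powr (- \<nu>) * (Z s)\<^sup>2))"
      using b unfolding l r by (simp add: power_mult_distrib)
  qed
qed

lemma bump_average_limit:
  assumes s0: "s0 \<in> I" and f: "\<And>n. smooth (f n)" "\<And>n s. f n s \<ge> 0" "\<And>n s. \<bar>s - s0\<bar> \<ge> d n \<Longrightarrow> f n s = 0" "\<And>n. (LINT s|lborel. f n s) = 1"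
    and d: "d \<longlonglongrightarrow> (0::real)"
  shows "(\<lambda>n::nat. LINT s|lborel. indicator I s * (w s * f n s)) \<longlonglongrightarrow> w s0"
proof (rule LIMSEQ_I)
  fix e :: real assume e: "e > 0"
  have "isCont w s0" using w_deriv[OF s0] DERIV_isCont by blast
  then obtain r where r: "r > 0" "\<And>s. \<bar>s - s0\<bar> < r \<Longrightarrow> \<bar>w s - w s0\<bar> < e / 2"
    using e unfolding continuous_at_eps_delta dist_real_def by (meson half_gt_zero)
  obtain r2 where r2: "r2 > 0" "cball s0 r2 \<subseteq> I" using s0 I_open(1) open_contains_cball by blast
  obtain N where N: "\<And>n. n \<ge> N \<Longrightarrow> d n < min r r2"
    using order_tendstoD(2)[OF d, of "min r r2"] r(1) r2(1) by (auto simp: eventually_sequentially)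
  show "\<exists>N. \<forall>n\<ge>N. norm ((LINT s|lborel. indicator I s * (w s * f n s)) - w s0) < e"
  proof (intro exI allI impI)
    fix n assume "n \<ge> N"
    then have dn: "d n < r" "d n < r2" using N by auto
    have fz: "f n s = 0" if "\<bar>s - s0\<bar> \<ge> r2" for s using f(3)[of n s] that dn by simp
    have fi: "integrable lborel (f n)"
      by (rule smooth_integrable[OF f(1), of "s0 - r2" "s0 + r2"]) (rule fz, auto)
    have sub: "{s0 - r2..s0 + r2} \<subseteq> I" using r2(2) by (auto simp: cball_eq_atLeastAtMost)
    have wi: "integrable lborel (\<lambda>s. indicator {s0 - r2..s0 + r2} s * (w s * f n s))"
      by (intro integrable_on_compact_subinterval continuous_intros w_continuous sub smooth_continuous f)
    have e1: "indicator I s * (w s * f n s) = indicator {s0 - r2..s0 + r2} s * (w s * f n s)" for s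
    proof (cases "s \<in> {s0 - r2..s0 + r2}")
      case True then show ?thesis using sub by auto
    next
      case False then have "f n s = 0" by (intro fz) auto
      then show ?thesis by simp
    qed
    have "(LINT s|lborel. indicator I s * (w s * f n s)) - w s0 = (LINT s|lborel. indicator {s0 - r2..s0 + r2} s * (w s * f n s) - w s0 * f n s)"
      unfolding e1 using wi fi f(4)[of n] by simp
    also have "\<bar>\<dots>\<bar> \<le> (LINT s|lborel. e / 2 * f n s)"
    proof (rule order_trans[OF integral_abs_bound], rule integral_mono)
      show "integrable lborel (\<lambda>s. \<bar>indicator {s0 - r2..s0 + r2} s * (w s * f n s) - w s0 * f n s\<bar>)" using wi fi by simp
      show "integrable lborel (\<lambda>s. e / 2 * f n s)" using fi by simp
      fix s
      show "\<bar>indicator {s0 - r2..s0 + r2} s * (w s * f n s) - w s0 * f n s\<bar> \<le> e / 2 * f n s"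
      proof (cases "\<bar>s - s0\<bar> < d n")
        case True
        then have "s \<in> {s0 - r2..s0 + r2}" "\<bar>w s - w s0\<bar> \<le> e / 2" using dn r(2)[of s] by auto
        moreover have "\<bar>w s - w s0\<bar> * f n s \<le> e / 2 * f n s" using calculation(2) f(2) by (rule mult_right_mono)
        ultimately show ?thesis using f(2)[of n s] by (simp add: left_diff_distrib[symmetric] abs_mult)
      next
        case False
        then show ?thesis using f(3)[of n s] by simp
      qed
    qed
    also have "\<dots> = e / 2" using f(4)[of n] by simp
    finally show "norm ((LINT s|lborel. indicator I s * (w s * f n s)) - w s0) < e" using e by simp
  qed
qed

lemma integral_weight_le:
  assumes Z: "\<And>s. 0 \<le> Z s \<and> Z s \<le> (1::real)" "\<And>s. s \<notin> {x<..<y} \<Longrightarrow> indicator I s * Z s = 0"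
    and E: "integrable lborel (\<lambda>s. indicator {x<..<y} s * h s)" "\<And>s. s \<in> {x<..<y} \<Longrightarrow> s \<in> I \<Longrightarrow> s powr (- \<nu>) \<le> h s" "\<And>s. s \<in> {x<..<y} \<Longrightarrow> 0 \<le> h s"
  shows "(LINT s|lborel. indicator I s * (s powr (- \<nu>) * (Z s)\<^sup>2)) \<le> (LINT s|lborel. indicator {x<..<y} s * h s)"
proof (cases "integrable lborel (\<lambda>s. indicator I s * (s powr (- \<nu>) * (Z s)\<^sup>2))")
  case True
  show ?thesis
  proof (rule integral_mono[OF True E(1)])
    fix s
    show "indicator I s * (s powr (- \<nu>) * (Z s)\<^sup>2) \<le> indicator {x<..<y} s * h s"
    proof (cases "s \<in> {x<..<y} \<and> s \<in> I")
      case True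
      have "(Z s)\<^sup>2 \<le> 1" using Z(1)[of s] by (simp add: power_le_one)
      then have "s powr (- \<nu>) * (Z s)\<^sup>2 \<le> s powr (- \<nu>) * 1" by (intro mult_left_mono) auto
      then show ?thesis using True E(2)[of s] by simp
    next
      case False
      have "indicator I s * (s powr (- \<nu>) * (Z s)\<^sup>2) = 0" using False Z(2)[of s] by (auto simp: indicator_def)
      moreover have "indicator {x<..<y} s * h s \<ge> 0" using E(3)[of s] by (auto simp: indicator_def)
      ultimately show ?thesis by linarith
    qed
  qed
next
  \<comment> \<open>A non-integrable integrand has integral 0 by convention, and the right side is
    nonnegative.\<close>
  case False
  have "(LINT s|lborel. indicator {x<..<y} s * h s) \<ge> 0"
    by (rule Bochner_Integration.integral_nonneg) (use E(3) in \<open>auto simp: indicator_def\<close>)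
  then show ?thesis using False by (simp add: not_integrable_integral_eq)
qed

text \<open>Z rises from 0 to 1 just left of s0 and stays 1 up to B, so the averages of w against Z'
  tend to w s0 and (w s0)^2 is controlled by the integral of s powr (-\<nu>) over (s0, B). The
  majorant h of the weight and the bound E are left open for one use near B and one near the
  centre.\<close>

lemma right_bound:
  obtains C where "C \<ge> 0" "\<And>s0 h E. s0 \<in> I \<Longrightarrow> isCont E s0 \<Longrightarrow>
    (\<And>x. A < x \<Longrightarrow> x < s0 \<Longrightarrow> integrable lborel (\<lambda>s. indicator {x<..<B} s * h x s)) \<Longrightarrow>
    (\<And>x. A < x \<Longrightarrow> x < s0 \<Longrightarrow> (LINT s|lborel. indicator {x<..<B} s * h x s) \<le> E x) \<Longrightarrow>
    (\<And>x s. A < x \<Longrightarrow> x < s0 \<Longrightarrow> x < s \<Longrightarrow> s < B \<Longrightarrow> s powr (- \<nu>) \<le> h x s) \<Longrightarrow> (w s0)\<^sup>2 \<le> C * E s0"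
proof -
  obtain C where C: "C \<ge> 0" "\<And>Z a. smooth Z \<Longrightarrow> a > 0 \<Longrightarrow> (\<And>s. s < a \<Longrightarrow> Z s = 0) \<Longrightarrow>
    (LINT s|lborel. indicator I s * (w s * deriv Z s))\<^sup>2 \<le> C * (LINT s|lborel. indicator I s * (s powr (- \<nu>) * (Z s)\<^sup>2))"
    by (rule gradient_bound_flux) blast
  show ?thesis
  proof (rule that[OF C(1)])
    fix s0 E and h :: "real \<Rightarrow> real \<Rightarrow> real"
    assume s0: "s0 \<in> I" and cE: "isCont E s0"
      and hi: "\<And>x. A < x \<Longrightarrow> x < s0 \<Longrightarrow> integrable lborel (\<lambda>s. indicator {x<..<B} s * h x s)"
      and hE: "\<And>x. A < x \<Longrightarrow> x < s0 \<Longrightarrow> (LINT s|lborel. indicator {x<..<B} s * h x s) \<le> E x"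
      and hb: "\<And>x s. A < x \<Longrightarrow> x < s0 \<Longrightarrow> x < s \<Longrightarrow> s < B \<Longrightarrow> s powr (- \<nu>) \<le> h x s"
    define d where "d n = (s0 - A) / (real n + 2)" for n
    have d: "0 < d n" "d n < s0 - A" for n
    proof -
      show "0 < d n" using s0 by (simp add: d_def)
      have "(s0 - A) / (real n + 2) < (s0 - A) / 1" by (rule divide_strict_left_mono) (use s0 in auto)
      then show "d n < s0 - A" by (simp add: d_def)
    qed
    have dl: "d \<longlonglongrightarrow> 0" unfolding d_def by real_asymp
    have "\<exists>f. smooth f \<and> (\<forall>s. f s \<ge> 0) \<and> (\<forall>s. s \<le> s0 - d n \<or> s \<ge> s0 \<longrightarrow> f s = 0) \<and> (LINT s|lborel. f s) = 1" for n
      using smooth_bump[of "s0 - d n" s0] d(1)[of n] by (metis diff_less_eq less_add_same_cancel1)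
    then obtain f where f: "\<And>n. smooth (f n)" "\<And>n s. f n s \<ge> 0" "\<And>n s. s \<le> s0 - d n \<or> s \<ge> s0 \<Longrightarrow> f n s = 0"
        "\<And>n. (LINT s|lborel. f n s) = 1" by metis
    have lim: "(\<lambda>n. LINT s|lborel. indicator I s * (w s * f n s)) \<longlonglongrightarrow> w s0"
      by (rule bump_average_limit[OF s0 f(1,2) _ f(4) dl]) (rule f(3), auto)
    have bnd: "(LINT s|lborel. indicator I s * (w s * f n s))\<^sup>2 \<le> C * E (s0 - d n)" for n
    proof -
      let ?x = "s0 - d n"
      have x: "A < ?x" "?x < s0" using d[of n] by auto
      have x0: "?x > 0" using x AB by linarith
      have fl: "f n s = 0" if "s < ?x" for s using f(3) that by simp
      have fr: "f n s = 0" if "s > s0" for s using f(3) that by simp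
      obtain Z0 where Z0: "\<And>s. (Z0 has_real_derivative f n s) (at s)"
        using primitive_exists[of UNIV "f n"] smooth_continuous[OF f(1)] by auto
      define Z where "Z s = Z0 s - Z0 ?x" for s
      have Zd: "(Z has_real_derivative f n s) (at s)" for s
        unfolding Z_def[abs_def] by (auto intro!: derivative_eq_intros Z0)
      have sZ: "smooth Z" by (rule smooth_realI[OF Zd f(1)])
      have dZ: "deriv Z = f n" using Zd by (auto intro: DERIV_imp_deriv)
      have Zx: "Z s = 0" if "s \<le> ?x" for s
        using constant_where_derivative_zero(1)[OF Zd fl fr that] by (simp add: Z_def)
      have "1 = Z s0 - Z ?x" unfolding f(4)[of n, symmetric]
        by (rule integral_compact_support_FTC[OF _ Zd smooth_continuous[OF f(1)]]) (use x fl fr in auto)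
      then have Zs0: "Z s = 1" if "s \<ge> s0" for s
        using constant_where_derivative_zero(2)[OF Zd fl fr that] by (simp add: Z_def)
      have mono: "Z s \<le> Z t" if "s \<le> t" for s t
        by (rule DERIV_nonneg_imp_nondecreasing[OF that]) (use Zd f(2) in blast)
      have Z01: "0 \<le> Z s \<and> Z s \<le> 1" for s
        using mono[of s "max s s0"] Zs0[of "max s s0"] mono[of "min s ?x" s] Zx[of "min s ?x"] by auto
      have "(LINT s|lborel. indicator I s * (w s * deriv Z s))\<^sup>2 \<le> C * (LINT s|lborel. indicator I s * (s powr (- \<nu>) * (Z s)\<^sup>2))"
        by (rule C(2)[OF sZ x0]) (use Zx in auto)
      also have "\<dots> \<le> C * (LINT s|lborel. indicator {?x<..<B} s * h ?x s)"
      proof (rule mult_left_mono[OF integral_weight_le C(1)])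
        show "0 \<le> Z s \<and> Z s \<le> 1" for s by (rule Z01)
        show "indicator I s * Z s = 0" if "s \<notin> {?x<..<B}" for s using that Zx[of s] by (auto simp: indicator_def)
        show "integrable lborel (\<lambda>s. indicator {?x<..<B} s * h ?x s)" by (rule hi[OF x])
        show "s powr (- \<nu>) \<le> h ?x s" if "s \<in> {?x<..<B}" "s \<in> I" for s using hb[OF x] that by simp
        show "0 \<le> h ?x s" if "s \<in> {?x<..<B}" for s
          using hb[OF x, of s] that order_trans[OF powr_ge_zero[of s "- \<nu>"]] by simp
      qed
      also have "\<dots> \<le> C * E ?x" using hE[OF x] C(1) by (intro mult_left_mono)
      finally show ?thesis by (simp add: dZ)
    qed
    have "(\<lambda>n. s0 - d n) \<longlonglongrightarrow> s0 - 0" by (intro tendsto_intros dl)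
    then have "(\<lambda>n. C * E (s0 - d n)) \<longlonglongrightarrow> C * E s0"
      using isCont_tendsto_compose[OF cE, of "\<lambda>n. s0 - d n"] by (intro tendsto_intros) simp
    moreover have "(\<lambda>n. (LINT s|lborel. indicator I s * (w s * f n s))\<^sup>2) \<longlonglongrightarrow> (w s0)\<^sup>2" by (intro tendsto_power lim)
    ultimately show "(w s0)\<^sup>2 \<le> C * E s0" using bnd by (intro LIMSEQ_le) auto
  qed
qed

text \<open>Its point is that w tends to 0 at B, which replaces the boundary condition and later
  produces the outer critical point.\<close>

lemma outer_boundary_bound:
  obtains C where "C \<ge> 0" "\<And>s. s \<in> I \<Longrightarrow> (w s)\<^sup>2 \<le> C * ((B - s) * s powr (- \<nu>))"
proof -
  obtain C where C: "C \<ge> 0" "\<And>s0 h E. s0 \<in> I \<Longrightarrow> isCont E s0 \<Longrightarrow>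
    (\<And>x. A < x \<Longrightarrow> x < s0 \<Longrightarrow> integrable lborel (\<lambda>s. indicator {x<..<B} s * h x s)) \<Longrightarrow>
    (\<And>x. A < x \<Longrightarrow> x < s0 \<Longrightarrow> (LINT s|lborel. indicator {x<..<B} s * h x s) \<le> E x) \<Longrightarrow>
    (\<And>x s. A < x \<Longrightarrow> x < s0 \<Longrightarrow> x < s \<Longrightarrow> s < B \<Longrightarrow> s powr (- \<nu>) \<le> h x s) \<Longrightarrow> (w s0)\<^sup>2 \<le> C * E s0"
    by (rule right_bound) blast
  show ?thesis
  proof (rule that[OF C(1)])
    fix s assume s: "s \<in> I"
    show "(w s)\<^sup>2 \<le> C * ((B - s) * s powr (- \<nu>))"
    proof (rule C(2)[where h="\<lambda>x s. x powr (- \<nu>)"])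
      show "isCont (\<lambda>x. (B - x) * x powr (- \<nu>)) s" using I_pos[OF s] by (intro continuous_intros) auto
      fix x assume x: "A < x" "x < s"
      show "integrable lborel (\<lambda>s. indicator {x<..<B} s * x powr (- \<nu>))"
        by (intro integrable_mult_left integrable_real_indicator) auto
      have "(LINT s|lborel. indicator {x<..<B} s * x powr (- \<nu>)) = measure lborel {x<..<B} * x powr (- \<nu>)" by simp
      then show "(LINT s|lborel. indicator {x<..<B} s * x powr (- \<nu>)) \<le> (B - x) * x powr (- \<nu>)" using x s by simp
      show "t powr (- \<nu>) \<le> x powr (- \<nu>)" if "x < t" "t < B" for t
        using that x AB nu by (intro powr_mono2') auto
    qed (rule s)
  qed
qed

text \<open>For \<nu> = 1 the integral of s powr (-\<nu>) is a logarithm. The slack \<kappa> trades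
  it for a small power, so that all \<nu> \<ge> 1 are treated alike.\<close>

lemma inner_growth_bound:
  assumes \<kappa>: "\<kappa> > 0"
  obtains C where "C \<ge> 0" "\<And>s. s \<in> I \<Longrightarrow> (w s)\<^sup>2 \<le> C * s powr (1 - \<nu> - \<kappa>)"
proof -
  obtain C where C: "C \<ge> 0" "\<And>s0 h E. s0 \<in> I \<Longrightarrow> isCont E s0 \<Longrightarrow>
    (\<And>x. A < x \<Longrightarrow> x < s0 \<Longrightarrow> integrable lborel (\<lambda>s. indicator {x<..<B} s * h x s)) \<Longrightarrow>
    (\<And>x. A < x \<Longrightarrow> x < s0 \<Longrightarrow> (LINT s|lborel. indicator {x<..<B} s * h x s) \<le> E x) \<Longrightarrow>
    (\<And>x s. A < x \<Longrightarrow> x < s0 \<Longrightarrow> x < s \<Longrightarrow> s < B \<Longrightarrow> s powr (- \<nu>) \<le> h x s) \<Longrightarrow> (w s0)\<^sup>2 \<le> C * E s0"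
    by (rule right_bound) blast
  define m where "m = \<nu> + \<kappa> - 1"
  have m: "m > 0" using nu \<kappa> by (simp add: m_def)
  show ?thesis
  proof (rule that[of "C * (B powr \<kappa> / m)"])
    show "0 \<le> C * (B powr \<kappa> / m)" using C(1) m by simp
    fix s assume s: "s \<in> I"
    have "(w s)\<^sup>2 \<le> C * (B powr \<kappa> / m * s powr (- m))"
    proof (rule C(2)[where h="\<lambda>x s. B powr \<kappa> * s powr (- m - 1)"])
      show "isCont (\<lambda>x. B powr \<kappa> / m * x powr (- m)) s" using I_pos[OF s] by (intro continuous_intros) auto
      fix x assume x: "A < x" "x < s"
      have x0: "x > 0" using x AB by simp
      have con: "continuous_on {x / 2..B + 1} (\<lambda>s. B powr \<kappa> * s powr (- m - 1))" using x0 by (intro continuous_intros) auto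
      show "integrable lborel (\<lambda>s. indicator {x<..<B} s * (B powr \<kappa> * s powr (- m - 1)))"
        by (rule integrable_on_compact_subinterval(2)[OF continuous_on_subset[OF con]]) (use x0 in auto)
      have "(LINT s|lborel. indicator {x<..<B} s * (B powr \<kappa> * s powr (- m - 1))) =
          - (B powr \<kappa> / m) * B powr (- m) - - (B powr \<kappa> / m) * x powr (- m)"
      proof (rule integral_Ioo_FTC[OF _ _ con])
        fix t assume "x \<le> t" "t \<le> B"
        then have t: "t > 0" using x0 by simp
        have "((\<lambda>t. - (B powr \<kappa> / m) * t powr (- m)) has_real_derivative - (B powr \<kappa> / m) * (- m * t powr (- m - 1))) (at t)"
          by (intro DERIV_cmult has_real_derivative_powr t)
        then show "((\<lambda>t. - (B powr \<kappa> / m) * t powr (- m)) has_real_derivative B powr \<kappa> * t powr (- m - 1)) (at t)"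
          using m by simp
      qed (use x s x0 in auto)
      also have "\<dots> \<le> B powr \<kappa> / m * x powr (- m)" using m by simp
      finally show "(LINT s|lborel. indicator {x<..<B} s * (B powr \<kappa> * s powr (- m - 1))) \<le> B powr \<kappa> / m * x powr (- m)" .
      fix t assume t: "x < t" "t < B"
      have "t powr \<kappa> \<le> B powr \<kappa>" using t x0 \<kappa> by (intro powr_mono2) auto
      then have "t powr \<kappa> * t powr (- m - 1) \<le> B powr \<kappa> * t powr (- m - 1)" by (intro mult_right_mono) auto
      moreover have "t powr \<kappa> * t powr (- m - 1) = t powr (- \<nu>)" unfolding powr_add[symmetric] by (simp add: m_def)
      ultimately show "t powr (- \<nu>) \<le> B powr \<kappa> * t powr (- m - 1)" by simp
    qed (rule s)
    moreover have "1 - \<nu> - \<kappa> = - m" by (simp add: m_def)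
    ultimately show "(w s)\<^sup>2 \<le> C * (B powr \<kappa> / m) * s powr (1 - \<nu> - \<kappa>)" by (simp only: mult.assoc)
  qed
qed

text \<open>The mirror image of the bound at B. Z should be 1 between A and s0 but has to vanish
  near 0; its rise is placed on (A/3, A/2), outside the interval of integration, which is possible
  because A > 0.\<close>

lemma inner_boundary_bound:
  assumes A: "A > 0"
  obtains C where "C \<ge> 0" "\<And>s. s \<in> I \<Longrightarrow> (w s)\<^sup>2 \<le> C * (s - A)"
proof -
  obtain C where C: "C \<ge> 0" "\<And>Z a. smooth Z \<Longrightarrow> a > 0 \<Longrightarrow> (\<And>s. s < a \<Longrightarrow> Z s = 0) \<Longrightarrow>
    (LINT s|lborel. indicator I s * (w s * deriv Z s))\<^sup>2 \<le> C * (LINT s|lborel. indicator I s * (s powr (- \<nu>) * (Z s)\<^sup>2))"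
    by (rule gradient_bound_flux) blast
  obtain g where g: "smooth g" "\<And>s. g s \<ge> 0" "\<And>s. s \<le> A / 3 \<or> s \<ge> A / 2 \<Longrightarrow> g s = 0" "(LINT s|lborel. g s) = 1"
    using smooth_bump[of "A / 3" "A / 2"] A by auto
  show ?thesis
  proof (rule that[of "C * A powr (- \<nu>)"])
    show "0 \<le> C * A powr (- \<nu>)" using C(1) by simp
    fix s0 assume s0: "s0 \<in> I"
    define d where "d n = (B - s0) / (real n + 2)" for n
    have d: "0 < d n" "d n < B - s0" for n
    proof -
      show "0 < d n" using s0 by (simp add: d_def)
      have "(B - s0) / (real n + 2) < (B - s0) / 1" by (rule divide_strict_left_mono) (use s0 in auto)
      then show "d n < B - s0" by (simp add: d_def)
    qed
    have dl: "d \<longlonglongrightarrow> 0" unfolding d_def by real_asymp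
    have "\<exists>f. smooth f \<and> (\<forall>s. f s \<ge> 0) \<and> (\<forall>s. s \<le> s0 \<or> s \<ge> s0 + d n \<longrightarrow> f s = 0) \<and> (LINT s|lborel. f s) = 1" for n
      using smooth_bump[of s0 "s0 + d n"] d(1)[of n] by (metis less_add_same_cancel1)
    then obtain f where f: "\<And>n. smooth (f n)" "\<And>n s. f n s \<ge> 0" "\<And>n s. s \<le> s0 \<or> s \<ge> s0 + d n \<Longrightarrow> f n s = 0"
        "\<And>n. (LINT s|lborel. f n s) = 1" by metis
    have lim: "(\<lambda>n. LINT s|lborel. indicator I s * (w s * f n s)) \<longlonglongrightarrow> w s0"
      by (rule bump_average_limit[OF s0 f(1,2) _ f(4) dl]) (rule f(3), auto)
    have bnd: "(LINT s|lborel. indicator I s * (w s * f n s))\<^sup>2 \<le> C * A powr (- \<nu>) * (s0 + d n - A)" for n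
    proof -
      let ?y = "s0 + d n"
      have y: "s0 < ?y" "?y < B" "A < s0" using d[of n] s0 by auto
      obtain Z0 where Z0: "\<And>s. (Z0 has_real_derivative g s - f n s) (at s)"
        using primitive_exists[of UNIV "\<lambda>s. g s - f n s"] smooth_continuous[OF smooth_intros(7)[OF g(1) f(1)]] by auto
      define Z where "Z s = Z0 s - Z0 (A / 3)" for s
      have Zd: "(Z has_real_derivative g s - f n s) (at s)" for s
        unfolding Z_def[abs_def] by (auto intro!: derivative_eq_intros Z0)
      have sZ: "smooth Z" by (rule smooth_realI[OF Zd smooth_intros(7)[OF g(1) f(1)]])
      have dZ: "deriv Z s = g s - f n s" for s using Zd by (auto intro: DERIV_imp_deriv)
      have zl: "g s - f n s = 0" if "s < A / 3" for s
      proof -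
        have "f n s = 0" by (rule f(3)) (use that y A in auto)
        moreover have "g s = 0" by (rule g(3)) (use that in auto)
        ultimately show ?thesis by simp
      qed
      have zr: "g s - f n s = 0" if "s > ?y" for s
      proof -
        have "f n s = 0" by (rule f(3)) (use that in auto)
        moreover have "g s = 0" by (rule g(3)) (use that y A in auto)
        ultimately show ?thesis by simp
      qed
      have Zx: "Z s = 0" if "s \<le> A / 3" for s
        using constant_where_derivative_zero(1)[of Z "\<lambda>s. g s - f n s" "A / 3" ?y s, OF Zd zl zr that] by (simp add: Z_def)
      have ig: "integrable lborel g" by (rule smooth_integrable[OF g(1), of "A / 3" "A / 2"]) (rule g(3), auto)
      have if': "integrable lborel (f n)" by (rule smooth_integrable[OF f(1), of s0 ?y]) (rule f(3), auto)
      have "(LINT s|lborel. g s - f n s) = Z ?y - Z (A / 3)"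
        by (rule integral_compact_support_FTC[OF _ Zd smooth_continuous[OF smooth_intros(7)[OF g(1) f(1)]]]) (use y A zl zr in auto)
      then have "Z ?y = 0" using ig if' g(4) f(4)[of n] Zx[of "A / 3"] by simp
      then have Zy: "Z s = 0" if "s \<ge> ?y" for s
        using constant_where_derivative_zero(2)[of Z "\<lambda>s. g s - f n s" "A / 3" ?y s, OF Zd zl zr that] by simp
      have ZI: "0 \<le> Z s" "Z s \<le> 1" if s: "s \<in> I" for s
      proof -
        have df: "Z ?y - Z s \<le> 0" if "s \<le> ?y"
        proof -
          have "Z ?y \<le> Z s"
          proof (rule DERIV_nonpos_imp_nonincreasing[OF that])
            fix x assume "s \<le> x" "x \<le> ?y"
            then have "g x = 0" using s A by (intro g(3)) auto
            then show "\<exists>y. (Z has_real_derivative y) (at x) \<and> y \<le> 0" using Zd[of x] f(2)[of n x] by (intro exI[of _ "g x - f n x"]) simp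
          qed
          then show ?thesis by simp
        qed
        show "0 \<le> Z s" using df Zy[of s] \<open>Z ?y = 0\<close> by (cases "s \<le> ?y") auto
        obtain G0 where G0: "\<And>s. (G0 has_real_derivative g s) (at s)"
          using primitive_exists[of UNIV g] smooth_continuous[OF g(1)] by auto
        have gl: "g x = 0" if "x < A / 3" for x by (rule g(3)) (use that in auto)
        have gr: "g x = 0" if "x > A / 2" for x by (rule g(3)) (use that in auto)
        have "1 = G0 (A / 2) - G0 (A / 3)" unfolding g(4)[symmetric]
          by (rule integral_compact_support_FTC[OF _ G0 smooth_continuous[OF g(1)]]) (use A gl gr in auto)
        moreover have "G0 s = G0 (A / 2)" using constant_where_derivative_zero(2)[of G0 g "A / 3" "A / 2" s, OF G0 gl gr] s A by auto
        moreover have "Z s - G0 s \<le> Z (A / 3) - G0 (A / 3)"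
        proof (rule DERIV_nonpos_imp_nonincreasing[of "A / 3" s "\<lambda>s. Z s - G0 s"])
          fix x show "\<exists>y. ((\<lambda>s. Z s - G0 s) has_real_derivative y) (at x) \<and> y \<le> 0"
            using DERIV_diff[OF Zd[of x] G0[of x]] f(2)[of n x] by (intro exI[of _ "g x - f n x - g x"]) simp
        qed (use s A in auto)
        ultimately show "Z s \<le> 1" using Zx[of "A / 3"] by simp
      qed
      define Z1 where "Z1 s = (if s \<in> I then Z s else 0)" for s
      have "(LINT s|lborel. indicator I s * (w s * f n s))\<^sup>2 = (LINT s|lborel. indicator I s * (w s * deriv Z s))\<^sup>2"
      proof -
        have "indicator I s * (w s * deriv Z s) = - (indicator I s * (w s * f n s))" for s
          using g(3)[of s] A by (auto simp: dZ indicator_def)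
        then show ?thesis by simp
      qed
      also have "\<dots> \<le> C * (LINT s|lborel. indicator I s * (s powr (- \<nu>) * (Z s)\<^sup>2))"
        by (rule C(2)[OF sZ, of "A / 3"]) (use Zx A in auto)
      also have "(LINT s|lborel. indicator I s * (s powr (- \<nu>) * (Z s)\<^sup>2)) = (LINT s|lborel. indicator I s * (s powr (- \<nu>) * (Z1 s)\<^sup>2))"
        by (rule Bochner_Integration.integral_cong) (auto simp: Z1_def indicator_def)
      also have "C * \<dots> \<le> C * (LINT s|lborel. indicator {A<..<?y} s * A powr (- \<nu>))"
      proof (rule mult_left_mono[OF integral_weight_le C(1)])
        show "0 \<le> Z1 s \<and> Z1 s \<le> 1" for s using ZI[of s] by (auto simp: Z1_def)
        show "indicator I s * Z1 s = 0" if "s \<notin> {A<..<?y}" for s using that Zy[of s] by (auto simp: Z1_def)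
        show "integrable lborel (\<lambda>s. indicator {A<..<?y} s * A powr (- \<nu>))"
          by (intro integrable_mult_left integrable_real_indicator) auto
        show "s powr (- \<nu>) \<le> A powr (- \<nu>)" if "s \<in> {A<..<?y}" for s using that A nu by (intro powr_mono2') auto
      qed simp
      also have "(LINT s|lborel. indicator {A<..<?y} s * A powr (- \<nu>)) = (?y - A) * A powr (- \<nu>)"
        using y by simp
      finally show ?thesis by (simp add: mult_ac)
    qed
    have "(\<lambda>n. C * A powr (- \<nu>) * (s0 + d n - A)) \<longlonglongrightarrow> C * A powr (- \<nu>) * (s0 + 0 - A)" by (intro tendsto_intros dl)
    moreover have "(\<lambda>n. (LINT s|lborel. indicator I s * (w s * f n s))\<^sup>2) \<longlonglongrightarrow> (w s0)\<^sup>2" by (intro tendsto_power lim)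
    ultimately have "(w s0)\<^sup>2 \<le> C * A powr (- \<nu>) * (s0 + 0 - A)" using bnd by (intro LIMSEQ_le) auto
    then show "(w s0)\<^sup>2 \<le> C * A powr (- \<nu>) * (s0 - A)" by simp
  qed
qed


subsection \<open>Behaviour at the centre of a ball\<close>

text \<open>On a ball the constant in the flux is 0, so the flux is -K / 4 and a power bound on w
  can be integrated from the centre; the condition on \<gamma> makes this integral converge.\<close>

lemma flux_bound:
  assumes A: "A = 0" and \<gamma>: "p * \<gamma> < \<nu> + \<alpha> / 2" and C: "C \<ge> 0" "\<And>s. 0 < s \<Longrightarrow> s \<le> B / 2 \<Longrightarrow> \<bar>w s\<bar> \<le> C * s powr (- \<gamma>)"
    and s: "0 < s" "s \<le> B / 2"
  shows "\<bar>s powr \<nu> * V s\<bar> \<le> C powr p / (4 * (\<nu> + \<alpha> / 2 - p * \<gamma>)) * s powr (\<nu> + \<alpha> / 2 - p * \<gamma>)"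
proof -
  let ?a = "\<nu> - 1 + \<alpha> / 2 - p * \<gamma>"
  have a: "?a > - 1" using \<gamma> by simp
  note i = integral_powr_from_0[OF a less_imp_le[OF s(1)]]
  have sI: "s \<in> I" using s A AB by auto
  have "\<bar>K s\<bar> \<le> (LINT t|lborel. \<bar>indicator {..s} t * k t\<bar>)"
    unfolding K_def by (rule integral_abs_bound)
  also have "\<dots> \<le> (LINT t|lborel. C powr p * (indicator {0<..<s} t * t powr ?a))"
  proof (rule integral_mono_AE)
    show "integrable lborel (\<lambda>t. \<bar>indicator {..s} t * k t\<bar>)"
      using integrable_mult_indicator[OF _ k_integrable, of "{..s}"] by simp
    show "integrable lborel (\<lambda>t. C powr p * (indicator {0<..<s} t * t powr ?a))" using i(1) by simp
    have "AE t in lborel. t \<noteq> s" by (rule AE_lborel_singleton)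
    with vw show "AE t in lborel. \<bar>indicator {..s} t * k t\<bar> \<le> C powr p * (indicator {0<..<s} t * t powr ?a)"
    proof eventually_elim
      case (elim t)
      show ?case
      proof (cases "0 < t \<and> t < s")
        case True
        then have tI: "t \<in> I" using s A AB by auto
        have "\<bar>w t\<bar> powr p \<le> (C * t powr (- \<gamma>)) powr p" using C(2)[of t] True s p by (intro powr_mono2) auto
        also have "\<dots> = C powr p * t powr (- \<gamma> * p)" using C(1) by (simp add: powr_mult powr_powr)
        finally have "t powr (\<nu> - 1 + \<alpha> / 2) * \<bar>w t\<bar> powr p \<le> t powr (\<nu> - 1 + \<alpha> / 2) * (C powr p * t powr (- \<gamma> * p))"
          by (intro mult_left_mono) auto
        also have "\<dots> = C powr p * t powr ?a"
        proof -
          have "t powr (\<nu> - 1 + \<alpha> / 2) * t powr (- \<gamma> * p) = t powr ?a" unfolding powr_add[symmetric] by (simp add: mult.commute)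
          then show ?thesis by (simp add: mult.left_commute)
        qed
        finally show ?thesis using True tI elim by (simp add: k_def abs_mult)
      next
        case False
        then consider "t \<notin> I" | "t > s" using elim A by force
        then have "indicator {..s} t * k t = 0" by cases (auto simp: k_def)
        then show ?thesis using False by simp
      qed
    qed
  qed
  also have "\<dots> = C powr p * (s powr (?a + 1) / (?a + 1))" using i(2) by simp
  finally have Kb: "\<bar>K s\<bar> \<le> C powr p * (s powr (\<nu> + \<alpha> / 2 - p * \<gamma>) / (\<nu> + \<alpha> / 2 - p * \<gamma>))" by (simp add: algebra_simps)
  have q: "y / 4 \<le> c1 / (4 * X) * c2" if "y \<le> c1 * (c2 / X)" for y c1 c2 X :: real
    using that by simp
  have "\<bar>s powr \<nu> * V s\<bar> = \<bar>K s\<bar> / 4" using flux[OF sI] no_flux[OF A] by simp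
  then show ?thesis using q[OF Kb] by (simp only:)
qed

text \<open>The flux bound gives |V s| \<le> D s powr (\<alpha>/2 - p \<gamma>), and integration
  from s to B/2 improves the exponent of w. The integration is a monotonicity argument for w plus or
  minus a multiple of s powr (-\<gamma>'); \<gamma>' > 0 avoids the logarithmic case.\<close>

lemma bootstrap_step:
  assumes A: "A = 0" and \<gamma>: "p * \<gamma> < \<nu> + \<alpha> / 2" and C: "C \<ge> 0" "\<And>s. 0 < s \<Longrightarrow> s \<le> B / 2 \<Longrightarrow> \<bar>w s\<bar> \<le> C * s powr (- \<gamma>)"
    and \<gamma>': "\<gamma>' > 0" "p * \<gamma> - 1 - \<alpha> / 2 \<le> \<gamma>'"
  shows "\<exists>C'\<ge>0. \<forall>s. 0 < s \<longrightarrow> s \<le> B / 2 \<longrightarrow> \<bar>w s\<bar> \<le> C' * s powr (- \<gamma>')"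
proof -
  define r where "r = B / 2"
  have r: "r > 0" "r < B" using A AB by (auto simp: r_def)
  define e where "e = \<alpha> / 2 - p * \<gamma> + 1 + \<gamma>'"
  have e: "e \<ge> 0" using \<gamma>' by (simp add: e_def)
  define D where "D = C powr p / (4 * (\<nu> + \<alpha> / 2 - p * \<gamma>))"
  have D: "D \<ge> 0" using \<gamma> by (simp add: D_def)
  define D' where "D' = D * r powr e / \<gamma>'"
  have D': "D' \<ge> 0" using D \<gamma>' by (simp add: D'_def)
  have Vb: "\<bar>V s\<bar> \<le> \<gamma>' * D' * s powr (- \<gamma>' - 1)" if s: "0 < s" "s \<le> r" for s
  proof -
    have sI: "s \<in> I" using s r A by auto
    have "\<bar>V s\<bar> = s powr (- \<nu>) * \<bar>s powr \<nu> * V s\<bar>" by (subst V_eq[OF sI]) (simp add: abs_mult)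
    also have "\<dots> \<le> s powr (- \<nu>) * (D * s powr (\<nu> + \<alpha> / 2 - p * \<gamma>))"
      using flux_bound[OF A \<gamma> C] s unfolding D_def r_def by (intro mult_left_mono) auto
    also have "\<dots> = D * (s powr e * s powr (- \<gamma>' - 1))"
    proof -
      have "s powr (- \<nu>) * s powr (\<nu> + \<alpha> / 2 - p * \<gamma>) = s powr e * s powr (- \<gamma>' - 1)"
        unfolding powr_add[symmetric] e_def by (simp add: algebra_simps)
      then show ?thesis by (simp add: mult.left_commute)
    qed
    also have "\<dots> \<le> D * (r powr e * s powr (- \<gamma>' - 1))"
      using s e D by (intro mult_left_mono mult_right_mono powr_mono2) auto
    also have "\<dots> = \<gamma>' * D' * s powr (- \<gamma>' - 1)" using \<gamma>' by (simp add: D'_def)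
    finally show ?thesis .
  qed
  let ?h = "\<lambda>t. D' * t powr (- \<gamma>')"
  have hd: "(?h has_real_derivative - (\<gamma>' * D' * t powr (- \<gamma>' - 1))) (at t)" if "t > 0" for t
    using DERIV_cmult[OF has_real_derivative_powr[OF that, of "- \<gamma>'"], of D'] by (simp add: mult_ac)
  have main: "\<bar>w s\<bar> \<le> \<bar>w r\<bar> + D' * s powr (- \<gamma>')" if s: "0 < s" "s \<le> r" for s
  proof -
    have wI: "(w has_real_derivative V t) (at t)" if "s \<le> t" "t \<le> r" for t
      by (rule w_deriv) (use that s r A in auto)
    have "w s - ?h s \<le> w r - ?h r"
    proof (rule DERIV_nonneg_imp_nondecreasing[OF s(2), of "\<lambda>t. w t - ?h t"])
      fix t assume t: "s \<le> t" "t \<le> r"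
      then show "\<exists>y. ((\<lambda>t. w t - ?h t) has_real_derivative y) (at t) \<and> 0 \<le> y"
        using DERIV_diff[OF wI[OF t] hd[of t]] Vb[of t] s by (intro exI[of _ "V t - - (\<gamma>' * D' * t powr (- \<gamma>' - 1))"]) auto
    qed
    moreover have "w s + ?h s \<ge> w r + ?h r"
    proof (rule DERIV_nonpos_imp_nonincreasing[OF s(2), of "\<lambda>t. w t + ?h t"])
      fix t assume t: "s \<le> t" "t \<le> r"
      then show "\<exists>y. ((\<lambda>t. w t + ?h t) has_real_derivative y) (at t) \<and> y \<le> 0"
        using DERIV_add[OF wI[OF t] hd[of t]] Vb[of t] s by (intro exI[of _ "V t + - (\<gamma>' * D' * t powr (- \<gamma>' - 1))"]) auto
    qed
    moreover have "?h r \<ge> 0" using D' by simp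
    ultimately show ?thesis by linarith
  qed
  show ?thesis
  proof (intro exI[of _ "\<bar>w r\<bar> * r powr \<gamma>' + D'"] conjI allI impI)
    show "0 \<le> \<bar>w r\<bar> * r powr \<gamma>' + D'" using D' by simp
    fix s assume s: "0 < s" "s \<le> B / 2"
    have "r powr \<gamma>' * s powr (- \<gamma>') \<ge> 1"
    proof -
      have "1 = s powr \<gamma>' * s powr (- \<gamma>')" using s by (simp add: powr_add[symmetric])
      also have "\<dots> \<le> r powr \<gamma>' * s powr (- \<gamma>')" using s \<gamma>' by (intro mult_right_mono powr_mono2) (auto simp: r_def)
      finally show ?thesis .
    qed
    then have "\<bar>w r\<bar> * 1 \<le> \<bar>w r\<bar> * (r powr \<gamma>' * s powr (- \<gamma>'))" by (intro mult_left_mono) auto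
    then show "\<bar>w s\<bar> \<le> (\<bar>w r\<bar> * r powr \<gamma>' + D') * s powr (- \<gamma>')"
      using main[of s] s by (simp add: r_def algebra_simps)
  qed
qed

text \<open>This is where the growth of the nonlinearity has to be subcritical.\<close>

lemma decay:
  assumes A: "A = 0"
  obtains \<gamma> C where "p * \<gamma> < \<nu> / 2 + \<alpha> / 4" "C \<ge> 0" "\<And>s. 0 < s \<Longrightarrow> s \<le> B / 2 \<Longrightarrow> \<bar>w s\<bar> \<le> C * s powr (- \<gamma>)"
proof -
  have q: "p * (\<nu> - 1) < 2 * \<nu> + \<alpha>"
    using subcritical nu by (simp add: algebra_simps)
  \<comment> \<open>Each entry is half a gap divided by p: the first one keeps the gain \<delta>
    positive, the second one keeps p * \<gamma>0 below \<nu> + \<alpha>/2, where the bootstrap may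
    start.\<close>
  define \<kappa> where "\<kappa> = min ((2 + \<alpha> - (p - 1) * (\<nu> - 1)) / (2 * p)) ((2 * \<nu> + \<alpha> - p * (\<nu> - 1)) / (2 * p))"
  have \<kappa>: "\<kappa> > 0" using subcritical q p by (simp add: \<kappa>_def)
  have pk: "p * \<kappa> \<le> (2 + \<alpha> - (p - 1) * (\<nu> - 1)) / 2" "p * \<kappa> \<le> (2 * \<nu> + \<alpha> - p * (\<nu> - 1)) / 2"
  proof -
    have "\<kappa> \<le> (2 + \<alpha> - (p - 1) * (\<nu> - 1)) / (2 * p)" "\<kappa> \<le> (2 * \<nu> + \<alpha> - p * (\<nu> - 1)) / (2 * p)" by (simp_all add: \<kappa>_def)
    then show "p * \<kappa> \<le> (2 + \<alpha> - (p - 1) * (\<nu> - 1)) / 2" "p * \<kappa> \<le> (2 * \<nu> + \<alpha> - p * (\<nu> - 1)) / 2"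
      using p by (auto simp: field_simps)
  qed
  define \<gamma>0 where "\<gamma>0 = (\<nu> - 1 + \<kappa>) / 2"
  have \<gamma>0: "\<gamma>0 > 0" using nu \<kappa> by (simp add: \<gamma>0_def)
  \<comment> \<open>The gain per step: the bootstrap allows \<gamma> to be replaced by p \<gamma> -
    1 - \<alpha>/2 as long as positivity is kept, and this is at most \<gamma> - \<delta> for
    \<gamma> \<le> \<gamma>0.\<close>
  define \<delta> where "\<delta> = 1 + \<alpha> / 2 - (p - 1) * \<gamma>0"
  have \<delta>: "\<delta> > 0"
  proof -
    have "(p - 1) * \<gamma>0 = ((p - 1) * (\<nu> - 1) + p * \<kappa> - \<kappa>) / 2" by (simp add: \<gamma>0_def algebra_simps)
    then show ?thesis using pk(1) \<kappa> subcritical unfolding \<delta>_def by (simp add: field_simps)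
  qed
  have p\<gamma>0: "p * \<gamma>0 < \<nu> + \<alpha> / 2"
  proof -
    have "p * \<gamma>0 = (p * (\<nu> - 1) + p * \<kappa>) / 2" by (simp add: \<gamma>0_def algebra_simps)
    then show ?thesis using pk(2) q by (simp add: field_simps)
  qed
  obtain C0 where C0: "C0 \<ge> 0" "\<And>s. s \<in> I \<Longrightarrow> (w s)\<^sup>2 \<le> C0 * s powr (1 - \<nu> - \<kappa>)"
    using inner_growth_bound[OF \<kappa>] by blast
  \<comment> \<open>The target exponent: p * \<gamma>t \<le> 1/8 lies below \<nu>/2 + \<alpha>/4,
    which is at least 1/2, and \<gamma>t stays positive as the bootstrap step demands.\<close>
  define \<gamma>t where "\<gamma>t = min \<gamma>0 (1 / (8 * p))"
  have \<gamma>t: "0 < \<gamma>t" "\<gamma>t \<le> \<gamma>0" using \<gamma>0 p by (auto simp: \<gamma>t_def)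
  have "p * \<gamma>t \<le> p * (1 / (8 * p))" using p by (intro mult_left_mono) (auto simp: \<gamma>t_def)
  then have p\<gamma>t: "p * \<gamma>t < \<nu> / 2 + \<alpha> / 4" using p nu al by simp
  define \<gamma> where "\<gamma> n = max \<gamma>t (\<gamma>0 - real n * \<delta>)" for n :: nat
  have \<gamma>pos: "\<gamma> n > 0" for n using \<gamma>t by (simp add: \<gamma>_def max_def)
  have "\<exists>C\<ge>0. \<forall>s. 0 < s \<longrightarrow> s \<le> B / 2 \<longrightarrow> \<bar>w s\<bar> \<le> C * s powr (- \<gamma> n)" for n
  proof (induction n)
    case 0
    show ?case
    proof (intro exI[of _ "sqrt C0"] conjI allI impI)
      fix s assume s: "0 < s" "s \<le> B / 2"
      have sI: "s \<in> I" using s A by auto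
      have g: "\<gamma> 0 = \<gamma>0" using \<gamma>t by (simp add: \<gamma>_def)
      have "(s powr (- \<gamma>0))\<^sup>2 = s powr (1 - \<nu> - \<kappa>)"
        by (simp add: power2_eq_square powr_add[symmetric] \<gamma>0_def)
      then have "(w s)\<^sup>2 \<le> (sqrt C0 * s powr (- \<gamma>0))\<^sup>2" using C0(2)[OF sI] C0(1) by (simp add: power_mult_distrib)
      then have "\<bar>w s\<bar> \<le> \<bar>sqrt C0 * s powr (- \<gamma>0)\<bar>" by (simp only: abs_le_square_iff)
      then show "\<bar>w s\<bar> \<le> sqrt C0 * s powr (- \<gamma> 0)" using C0(1) by (simp add: g)
    qed (use C0 in simp)
  next
    case (Suc n)
    then obtain C where C: "C \<ge> 0" "\<And>s. 0 < s \<Longrightarrow> s \<le> B / 2 \<Longrightarrow> \<bar>w s\<bar> \<le> C * s powr (- \<gamma> n)" by blast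
    have le: "\<gamma> n \<le> \<gamma>0" using \<gamma>t \<delta> by (simp add: \<gamma>_def)
    have "p * \<gamma> n \<le> p * \<gamma>0" using le p by (intro mult_left_mono) auto
    then have c1: "p * \<gamma> n < \<nu> + \<alpha> / 2" using p\<gamma>0 by linarith
    have "(p - 1) * \<gamma> n \<le> (p - 1) * \<gamma>0" using le p by (intro mult_left_mono) auto
    then have "p * \<gamma> n - 1 - \<alpha> / 2 \<le> \<gamma> n - \<delta>" unfolding \<delta>_def by (simp add: algebra_simps)
    also have "\<dots> \<le> \<gamma> (Suc n)" using \<delta> unfolding \<gamma>_def by (auto simp: max_def algebra_simps)
    finally show ?case using bootstrap_step[OF A c1 C \<gamma>pos] by blast
  qed
  moreover obtain n where "\<gamma> n = \<gamma>t"
  proof -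
    obtain n where "\<gamma>0 / \<delta> < real n" using reals_Archimedean2 by blast
    then have "\<gamma>0 < real n * \<delta>" using \<delta> by (simp add: field_simps)
    then have "\<gamma> n = \<gamma>t" using \<gamma>t by (simp add: \<gamma>_def max_def)
    then show ?thesis by (rule that)
  qed
  ultimately show ?thesis using that[OF p\<gamma>t] by metis
qed

text \<open>The two quantities that make up the contribution of the left end on a ball. Inserting
  the bounds for the flux and for w gives in both cases the exponent \<nu> + \<alpha>/2 - 2 p
  \<gamma>, whose positivity is exactly what \<open>decay\<close> guarantees.\<close>

lemma centre_limits:
  assumes A: "A = 0"
  shows "((\<lambda>l. l powr (\<nu> - \<alpha> / 2) * (V l)\<^sup>2) \<longlongrightarrow> 0) (at_right 0)"
    and "((\<lambda>l. l powr \<nu> * V l * spow p (w l)) \<longlongrightarrow> 0) (at_right 0)"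
proof -
  obtain \<gamma> C where \<gamma>: "p * \<gamma> < \<nu> / 2 + \<alpha> / 4" and C: "C \<ge> 0" "\<And>s. 0 < s \<Longrightarrow> s \<le> B / 2 \<Longrightarrow> \<bar>w s\<bar> \<le> C * s powr (- \<gamma>)"
    by (rule decay[OF A]) blast
  have \<gamma>2: "p * \<gamma> < \<nu> + \<alpha> / 2" using \<gamma> nu al by linarith
  define D where "D = C powr p / (4 * (\<nu> + \<alpha> / 2 - p * \<gamma>))"
  define e where "e = \<nu> + \<alpha> / 2 - 2 * (p * \<gamma>)"
  have e: "e > 0" using \<gamma> by (simp add: e_def)
  have le0: "((\<lambda>l. c * l powr e) \<longlongrightarrow> 0) (at_right 0)" for c
  proof -
    have "((\<lambda>l. l powr e) \<longlongrightarrow> 0) (at_right (0::real))"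
      using e by (intro tendsto_eq_intros) (auto simp: eventually_at_right_less intro: eventually_mono[OF eventually_at_right_less])
    from tendsto_mult[OF tendsto_const this, of c] show ?thesis by simp
  qed
  have ev: "eventually (\<lambda>l. 0 < l \<and> l \<le> B / 2) (at_right 0)"
    using A AB by (auto simp: eventually_at_right_field intro!: exI[of _ "B / 2"])
  have fb: "\<bar>s powr \<nu> * V s\<bar> \<le> D * s powr (\<nu> + \<alpha> / 2 - p * \<gamma>)" if "0 < s" "s \<le> B / 2" for s
    using flux_bound[OF A \<gamma>2 C that] by (simp add: D_def)
  show "((\<lambda>l. l powr (\<nu> - \<alpha> / 2) * (V l)\<^sup>2) \<longlongrightarrow> 0) (at_right 0)"
  proof (rule Lim_null_comparison[OF _ le0[of "D\<^sup>2"]])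
    show "eventually (\<lambda>l. norm (l powr (\<nu> - \<alpha> / 2) * (V l)\<^sup>2) \<le> D\<^sup>2 * l powr e) (at_right 0)"
      using ev
    proof eventually_elim
      case (elim s)
      then have sI: "s \<in> I" using A by auto
      have "(s powr \<nu> * V s)\<^sup>2 \<le> (D * s powr (\<nu> + \<alpha> / 2 - p * \<gamma>))\<^sup>2"
        using fb[of s] elim power_mono[of "\<bar>s powr \<nu> * V s\<bar>" _ 2] by fastforce
      then have "s powr (- \<nu> - \<alpha> / 2) * (s powr \<nu> * V s)\<^sup>2 \<le> s powr (- \<nu> - \<alpha> / 2) * (D * s powr (\<nu> + \<alpha> / 2 - p * \<gamma>))\<^sup>2"
        by (intro mult_left_mono) auto
      also have "\<dots> = D\<^sup>2 * (s powr (- \<nu> - \<alpha> / 2) * (s powr (\<nu> + \<alpha> / 2 - p * \<gamma>) * s powr (\<nu> + \<alpha> / 2 - p * \<gamma>)))"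
        by (simp add: power2_eq_square mult_ac)
      also have "s powr (- \<nu> - \<alpha> / 2) * (s powr (\<nu> + \<alpha> / 2 - p * \<gamma>) * s powr (\<nu> + \<alpha> / 2 - p * \<gamma>)) = s powr e"
        unfolding powr_add[symmetric] e_def by (simp add: algebra_simps)
      also have "s powr (- \<nu> - \<alpha> / 2) * (s powr \<nu> * V s)\<^sup>2 = (s powr (- \<nu> - \<alpha> / 2) * (s powr \<nu> * s powr \<nu>)) * (V s)\<^sup>2"
        by (simp add: power2_eq_square mult_ac)
      also have "s powr (- \<nu> - \<alpha> / 2) * (s powr \<nu> * s powr \<nu>) = s powr (\<nu> - \<alpha> / 2)"
        unfolding powr_add[symmetric] by simp
      finally show ?case by simp
    qed
  qed
  show "((\<lambda>l. l powr \<nu> * V l * spow p (w l)) \<longlongrightarrow> 0) (at_right 0)"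
  proof (rule Lim_null_comparison[OF _ le0[of "D * C powr p"]])
    show "eventually (\<lambda>l. norm (l powr \<nu> * V l * spow p (w l)) \<le> D * C powr p * l powr e) (at_right 0)"
      using ev
    proof eventually_elim
      case (elim s)
      have "\<bar>w s\<bar> powr p \<le> (C * s powr (- \<gamma>)) powr p" using C(2)[of s] elim p by (intro powr_mono2) auto
      also have "\<dots> = C powr p * s powr (- \<gamma> * p)" using C(1) by (simp add: powr_mult powr_powr)
      finally have "\<bar>s powr \<nu> * V s\<bar> * \<bar>w s\<bar> powr p \<le> (D * s powr (\<nu> + \<alpha> / 2 - p * \<gamma>)) * (C powr p * s powr (- \<gamma> * p))"
        using fb[of s] elim by (intro mult_mono order_trans[OF abs_ge_zero fb]) auto
      also have "\<dots> = D * C powr p * (s powr (\<nu> + \<alpha> / 2 - p * \<gamma>) * s powr (- \<gamma> * p))" by (simp add: mult_ac)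
      also have "s powr (\<nu> + \<alpha> / 2 - p * \<gamma>) * s powr (- \<gamma> * p) = s powr e"
        unfolding powr_add[symmetric] e_def by (simp add: algebra_simps)
      finally show ?case by (simp add: abs_mult)
    qed
  qed
qed

subsection \<open>Stability in the odd directions\<close>

lemma stability_limit:
  assumes ab: "A < a" "a < b" "b < B" and \<theta>: "test_limit a b \<theta>" and z: "(LINT s|lborel. \<theta> s) = 0"
  shows "p * (LINT s|lborel. indicator I s * (s powr (\<nu> + \<alpha> / 2) * (\<bar>w s\<bar> powr (p - 1) * (LINT t|lborel. indicator {..s} t * \<theta> t)\<^sup>2))) \<le>
      4 * (LINT s|lborel. indicator I s * (s powr (\<nu> + 1) * (\<theta> s)\<^sup>2))"
proof -
  obtain \<theta>n C where \<theta>n: "\<And>n. smooth (\<theta>n n)" "\<And>n s. s < a \<or> s > b \<Longrightarrow> \<theta>n n s = 0" "\<And>n s. \<bar>\<theta>n n s\<bar> \<le> C"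
      "\<And>s. (\<lambda>n. \<theta>n n s) \<longlonglongrightarrow> \<theta> s" for n :: nat
    using \<theta> unfolding test_limit_def by metis
  obtain f where f: "smooth f" "\<And>s. f s \<ge> 0" "\<And>s. s \<le> a \<or> s \<ge> b \<Longrightarrow> f s = 0" "(LINT s|lborel. f s) = 1"
    using smooth_bump[OF ab(2)] by blast
  have fz: "f s = 0" if "s < a \<or> s > b" for s by (rule f(3)) (use that in auto)
  have cap: "integrable lborel (\<lambda>s. c * indicator {a..b} s)" for c :: real
    by (intro integrable_mult_right integrable_real_indicator) (use ab in auto)
  have C0: "C \<ge> 0" using \<theta>n(3)[of 0 a] abs_ge_zero[of "\<theta>n 0 a"] by linarith
  have nm [measurable]: "\<theta>n n \<in> borel_measurable borel" "f \<in> borel_measurable borel" for n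
    using \<theta>n(1)[of n] f(1) by (auto intro: borel_measurable_continuous_onI smooth_continuous)
  have \<theta>m [measurable]: "\<theta> \<in> borel_measurable borel" by (rule borel_measurable_LIMSEQ_real[OF \<theta>n(4)]) auto
  define r where "r n = (LINT s|lborel. \<theta>n n s)" for n
  have r: "r \<longlonglongrightarrow> 0"
    unfolding r_def z[symmetric]
  proof (rule integral_dominated_convergence[OF _ _ cap[of C]])
    show "AE s in lborel. norm (\<theta>n n s) \<le> C * indicator {a..b} s" for n
    proof (intro AE_I2)
      fix s show "norm (\<theta>n n s) \<le> C * indicator {a..b} s"
        using \<theta>n(2)[of s n] \<theta>n(3)[of n s] by (cases "s \<in> {a..b}") auto
    qed
  qed (use \<theta>n(4) in auto)
  then have "Bseq r" by (intro convergent_imp_Bseq) (auto simp: convergent_def)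
  then obtain R where R: "R > 0" "\<And>n. \<bar>r n\<bar> \<le> R" by (auto elim!: BseqE)
  have "bounded (f ` {a..b})" by (intro compact_imp_bounded compact_continuous_image smooth_continuous[OF f(1)]) auto
  then obtain F where F: "\<forall>y\<in>f ` {a..b}. norm y \<le> F" unfolding bounded_iff by blast
  have Fb: "\<bar>f s\<bar> \<le> \<bar>F\<bar>" for s
  proof (cases "s \<in> {a..b}")
    case True
    then have "f s \<in> f ` {a..b}" by auto
    from bspec[OF F this] show ?thesis by simp
  next
    case False
    then have "f s = 0" by (intro fz) auto
    then show ?thesis by simp
  qed
  define D where "D = C + R * \<bar>F\<bar>"
  have D0: "D \<ge> 0" using C0 R(1) by (simp add: D_def)
  define g where "g n s = \<theta>n n s - r n * f s" for n s
  have g: "smooth (g n)" for n unfolding g_def[abs_def] by (intro smooth_intros \<theta>n(1) f(1))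
  have gz: "g n s = 0" if "s < a \<or> s > b" for n s using \<theta>n(2)[OF that] fz[OF that] by (simp add: g_def)
  have gD: "\<bar>g n s\<bar> \<le> D" for n s
  proof -
    have "\<bar>r n * f s\<bar> \<le> R * \<bar>F\<bar>" unfolding abs_mult using R Fb by (intro mult_mono) auto
    then show ?thesis using \<theta>n(3)[of n s] unfolding g_def D_def by linarith
  qed
  have gD': "norm (g n s) \<le> D * indicator {a..b} s" for n s
    using gD[of n s] gz[of s n] by (cases "s \<in> {a..b}") auto
  have gl: "(\<lambda>n. g n s) \<longlonglongrightarrow> \<theta> s" for s
  proof -
    have "(\<lambda>n. g n s) \<longlonglongrightarrow> \<theta> s - 0 * f s" unfolding g_def by (intro tendsto_intros \<theta>n(4) r)
    then show ?thesis by simp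
  qed
  have gm [measurable]: "g n \<in> borel_measurable borel" for n unfolding g_def[abs_def] by measurable
  have gi: "integrable lborel (g n)" for n
    by (rule Bochner_Integration.integrable_bound[OF cap[of D]]) (use gD' D0 in auto)
  have g0: "(LINT s|lborel. g n s) = 0" for n
  proof -
    have "integrable lborel (\<theta>n n)" by (rule smooth_integrable[OF \<theta>n(1)]) (rule \<theta>n(2), auto)
    moreover have "integrable lborel f" by (rule smooth_integrable[OF f(1), of a b]) (rule fz, auto)
    ultimately show ?thesis unfolding g_def using f(4) by (simp add: r_def)
  qed
  define G where "G n s = (LINT t|lborel. indicator {..s} t * g n t)" for n s
  define \<psi> where "\<psi> s = (LINT t|lborel. indicator {..s} t * \<theta> t)" for s
  have prim: "\<exists>Z. (\<forall>s. (Z has_real_derivative g n s) (at s)) \<and> Z = G n \<and> (\<forall>s<a. G n s = 0) \<and> (\<forall>s>b. G n s = 0)" for n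
  proof -
    obtain Z0 where Z0: "\<And>s. (Z0 has_real_derivative g n s) (at s)"
      using primitive_exists[of UNIV "g n"] smooth_continuous[OF g] by auto
    define Z where "Z s = Z0 s - Z0 a" for s
    have Zd: "(Z has_real_derivative g n s) (at s)" for s
      unfolding Z_def[abs_def] by (auto intro!: derivative_eq_intros Z0)
    have gzl: "g n s = 0" if "s < a" for s using gz that by simp
    have gzr: "g n s = 0" if "s > b" for s using gz that by simp
    have Zl: "Z s = 0" if "s \<le> a" for s
      using constant_where_derivative_zero(1)[of Z "g n" a b s, OF Zd gzl gzr that] by (simp add: Z_def)
    have "(LINT s|lborel. g n s) = Z b - Z a"
      by (rule integral_compact_support_FTC[OF _ Zd smooth_continuous[OF g]]) (use ab gz in auto)
    then have "Z b = 0" using g0[of n] Zl[of a] by simp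
    then have Zr: "Z s = 0" if "s \<ge> b" for s
      using constant_where_derivative_zero(2)[of Z "g n" a b s, OF Zd gzl gzr that] by simp
    have "G n s = Z s" for s
    proof (cases "s < a")
      case True
      then have "(\<lambda>t. indicator {..s} t * g n t) = (\<lambda>t. 0)" using gzl by (auto simp: indicator_def fun_eq_iff)
      then have "G n s = 0" by (simp add: G_def)
      then show ?thesis using Zl[of s] True by simp
    next
      case False
      have "(\<lambda>t. indicator {..s} t * g n t) = (\<lambda>t. g n t * indicator {a..s} t)" using gzl by (auto simp: indicator_def fun_eq_iff)
      then have "G n s = (LINT t|lborel. g n t * indicator {a..s} t)" by (simp add: G_def)
      also have "\<dots> = Z s - Z a"
        using False smooth_continuous[OF g, of UNIV n] by (intro integral_FTC_Icc_real Zd) (auto simp: continuous_on_eq_continuous_at)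
      finally show ?thesis using Zl[of a] by simp
    qed
    then have ZG: "Z = G n" by auto
    show ?thesis
      by (rule exI[of _ Z]) (use Zd ZG Zl Zr in auto)
  qed
  have Gd: "(G n has_real_derivative g n s) (at s)" for n s using prim[of n] by auto
  have sG: "smooth (G n)" for n by (rule smooth_realI[OF Gd g])
  have dG: "deriv (G n) = g n" for n using Gd by (auto intro: DERIV_imp_deriv)
  have Gz: "G n s = 0" if "s < a \<or> s > b" for n s using prim[of n] that by auto
  have st: "p * (LINT s|lborel. indicator I s * (s powr (\<nu> + \<alpha> / 2) * (\<bar>v s\<bar> powr (p - 1) * (G n s)\<^sup>2))) \<le>
      4 * (LINT s|lborel. indicator I s * (s powr (\<nu> + 1) * (g n s)\<^sup>2))" for n
    using stability[OF sG ab(1,3), of n] Gz unfolding dG by auto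
  have Gb: "\<bar>G n s\<bar> \<le> D * (b - a)" for n s
  proof -
    have "\<bar>G n s\<bar> \<le> (LINT t|lborel. \<bar>indicator {..s} t * g n t\<bar>)" unfolding G_def by (rule integral_abs_bound)
    also have "\<dots> \<le> (LINT t|lborel. D * indicator {a..b} t)"
    proof (rule integral_mono[OF _ cap])
      show "integrable lborel (\<lambda>t. \<bar>indicator {..s} t * g n t\<bar>)" using integrable_mult_indicator[OF _ gi, of "{..s}" n] by simp
      show "\<bar>indicator {..s} t * g n t\<bar> \<le> D * indicator {a..b} t" for t
        using gD'[of n t] D0 by (auto simp: abs_mult indicator_def)
    qed
    also have "\<dots> = D * (b - a)" using ab by simp
    finally show ?thesis .
  qed
  have Gl: "(\<lambda>n. G n s) \<longlonglongrightarrow> \<psi> s" for s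
    unfolding G_def \<psi>_def
  proof (rule integral_dominated_convergence[OF _ _ cap[of D]])
    show "AE t in lborel. norm (indicator {..s} t * g n t) \<le> D * indicator {a..b} t" for n
    proof (intro AE_I2)
      fix t show "norm (indicator {..s} t * g n t) \<le> D * indicator {a..b} t"
        using gD'[of n t] D0 by (auto simp: abs_mult indicator_def)
    qed
    show "AE t in lborel. (\<lambda>n. indicator {..s} t * g n t) \<longlonglongrightarrow> indicator {..s} t * \<theta> t"
      by (intro AE_I2 tendsto_intros gl)
  qed measurable
  have Gm [measurable]: "G n \<in> borel_measurable borel" for n
    by (rule borel_measurable_continuous_onI[OF smooth_continuous[OF sG]])
  have \<psi>m [measurable]: "\<psi> \<in> borel_measurable borel" by (rule borel_measurable_LIMSEQ_real[OF Gl]) auto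
  have ptw: "a > 0" using ab AB by simp
  have sub: "{a..b} \<subseteq> I" using ab by auto
  have "continuous_on {a..b} (\<lambda>s. s powr (\<nu> + \<alpha> / 2) * \<bar>w s\<bar> powr (p - 1))"
    using ptw p by (intro continuous_intros continuous_on_powr' w_continuous sub) auto
  then have "bounded ((\<lambda>s. s powr (\<nu> + \<alpha> / 2) * \<bar>w s\<bar> powr (p - 1)) ` {a..b})"
    by (intro compact_imp_bounded compact_continuous_image) auto
  then obtain H where H: "\<forall>y\<in>(\<lambda>s. s powr (\<nu> + \<alpha> / 2) * \<bar>w s\<bar> powr (p - 1)) ` {a..b}. norm y \<le> H" unfolding bounded_iff by blast
  have Hb: "s powr (\<nu> + \<alpha> / 2) * \<bar>w s\<bar> powr (p - 1) \<le> \<bar>H\<bar>" if "s \<in> {a..b}" for s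
  proof -
    have "s powr (\<nu> + \<alpha> / 2) * \<bar>w s\<bar> powr (p - 1) \<in> (\<lambda>s. s powr (\<nu> + \<alpha> / 2) * \<bar>w s\<bar> powr (p - 1)) ` {a..b}" using that by auto
    from bspec[OF H this] show ?thesis by simp
  qed
  have \<psi>z: "\<psi> s = 0" if "s < a \<or> s > b" for s
    using LIMSEQ_unique[OF Gl[of s]] Gz[OF that] by simp
  have L1: "(\<lambda>n. LINT s|lborel. indicator I s * (s powr (\<nu> + \<alpha> / 2) * (\<bar>v s\<bar> powr (p - 1) * (G n s)\<^sup>2))) \<longlonglongrightarrow>
      (LINT s|lborel. indicator I s * (s powr (\<nu> + \<alpha> / 2) * (\<bar>v s\<bar> powr (p - 1) * (\<psi> s)\<^sup>2)))"
  proof (rule integral_dominated_convergence[OF _ _ cap[of "\<bar>H\<bar> * (D * (b - a))\<^sup>2"]])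
    show "AE s in lborel. norm (indicator I s * (s powr (\<nu> + \<alpha> / 2) * (\<bar>v s\<bar> powr (p - 1) * (G n s)\<^sup>2))) \<le> \<bar>H\<bar> * (D * (b - a))\<^sup>2 * indicator {a..b} s" for n
      using vw
    proof eventually_elim
      case (elim s)
      show ?case
      proof (cases "s \<in> {a..b}")
        case True
        then have "v s = w s" using elim sub by auto
        moreover have "(G n s)\<^sup>2 \<le> (D * (b - a))\<^sup>2" using Gb[of n s] power_mono[of "\<bar>G n s\<bar>" _ 2] by fastforce
        then have "(s powr (\<nu> + \<alpha> / 2) * \<bar>w s\<bar> powr (p - 1)) * (G n s)\<^sup>2 \<le> \<bar>H\<bar> * (D * (b - a))\<^sup>2"
          using Hb[OF True] by (intro mult_mono) auto
        ultimately show ?thesis using True sub by (simp add: abs_mult mult.assoc indicator_def)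
      next
        case False
        then have "G n s = 0" by (intro Gz) auto
        then show ?thesis using False by simp
      qed
    qed
    show "AE s in lborel. (\<lambda>n. indicator I s * (s powr (\<nu> + \<alpha> / 2) * (\<bar>v s\<bar> powr (p - 1) * (G n s)\<^sup>2))) \<longlonglongrightarrow>
        indicator I s * (s powr (\<nu> + \<alpha> / 2) * (\<bar>v s\<bar> powr (p - 1) * (\<psi> s)\<^sup>2))"
      by (intro AE_I2 tendsto_mult tendsto_const tendsto_power Gl)
  qed measurable
  have L2: "(\<lambda>n. LINT s|lborel. indicator I s * (s powr (\<nu> + 1) * (g n s)\<^sup>2)) \<longlonglongrightarrow>
      (LINT s|lborel. indicator I s * (s powr (\<nu> + 1) * (\<theta> s)\<^sup>2))"
  proof (rule integral_dominated_convergence[OF _ _ cap[of "B powr (\<nu> + 1) * D\<^sup>2"]])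
    show "AE s in lborel. norm (indicator I s * (s powr (\<nu> + 1) * (g n s)\<^sup>2)) \<le> B powr (\<nu> + 1) * D\<^sup>2 * indicator {a..b} s" for n
    proof (intro AE_I2)
      fix s show "norm (indicator I s * (s powr (\<nu> + 1) * (g n s)\<^sup>2)) \<le> B powr (\<nu> + 1) * D\<^sup>2 * indicator {a..b} s"
      proof (cases "s \<in> {a..b}")
        case True
        have "(g n s)\<^sup>2 \<le> D\<^sup>2" using gD[of n s] power_mono[of "\<bar>g n s\<bar>" D 2] by simp
        moreover have "s powr (\<nu> + 1) \<le> B powr (\<nu> + 1)" using True ab ptw nu by (intro powr_mono2) auto
        ultimately have "s powr (\<nu> + 1) * (g n s)\<^sup>2 \<le> B powr (\<nu> + 1) * D\<^sup>2" by (intro mult_mono) auto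
        then show ?thesis using True sub by (simp add: abs_mult indicator_def)
      next
        case False
        then have "g n s = 0" by (intro gz) auto
        then show ?thesis using False by simp
      qed
    qed
    show "AE s in lborel. (\<lambda>n. indicator I s * (s powr (\<nu> + 1) * (g n s)\<^sup>2)) \<longlonglongrightarrow> indicator I s * (s powr (\<nu> + 1) * (\<theta> s)\<^sup>2)"
      by (intro AE_I2 tendsto_mult tendsto_const tendsto_power gl)
  qed measurable
  have "p * (LINT s|lborel. indicator I s * (s powr (\<nu> + \<alpha> / 2) * (\<bar>v s\<bar> powr (p - 1) * (\<psi> s)\<^sup>2))) \<le>
      4 * (LINT s|lborel. indicator I s * (s powr (\<nu> + 1) * (\<theta> s)\<^sup>2))"
    by (rule LIMSEQ_le[OF tendsto_mult[OF tendsto_const L1] tendsto_mult[OF tendsto_const L2]]) (use st in auto)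
  also have "(LINT s|lborel. indicator I s * (s powr (\<nu> + \<alpha> / 2) * (\<bar>v s\<bar> powr (p - 1) * (\<psi> s)\<^sup>2))) =
    (LINT s|lborel. indicator I s * (s powr (\<nu> + \<alpha> / 2) * (\<bar>w s\<bar> powr (p - 1) * (\<psi> s)\<^sup>2)))"
  proof (rule integral_cong_AE)
    show "AE s in lborel. indicator I s * (s powr (\<nu> + \<alpha> / 2) * (\<bar>v s\<bar> powr (p - 1) * (\<psi> s)\<^sup>2)) =
        indicator I s * (s powr (\<nu> + \<alpha> / 2) * (\<bar>w s\<bar> powr (p - 1) * (\<psi> s)\<^sup>2))"
      using vw by eventually_elim (auto simp: indicator_def)
    have "(\<lambda>s. indicator I s *\<^sub>R (s powr (\<nu> + \<alpha> / 2) * \<bar>w s\<bar> powr (p - 1))) \<in> borel_measurable borel"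
      using AB p by (intro borel_measurable_continuous_on_indicator continuous_intros continuous_on_powr' w_continuous) auto
    then have "(\<lambda>s. (indicator I s *\<^sub>R (s powr (\<nu> + \<alpha> / 2) * \<bar>w s\<bar> powr (p - 1))) * (\<psi> s)\<^sup>2) \<in> borel_measurable borel" by measurable
    then show "(\<lambda>s. indicator I s * (s powr (\<nu> + \<alpha> / 2) * (\<bar>w s\<bar> powr (p - 1) * (\<psi> s)\<^sup>2))) \<in> borel_measurable lborel"
      by (simp add: mult.assoc)
  qed measurable
  finally show ?thesis by (simp add: \<psi>_def)
qed


subsection \<open>Cutting off the transformed derivative\<close>

text \<open>The direction \<open>x\<^sub>i \<psi>0(|x|\<^sup>2)\<close> is a multiple of \<open>|x| powr (- \<alpha> / 2)\<close> times the \<open>i\<close>-th partial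
  derivative of \<open>u\<close>, the second variation in this direction has density \<open>F\<close>, and \<open>Q\<close> is the
  boundary term of the integration by parts: by the differentiated equation \<open>Q' - F\<close> is
  \<open>\<alpha> * m * s powr (\<nu> - 1 - \<alpha> / 2) * (V s)\<^sup>2\<close>.\<close>

definition "m = \<nu> + \<alpha> / 4"
definition "W s = - spow p (w s) / 4" for s
definition "Y s = s powr \<nu> * V s" for s
definition "\<psi>0 s = s powr (- m) * Y s" for s
definition "\<psi>1 s = s powr (- m) * (s powr (\<nu> - 1 + \<alpha> / 2) * W s) - m * s powr (- m - 1) * Y s" for s
definition "Q s = 4 * Y s * W s - 4 * m * s powr (- \<nu> - \<alpha> / 2) * (Y s)\<^sup>2" for s
definition "F s = 4 * (s powr (\<nu> + 1) * (\<psi>1 s)\<^sup>2) - p * (s powr (\<nu> + \<alpha> / 2) * (\<bar>w s\<bar> powr (p - 1) * (\<psi>0 s)\<^sup>2))" for s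

lemma m_pos: "m > 0" using nu al by (simp add: m_def)

lemma Y_deriv: "s \<in> I \<Longrightarrow> (Y has_real_derivative s powr (\<nu> - 1 + \<alpha> / 2) * W s) (at s)"
  using flux_deriv[of s] unfolding Y_def[abs_def] W_def by simp

lemma W_deriv:
  assumes s: "s \<in> I" shows "(W has_real_derivative - p * \<bar>w s\<bar> powr (p - 1) * V s / 4) (at s)"
proof -
  have "((\<lambda>s. - spow p (w s) / 4) has_real_derivative - (p * \<bar>w s\<bar> powr (p - 1) * V s) / 4) (at s)"
    by (auto intro!: derivative_eq_intros DERIV_chain2[OF spow_derivative[OF p] w_deriv[OF s]])
  then show ?thesis unfolding W_def[abs_def] by simp
qed

lemma Y_continuous: "S \<subseteq> I \<Longrightarrow> continuous_on S Y"
  using Y_deriv DERIV_isCont by (intro continuous_at_imp_continuous_on ballI) blast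

lemma W_continuous: "S \<subseteq> I \<Longrightarrow> continuous_on S W"
  using W_deriv DERIV_isCont by (intro continuous_at_imp_continuous_on ballI) blast

lemma \<psi>0_deriv:
  assumes s: "s \<in> I" shows "(\<psi>0 has_real_derivative \<psi>1 s) (at s)"
proof -
  have "((\<lambda>s. s powr (- m)) has_real_derivative - m * s powr (- m - 1)) (at s)"
    using has_real_derivative_powr[OF I_pos[OF s], of "- m"] by simp
  from DERIV_mult[OF this Y_deriv[OF s]] show ?thesis
    unfolding \<psi>0_def[abs_def] \<psi>1_def by (simp add: algebra_simps)
qed

lemma powr_continuous: "S \<subseteq> I \<Longrightarrow> continuous_on S (\<lambda>s. s powr a)"
  using I_pos by (intro continuous_intros) force

lemma \<psi>1_continuous: "S \<subseteq> I \<Longrightarrow> continuous_on S \<psi>1"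
  unfolding \<psi>1_def[abs_def] by (intro continuous_intros powr_continuous W_continuous Y_continuous)

lemma \<psi>0_continuous: "S \<subseteq> I \<Longrightarrow> continuous_on S \<psi>0"
  unfolding \<psi>0_def[abs_def] by (intro continuous_intros powr_continuous Y_continuous)

lemma potential_continuous: "S \<subseteq> I \<Longrightarrow> continuous_on S (\<lambda>s. s powr (\<nu> + \<alpha> / 2) * \<bar>w s\<bar> powr (p - 1))"
  using p by (intro continuous_intros continuous_on_powr' powr_continuous w_continuous) auto

lemma F_continuous: "S \<subseteq> I \<Longrightarrow> continuous_on S F"
proof -
  assume S: "S \<subseteq> I"
  have "F = (\<lambda>s. 4 * (s powr (\<nu> + 1) * (\<psi>1 s)\<^sup>2) - p * ((s powr (\<nu> + \<alpha> / 2) * \<bar>w s\<bar> powr (p - 1)) * (\<psi>0 s)\<^sup>2))"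
    unfolding F_def[abs_def] by (simp add: mult.assoc)
  moreover have "continuous_on S \<dots>"
    by (intro continuous_on_diff continuous_on_mult continuous_on_const continuous_on_power potential_continuous[OF S]
        \<psi>1_continuous[OF S] \<psi>0_continuous[OF S] powr_continuous[OF S])
  ultimately show ?thesis by simp
qed

text \<open>This determines m. With s powr (-k) * Y as direction, the terms in W^2 and in Y W' of
  the second variation carry a common factor s powr (2 m - 2 k), so k = m makes them the exact
  derivative of 4 Y W. The mixed term is absorbed by the second half of \<open>Q\<close>, and 4 m
  (\<nu> + \<alpha>/2) - 4 m^2 = \<alpha> m remains in front of a square.\<close>

lemma Q_deriv:
  assumes s: "s \<in> I"
  obtains D where "(Q has_real_derivative D) (at s)" "F s \<le> D"
proof -
  note s0 = I_pos[OF s]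
  \<comment> \<open>All exponents are integer combinations of \<alpha>/4, \<nu> and 1, so the claim
    becomes an identity between rational functions of x, y and s.\<close>
  define x y where "x = s powr (\<alpha> / 4)" and "y = s powr \<nu>"
  have xy: "x > 0" "y > 0" using s0 by (auto simp: x_def y_def)
  have xx: "s powr (\<alpha> / 2) = x\<^sup>2" unfolding x_def power2_eq_square powr_add[symmetric] by simp
  have xi: "s powr (- (\<alpha> / 4)) = inverse x" "s powr (- \<nu>) = inverse y" "s powr (- 1) = inverse s"
    using s0 unfolding x_def y_def powr_minus by simp_all
  have pw: "s powr (\<nu> - 1 + \<alpha> / 2) = y * x\<^sup>2 / s" "s powr (- m) = 1 / (y * x)" "s powr (- m - 1) = 1 / (y * x * s)"
    "s powr (- \<nu> - \<alpha> / 2) = 1 / (y * x\<^sup>2)" "s powr (- \<nu> - \<alpha> / 2 - 1) = 1 / (y * x\<^sup>2 * s)"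
    "s powr (\<nu> + 1) = y * s" "s powr (\<nu> + \<alpha> / 2) = y * x\<^sup>2"
  proof -
    have X: "a * inverse b * c = a * c / b" "inverse a * inverse b = 1 / (a * b)" "1 / a * inverse b = 1 / (a * b)"
      "1 / (a * b * b) = 1 / (a * b\<^sup>2)" "inverse a * inverse b * inverse b = 1 / (a * b\<^sup>2)" for a b c :: real
      by (simp_all add: divide_inverse power2_eq_square)
    have "s powr (\<nu> - 1 + \<alpha> / 2) = s powr \<nu> * s powr (- 1) * (s powr (\<alpha> / 2))" unfolding powr_add[symmetric] by simp
    then show "s powr (\<nu> - 1 + \<alpha> / 2) = y * x\<^sup>2 / s" unfolding xi xx y_def[symmetric] by (simp only: X)
    have "s powr (- m) = s powr (- \<nu>) * s powr (- (\<alpha> / 4))" unfolding powr_add[symmetric] by (simp add: m_def)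
    then show e: "s powr (- m) = 1 / (y * x)" unfolding xi by (simp only: X)
    have "s powr (- m - 1) = s powr (- m) * s powr (- 1)" unfolding powr_add[symmetric] by simp
    then show "s powr (- m - 1) = 1 / (y * x * s)" unfolding xi e by (simp only: X)
    have "s powr (- \<nu> - \<alpha> / 2) = s powr (- \<nu>) * s powr (- (\<alpha> / 4)) * s powr (- (\<alpha> / 4))" unfolding powr_add[symmetric] by (rule arg_cong[of _ _ "(powr) s"]) simp
    then show f: "s powr (- \<nu> - \<alpha> / 2) = 1 / (y * x\<^sup>2)" unfolding xi by (simp only: X)
    have "s powr (- \<nu> - \<alpha> / 2 - 1) = s powr (- \<nu> - \<alpha> / 2) * s powr (- 1)" unfolding powr_add[symmetric] by simp
    then show "s powr (- \<nu> - \<alpha> / 2 - 1) = 1 / (y * x\<^sup>2 * s)" unfolding xi f by (simp only: X)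
    show "s powr (\<nu> + 1) = y * s" using s0 by (simp add: powr_add y_def)
    show "s powr (\<nu> + \<alpha> / 2) = y * x\<^sup>2" by (simp add: powr_add y_def xx)
  qed
  define D where "D = 4 * (y * x\<^sup>2 / s * W s) * W s + 4 * Y s * (- p * \<bar>w s\<bar> powr (p - 1) * V s / 4)
    + 4 * m * (\<nu> + \<alpha> / 2) * (1 / (y * x\<^sup>2 * s)) * (Y s)\<^sup>2 - 8 * m * (1 / (y * x\<^sup>2)) * Y s * (y * x\<^sup>2 / s * W s)"
  have dp: "((\<lambda>s. s powr (- \<nu> - \<alpha> / 2)) has_real_derivative (- \<nu> - \<alpha> / 2) * s powr (- \<nu> - \<alpha> / 2 - 1)) (at s)"
    by (rule has_real_derivative_powr[OF s0])
  have "(Q has_real_derivative D) (at s)"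
    using DERIV_diff[OF DERIV_mult[OF DERIV_cmult[OF Y_deriv[OF s], of 4] W_deriv[OF s]]
      DERIV_mult[OF DERIV_cmult[OF dp, of "4 * m"] DERIV_power[OF Y_deriv[OF s], of 2]]]
    unfolding Q_def[abs_def] D_def pw by (rule back_subst[of "\<lambda>D. (_ has_real_derivative D) (at s)"]) (simp add: algebra_simps add_divide_distrib diff_divide_distrib)
  moreover have "D - F s = \<alpha> * m * (y * (V s)\<^sup>2 / (x\<^sup>2 * s))"
  proof -
    have Y: "Y s = y * V s" by (simp add: Y_def y_def)
    have mm: "\<nu> + \<alpha> / 2 = m + \<alpha> / 4" by (simp add: m_def)
    have e: "\<psi>1 s = x * W s / s - m * V s / (x * s)" "\<psi>0 s = V s / x"
      unfolding \<psi>1_def \<psi>0_def pw Y using xy s0 by (simp_all add: field_simps power2_eq_square)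
    have e1: "y * s * (x * W s / s - m * V s / (x * s))\<^sup>2 =
        y * x\<^sup>2 * (W s)\<^sup>2 / s - 2 * m * y * W s * V s / s + m\<^sup>2 * y * (V s)\<^sup>2 / (x\<^sup>2 * s)"
      using xy s0 by (simp add: field_simps power2_eq_square)
    have e2: "y * x\<^sup>2 * (P * (V s / x)\<^sup>2) = y * P * (V s)\<^sup>2" for P
      using xy by (simp add: field_simps power2_eq_square)
    have e3: "4 * m * (m + \<alpha> / 4) * (1 / (y * x\<^sup>2 * s)) * (y * V s)\<^sup>2 = 4 * (m\<^sup>2 * y * (V s)\<^sup>2 / (x\<^sup>2 * s)) + \<alpha> * m * (y * (V s)\<^sup>2 / (x\<^sup>2 * s))"
      using xy s0 by (simp add: field_simps power2_eq_square)
    have e4: "8 * m * (1 / (y * x\<^sup>2)) * (y * V s) * (y * x\<^sup>2 / s * W s) = 8 * (m * y * W s * V s / s)"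
      using xy s0 by (simp add: field_simps power2_eq_square)
    have e5: "4 * (y * x\<^sup>2 / s * W s) * W s = 4 * (y * x\<^sup>2 * (W s)\<^sup>2 / s)" "4 * (y * V s) * (- p * X * V s / 4) = - (p * (y * X * (V s)\<^sup>2))" for X
      by (simp_all add: power2_eq_square)
    have Fs: "F s = 4 * (y * s * (x * W s / s - m * V s / (x * s))\<^sup>2) - p * (y * x\<^sup>2 * (\<bar>w s\<bar> powr (p - 1) * (V s / x)\<^sup>2))"
      unfolding F_def pw(6,7) e by (rule refl)
    show ?thesis unfolding D_def Fs Y mm e1 e2 e3 e4 e5 by (simp add: algebra_simps)
  qed
  then have "F s \<le> D" using al m_pos xy s0 by (simp add: algebra_simps)
  ultimately show ?thesis by (rule that)
qed

text \<open>\<open>Q\<close> is compared with a primitive of the continuous \<open>F\<close>; this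
  uses the derivative of \<open>Q\<close> pointwise only and avoids integrating it.\<close>

lemma F_integral_le:
  assumes "l \<in> I" "r \<in> I" "l < r"
  shows "(LINT s|lborel. indicator {l<..<r} s * F s) \<le> Q r - Q l"
proof -
  obtain P where P: "\<And>s. s \<in> I \<Longrightarrow> (P has_real_derivative F s) (at s)"
    using primitive_exists[OF I_open F_continuous[OF order_refl]] by blast
  have sub: "{(A + l) / 2..(r + B) / 2} \<subseteq> I" using assms by auto
  have "(LINT s|lborel. indicator {l<..<r} s * F s) = P r - P l"
    by (rule integral_Ioo_FTC[OF _ P F_continuous[OF sub]]) (use assms in auto)
  also have "\<dots> \<le> Q r - Q l"
  proof -
    have "Q l - P l \<le> Q r - P r"
    proof (rule DERIV_nonneg_imp_nondecreasing[where f = "\<lambda>s. Q s - P s" and a = l and b = r])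
      show "l \<le> r" using assms by simp
      fix x assume "l \<le> x" "x \<le> r"
      then have x: "x \<in> I" using assms by auto
      obtain D where "(Q has_real_derivative D) (at x)" "F x \<le> D" by (rule Q_deriv[OF x])
      then show "\<exists>y. ((\<lambda>s. Q s - P s) has_real_derivative y) (at x) \<and> 0 \<le> y"
        using DERIV_diff[OF _ P[OF x]] by (intro exI[of _ "D - F x"]) auto
    qed
    then show ?thesis by simp
  qed
  finally show ?thesis .
qed

lemma ramp_integral_le:
  assumes "A < a" "a < b" "b < B"
  shows "(LINT s|lborel. indicator {a<..<b} s * (s powr (\<nu> + 1) * q\<^sup>2)) \<le> b powr (\<nu> + 1) * q\<^sup>2 * (b - a)"
proof -
  have "(LINT s|lborel. indicator {a<..<b} s * (s powr (\<nu> + 1) * q\<^sup>2)) \<le> (LINT s|lborel. indicator {a<..<b} s * (b powr (\<nu> + 1) * q\<^sup>2))"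
  proof (rule integral_mono)
    have "{a..b} \<subseteq> I" using assms by auto
    then show "integrable lborel (\<lambda>s. indicator {a<..<b} s * (s powr (\<nu> + 1) * q\<^sup>2))"
      by (intro integrable_on_compact_subinterval continuous_intros powr_continuous)
    show "integrable lborel (\<lambda>s. indicator {a<..<b} s * (b powr (\<nu> + 1) * q\<^sup>2))"
      by (intro integrable_on_compact_subinterval continuous_intros)
    fix s
    show "indicator {a<..<b} s * (s powr (\<nu> + 1) * q\<^sup>2) \<le> indicator {a<..<b} s * (b powr (\<nu> + 1) * q\<^sup>2)"
      using assms AB nu by (auto simp: indicator_def intro!: mult_right_mono powr_mono2)
  qed
  also have "\<dots> = b powr (\<nu> + 1) * q\<^sup>2 * (b - a)" using assms by simp
  finally show ?thesis .
qed

text \<open>The test function is \<open>\<psi>0\<close> between \<open>l\<close> and \<open>r\<close>, continued linearly to zeros at \<open>l'\<close> and \<open>r'\<close>.\<close>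

lemma corner_cut:
  assumes l: "A < l'" "l' < l" "l < r" "r < r'" "r' < B"
  shows "0 \<le> 4 * (\<psi>0 l)\<^sup>2 * l powr (\<nu> + 1) / (l - l') - Q l + Q r + 4 * (\<psi>0 r)\<^sup>2 * r' powr (\<nu> + 1) / (r' - r)"
proof -
  \<comment> \<open>The slopes of the two ramps, joining 0 to the value at l and the value at r to
    0; with them \<theta> has integral 0.\<close>
  define c d where "c = \<psi>0 l / (l - l')" and "d = - \<psi>0 r / (r' - r)"
  define f g h where "f s = indicator {l'<..<l} s * c" and "g s = indicator {l<..<r} s * \<psi>1 s" and "h s = indicator {r<..<r'} s * d" for s
  define \<theta> where "\<theta> s = f s + (g s + h s)" for s
  have sub: "{l'..l} \<subseteq> I" "{l..r} \<subseteq> I" "{r..r'} \<subseteq> I" "{l'..r'} \<subseteq> I" and lr: "l \<in> I" "r \<in> I" using l by auto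
  have int: "integrable lborel f" "integrable lborel g" "integrable lborel h"
    unfolding f_def[abs_def] g_def[abs_def] h_def[abs_def]
    by (intro integrable_on_compact_subinterval continuous_intros \<psi>1_continuous sub)+
  note [measurable] = borel_measurable_integrable[OF int(1)] borel_measurable_integrable[OF int(2)] borel_measurable_integrable[OF int(3)]
  have \<theta>i: "integrable lborel \<theta>" unfolding \<theta>_def[abs_def] using int by simp
  note [measurable] = borel_measurable_integrable[OF \<theta>i]
  have I\<psi>1: "(LINT s|lborel. indicator {a<..<b} s * \<psi>1 s) = \<psi>0 b - \<psi>0 a" if "l \<le> a" "a \<le> b" "b \<le> r" for a b
    by (rule integral_Ioo_FTC[OF _ \<psi>0_deriv \<psi>1_continuous[OF sub(4)]]) (use that l in auto)
  have If: "(LINT s|lborel. f s) = \<psi>0 l" and Ih: "(LINT s|lborel. h s) = - \<psi>0 r"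
    using l by (simp_all add: f_def h_def c_def d_def)
  have z: "(LINT s|lborel. \<theta> s) = 0"
  proof -
    have "(LINT s|lborel. g s) = \<psi>0 r - \<psi>0 l" unfolding g_def using I\<psi>1[of l r] l by simp
    then show ?thesis unfolding \<theta>_def using int If Ih by simp
  qed
  define \<psi> where "\<psi> s = (LINT t|lborel. indicator {..s} t * \<theta> t)" for s
  have \<psi>c: "continuous_on S \<psi>" for S
    using continuous_on_subset[OF continuous_indefinite_integral[OF \<theta>i]] unfolding \<psi>_def[abs_def] by blast
  have \<theta>0: "\<theta> t = 0" if "t \<le> l' \<or> t \<ge> r'" for t using that l by (auto simp: \<theta>_def f_def g_def h_def)
  have \<psi>z: "\<psi> s = 0" if "s \<notin> {l'..r'}" for s
  proof (cases "s < l'")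
    case True
    then have "(\<lambda>t. indicator {..s} t * \<theta> t) = (\<lambda>t. 0)" using \<theta>0 by (auto simp: indicator_def fun_eq_iff)
    then show ?thesis by (simp add: \<psi>_def)
  next
    case False
    then have "(\<lambda>t. indicator {..s} t * \<theta> t) = \<theta>" using \<theta>0 that by (auto simp: indicator_def fun_eq_iff)
    then show ?thesis using z by (simp add: \<psi>_def)
  qed
  have \<psi>eq: "\<psi> s = \<psi>0 s" if s: "s \<in> {l<..<r}" for s
  proof -
    have "\<psi> s = (LINT t|lborel. f t + indicator {l<..<s} t * \<psi>1 t)"
      unfolding \<psi>_def
    proof (rule integral_cong_AE)
      have "AE t in lborel. t \<noteq> s" by (rule AE_lborel_singleton)
      then show "AE t in lborel. indicator {..s} t * \<theta> t = f t + indicator {l<..<s} t * \<psi>1 t"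
        by eventually_elim (use s l in \<open>auto simp: indicator_def \<theta>_def f_def g_def h_def\<close>)
      show "(\<lambda>t. f t + indicator {l<..<s} t * \<psi>1 t) \<in> borel_measurable lborel"
        using continuous_on_I_measurable[OF \<psi>1_continuous[OF order_refl], of l s] s l by simp
    qed measurable
    also have "\<dots> = (LINT t|lborel. f t) + (LINT t|lborel. indicator {l<..<s} t * \<psi>1 t)"
    proof (rule Bochner_Integration.integral_add[OF int(1)])
      have "{l..s} \<subseteq> I" using s l by auto
      then show "integrable lborel (\<lambda>t. indicator {l<..<s} t * \<psi>1 t)"
        by (intro integrable_on_compact_subinterval \<psi>1_continuous)
    qed
    finally show ?thesis using If I\<psi>1[of l s] s by simp
  qed
  define U where "U s = s powr (\<nu> + \<alpha> / 2) * \<bar>w s\<bar> powr (p - 1)" for s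
  have U0: "U s \<ge> 0" for s by (simp add: U_def)
  have Uc: "S \<subseteq> I \<Longrightarrow> continuous_on S U" for S unfolding U_def[abs_def] by (rule potential_continuous)
  have iF: "integrable lborel (\<lambda>s. indicator {l<..<r} s * (U s * (\<psi>0 s)\<^sup>2))"
    by (intro integrable_on_compact_subinterval continuous_intros Uc \<psi>0_continuous sub)
  have iP: "integrable lborel (\<lambda>s. indicator {l<..<r} s * (s powr (\<nu> + 1) * (\<psi>1 s)\<^sup>2))"
    by (intro integrable_on_compact_subinterval continuous_intros powr_continuous \<psi>1_continuous sub)
  have "p * (LINT s|lborel. indicator I s * (s powr (\<nu> + \<alpha> / 2) * (\<bar>w s\<bar> powr (p - 1) * (\<psi> s)\<^sup>2))) \<le>
      4 * (LINT s|lborel. indicator I s * (s powr (\<nu> + 1) * (\<theta> s)\<^sup>2))"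
    unfolding \<psi>_def
  proof (rule stability_limit[of l' r', OF _ _ _ _ z])
    show "test_limit l' r' \<theta>" unfolding \<theta>_def[abs_def] f_def g_def h_def
      by (intro test_limit_add test_limit_piece continuous_intros \<psi>1_continuous sub) (use l in auto)
  qed (use l in auto)
  also have "(LINT s|lborel. indicator I s * (s powr (\<nu> + 1) * (\<theta> s)\<^sup>2)) =
      (LINT s|lborel. indicator {l'<..<l} s * (s powr (\<nu> + 1) * c\<^sup>2) + (indicator {l<..<r} s * (s powr (\<nu> + 1) * (\<psi>1 s)\<^sup>2)
        + indicator {r<..<r'} s * (s powr (\<nu> + 1) * d\<^sup>2)))"
    by (rule Bochner_Integration.integral_cong[OF refl]) (use l in \<open>auto simp: \<theta>_def f_def g_def h_def indicator_def\<close>)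
  also have "\<dots> = (LINT s|lborel. indicator {l'<..<l} s * (s powr (\<nu> + 1) * c\<^sup>2)) + ((LINT s|lborel. indicator {l<..<r} s * (s powr (\<nu> + 1) * (\<psi>1 s)\<^sup>2))
        + (LINT s|lborel. indicator {r<..<r'} s * (s powr (\<nu> + 1) * d\<^sup>2)))"
  proof -
    have "integrable lborel (\<lambda>s. indicator {l'<..<l} s * (s powr (\<nu> + 1) * c\<^sup>2))" "integrable lborel (\<lambda>s. indicator {r<..<r'} s * (s powr (\<nu> + 1) * d\<^sup>2))"
      by (intro integrable_on_compact_subinterval continuous_intros powr_continuous sub)+
    then show ?thesis using iP by simp
  qed
  also have "\<dots> \<le> l powr (\<nu> + 1) * c\<^sup>2 * (l - l') + ((LINT s|lborel. indicator {l<..<r} s * (s powr (\<nu> + 1) * (\<psi>1 s)\<^sup>2)) + r' powr (\<nu> + 1) * d\<^sup>2 * (r' - r))"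
    by (intro add_mono order_refl ramp_integral_le) (use l in auto)
  finally have main: "p * (LINT s|lborel. indicator I s * (U s * (\<psi> s)\<^sup>2)) \<le>
    4 * (l powr (\<nu> + 1) * c\<^sup>2 * (l - l') + ((LINT s|lborel. indicator {l<..<r} s * (s powr (\<nu> + 1) * (\<psi>1 s)\<^sup>2)) + r' powr (\<nu> + 1) * d\<^sup>2 * (r' - r)))"
    by (simp add: U_def mult.assoc)
  \<comment> \<open>On the ramps the potential term has the favourable sign and is
    discarded.\<close>
  have "(LINT s|lborel. indicator {l<..<r} s * (U s * (\<psi>0 s)\<^sup>2)) \<le> (LINT s|lborel. indicator I s * (U s * (\<psi> s)\<^sup>2))"
  proof (rule integral_mono[OF iF])
    have "(\<lambda>s. indicator I s * (U s * (\<psi> s)\<^sup>2)) = (\<lambda>s. indicator {l'..r'} s * (U s * (\<psi> s)\<^sup>2))"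
      using \<psi>z l by (auto simp: indicator_def fun_eq_iff)
    then show "integrable lborel (\<lambda>s. indicator I s * (U s * (\<psi> s)\<^sup>2))"
      using integrable_on_compact_subinterval(1)[OF continuous_on_mult[OF Uc[OF sub(4)] continuous_on_power[OF \<psi>c], of 2]] by simp
    show "indicator {l<..<r} s * (U s * (\<psi>0 s)\<^sup>2) \<le> indicator I s * (U s * (\<psi> s)\<^sup>2)" for s
      using \<psi>eq[of s] l U0[of s] by (auto simp: indicator_def)
  qed
  then have potential: "p * (LINT s|lborel. indicator {l<..<r} s * (U s * (\<psi>0 s)\<^sup>2)) \<le> p * (LINT s|lborel. indicator I s * (U s * (\<psi> s)\<^sup>2))"
    using p by (intro mult_left_mono) auto
  have split: "(LINT s|lborel. indicator {l<..<r} s * F s) =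
      4 * (LINT s|lborel. indicator {l<..<r} s * (s powr (\<nu> + 1) * (\<psi>1 s)\<^sup>2)) - p * (LINT s|lborel. indicator {l<..<r} s * (U s * (\<psi>0 s)\<^sup>2))"
  proof -
    have "(LINT s|lborel. indicator {l<..<r} s * F s) =
      (LINT s|lborel. 4 * (indicator {l<..<r} s * (s powr (\<nu> + 1) * (\<psi>1 s)\<^sup>2)) - p * (indicator {l<..<r} s * (U s * (\<psi>0 s)\<^sup>2)))"
      by (rule Bochner_Integration.integral_cong[OF refl]) (simp add: F_def U_def algebra_simps)
    then show ?thesis using iF iP by simp
  qed
  have left: "4 * (l powr (\<nu> + 1) * c\<^sup>2 * (l - l')) = 4 * (\<psi>0 l)\<^sup>2 * l powr (\<nu> + 1) / (l - l')"
    using l by (simp add: c_def power_divide power2_eq_square)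
  have right: "4 * (r' powr (\<nu> + 1) * d\<^sup>2 * (r' - r)) = 4 * (\<psi>0 r)\<^sup>2 * r' powr (\<nu> + 1) / (r' - r)"
    using l by (simp add: d_def power_divide power2_eq_square)
  have sum: "0 \<le> b1 - y + x + b2" if "z1 \<le> z2" "J = 4 * P - z1" "z2 \<le> 4 * (a1 + (P + a2))" "J \<le> x - y" "4 * a1 = b1" "4 * a2 = b2"
    for a1 a2 b1 b2 x y z1 z2 J P :: real using that by argo
  show ?thesis by (rule sum[OF potential split main F_integral_le[OF lr l(3)] left right])
qed


text \<open>With \<open>r = s - t\<close> and \<open>r' = s + t\<close> the expression is \<open>- 2 t s powr (\<nu> - 1 + \<alpha> / 2) (W s)\<^sup>2 + o(t)\<close>:
  the ramp costs half of what is gained by stopping before the critical point.\<close>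

lemma corner_negative:
  assumes s: "s \<in> I" "V s = 0" "w s \<noteq> 0" and l: "l < s"
  obtains r r' where "A < r" "l < r" "r < r'" "r' < B" "Q r + 4 * (\<psi>0 r)\<^sup>2 * r' powr (\<nu> + 1) / (r' - r) < 0"
proof -
  define e where "e = s powr (\<nu> - 1 + \<alpha> / 2)"
  define L where "L = e * W s"
  have s0: "s > 0" using I_pos[OF s(1)] .
  have Ys: "Y s = 0" by (simp add: Y_def s)
  have "((\<lambda>t. Y (s - t)) has_real_derivative L * (0 - 1)) (at 0)"
    by (rule DERIV_chain2[of Y]) (use Y_deriv[OF s(1)] in \<open>auto simp: L_def e_def intro!: derivative_eq_intros\<close>)
  then have "((\<lambda>t. Y (s - t) / t) \<longlongrightarrow> - L) (at 0)" by (simp add: DERIV_def Ys)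
  then have y: "((\<lambda>t. Y (s - t) / t) \<longlongrightarrow> - L) (at_right 0)" by (rule tendsto_mono[OF at_le[OF subset_UNIV]])
  have t0: "((\<lambda>t. s - t) \<longlongrightarrow> s) (at_right 0)" "((\<lambda>t. s + t) \<longlongrightarrow> s) (at_right 0)"
    by (auto intro!: tendsto_eq_intros)
  have comp: "((\<lambda>t. G (s - t)) \<longlongrightarrow> G s) (at_right 0)" if "isCont G s" for G :: "real \<Rightarrow> real"
    by (rule isCont_tendsto_compose[OF that t0(1)])
  have iW: "isCont W s" and iY: "isCont Y s" using W_deriv[OF s(1)] Y_deriv[OF s(1)] DERIV_isCont by blast+
  have ip: "isCont (\<lambda>s. s powr a) s" for a using s0 by (intro continuous_intros) auto
  define R where "R t = Q (s - t) + 4 * (\<psi>0 (s - t))\<^sup>2 * (s + t) powr (\<nu> + 1) / ((s + t) - (s - t))" for t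
  have R: "R t / t = 4 * (Y (s - t) / t) * W (s - t) - 4 * m * (s - t) powr (- \<nu> - \<alpha> / 2) * (Y (s - t) / t) * Y (s - t)
      + 2 * ((s - t) powr (- m))\<^sup>2 * (Y (s - t) / t)\<^sup>2 * (s + t) powr (\<nu> + 1)" if "t > 0" for t
  proof -
    have "(4 * y * x - 4 * m * z * y\<^sup>2 + 4 * (q * y)\<^sup>2 * h / (2 * t)) / t
      = 4 * (y / t) * x - 4 * m * z * (y / t) * y + 2 * q\<^sup>2 * (y / t)\<^sup>2 * h" for x y z q h
      using \<open>t > 0\<close> by (simp add: field_simps power2_eq_square)
    then show ?thesis unfolding R_def Q_def \<psi>0_def by simp
  qed
  have "((\<lambda>t. 4 * (Y (s - t) / t) * W (s - t) - 4 * m * (s - t) powr (- \<nu> - \<alpha> / 2) * (Y (s - t) / t) * Y (s - t)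
      + 2 * ((s - t) powr (- m))\<^sup>2 * (Y (s - t) / t)\<^sup>2 * (s + t) powr (\<nu> + 1)) \<longlongrightarrow>
      4 * (- L) * W s - 4 * m * s powr (- \<nu> - \<alpha> / 2) * (- L) * Y s + 2 * (s powr (- m))\<^sup>2 * (- L)\<^sup>2 * s powr (\<nu> + 1)) (at_right 0)"
    by (intro tendsto_intros y comp[OF iW] comp[OF iY] t0) (use s0 in auto)
  also have "4 * (- L) * W s - 4 * m * s powr (- \<nu> - \<alpha> / 2) * (- L) * Y s + 2 * (s powr (- m))\<^sup>2 * (- L)\<^sup>2 * s powr (\<nu> + 1)
    = - 2 * e * (W s)\<^sup>2"
  proof -
    \<comment> \<open>The exponents cancel by the value of m: -2 m + (\<nu> - 1 + \<alpha>/2) +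
      (\<nu> + 1) = 0.\<close>
    have "(s powr (- m))\<^sup>2 * e * s powr (\<nu> + 1) = s powr 0"
      unfolding power2_eq_square e_def powr_add[symmetric] m_def by (rule arg_cong[of _ _ "(powr) s"]) simp
    then have "(s powr (- m))\<^sup>2 * e * s powr (\<nu> + 1) = 1" using s0 by simp
    moreover have "(q * L\<^sup>2) * h = (q * e * h) * (e * (W s)\<^sup>2)" for q h by (simp add: L_def power2_eq_square)
    ultimately have "(s powr (- m))\<^sup>2 * L\<^sup>2 * s powr (\<nu> + 1) = e * (W s)\<^sup>2" by (metis mult_1)
    moreover have "4 * (- L) * W s = - (4 * (e * (W s)\<^sup>2))" by (simp add: L_def power2_eq_square)
    ultimately show ?thesis unfolding Ys by simp
  qed
  finally have "((\<lambda>t. R t / t) \<longlongrightarrow> - 2 * e * (W s)\<^sup>2) (at_right 0)"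
    by (rule Lim_transform_eventually) (rule eventually_mono[OF eventually_at_right_less[of 0]], rule R[symmetric])
  moreover have "- 2 * e * (W s)\<^sup>2 < 0"
  proof -
    have "e > 0" "W s \<noteq> 0" using s s0 by (auto simp: e_def W_def spow_def sgn_if)
    then show ?thesis by simp
  qed
  ultimately have "\<forall>\<^sub>F t in at_right 0. R t / t < 0" by (rule order_tendstoD(2))
  moreover have "\<forall>\<^sub>F t in at_right 0. s - t > max A l" by (rule order_tendstoD(1)[OF t0(1)]) (use s l in auto)
  moreover have "\<forall>\<^sub>F t in at_right 0. s + t < B" by (rule order_tendstoD(2)[OF t0(2)]) (use s in auto)
  moreover have "\<forall>\<^sub>F t in at_right 0. t > (0::real)" by (rule eventually_at_right_less)
  ultimately have "\<forall>\<^sub>F t in at_right 0. R t / t < 0 \<and> s - t > max A l \<and> s + t < B \<and> t > 0" by eventually_elim auto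
  then obtain t where t: "R t / t < 0" "s - t > max A l" "s + t < B" "t > 0"
    using eventually_happens'[OF trivial_limit_at_right_real[of 0]] by blast
  show ?thesis
    by (rule that[of "s - t" "s + t"]) (use t in \<open>auto simp: R_def divide_less_0_iff\<close>)
qed

section \<open>Critical points of the profile\<close>

lemma no_critical_pair:
  assumes A: "A > 0" and l: "l \<in> I" "V l = 0" and s: "s \<in> I" "V s = 0" "w s \<noteq> 0" and ls: "l < s"
  shows False
proof -
  obtain r r' where r: "A < r" "l < r" "r < r'" "r' < B" "Q r + 4 * (\<psi>0 r)\<^sup>2 * r' powr (\<nu> + 1) / (r' - r) < 0"
    by (rule corner_negative[OF s ls])
  \<comment> \<open>At the inner critical point both the direction and the boundary term vanish, so
    the left ramp is flat and costs nothing wherever it begins; the midpoint used below is one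
    choice.\<close>
  have Y: "Y l = 0" by (simp add: Y_def l)
  then have "\<psi>0 l = 0" "Q l = 0" by (simp_all add: \<psi>0_def Q_def)
  then show False using corner_cut[of "(A + l) / 2" l r r'] r l by auto
qed

text \<open>The centre takes the part of the inner critical point: the left ramp runs from l / 2 to
  l, and its contribution tends to 0 with l, while the gain at the outer critical point has been
  fixed before.\<close>

lemma no_critical_point_ball:
  assumes A: "A = 0" and s: "s \<in> I" "V s = 0" "w s \<noteq> 0"
  shows False
proof -
  obtain r r' where r: "A < r" "0 < r" "r < r'" "r' < B" "Q r + 4 * (\<psi>0 r)\<^sup>2 * r' powr (\<nu> + 1) / (r' - r) < 0"
    by (rule corner_negative[OF s I_pos[OF s(1)]])
  \<comment> \<open>The left contribution written out. The ramp gives 8, as l / (l - l/2) = 2; the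
    second half of \<open>Q\<close> gives 4 m; and -4 Y W is Y times
    \<open>spow p (w l)\<close>.\<close>
  define T where "T l = (8 + 4 * m) * (l powr (\<nu> - \<alpha> / 2) * (V l)\<^sup>2) + l powr \<nu> * V l * spow p (w l)" for l
  have "(T \<longlongrightarrow> (8 + 4 * m) * 0 + 0) (at_right 0)"
    unfolding T_def[abs_def] by (intro tendsto_intros centre_limits[OF A])
  then have "\<forall>\<^sub>F l in at_right 0. T l < - (Q r + 4 * (\<psi>0 r)\<^sup>2 * r' powr (\<nu> + 1) / (r' - r))"
    by (rule order_tendstoD(2)) (use r in auto)
  moreover have "\<forall>\<^sub>F l in at_right 0. l < r" by (rule eventually_at_right_real[OF r(2), THEN eventually_mono]) auto
  moreover have "\<forall>\<^sub>F t in at_right 0. t > (0::real)" by (rule eventually_at_right_less)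
  ultimately have "\<forall>\<^sub>F l in at_right 0. T l < - (Q r + 4 * (\<psi>0 r)\<^sup>2 * r' powr (\<nu> + 1) / (r' - r)) \<and> l < r \<and> l > 0" by eventually_elim auto
  then obtain l where l: "T l < - (Q r + 4 * (\<psi>0 r)\<^sup>2 * r' powr (\<nu> + 1) / (r' - r))" "l < r" "l > 0"
    using eventually_happens'[OF trivial_limit_at_right_real[of 0]] by blast
  have "4 * (\<psi>0 l)\<^sup>2 * l powr (\<nu> + 1) / (l - l / 2) - Q l = T l"
  proof -
    have p1: "(l powr (- m))\<^sup>2 * (l powr \<nu>)\<^sup>2 * l powr (\<nu> + 1) = l * l powr (\<nu> - \<alpha> / 2)"
    proof -
      have "(l powr (- m))\<^sup>2 * (l powr \<nu>)\<^sup>2 * l powr (\<nu> + 1) = l powr 1 * l powr (\<nu> - \<alpha> / 2)"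
        unfolding power2_eq_square powr_add[symmetric] m_def by (rule arg_cong[of _ _ "(powr) l"]) simp
      then show ?thesis using l by simp
    qed
    have p2: "l powr (- \<nu> - \<alpha> / 2) * (l powr \<nu>)\<^sup>2 = l powr (\<nu> - \<alpha> / 2)"
      unfolding power2_eq_square powr_add[symmetric] by (rule arg_cong[of _ _ "(powr) l"]) simp
    have "4 * (\<psi>0 l)\<^sup>2 * l powr (\<nu> + 1) = 4 * ((l powr (- m))\<^sup>2 * (l powr \<nu>)\<^sup>2 * l powr (\<nu> + 1)) * (V l)\<^sup>2"
      by (simp add: \<psi>0_def Y_def power_mult_distrib)
    then have "4 * (\<psi>0 l)\<^sup>2 * l powr (\<nu> + 1) / (l - l / 2) = 8 * (l powr (\<nu> - \<alpha> / 2) * (V l)\<^sup>2)"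
      unfolding p1 using l by (simp add: field_simps)
    moreover have "4 * m * l powr (- \<nu> - \<alpha> / 2) * (Y l)\<^sup>2 = 4 * m * ((l powr (- \<nu> - \<alpha> / 2) * (l powr \<nu>)\<^sup>2) * (V l)\<^sup>2)"
      by (simp add: Y_def power_mult_distrib)
    ultimately show ?thesis unfolding Q_def p2 by (simp add: T_def W_def Y_def algebra_simps)
  qed
  then show False using corner_cut[of "l / 2" l r r'] l r A by linarith
qed

text \<open>The factor \<sigma> covers minima and maxima together: a value at z below both end
  values forces the minimum of \<sigma> w into the interior. The last conclusion is what keeps w
  away from 0 at the point found.\<close>

lemma interior_critical:
  assumes xy: "x \<in> I" "y \<in> I" "x < z" "z < y" and z: "\<sigma> * w z < \<sigma> * w x" "\<sigma> * w z < \<sigma> * w y"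
  obtains s where "x < s" "s < y" "V s = 0" "\<sigma> * w s \<le> \<sigma> * w z"
proof -
  have sub: "{x..y} \<subseteq> I" using xy by auto
  have "continuous_on {x..y} (\<lambda>s. \<sigma> * w s)" by (intro continuous_intros w_continuous sub)
  then obtain s where s: "s \<in> {x..y}" "\<And>t. t \<in> {x..y} \<Longrightarrow> \<sigma> * w s \<le> \<sigma> * w t"
    using continuous_attains_inf[of "{x..y}" "\<lambda>s. \<sigma> * w s"] xy by auto
  have le: "\<sigma> * w s \<le> \<sigma> * w z" by (rule s(2)) (use xy in auto)
  then have "s \<noteq> x" "s \<noteq> y" using z by auto
  then have sxy: "x < s" "s < y" using s(1) by auto
  have "\<sigma> * V s = 0"
  proof (rule DERIV_local_min)
    show "((\<lambda>s. \<sigma> * w s) has_real_derivative \<sigma> * V s) (at s)"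
      using w_deriv[of s] s(1) sub by (intro DERIV_cmult) auto
    show "0 < min (s - x) (y - s)" using sxy by simp
    show "\<forall>t. \<bar>s - t\<bar> < min (s - x) (y - s) \<longrightarrow> \<sigma> * w s \<le> \<sigma> * w t"
      by (auto intro!: s(2))
  qed
  moreover have "\<sigma> \<noteq> 0" using z by auto
  ultimately show ?thesis using that sxy le by simp
qed

text \<open>As w tends to 0 at B, some b' beyond b has |w b'| < |w b|, so \<sigma> w has a negative
  interior minimum s between a and b'; on a ball this is already excluded. On an annulus w tends to
  0 at A too, which yields an interior maximum of \<sigma> w to the left of s, and the two critical
  points exclude each other.\<close>

lemma sign_change_impossible:
  assumes a: "a \<in> I" "\<sigma> * w a > 0" and b: "b \<in> I" "\<sigma> * w b < 0" and ab: "a < b" and \<sigma>: "\<bar>\<sigma>\<bar> = 1"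
  shows False
proof -
  have \<sigma>2: "(w t)\<^sup>2 = (\<sigma> * w t)\<^sup>2" for t using \<sigma> by (metis abs_mult mult_1 power2_abs)
  have small: "\<bar>\<sigma> * w x\<bar> < \<bar>\<sigma> * w y\<bar>" if "(w x)\<^sup>2 < (w y)\<^sup>2" for x y
    using that \<sigma>2[of x] \<sigma>2[of y] abs_le_square_iff[of "\<sigma> * w y" "\<sigma> * w x"] by (metis not_le)
  obtain C where C: "C \<ge> 0" "\<And>s. s \<in> I \<Longrightarrow> (w s)\<^sup>2 \<le> C * ((B - s) * s powr (- \<nu>))" by (rule outer_boundary_bound) blast
  have wb: "(w b)\<^sup>2 > 0" "(w a)\<^sup>2 > 0" using a b by auto
  have "((\<lambda>s. C * ((B - s) * s powr (- \<nu>))) \<longlongrightarrow> C * ((B - B) * B powr (- \<nu>))) (at_left B)"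
    by (intro tendsto_intros) (use AB in auto)
  then have "\<forall>\<^sub>F s in at_left B. C * ((B - s) * s powr (- \<nu>)) < (w b)\<^sup>2"
    by (rule order_tendstoD(2)) (use wb in simp)
  moreover have "\<forall>\<^sub>F s in at_left B. s \<in> {b<..<B}" by (rule eventually_at_left_real) (use b in simp)
  ultimately have "\<forall>\<^sub>F s in at_left B. C * ((B - s) * s powr (- \<nu>)) < (w b)\<^sup>2 \<and> s \<in> {b<..<B}" by eventually_elim auto
  then obtain b' where b': "C * ((B - b') * b' powr (- \<nu>)) < (w b)\<^sup>2" "b' \<in> {b<..<B}"
    using eventually_happens'[OF trivial_limit_at_left_real[of B]] by blast
  have b'I: "b' \<in> I" using b b' by auto
  have "\<bar>\<sigma> * w b'\<bar> < \<bar>\<sigma> * w b\<bar>" using small[of b' b] C(2)[OF b'I] b' by simp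
  then have lt: "\<sigma> * w b < \<sigma> * w a" "\<sigma> * w b < \<sigma> * w b'" using a b by linarith+
  obtain s where s: "a < s" "s < b'" "V s = 0" "\<sigma> * w s \<le> \<sigma> * w b"
    by (rule interior_critical[OF a(1) b'I ab _ lt]) (use b' in auto)
  have sI: "s \<in> I" and ws: "w s \<noteq> 0" using s a b b' by auto
  show False
  proof (cases "A = 0")
    case True
    then show False by (rule no_critical_point_ball[OF _ sI s(3) ws])
  next
    case False
    then have A: "A > 0" using AB by simp
    obtain C where C: "C \<ge> 0" "\<And>s. s \<in> I \<Longrightarrow> (w s)\<^sup>2 \<le> C * (s - A)" by (rule inner_boundary_bound[OF A]) blast
    have "((\<lambda>s. C * (s - A)) \<longlongrightarrow> C * (A - A)) (at_right A)"
      by (intro tendsto_intros)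
    then have "\<forall>\<^sub>F s in at_right A. C * (s - A) < (w a)\<^sup>2"
      by (rule order_tendstoD(2)) (use wb in simp)
    moreover have "\<forall>\<^sub>F s in at_right A. s \<in> {A<..<a}" by (rule eventually_at_right_real) (use a in simp)
    ultimately have "\<forall>\<^sub>F s in at_right A. C * (s - A) < (w a)\<^sup>2 \<and> s \<in> {A<..<a}" by eventually_elim auto
    then obtain a' where a': "C * (a' - A) < (w a)\<^sup>2" "a' \<in> {A<..<a}"
      using eventually_happens'[OF trivial_limit_at_right_real[of A]] by blast
    have a'I: "a' \<in> I" using a a' by auto
    have "\<bar>\<sigma> * w a'\<bar> < \<bar>\<sigma> * w a\<bar>" using small[of a' a] C(2)[OF a'I] a' by simp
    then have lt: "- \<sigma> * w a < - \<sigma> * w a'" "- \<sigma> * w a < - \<sigma> * w s" using a b s by (auto simp: abs_if split: if_splits)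
    obtain l where l: "a' < l" "l < s" "V l = 0"
      by (rule interior_critical[OF a'I sI _ s(1) lt]) (use a' in auto)
    show False by (rule no_critical_pair[OF A _ l(3) sI s(3) ws l(2)]) (use l a'I sI in auto)
  qed
qed

lemma contradiction: False
proof -
  have "\<exists>s\<in>I. w s > 0"
  proof (rule ccontr)
    assume n: "\<not> (\<exists>s\<in>I. w s > 0)"
    have "AE s in lborel. A < s \<longrightarrow> s < B \<longrightarrow> v s \<le> 0"
      using vw by eventually_elim (use n in force)
    then show False using sign_change(1) by simp
  qed
  then obtain a where a: "a \<in> I" "w a > 0" by blast
  have "\<exists>s\<in>I. w s < 0"
  proof (rule ccontr)
    assume n: "\<not> (\<exists>s\<in>I. w s < 0)"
    have "AE s in lborel. A < s \<longrightarrow> s < B \<longrightarrow> v s \<ge> 0"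
      using vw by eventually_elim (use n in \<open>auto simp: not_less\<close>)
    then show False using sign_change(2) by simp
  qed
  then obtain b where b: "b \<in> I" "w b < 0" by blast
  have "a \<noteq> b" using a b by auto
  then consider "a < b" | "b < a" by linarith
  then show False
    by cases (use sign_change_impossible[of a 1 b] sign_change_impossible[of b "- 1" a] a b in auto)
qed

end

section \<open>Transfer from the profile back to the domain\<close>

lemma (in profile) inconsistent: False
proof -
  obtain w V c where r: "\<And>s. s \<in> I \<Longrightarrow> (w has_real_derivative V s) (at s)"
    "\<And>s. s \<in> I \<Longrightarrow> s powr \<nu> * V s = - K s / 4 - c" "A = 0 \<Longrightarrow> c = 0" "AE s in lborel. s \<in> I \<longrightarrow> v s = w s"
    by (rule profile_regular) blast
  interpret regular_profile \<nu> \<alpha> p A B v w V c by unfold_locales (use r in auto)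
  show False by (rule contradiction)
qed

text \<open>For N \<ge> 3 the second hypothesis reads p < (N + 2 + 2 \<alpha>) / (N - 2), the form
  in which the growth condition enters the estimate at the centre.\<close>

lemma (in radial_minimizer) profile_axioms:
  assumes "DIM('a) \<ge> 2" "(p - 1) * (real DIM('a) / 2 - 1) < 2 + \<alpha>"
  shows "profile \<nu> \<alpha> p A B v"
proof unfold_locales
  show "1 \<le> \<nu>" "(p - 1) * (\<nu> - 1) < 2 + \<alpha>" using assms by (simp_all add: \<nu>_def)
  show "0 \<le> \<alpha>" "1 < p" "0 \<le> A" "A < B" "v \<in> borel_measurable borel" by (rule \<alpha> p AB v_measurable)+
  show "integrable lborel (\<lambda>s. ind s * (s powr (\<nu> - 1 + \<alpha> / 2) * \<bar>v s\<bar> powr (p + 1)))" by (rule profile_integrable)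
  show "integrable lborel (\<lambda>s. ind s * (s powr (\<nu> - 1) * (v s)\<^sup>2))" by (rule profile_sq_integrable)
  show "(LINT s|lborel. ind s * (s powr (\<nu> - 1) * (v s * (4 * \<nu> * deriv \<eta> s + 4 * s * deriv (deriv \<eta>) s)))) =
      - (LINT s|lborel. ind s * (s powr (\<nu> - 1 + \<alpha> / 2) * (spow p (v s) * \<eta> s)))"
    if "smooth \<eta>" "\<exists>b<B. \<forall>s>b. \<eta> s = 0" "0 < A \<longrightarrow> (\<exists>a>A. \<forall>s<a. \<eta> s = 0)" for \<eta>
    by (rule profile_euler_lagrange) (use that in \<open>simp add: admissible_def\<close>)
  obtain C where "C \<ge> 0" "\<And>\<eta> \<eta>'. (\<And>s. (\<eta> has_real_derivative \<eta>' s) (at s)) \<Longrightarrow> continuous_on UNIV \<eta>' \<Longrightarrow>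
    (LINT s|lborel. ind s * (s powr (\<nu> - 1) * (v s * (2 * \<nu> * \<eta> s + 2 * s * \<eta>' s))))\<^sup>2 \<le>
      C * (LINT s|lborel. ind s * (s powr \<nu> * (\<eta> s)\<^sup>2))"
    by (rule profile_gradient_bound) blast
  then show "\<exists>C\<ge>0. \<forall>\<eta> \<eta>'. (\<forall>s. (\<eta> has_real_derivative \<eta>' s) (at s)) \<longrightarrow> continuous_on UNIV \<eta>' \<longrightarrow>
    (LINT s|lborel. ind s * (s powr (\<nu> - 1) * (v s * (2 * \<nu> * \<eta> s + 2 * s * \<eta>' s))))\<^sup>2 \<le>
      C * (LINT s|lborel. ind s * (s powr \<nu> * (\<eta> s)\<^sup>2))"
    by (intro exI[of _ C] conjI allI impI) auto
  show "p * (LINT s|lborel. ind s * (s powr (\<nu> + \<alpha> / 2) * (\<bar>v s\<bar> powr (p - 1) * (\<psi> s)\<^sup>2))) \<le>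
      4 * (LINT s|lborel. ind s * (s powr (\<nu> + 1) * (deriv \<psi> s)\<^sup>2))"
    if "smooth \<psi>" "A < a" "b < B" "\<And>s. s < a \<Longrightarrow> \<psi> s = 0" "\<And>s. b < s \<Longrightarrow> \<psi> s = 0" for \<psi> a b
    by (rule profile_stability) (use that in auto)
  show "\<not> (AE s in lborel. A < s \<longrightarrow> s < B \<longrightarrow> v s \<le> 0)" "\<not> (AE s in lborel. A < s \<longrightarrow> s < B \<longrightarrow> v s \<ge> 0)"
    by (rule profile_sign_change)+
qed

lemma bounded_radial_domain_squares:
  fixes \<Omega> :: "'a::euclidean_space set"
  assumes "bounded_radial_domain \<Omega>"
  obtains A B where "radial_domain \<Omega> A B"
proof -
  have sq: "norm x < r \<longleftrightarrow> x \<bullet> x < r\<^sup>2" "r < norm x \<longleftrightarrow> r\<^sup>2 < x \<bullet> x" if "r \<ge> 0" for x :: 'a and r :: real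
    using that by (simp_all add: not_le[symmetric] power_mono_iff flip: power2_norm_eq_inner)
  consider R where "R > 0" "\<Omega> = ball 0 R" | a b where "0 < a" "a < b" "\<Omega> = {x. a < norm x \<and> norm x < b}"
    using assms unfolding bounded_radial_domain_def by blast
  then show ?thesis
  proof cases
    case 1
    have "radial_domain \<Omega> 0 (R\<^sup>2)"
      by unfold_locales (use 1 sq(1)[of R] in auto)
    then show ?thesis by (rule that)
  next
    case 2
    have "open \<Omega>" unfolding 2 by (intro open_Collect_conj open_Collect_less continuous_intros)
    moreover have "bounded \<Omega>" by (rule bounded_subset[OF bounded_ball[of 0 b]]) (use 2 in auto)
    moreover have "a\<^sup>2 < b\<^sup>2" using 2 by (intro power_strict_mono) auto
    ultimately have "radial_domain \<Omega> (a\<^sup>2) (b\<^sup>2)"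
      by unfold_locales (use 2 sq(1)[of b] sq(2)[of a] in auto)
    then show ?thesis by (rule that)
  qed
qed

theorem corollary1p4:
  fixes \<Omega> :: "(real ^ 'n) set" and \<alpha> p :: real and u :: "real ^ 'n \<Rightarrow> real"
  assumes "CARD('n) \<ge> 2"
    and "bounded_radial_domain \<Omega>"
    and "\<alpha> \<ge> 0"
    and "p > 1"
    and "CARD('n) \<ge> 3 \<Longrightarrow> p < (real CARD('n) + 2) / (real CARD('n) - 2)"
    and "least_energy_nodal_solution \<Omega> \<alpha> p u"
  shows "\<not> radial_on \<Omega> u"
proof
  assume "radial_on \<Omega> u"
  then obtain f where f: "AE x in lebesgue_on \<Omega>. u x = f (norm x)" unfolding radial_on_def by blast
  obtain A B where "radial_domain \<Omega> A B" by (rule bounded_radial_domain_squares[OF assms(2)])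
  then interpret radial_domain \<Omega> A B .
  have "u \<in> H10 \<Omega>"
    using assms(6) by (auto simp: least_energy_nodal_solution_def is_arg_min_def nodal_Nehari_set_def)
  then obtain g where H: "H0 u g" using H10_iff by blast
  obtain v where v: "v \<in> borel_measurable borel" "AE x in lebesgue_on \<Omega>. u x = v (x \<bullet> x)"
    using radial_borel_representative[OF _ L2D(1)[OF H0_L2(1)[OF H]] f] by auto
  interpret radial_minimizer \<Omega> \<alpha> p u g A B v
    by unfold_locales (use assms H v in auto)
  \<comment> \<open>For N = 2 the second factor is 0; for N \<ge> 3 this is the subcriticality
    assumption with denominators cleared.\<close>
  have "(p - 1) * (real CARD('n) / 2 - 1) < 2"
  proof (cases "CARD('n) = 2")
    case False
    then have N: "CARD('n) \<ge> 3" using assms(1) by simp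
    then have "p * (real CARD('n) - 2) < real CARD('n) + 2" using assms(5)[OF N] by (simp add: pos_less_divide_eq)
    then show ?thesis by (simp add: algebra_simps)
  qed simp
  then have "profile \<nu> \<alpha> p A B v"
    by (intro profile_axioms) (use assms(1,3) in auto)
  then show False by (rule profile.inconsistent)
qed

end
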